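(* Let $f:\mathbb{R}\to\mathbb{C}$ be a non-degenerate complex Gaussian stationary process with covariance kernel $r$ normalized by $r(0)=1$, whose spectral measure $\rho$ satisfies $\int_{\mathbb{R}}\lambda^2\log^{1+\alpha}(1+|\lambda|)\,d\rho(\lambda)<\infty$ for some $\alpha>0$. Let $\Delta(T)$ be the winding of $f$ in the interval $[0,T]$. Then there exists $C>0$ (depending on the covariance function $r$) such that $$\mathrm{var}[\Delta(T)]\ge C\cdot T.$$
   Context: A standard complex Gaussian $\mathcal{N}_{\mathbb{C}}(0,1)$ is a $\mathbb{C}$-valued random variable with density $\frac1\pi e^{-|z|^2}$ with respect to Lebesgue measure on the plane. A complex Gaussian vector is a random vector in $\mathbb{C}^n$ equal in distribution to $A\mathbf{v}$, with $A$ an $n\times m$ matrix and $\mathbf{v}$ a random vector in $\mathbb{C}^m$ having i.i.d. $\mathcal{N}_{\mathbb{C}}(0,1)$ components (all random variables and processes are centred, i.e. have mean $0$). A complex Gaussian process $f:\mathbb{R}\to\mathbb{C}$ is a random process all of whose finite marginals are complex Gaussian vectors; it is stationary if its distribution is invariant under all real shifts. Its covariance kernel is $r(t)=\mathbb{E}[f(t)\overline{f(0)}]$, assumed continuous and normalized by $r(0)=1$. Its spectral measure is the probability measure $\rho$ on $\mathbb{R}$ with $r(t)=\int_{\mathbb{R}}e^{-it\lambda}\,d\rho(\lambda)$. The process is degenerate if $\rho$ consists of exactly one atom. The logarithmic moment condition on $\rho$ ensures that $f$ is almost surely continuously differentiable and that $r$ is twice differentiable with $r''$ continuous. The winding (increment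 of the argument) of $f$ in $[0,T]$ is $$\Delta(T)=\frac{1}{2i}\int_0^T\left[\frac{f'(t)}{f(t)}-\overline{\left(\frac{f'(t)}{f(t)}\right)}\right]dt$$ (almost surely $f$ does not vanish on $[0,T]$).
   Formalization: The bound is proved for all T ≥ T₀, with T₀ > 0 arbitrary and C depending on r and T₀; with C depending on r alone it fails for small T, since var[Δ(T)] = o(T) as T → 0. *)

theory Defs
  imports "HOL-Probability.Probability"
begin

definition std_complex_gaussian :: "complex measure" where
  "std_complex_gaussian = density lborel (\<lambda>z. ennreal (exp (- (cmod z)\<^sup>2) / pi))"

text \<open>
  A finite family of complex random variables is a complex Gaussian vector if its joint law is the
  law of \<open>A v\<close>, where \<open>v\<close> has \<open>m\<close> i.i.d. standard complex Gaussian components.  In particular such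
  vectors are centred and circularly symmetric.  The number \<open>m\<close> of columns is arbitrary, so vectors
  are functions on finite index sets and laws live on the finite products \<open>Pi\<^sub>M\<close>.
\<close>

definition complex_gaussian_vector ::
  "'a measure \<Rightarrow> 'i set \<Rightarrow> ('i \<Rightarrow> 'a \<Rightarrow> complex) \<Rightarrow> bool" where
  "complex_gaussian_vector M I X \<longleftrightarrow>
     finite I \<and> (\<forall>i\<in>I. X i \<in> borel_measurable M) \<and>
     (\<exists>(m::nat) (A :: 'i \<Rightarrow> nat \<Rightarrow> complex).
        distr M (Pi\<^sub>M I (\<lambda>_. borel)) (\<lambda>\<omega>. \<lambda>i\<in>I. X i \<omega>) =
        distr (Pi\<^sub>M {..<m} (\<lambda>_. std_complex_gaussian)) (Pi\<^sub>M I (\<lambda>_. borel))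
          (\<lambda>v. \<lambda>i\<in>I. \<Sum>j<m. A i j * v j))"

definition complex_gaussian_process ::
  "'a measure \<Rightarrow> (real \<Rightarrow> 'a \<Rightarrow> complex) \<Rightarrow> bool" where
  "complex_gaussian_process M f \<longleftrightarrow>
     prob_space M \<and> (\<forall>I. finite I \<longrightarrow> complex_gaussian_vector M I f)"

definition stationary :: "'a measure \<Rightarrow> (real \<Rightarrow> 'a \<Rightarrow> complex) \<Rightarrow> bool" where
  "stationary M f \<longleftrightarrow>
     (\<forall>s. distr M (Pi\<^sub>M UNIV (\<lambda>_. borel)) (\<lambda>\<omega> t. f (t + s) \<omega>) =
          distr M (Pi\<^sub>M UNIV (\<lambda>_. borel)) (\<lambda>\<omega> t. f t \<omega>))"

definition covariance_kernel ::
  "'a measure \<Rightarrow> (real \<Rightarrow> 'a \<Rightarrow> complex) \<Rightarrow> real \<Rightarrow> complex" where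
  "covariance_kernel M f t = prob_space.expectation M (\<lambda>\<omega>. f t \<omega> * cnj (f 0 \<omega>))"

definition is_spectral_measure :: "(real \<Rightarrow> complex) \<Rightarrow> real measure \<Rightarrow> bool" where
  "is_spectral_measure r \<rho> \<longleftrightarrow>
     real_distribution \<rho> \<and> (\<forall>t. r t = (CLINT l|\<rho>. iexp (- (t * l))))"

definition degenerate :: "real measure \<Rightarrow> bool" where
  "degenerate \<rho> \<longleftrightarrow> (\<exists>a. \<rho> = return borel a)"

definition log_moment_condition :: "real measure \<Rightarrow> real \<Rightarrow> bool" where
  "log_moment_condition \<rho> \<alpha> \<longleftrightarrow>
     (\<integral>\<^sup>+ l. ennreal (l\<^sup>2 * ln (1 + \<bar>l\<bar>) powr (1 + \<alpha>)) \<partial>\<rho>) < \<infinity>"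

text \<open>
  A mere family of random variables does not determine its sample paths.  As usual, the process is
  understood as a version with almost surely continuous paths; continuous differentiability of
  the paths is then a consequence of the logarithmic moment condition and is not assumed.
\<close>

definition continuous_paths :: "'a measure \<Rightarrow> (real \<Rightarrow> 'a \<Rightarrow> complex) \<Rightarrow> bool" where
  "continuous_paths M f \<longleftrightarrow> (AE \<omega> in M. continuous_on UNIV (\<lambda>t. f t \<omega>))"

text \<open>The expression under \<open>Re\<close> is real; \<open>Re\<close> only changes its type.\<close>

definition winding :: "(real \<Rightarrow> complex) \<Rightarrow> real \<Rightarrow> real" where
  "winding g T =
     Re (1 / (2 * \<i>) *
       (CLBINT t:{0..T}. vector_derivative g (at t) / g t -
                         cnj (vector_derivative g (at t) / g t)))"

text \<open>
  The winding is a sensible random variable only up to a null set (the paths may fail to be smooth,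
  or may vanish, on one), and on that null set it need not be measurable.  The variance is therefore
  taken over the completion of \<open>M\<close>; this changes nothing for \<open>M\<close>-measurable functions, and avoids the
  convention that the integral of a non-measurable function is \<open>0\<close>.
\<close>

definition winding_variance :: "'a measure \<Rightarrow> (real \<Rightarrow> 'a \<Rightarrow> complex) \<Rightarrow> real \<Rightarrow> real" where
  "winding_variance M f T =
     prob_space.variance (completion M) (\<lambda>\<omega>. winding (\<lambda>t. f t \<omega>) T)"

end

theory Submission
  imports Defs
begin

text \<open>
  Let \<open>m\<close> be the mean of \<open>\<rho>\<close>, and let \<open>U = f' + i m f\<close>, so that \<open>f(t)\<close> and \<open>U(t)\<close> are independent. Up to
  the deterministic drift \<open>- m T\<close>, the winding is \<open>\<Delta> = \<integral>\<^sub>0\<^sup>T Im (U / f) dt\<close>. Compare it with the polynomial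
  functional \<open>Y = \<integral>\<^sub>0\<^sup>T Im (U cnj f) dt\<close>. Decomposing the other variables along \<open>f(t)\<close> and using
  invariance under phase rotations, \<open>E[Im (U(t) \<phi>(f(t))) Im (U(s) cnj (f(s)))]\<close> is the same for
  \<open>\<phi>(x) = 1/x\<close> and \<open>\<phi>(x) = cnj x\<close>, since \<open>E[\<phi>(f(t)) f(t)] = 1\<close> in both cases. Hence \<open>E[\<Delta> Y] = E[Y\<^sup>2]\<close>,
  so \<open>Y\<close> is the projection of \<open>\<Delta> - E \<Delta>\<close> onto its line and \<open>var \<Delta> \<ge> E[Y\<^sup>2]\<close>. On the spectral side,
  \<open>E[Y\<^sup>2] = 1/4 \<integral>\<integral> (l + l' - 2 m)\<^sup>2 |\<integral>\<^sub>0\<^sup>T exp (i t (l - l')) dt|\<^sup>2 d\<rho>(l) d\<rho>(l')\<close>. An interval of positive mass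
  away from \<open>m\<close> is cut into about \<open>T\<close> cells of length of order \<open>1/T\<close>; on each diagonal block the integrand
  is of order \<open>T\<^sup>2\<close>, and the Cauchy-Schwarz inequality for the masses of the cells gives a total of order \<open>T\<close>.

  The differentiability of the paths comes from the logarithmic moment, which makes
  \<open>\<integral> |G(t + s) - G(t)|\<^sup>2 / |s| ds\<close> finite for the mean square derivative \<open>G\<close>. Square integrability of \<open>\<Delta>\<close>
  follows from \<open>E |U(t) U(s) / (f(t) f(s))| = O(|t - s| powr (- 8/9))\<close> near the diagonal.
\<close>

subsection \<open>The standard complex Gaussian\<close>

text \<open>The quotient \<open>U / F\<close> has no second moment at a fixed time, since
  \<open>E |F|^-2\<close> diverges logarithmically. Square integrability of the winding must
  therefore come from pairs of distinct times, where \<open>F s\<close> has a part independent of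
  \<open>F t\<close> of size about \<open>|s - t|\<close>. That part can vanish again at a larger
  lag, for instance when \<open>\<rho>\<close> lives on a lattice, so only short time intervals are
  treated directly and long ones are assembled from them.

  The derivative is only available as a limit of difference quotients. All Gaussian identities are
  proved for the quotients, where the matrix of the definition is at hand, and are carried to the
  limit by Fatou's lemma and uniform integrability. The quotients are corrected so that they are
  exactly uncorrelated with \<open>F\<close> at the same time; no error terms have to be followed.

  Uncorrelated variables become independent by rotating the underlying i.i.d. Gaussians until one
  variable is a multiple of a single one of them.

  The lower bound depends on \<open>\<rho>\<close> alone, so one constant serves every process with
  this covariance. For short \<open>T\<close> the bound is only of order \<open>T^2\<close>, hence
  the restriction to \<open>T \<ge> T\<^sub>0\<close>.\<close>

lemma nn_integral_lborel_shear1: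
  fixes h :: "complex \<times> complex \<Rightarrow> ennreal"
  assumes [measurable]: "h \<in> borel_measurable (borel \<Otimes>\<^sub>M borel)"
  shows "(\<integral>\<^sup>+x. \<integral>\<^sup>+y. h (x + p * y, y) \<partial>lborel \<partial>lborel) = (\<integral>\<^sup>+x. \<integral>\<^sup>+y. h (x, y) \<partial>lborel \<partial>lborel)"
proof -
  have sh: "(\<integral>\<^sup>+x. g (x + c) \<partial>lborel) = (\<integral>\<^sup>+x. g x \<partial>lborel)"
    if [measurable]: "g \<in> borel_measurable borel" for g :: "complex \<Rightarrow> ennreal" and c
  proof -
    have "(\<integral>\<^sup>+x. g x \<partial>lborel) = (\<integral>\<^sup>+x. g x \<partial>distr lborel borel ((+) c))"
      by (simp add: lborel_distr_plus)
    also have "\<dots> = (\<integral>\<^sup>+x. g (x + c) \<partial>lborel)"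
      by (subst nn_integral_distr) (auto simp: add.commute)
    finally show ?thesis by simp
  qed
  have "(\<integral>\<^sup>+x. \<integral>\<^sup>+y. h (x + p * y, y) \<partial>lborel \<partial>lborel) = (\<integral>\<^sup>+y. \<integral>\<^sup>+x. h (x + p * y, y) \<partial>lborel \<partial>lborel)"
    by (rule lborel_pair.Fubini'[symmetric]) measurable
  also have "\<dots> = (\<integral>\<^sup>+y. \<integral>\<^sup>+x. h (x, y) \<partial>lborel \<partial>lborel)"
    by (intro nn_integral_cong sh) measurable
  also have "\<dots> = (\<integral>\<^sup>+x. \<integral>\<^sup>+y. h (x, y) \<partial>lborel \<partial>lborel)"
    by (rule lborel_pair.Fubini') measurable
  finally show ?thesis .
qed

lemma nn_integral_lborel_shear2:
  fixes h :: "complex \<times> complex \<Rightarrow> ennreal"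
  assumes [measurable]: "h \<in> borel_measurable (borel \<Otimes>\<^sub>M borel)"
  shows "(\<integral>\<^sup>+x. \<integral>\<^sup>+y. h (x, y + p * x) \<partial>lborel \<partial>lborel) = (\<integral>\<^sup>+x. \<integral>\<^sup>+y. h (x, y) \<partial>lborel \<partial>lborel)"
proof -
  have "(\<integral>\<^sup>+x. \<integral>\<^sup>+y. h (x, y + p * x) \<partial>lborel \<partial>lborel) = (\<integral>\<^sup>+y. \<integral>\<^sup>+x. h (x, y + p * x) \<partial>lborel \<partial>lborel)"
    by (rule lborel_pair.Fubini'[symmetric]) measurable
  also have "\<dots> = (\<integral>\<^sup>+y. \<integral>\<^sup>+x. h (x, y) \<partial>lborel \<partial>lborel)"
    using nn_integral_lborel_shear1[of "\<lambda>(x, y). h (y, x)" p] by simp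
  also have "\<dots> = (\<integral>\<^sup>+x. \<integral>\<^sup>+y. h (x, y) \<partial>lborel \<partial>lborel)"
    by (rule lborel_pair.Fubini') measurable
  finally show ?thesis .
qed

text \<open>A unitary matrix of determinant one with nonzero off-diagonal entries is a product of three shears.\<close>

lemma nn_integral_lborel_unitary:
  fixes h :: "complex \<times> complex \<Rightarrow> ennreal"
  assumes [measurable]: "h \<in> borel_measurable (borel \<Otimes>\<^sub>M borel)"
    and ab: "a * cnj a + b * cnj b = 1" and b: "b \<noteq> 0"
  shows "(\<integral>\<^sup>+x. \<integral>\<^sup>+y. h (a * x + b * y, - cnj b * x + cnj a * y) \<partial>lborel \<partial>lborel)
       = (\<integral>\<^sup>+x. \<integral>\<^sup>+y. h (x, y) \<partial>lborel \<partial>lborel)"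
proof -
  \<comment> \<open>The product of the three shears has lower left entry \<open>c\<close> and
    diagonal entries \<open>1 + p * c\<close> and \<open>1 + c * q\<close>. Matching these fixes
    \<open>p\<close> and \<open>q\<close>, and determinant one then forces the last entry, which is
    \<open>aq\<close>.\<close>
  define c p q where "c = - cnj b" and "p = (a - 1) / c" and "q = (cnj a - 1) / c"
  have c: "c \<noteq> 0" using b by (simp add: c_def)
  have pc: "1 + p * c = a" and cq: "1 + c * q = cnj a"
    using c by (simp_all add: p_def q_def)
  have "a * q + p = (a * cnj a - 1) / c"
    by (simp add: p_def q_def field_simps c)
  also have "a * cnj a - 1 = b * c"
    using ab by (simp add: c_def algebra_simps)
  finally have aq: "a * q + p = b" using c by simp
  have eq: "h (a * x + b * y, - cnj b * x + cnj a * y)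
     = h ((x + q * y) + p * (y + c * (x + q * y)), y + c * (x + q * y))" for x y
  proof -
    have "(x + q * y) + p * (y + c * (x + q * y)) = (1 + p * c) * x + ((1 + p * c) * q + p) * y"
      by (simp add: algebra_simps)
    moreover have "y + c * (x + q * y) = c * x + (1 + c * q) * y"
      by (simp add: algebra_simps)
    ultimately show ?thesis by (simp add: pc cq aq) (simp add: c_def)
  qed
  have "(\<integral>\<^sup>+x. \<integral>\<^sup>+y. h (x, y) \<partial>lborel \<partial>lborel) = (\<integral>\<^sup>+x. \<integral>\<^sup>+y. h (x + p * y, y) \<partial>lborel \<partial>lborel)"
    by (rule nn_integral_lborel_shear1[symmetric]) measurable
  also have "\<dots> = (\<integral>\<^sup>+x. \<integral>\<^sup>+y. h (x + p * (y + c * x), y + c * x) \<partial>lborel \<partial>lborel)"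
    using nn_integral_lborel_shear2[of "\<lambda>(x, y). h (x + p * y, y)" c] by simp
  also have "\<dots> = (\<integral>\<^sup>+x. \<integral>\<^sup>+y. h ((x + q * y) + p * (y + c * (x + q * y)), y + c * (x + q * y)) \<partial>lborel \<partial>lborel)"
    using nn_integral_lborel_shear1[of "\<lambda>(x, y). h (x + p * (y + c * x), y + c * x)" q] by simp
  finally show ?thesis by (simp only: eq)
qed

section \<open>The standard Gaussian law: rotation invariance and moments\<close>

lemma sets_std_complex_gaussian [simp, measurable_cong]: "sets std_complex_gaussian = sets borel"
  by (simp add: std_complex_gaussian_def)

lemma space_std_complex_gaussian [simp]: "space std_complex_gaussian = UNIV"
  by (simp add: std_complex_gaussian_def)

lemma nn_integral_std_complex_gaussian:
  assumes [measurable]: "g \<in> borel_measurable borel"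
  shows "(\<integral>\<^sup>+z. g z \<partial>std_complex_gaussian) = (\<integral>\<^sup>+z. ennreal (exp (- (cmod z)\<^sup>2) / pi) * g z \<partial>lborel)"
  unfolding std_complex_gaussian_def by (subst nn_integral_density) simp_all

text \<open>The joint density of two independent standard Gaussians depends only on
  \<open>|x|^2 + |y|^2\<close>, which a unitary map preserves, and Lebesgue measure is preserved as
  well.\<close>

lemma nn_integral_std_complex_gaussian_unitary:
  fixes h :: "complex \<times> complex \<Rightarrow> ennreal"
  assumes [measurable]: "h \<in> borel_measurable (borel \<Otimes>\<^sub>M borel)"
    and ab: "a * cnj a + b * cnj b = 1" and b: "b \<noteq> 0"
  shows "(\<integral>\<^sup>+x. \<integral>\<^sup>+y. h (a * x + b * y, - cnj b * x + cnj a * y) \<partial>std_complex_gaussian \<partial>std_complex_gaussian)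
       = (\<integral>\<^sup>+x. \<integral>\<^sup>+y. h (x, y) \<partial>std_complex_gaussian \<partial>std_complex_gaussian)"
proof -
  define e where "e z = ennreal (exp (- (cmod z)\<^sup>2) / pi)" for z
  have [measurable]: "e \<in> borel_measurable borel" unfolding e_def by measurable
  have expand: "(\<integral>\<^sup>+x. \<integral>\<^sup>+y. k (x, y) \<partial>std_complex_gaussian \<partial>std_complex_gaussian)
      = (\<integral>\<^sup>+x. \<integral>\<^sup>+y. e x * e y * k (x, y) \<partial>lborel \<partial>lborel)"
    if [measurable]: "k \<in> borel_measurable (borel \<Otimes>\<^sub>M borel)" for k
    by (subst nn_integral_std_complex_gaussian, measurable)
      (auto simp: nn_integral_std_complex_gaussian e_def[symmetric] nn_integral_cmult[symmetric]
        mult.assoc intro!: nn_integral_cong)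
  have inv: "e (a * x + b * y) * e (- cnj b * x + cnj a * y) = e x * e y" for x y
  proof -
    have "complex_of_real ((cmod (a * x + b * y))\<^sup>2 + (cmod (- cnj b * x + cnj a * y))\<^sup>2)
       = (a * cnj a + b * cnj b) * (x * cnj x + y * cnj y)"
      unfolding of_real_add complex_norm_square by (simp add: algebra_simps)
    also have "\<dots> = complex_of_real ((cmod x)\<^sup>2 + (cmod y)\<^sup>2)"
      unfolding ab of_real_add complex_norm_square by simp
    finally have "(cmod (a * x + b * y))\<^sup>2 + (cmod (- cnj b * x + cnj a * y))\<^sup>2 = (cmod x)\<^sup>2 + (cmod y)\<^sup>2"
      using of_real_eq_iff by blast
    then have "- (cmod (a * x + b * y))\<^sup>2 - (cmod (- cnj b * x + cnj a * y))\<^sup>2 = - (cmod x)\<^sup>2 - (cmod y)\<^sup>2"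
      by simp
    then show ?thesis
      by (simp add: e_def ennreal_mult[symmetric] exp_add[symmetric] del: minus_mult_left)
  qed
  have "(\<integral>\<^sup>+x. \<integral>\<^sup>+y. h (a * x + b * y, - cnj b * x + cnj a * y) \<partial>std_complex_gaussian \<partial>std_complex_gaussian)
      = (\<integral>\<^sup>+x. \<integral>\<^sup>+y. e (a * x + b * y) * e (- cnj b * x + cnj a * y) *
            h (a * x + b * y, - cnj b * x + cnj a * y) \<partial>lborel \<partial>lborel)"
    unfolding inv by (rule expand[of "\<lambda>(x, y). h (a * x + b * y, - cnj b * x + cnj a * y)", unfolded prod.case]) measurable
  also have "\<dots> = (\<integral>\<^sup>+x. \<integral>\<^sup>+y. e x * e y * h (x, y) \<partial>lborel \<partial>lborel)"
    using nn_integral_lborel_unitary[of "\<lambda>(x, y). e x * e y * h (x, y)" a b] ab b by simp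
  also have "\<dots> = (\<integral>\<^sup>+x. \<integral>\<^sup>+y. h (x, y) \<partial>std_complex_gaussian \<partial>std_complex_gaussian)"
    by (rule expand[symmetric]) measurable
  finally show ?thesis .
qed

text \<open>Both measures agree on boxes, which determines Lebesgue measure. This reduces planar
  Gaussian integrals to real normal densities with known moments.\<close>

lemma distr_normal_Complex:
  "distr (lborel \<Otimes>\<^sub>M lborel) borel (\<lambda>(x, y). Complex x y) = (lborel :: complex measure)"
proof (rule lborel_eqI[symmetric])
  have [measurable]: "(\<lambda>(x, y). Complex x y) \<in> borel_measurable (borel \<Otimes>\<^sub>M borel)"
    unfolding Complex_eq by measurable
  show "sets (distr (lborel \<Otimes>\<^sub>M lborel) borel (\<lambda>(x, y). Complex x y)) = sets borel" by simp
  fix l u :: complex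
  assume le: "\<And>b. b \<in> Basis \<Longrightarrow> l \<bullet> b \<le> u \<bullet> b"
  have lu: "Re l \<le> Re u" "Im l \<le> Im u"
    using le[of 1] le[of \<i>] by (auto simp: Basis_complex_def)
  have "(\<lambda>(x, y). Complex x y) -` box l u = box (Re l) (Re u) \<times> box (Im l) (Im u)"
    by (auto simp: in_box_complex_iff box_real)
  then have "emeasure (distr (lborel \<Otimes>\<^sub>M lborel) borel (\<lambda>(x, y). Complex x y)) (box l u)
     = emeasure (lborel \<Otimes>\<^sub>M lborel) (box (Re l) (Re u) \<times> box (Im l) (Im u))"
    by (subst emeasure_distr) (simp_all add: space_pair_measure)
  also have "\<dots> = ennreal (Re u - Re l) * ennreal (Im u - Im l)"
    using lu by (subst lborel.emeasure_pair_measure_Times) (simp_all add: box_real)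
  also have "\<dots> = ennreal (\<Prod>b\<in>Basis. (u - l) \<bullet> b)"
    using lu by (simp add: Basis_complex_def ennreal_mult[symmetric])
  finally show "emeasure (distr (lborel \<Otimes>\<^sub>M lborel) borel (\<lambda>(x, y). Complex x y)) (box l u)
     = ennreal (\<Prod>b\<in>Basis. (u - l) \<bullet> b)" .
qed

text \<open>The density \<open>exp (-|z|^2) / pi\<close> is the product of two centred normal
  densities of variance 1/2, one for each coordinate.\<close>

lemma nn_integral_std_complex_gaussian_normal:
  assumes [measurable]: "g \<in> borel_measurable borel"
  shows "(\<integral>\<^sup>+z. g z \<partial>std_complex_gaussian) =
    (\<integral>\<^sup>+x. \<integral>\<^sup>+y. ennreal (normal_density 0 (1 / sqrt 2) x) * ennreal (normal_density 0 (1 / sqrt 2) y) *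
       g (Complex x y) \<partial>lborel \<partial>lborel)"
proof -
  have [measurable]: "(\<lambda>(x, y). Complex x y) \<in> borel_measurable (borel \<Otimes>\<^sub>M borel)"
    unfolding Complex_eq by measurable
  have "normal_density 0 (1 / sqrt 2) x * normal_density 0 (1 / sqrt 2) y = exp (- (cmod (Complex x y))\<^sup>2) / pi" for x y
    by (simp add: normal_density_def cmod_def power_divide real_sqrt_mult[symmetric] mult_exp_exp
        del: real_sqrt_mult)
  then have *: "ennreal (exp (- (cmod (Complex x y))\<^sup>2) / pi) = ennreal (normal_density 0 (1 / sqrt 2) x) * ennreal (normal_density 0 (1 / sqrt 2) y)" for x y
    by (metis ennreal_mult normal_density_nonneg)
  have "(\<integral>\<^sup>+z. g z \<partial>std_complex_gaussian) = (\<integral>\<^sup>+z. ennreal (exp (- (cmod z)\<^sup>2) / pi) * g z \<partial>lborel)"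
    by (rule nn_integral_std_complex_gaussian) measurable
  also have "\<dots> = (\<integral>\<^sup>+z. ennreal (exp (- (cmod z)\<^sup>2) / pi) * g z \<partial>distr (lborel \<Otimes>\<^sub>M lborel) borel (\<lambda>(x, y). Complex x y))"
    by (simp add: distr_normal_Complex)
  also have "\<dots> = (\<integral>\<^sup>+p. ennreal (exp (- (cmod (Complex (fst p) (snd p)))\<^sup>2) / pi) * g (Complex (fst p) (snd p)) \<partial>(lborel \<Otimes>\<^sub>M lborel))"
    by (subst nn_integral_distr) (simp_all add: split_beta')
  also have "\<dots> = (\<integral>\<^sup>+x. \<integral>\<^sup>+y. ennreal (exp (- (cmod (Complex x y))\<^sup>2) / pi) * g (Complex x y) \<partial>lborel \<partial>lborel)"
    by (subst lborel.nn_integral_fst[symmetric]) simp_all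
  finally show ?thesis by (simp add: *)
qed

lemma nn_integral_normal_density [simp]:
  "\<sigma> > 0 \<Longrightarrow> (\<integral>\<^sup>+x. ennreal (normal_density \<mu> \<sigma> x) \<partial>lborel) = 1"
  by (subst nn_integral_eq_integral) (auto simp: integral_normal_density)

lemma nn_integral_std_complex_gaussian_product:
  assumes [measurable]: "f \<in> borel_measurable borel" "g \<in> borel_measurable borel"
  shows "(\<integral>\<^sup>+z. f (Re z) * g (Im z) \<partial>std_complex_gaussian) =
    (\<integral>\<^sup>+x. ennreal (normal_density 0 (1 / sqrt 2) x) * f x \<partial>lborel) *
    (\<integral>\<^sup>+x. ennreal (normal_density 0 (1 / sqrt 2) x) * g x \<partial>lborel)"
proof -
  have "(\<integral>\<^sup>+z. f (Re z) * g (Im z) \<partial>std_complex_gaussian) =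
    (\<integral>\<^sup>+x. \<integral>\<^sup>+y. (ennreal (normal_density 0 (1 / sqrt 2) x) * f x) * (ennreal (normal_density 0 (1 / sqrt 2) y) * g y) \<partial>lborel \<partial>lborel)"
    by (subst nn_integral_std_complex_gaussian_normal) (auto intro!: nn_integral_cong simp: ac_simps)
  then show ?thesis
    by (simp add: nn_integral_cmult nn_integral_multc)
qed

lemma prob_space_std_complex_gaussian: "prob_space std_complex_gaussian"
proof
  have "(\<integral>\<^sup>+z. 1 \<partial>std_complex_gaussian) = 1"
    using nn_integral_std_complex_gaussian_product[of "\<lambda>_. 1" "\<lambda>_. 1"] by simp
  then show "emeasure std_complex_gaussian (space std_complex_gaussian) = 1" by simp
qed

interpretation gauss: prob_space std_complex_gaussian
  by (rule prob_space_std_complex_gaussian)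

interpretation gauss_pi: product_prob_space "\<lambda>_. std_complex_gaussian" I for I :: "'i set" ..

lemma std_complex_gaussian_moment:
  "(\<integral>\<^sup>+z. ennreal (cmod z ^ (2 * n)) \<partial>std_complex_gaussian) < \<infinity>"
proof -
  have fin: "(\<integral>\<^sup>+x. ennreal (normal_density 0 (1 / sqrt 2) x) * ennreal (x ^ (2 * n)) \<partial>lborel) < \<infinity>"
  proof -
    have "integrable lborel (\<lambda>x. normal_density 0 (1 / sqrt 2) x * (x - 0) ^ (2 * n))"
      by (rule integrable_normal_moment) simp
    then show ?thesis
      by (subst ennreal_mult[symmetric], simp, simp, subst nn_integral_eq_integral) auto
  qed
  have "cmod z ^ (2 * n) \<le> 2 ^ n * (Re z ^ (2 * n) + Im z ^ (2 * n))" for z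
  proof -
    have "cmod z ^ (2 * n) = ((Re z)\<^sup>2 + (Im z)\<^sup>2) ^ n"
      by (simp add: power_mult cmod_power2)
    also have "\<dots> \<le> (2 * max ((Re z)\<^sup>2) ((Im z)\<^sup>2)) ^ n"
      by (intro power_mono) auto
    also have "\<dots> \<le> 2 ^ n * ((Re z)\<^sup>2 ^ n + (Im z)\<^sup>2 ^ n)"
      by (auto simp: power_mult_distrib max_def)
    finally show ?thesis by (simp add: power_mult)
  qed
  then have "ennreal (cmod z ^ (2 * n)) \<le> ennreal (2 ^ n) * (ennreal (Re z ^ (2 * n)) + ennreal (Im z ^ (2 * n)))" for z
    by (subst ennreal_plus[symmetric], simp, simp, subst ennreal_mult[symmetric]) (auto intro!: ennreal_leI)
  then have "(\<integral>\<^sup>+z. ennreal (cmod z ^ (2 * n)) \<partial>std_complex_gaussian)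
      \<le> (\<integral>\<^sup>+z. ennreal (2 ^ n) * (ennreal (Re z ^ (2 * n)) + ennreal (Im z ^ (2 * n))) \<partial>std_complex_gaussian)"
    by (intro nn_integral_mono)
  also have "\<dots> < \<infinity>"
    using fin nn_integral_std_complex_gaussian_product[of "\<lambda>x. ennreal (x ^ (2 * n))" "\<lambda>_. 1"]
      nn_integral_std_complex_gaussian_product[of "\<lambda>_. 1" "\<lambda>x. ennreal (x ^ (2 * n))"]
    by (simp add: nn_integral_cmult nn_integral_add ennreal_mult_less_top)
  finally show ?thesis .
qed

lemma nn_integral_neg_powr_finite:
  fixes s :: real
  assumes "0 \<le> s" "s < 1"
  shows "(\<integral>\<^sup>+x. ennreal (\<bar>x\<bar> powr - s) * indicator {-1..1} x \<partial>lborel) < \<infinity>"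
proof -
  have half: "(\<integral>\<^sup>+x. ennreal (x powr - s) * indicator {0..1} x \<partial>lborel) < \<infinity>"
  proof -
    have "((\<lambda>x. x powr - s) has_integral (1 powr (- s + 1) / (- s + 1))) {0..1}"
      by (rule has_integral_powr_from_0) (use assms in auto)
    then have "(\<integral>\<^sup>+x. ennreal (x powr - s) * indicator {0..1} x \<partial>lborel) = ennreal (1 powr (- s + 1) / (- s + 1))"
      by (intro nn_integral_has_integral_lebesgue'[THEN trans, rotated]) (auto intro!: nn_integral_cong)
    then show ?thesis by simp
  qed
  have "(\<integral>\<^sup>+x. ennreal (\<bar>x\<bar> powr - s) * indicator {-1..1} x \<partial>lborel)
     \<le> (\<integral>\<^sup>+x. ennreal (x powr - s) * indicator {0..1} x + ennreal ((- x) powr - s) * indicator {0..1} (- x) \<partial>lborel)"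
    by (intro nn_integral_mono) (auto split: split_indicator)
  also have "\<dots> = (\<integral>\<^sup>+x. ennreal (x powr - s) * indicator {0..1} x \<partial>lborel) + (\<integral>\<^sup>+x. ennreal ((- x) powr - s) * indicator {0..1} (- x) \<partial>lborel)"
    by (rule nn_integral_add) measurable
  also have "(\<integral>\<^sup>+x. ennreal ((- x) powr - s) * indicator {0..1} (- x) \<partial>lborel) = (\<integral>\<^sup>+x. ennreal (x powr - s) * indicator {0..1} x \<partial>lborel)"
    using nn_integral_real_affine[of "\<lambda>x. ennreal (x powr - s) * indicator {0..1} x" "-1" 0] by simp
  also have "(\<integral>\<^sup>+x. ennreal (x powr - s) * indicator {0..1} x \<partial>lborel) +
     (\<integral>\<^sup>+x. ennreal (x powr - s) * indicator {0..1} x \<partial>lborel) < \<infinity>"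
    using half by (simp add: less_top[symmetric])
  finally show ?thesis .
qed

text \<open>From \<open>|Re z| |Im z| \<le> |z|^2\<close> follows
  \<open>|z|^-q \<le> |Re z|^(-q/2) |Im z|^(-q/2)\<close>. The right side factors over the
  independent coordinates, and each factor has a singularity of order \<open>q/2 < 1\<close>, which
  is integrable on the line.\<close>

lemma std_complex_gaussian_neg_moment:
  assumes "0 \<le> q" "q < 2"
  shows "(\<integral>\<^sup>+z. ennreal (cmod z powr - q) \<partial>std_complex_gaussian) < \<infinity>"
proof -
  define s where "s = q / 2"
  have s: "0 \<le> s" "s < 1" using assms by (auto simp: s_def)
  have fin: "(\<integral>\<^sup>+x. ennreal (normal_density 0 (1 / sqrt 2) x) * ennreal (\<bar>x\<bar> powr - s) \<partial>lborel) < \<infinity>"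
  proof -
    have "ennreal (normal_density 0 (1 / sqrt 2) x) * ennreal (\<bar>x\<bar> powr - s)
       \<le> ennreal (\<bar>x\<bar> powr - s) * indicator {-1..1} x + ennreal (normal_density 0 (1 / sqrt 2) x)" for x :: real
    proof (cases "\<bar>x\<bar> \<le> 1")
      case True
      have "normal_density 0 (1 / sqrt 2) x \<le> 1 / sqrt pi"
        by (simp add: normal_density_def power_divide divide_simps)
      also have "\<dots> \<le> 1" using pi_ge_two by simp
      finally have "ennreal (normal_density 0 (1 / sqrt 2) x) \<le> 1" by simp
      then have "ennreal (normal_density 0 (1 / sqrt 2) x) * ennreal (\<bar>x\<bar> powr - s) \<le> 1 * ennreal (\<bar>x\<bar> powr - s)"
        by (intro mult_right_mono) auto
      also have "\<dots> \<le> ennreal (\<bar>x\<bar> powr - s) * indicator {-1..1} x + ennreal (normal_density 0 (1 / sqrt 2) x)"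
        using True by (simp add: indicator_def abs_le_iff)
      finally show ?thesis .
    next
      case False
      then have "x \<noteq> 0" by auto
      with False have "\<bar>x\<bar> powr - s \<le> 1"
        using s powr_mono[of "- s" 0 "\<bar>x\<bar>"] by simp
      then have "ennreal (normal_density 0 (1 / sqrt 2) x) * ennreal (\<bar>x\<bar> powr - s) \<le> ennreal (normal_density 0 (1 / sqrt 2) x) * 1"
        by (intro mult_left_mono) auto
      also have "\<dots> \<le> ennreal (\<bar>x\<bar> powr - s) * indicator {-1..1} x + ennreal (normal_density 0 (1 / sqrt 2) x)"
        by simp
      finally show ?thesis .
    qed
    then have "(\<integral>\<^sup>+x. ennreal (normal_density 0 (1 / sqrt 2) x) * ennreal (\<bar>x\<bar> powr - s) \<partial>lborel)
       \<le> (\<integral>\<^sup>+x. ennreal (\<bar>x\<bar> powr - s) * indicator {-1..1} x + ennreal (normal_density 0 (1 / sqrt 2) x) \<partial>lborel)"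
      by (intro nn_integral_mono)
    also have "\<dots> < \<infinity>"
      using nn_integral_neg_powr_finite[OF s] by (subst nn_integral_add) auto
    finally show ?thesis .
  qed
  \<comment> \<open>Since \<open>0 powr - s\<close> is 0, the product bound below fails on the
    coordinate axes; they are discarded as a null set.\<close>
  have "AE z in std_complex_gaussian. Re z \<noteq> 0 \<and> Im z \<noteq> 0"
  proof (rule AE_conjI)
    have "(\<integral>\<^sup>+x. ennreal (normal_density 0 (1 / sqrt 2) x) * indicator {0} x \<partial>lborel) = 0"
      by (rule nn_integral_null_set) (auto simp: null_sets_def)
    moreover have "AE x in lborel. x \<noteq> (0::real)" by (rule AE_lborel_singleton)
    ultimately have z: "(\<integral>\<^sup>+x. ennreal (normal_density 0 (1 / sqrt 2) x) * indicator {0} x \<partial>lborel) = 0" by simp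
    have "(\<integral>\<^sup>+z. indicator {0} (Re z) * 1 \<partial>std_complex_gaussian) = 0"
      by (subst nn_integral_std_complex_gaussian_product) (simp_all add: z)
    then show "AE z in std_complex_gaussian. Re z \<noteq> 0"
      by (subst (asm) nn_integral_0_iff_AE) (auto simp: indicator_def elim!: eventually_mono)
    have "(\<integral>\<^sup>+z. 1 * indicator {0} (Im z) \<partial>std_complex_gaussian) = 0"
      by (subst nn_integral_std_complex_gaussian_product) (simp_all add: z)
    then show "AE z in std_complex_gaussian. Im z \<noteq> 0"
      by (subst (asm) nn_integral_0_iff_AE) (auto simp: indicator_def elim!: eventually_mono)
  qed
  moreover have "ennreal (cmod z powr - q) \<le> ennreal (\<bar>Re z\<bar> powr - s) * ennreal (\<bar>Im z\<bar> powr - s)"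
    if "Re z \<noteq> 0" "Im z \<noteq> 0" for z
  proof -
    have pos: "0 < \<bar>Re z\<bar> * \<bar>Im z\<bar>" using that by simp
    have "\<bar>Re z\<bar> * \<bar>Im z\<bar> \<le> cmod z * cmod z"
      by (intro mult_mono abs_Re_le_cmod abs_Im_le_cmod) auto
    then have "\<bar>Re z\<bar> * \<bar>Im z\<bar> \<le> (cmod z)\<^sup>2" by (simp add: power2_eq_square)
    then have "((cmod z)\<^sup>2) powr - s \<le> (\<bar>Re z\<bar> * \<bar>Im z\<bar>) powr - s"
      using pos s by (intro powr_mono2') auto
    moreover have "((cmod z)\<^sup>2) powr - s = cmod z powr - q"
    proof -
      have "cmod z \<noteq> 0" using that by auto
      then have "(cmod z)\<^sup>2 = cmod z powr 2" by simp
      then show ?thesis by (simp only: powr_powr) (simp add: s_def)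
    qed
    ultimately show ?thesis by (simp add: powr_mult ennreal_mult[symmetric])
  qed
  ultimately have "(\<integral>\<^sup>+z. ennreal (cmod z powr - q) \<partial>std_complex_gaussian)
      \<le> (\<integral>\<^sup>+z. ennreal (\<bar>Re z\<bar> powr - s) * ennreal (\<bar>Im z\<bar> powr - s) \<partial>std_complex_gaussian)"
    by (intro nn_integral_mono_AE) auto
  also have "\<dots> < \<infinity>"
    using fin by (subst nn_integral_std_complex_gaussian_product) (auto simp: ennreal_mult_less_top)
  finally show ?thesis .
qed

section \<open>Products of standard Gaussians and normal forms of their linear images\<close>

abbreviation gauss_PiM :: "nat \<Rightarrow> (nat \<Rightarrow> complex) measure" where
  "gauss_PiM m \<equiv> Pi\<^sub>M {..<m} (\<lambda>_. std_complex_gaussian)"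

lemma sets_PiM_gauss [measurable_cong]:
  "sets (Pi\<^sub>M I (\<lambda>_. std_complex_gaussian)) = sets (Pi\<^sub>M I (\<lambda>_. borel))"
  by (intro sets_PiM_cong) auto

lemma prob_space_gauss_PiM: "prob_space (gauss_PiM m)"
  by (intro prob_space_PiM prob_space_std_complex_gaussian)

lemma nn_integral_PiM_gauss_insert2:
  assumes J: "finite J" "i \<notin> J" "j \<notin> J" "i \<noteq> j"
    and [measurable]: "g \<in> borel_measurable (Pi\<^sub>M (insert i (insert j J)) (\<lambda>_. borel))"
  shows "(\<integral>\<^sup>+v. g v \<partial>Pi\<^sub>M (insert i (insert j J)) (\<lambda>_. std_complex_gaussian)) =
    (\<integral>\<^sup>+w. \<integral>\<^sup>+y. \<integral>\<^sup>+x. g (w(j := y, i := x)) \<partial>std_complex_gaussian \<partial>std_complex_gaussian \<partial>Pi\<^sub>M J (\<lambda>_. std_complex_gaussian))"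
proof -
  have "(\<integral>\<^sup>+v. g v \<partial>Pi\<^sub>M (insert i (insert j J)) (\<lambda>_. std_complex_gaussian)) =
     (\<integral>\<^sup>+u. \<integral>\<^sup>+x. g (u(i := x)) \<partial>std_complex_gaussian \<partial>Pi\<^sub>M (insert j J) (\<lambda>_. std_complex_gaussian))"
    using J by (intro gauss_pi.product_nn_integral_insert) (auto, measurable)
  also have "\<dots> = (\<integral>\<^sup>+w. \<integral>\<^sup>+y. \<integral>\<^sup>+x. g (w(j := y, i := x)) \<partial>std_complex_gaussian \<partial>std_complex_gaussian \<partial>Pi\<^sub>M J (\<lambda>_. std_complex_gaussian))"
    using J by (intro gauss_pi.product_nn_integral_insert) (auto, measurable)
  finally show ?thesis .
qed

lemma measurable_upd2:
  assumes "J \<subseteq> L" "i \<in> J" "j \<in> J"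
    and [measurable]: "p \<in> borel_measurable (Pi\<^sub>M J (\<lambda>_. borel))" "q \<in> borel_measurable (Pi\<^sub>M J (\<lambda>_. borel))"
  shows "(\<lambda>v. v(i := p v, j := q v)) \<in> measurable (Pi\<^sub>M J (\<lambda>_. borel)) (Pi\<^sub>M J (\<lambda>_. borel))"
proof -
  have "(\<lambda>v. (\<lambda>k\<in>J. if k = j then q v else if k = i then p v else v k)) \<in> measurable (Pi\<^sub>M J (\<lambda>_. borel)) (Pi\<^sub>M J (\<lambda>_. borel))"
    by (intro measurable_restrict) (auto intro: measurable_component_singleton)
  also have "?this \<longleftrightarrow> ?thesis"
    using assms by (intro measurable_cong) (auto simp: space_PiM PiE_def extensional_def)
  finally show ?thesis .
qed

text \<open>With the remaining coordinates frozen, Fubini's theorem reduces the claim to the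
  rotation invariance of the pair at \<open>i\<close> and \<open>j\<close>.\<close>

lemma distr_gauss_PiM_unitary:
  assumes ij: "i < m" "j < m" "i \<noteq> j" and ab: "a * cnj a + b * cnj b = 1" and b: "b \<noteq> 0"
  shows "distr (gauss_PiM m) (gauss_PiM m)
    (\<lambda>v. v(i := a * v i + b * v j, j := - cnj b * v i + cnj a * v j)) = gauss_PiM m"
    (is "distr _ _ ?T = _")
proof (rule measure_eqI)
  have T: "?T \<in> measurable (Pi\<^sub>M {..<m} (\<lambda>_. borel)) (Pi\<^sub>M {..<m} (\<lambda>_. borel))"
    using ij by (intro measurable_upd2[of _ UNIV])
      (auto intro!: borel_measurable_add borel_measurable_times measurable_component_singleton borel_measurable_diff)
  have [measurable]: "?T \<in> measurable (gauss_PiM m) (gauss_PiM m)"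
    using T unfolding measurable_cong_sets[OF sets_PiM_gauss sets_PiM_gauss] .
  show "sets (distr (gauss_PiM m) (gauss_PiM m) ?T) = sets (gauss_PiM m)" by simp
  fix A assume "A \<in> sets (distr (gauss_PiM m) (gauss_PiM m) ?T)"
  then have A [measurable]: "A \<in> sets (gauss_PiM m)" by simp
  then have A' [measurable]: "A \<in> sets (Pi\<^sub>M {..<m} (\<lambda>_. borel))"
    by (simp add: sets_PiM_gauss)
  define J where "J = {..<m} - {i, j}"
  have m: "{..<m} = insert i (insert j J)" using ij by (auto simp: J_def)
  have J: "finite J" "i \<notin> J" "j \<notin> J" "i \<noteq> j" using ij by (auto simp: J_def)
  have ind [measurable]: "(\<lambda>v. indicator A v :: ennreal) \<in> borel_measurable (Pi\<^sub>M (insert i (insert j J)) (\<lambda>_. borel))"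
    using A' unfolding m[symmetric] by measurable
  have ind2 [measurable]: "(\<lambda>v. indicator A (?T v) :: ennreal) \<in> borel_measurable (Pi\<^sub>M (insert i (insert j J)) (\<lambda>_. borel))"
    using A' T unfolding m[symmetric] by measurable
  have "emeasure (distr (gauss_PiM m) (gauss_PiM m) ?T) A = (\<integral>\<^sup>+v. indicator A (?T v) \<partial>gauss_PiM m)"
    by (subst nn_integral_indicator[symmetric], simp, rule nn_integral_distr) measurable
  also have "\<dots> = (\<integral>\<^sup>+w. \<integral>\<^sup>+y. \<integral>\<^sup>+x. indicator A (?T (w(j := y, i := x))) \<partial>std_complex_gaussian \<partial>std_complex_gaussian \<partial>Pi\<^sub>M J (\<lambda>_. std_complex_gaussian))"
    unfolding m by (rule nn_integral_PiM_gauss_insert2[OF J ind2])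
  also have "\<dots> = (\<integral>\<^sup>+w. \<integral>\<^sup>+y. \<integral>\<^sup>+x. indicator A (w(j := y, i := x)) \<partial>std_complex_gaussian \<partial>std_complex_gaussian \<partial>Pi\<^sub>M J (\<lambda>_. std_complex_gaussian))"
  proof (rule nn_integral_cong)
    fix w assume w: "w \<in> space (Pi\<^sub>M J (\<lambda>_. std_complex_gaussian))"
    have w': "w \<in> space (Pi\<^sub>M J (\<lambda>_. borel))" using w by (simp add: space_PiM)
    have h: "(\<lambda>(y, x). indicator A (w(j := y, i := x)) :: ennreal) \<in> borel_measurable (borel \<Otimes>\<^sub>M borel)"
    proof -
      have "(\<lambda>p. (\<lambda>k\<in>insert i (insert j J). if k = i then snd p else if k = j then fst p else w k)) \<in> measurable (borel \<Otimes>\<^sub>M borel) (Pi\<^sub>M {..<m} (\<lambda>_. borel))"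
        unfolding m by (intro measurable_restrict) auto
      also have "(\<lambda>p. (\<lambda>k\<in>insert i (insert j J). if k = i then snd p else if k = j then fst p else w k)) = (\<lambda>(y, x). w(j := y, i := x))"
        using w J by (auto simp: fun_eq_iff space_PiM PiE_def extensional_def)
      finally have [measurable]: "(\<lambda>(y, x). w(j := y, i := x)) \<in> measurable (borel \<Otimes>\<^sub>M borel) (Pi\<^sub>M {..<m} (\<lambda>_. borel))" .
      have "(\<lambda>p. indicator A ((\<lambda>(y, x). w(j := y, i := x)) p) :: ennreal) \<in> borel_measurable (borel \<Otimes>\<^sub>M borel)"
        by measurable
      then show ?thesis by (simp add: split_beta')
    qed
    \<comment> \<open>The outer integral runs over \<open>y\<close>, so \<open>y\<close> takes the
      place of the first coordinate; the same rotation is then described by \<open>cnj a\<close> and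
      \<open>- cnj b\<close> instead of \<open>a\<close> and \<open>b\<close>.\<close>
    have eq: "?T (w(j := y, i := x)) = w(j := cnj a * y + (- cnj b) * x, i := - cnj (- cnj b) * y + cnj (cnj a) * x)" for x y
      using ij by (auto simp: fun_eq_iff)
    show "(\<integral>\<^sup>+y. \<integral>\<^sup>+x. indicator A (?T (w(j := y, i := x))) \<partial>std_complex_gaussian \<partial>std_complex_gaussian)
        = (\<integral>\<^sup>+y. \<integral>\<^sup>+x. indicator A (w(j := y, i := x)) \<partial>std_complex_gaussian \<partial>std_complex_gaussian)"
      unfolding eq
      by (rule nn_integral_std_complex_gaussian_unitary[of "\<lambda>(y, x). indicator A (w(j := y, i := x))", unfolded prod.case, OF h])
        (use ab b in \<open>auto simp: mult.commute\<close>)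
  qed
  also have "\<dots> = (\<integral>\<^sup>+v. indicator A v \<partial>gauss_PiM m)"
    unfolding m by (rule nn_integral_PiM_gauss_insert2[OF J ind, symmetric])
  finally show "emeasure (distr (gauss_PiM m) (gauss_PiM m) ?T) A = emeasure (gauss_PiM m) A"
    by simp
qed

definition lin_map :: "'i set \<Rightarrow> nat \<Rightarrow> ('i \<Rightarrow> nat \<Rightarrow> complex) \<Rightarrow> (nat \<Rightarrow> complex) \<Rightarrow> 'i \<Rightarrow> complex" where
  "lin_map K m A v = (\<lambda>i\<in>K. \<Sum>j<m. A i j * v j)"

lemma measurable_lin_map [measurable]:
  "lin_map K m A \<in> measurable (gauss_PiM m) (Pi\<^sub>M K (\<lambda>_. borel))"
  unfolding lin_map_def by measurable

text \<open>Givens rotations: the law is unchanged when the coefficient matrix is multiplied on the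
  right by a unitary matrix. Each induction step rotates columns \<open>0\<close> and
  \<open>n\<close> so that the entry of row \<open>k\<close> in column \<open>n\<close> moves into
  column \<open>0\<close>.\<close>

lemma gaussian_law_eliminate:
  assumes "n \<le> m"
  shows "\<exists>B. distr (gauss_PiM m) (Pi\<^sub>M K (\<lambda>_. borel)) (lin_map K m A) = distr (gauss_PiM m) (Pi\<^sub>M K (\<lambda>_. borel)) (lin_map K m B)
     \<and> (\<forall>j. 0 < j \<and> j < n \<longrightarrow> B k j = 0)"
  using assms
proof (induction n)
  case 0
  show ?case by (rule exI[of _ A]) auto
next
  case (Suc n)
  then obtain B where B: "distr (gauss_PiM m) (Pi\<^sub>M K (\<lambda>_. borel)) (lin_map K m A) = distr (gauss_PiM m) (Pi\<^sub>M K (\<lambda>_. borel)) (lin_map K m B)"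
    and B0: "\<And>j. 0 < j \<Longrightarrow> j < n \<Longrightarrow> B k j = 0" by auto
  show ?case
  proof (cases "n = 0 \<or> B k n = 0")
    case True
    then show ?thesis using B B0 by (intro exI[of _ B]) (auto simp: less_Suc_eq)
  next
    case False
    define p q s where "p = B k 0" and "q = B k n" and "s = sqrt ((cmod p)\<^sup>2 + (cmod q)\<^sup>2)"
    have q: "q \<noteq> 0" using False by (simp add: q_def)
    have s: "s > 0" using q by (simp add: s_def add_nonneg_pos)
    \<comment> \<open>The new entry of row \<open>k\<close> in column \<open>n\<close> is
      \<open>p * b + q * cnj a\<close>, which cancels for this choice; \<open>s\<close> normalises
      the rotation.\<close>
    define a b where "a = cnj p / of_real s" and "b = - q / of_real s"
    have bn: "b \<noteq> 0" using q s by (simp add: b_def)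
    have "a * cnj a + b * cnj b = (p * cnj p + q * cnj q) / (of_real s)\<^sup>2"
      by (simp add: a_def b_def add_divide_distrib power2_eq_square mult.commute)
    also have "p * cnj p + q * cnj q = of_real (s\<^sup>2)"
      unfolding s_def by (simp add: complex_norm_square[symmetric])
    finally have ab: "a * cnj a + b * cnj b = 1" using s by simp
    have nm: "0 < m" "n < m" "0 \<noteq> n" using Suc.prems False by auto
    define C where "C i j = (if j = 0 then B i 0 * a - B i n * cnj b else if j = n then B i 0 * b + B i n * cnj a else B i j)" for i j
    define T where "T = (\<lambda>v :: nat \<Rightarrow> complex. v(0 := a * v 0 + b * v n, n := - cnj b * v 0 + cnj a * v n))"
    have T: "distr (gauss_PiM m) (gauss_PiM m) T = gauss_PiM m"
      unfolding T_def by (rule distr_gauss_PiM_unitary[OF nm ab bn])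
    have Tm [measurable]: "T \<in> measurable (gauss_PiM m) (gauss_PiM m)"
    proof -
      have "T \<in> measurable (Pi\<^sub>M {..<m} (\<lambda>_. borel)) (Pi\<^sub>M {..<m} (\<lambda>_. borel))"
        unfolding T_def using nm by (intro measurable_upd2[of _ UNIV])
          (auto intro!: borel_measurable_add borel_measurable_times measurable_component_singleton borel_measurable_diff)
      then show ?thesis unfolding measurable_cong_sets[OF sets_PiM_gauss sets_PiM_gauss] .
    qed
    define J where "J = {..<m} - {0, n}"
    have m: "{..<m} = insert 0 (insert n J)" and J: "finite J" "0 \<notin> J" "n \<notin> J" using nm by (auto simp: J_def)
    have comp: "lin_map K m B (T v) = lin_map K m C v" for v
    proof -
      have "(\<Sum>j<m. B i j * T v j) = (\<Sum>j<m. C i j * v j)" for i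
      proof -
        have "(\<Sum>j\<in>J. B i j * T v j) = (\<Sum>j\<in>J. C i j * v j)"
          using J by (intro sum.cong) (auto simp: T_def C_def)
        then show ?thesis
          using J nm unfolding m by (simp add: T_def C_def algebra_simps)
      qed
      then show ?thesis by (simp add: lin_map_def)
    qed
    have "distr (gauss_PiM m) (Pi\<^sub>M K (\<lambda>_. borel)) (lin_map K m B) = distr (distr (gauss_PiM m) (gauss_PiM m) T) (Pi\<^sub>M K (\<lambda>_. borel)) (lin_map K m B)"
      by (simp add: T)
    also have "\<dots> = distr (gauss_PiM m) (Pi\<^sub>M K (\<lambda>_. borel)) (lin_map K m C)"
      by (subst distr_distr) (auto simp: o_def comp)
    finally have "distr (gauss_PiM m) (Pi\<^sub>M K (\<lambda>_. borel)) (lin_map K m A) = distr (gauss_PiM m) (Pi\<^sub>M K (\<lambda>_. borel)) (lin_map K m C)"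
      using B by simp
    moreover have "C k j = 0" if "0 < j" "j < Suc n" for j
    proof (cases "j = n")
      case True
      then show ?thesis using nm s by (simp add: C_def a_def b_def p_def[symmetric] q_def[symmetric])
    next
      case False
      then show ?thesis using that B0 by (simp add: C_def)
    qed
    ultimately show ?thesis by blast
  qed
qed

text \<open>The distinguished variable \<open>Y k\<close> becomes a multiple of the first Gaussian
  alone. Its law, and its independence of variables orthogonal to it, can then be read off the
  matrix.\<close>

lemma gaussian_vector_canonical:
  assumes M: "prob_space M" and Y: "complex_gaussian_vector M K Y"
  obtains m B where "0 < m"
    "distr M (Pi\<^sub>M K (\<lambda>_. borel)) (\<lambda>\<omega>. \<lambda>k\<in>K. Y k \<omega>) = distr (gauss_PiM m) (Pi\<^sub>M K (\<lambda>_. borel)) (lin_map K m B)"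
    "\<And>j. 0 < j \<Longrightarrow> j < m \<Longrightarrow> B k j = 0"
proof -
  obtain m A where A: "distr M (Pi\<^sub>M K (\<lambda>_. borel)) (\<lambda>\<omega>. \<lambda>i\<in>K. Y i \<omega>) = distr (gauss_PiM m) (Pi\<^sub>M K (\<lambda>_. borel)) (lin_map K m A)"
    using Y unfolding complex_gaussian_vector_def lin_map_def[abs_def] by blast
  show ?thesis
  proof (cases "m = 0")
    \<comment> \<open>Without columns the vector is zero; it is represented by one zero column so
      that the index \<open>0\<close> exists.\<close>
    case True
    have *: "lin_map K 1 (\<lambda>_ _. 0) = (\<lambda>_. \<lambda>k\<in>K. 0)" "lin_map K 0 A = (\<lambda>_. \<lambda>k\<in>K. 0)"
      by (auto simp: lin_map_def fun_eq_iff)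
    have sp: "(\<lambda>k\<in>K. 0) \<in> space (Pi\<^sub>M K (\<lambda>_. borel :: complex measure))" by (auto simp: space_PiM)
    have "distr M (Pi\<^sub>M K (\<lambda>_. borel)) (\<lambda>\<omega>. \<lambda>k\<in>K. Y k \<omega>) = distr (gauss_PiM 1) (Pi\<^sub>M K (\<lambda>_. borel)) (lin_map K 1 (\<lambda>_ _. 0))"
      unfolding A True * prob_space.distr_const[OF prob_space_gauss_PiM sp] by (rule refl)
    then show ?thesis by (intro that[of 1 "\<lambda>_ _. 0"]) auto
  next
    case False
    obtain B where "distr (gauss_PiM m) (Pi\<^sub>M K (\<lambda>_. borel)) (lin_map K m A) = distr (gauss_PiM m) (Pi\<^sub>M K (\<lambda>_. borel)) (lin_map K m B)"
     "\<forall>j. 0 < j \<and> j < m \<longrightarrow> B k j = 0"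
      using gaussian_law_eliminate[of m m K A k] by auto
    with A False show ?thesis by (intro that[of m B]) auto
  qed
qed

subsection \<open>Complex Gaussian vectors\<close>

lemma has_bochner_integral_nn_integral_eq:
  assumes "has_bochner_integral M f x" "\<And>x. 0 \<le> f x"
  shows "(\<integral>\<^sup>+x. ennreal (f x) \<partial>M) = ennreal x"
  using assms by (simp add: has_bochner_integral_iff nn_integral_eq_integral)

lemma std_complex_gaussian_second_moment:
  "(\<integral>\<^sup>+z. ennreal ((cmod z)\<^sup>2) \<partial>std_complex_gaussian) = 1"
proof -
  have "has_bochner_integral lborel (\<lambda>x. normal_density 0 (1 / sqrt 2) x * (x - 0) ^ (2 * 1)) (fact (2 * 1) / ((2 / (1 / sqrt 2)\<^sup>2) ^ 1 * fact 1))"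
    by (rule normal_moment_even) simp
  then have "has_bochner_integral lborel (\<lambda>x. normal_density 0 (1 / sqrt 2) x * x\<^sup>2) (1 / 2)"
    by (simp add: power_divide fact_numeral)
  then have *: "(\<integral>\<^sup>+x. ennreal (normal_density 0 (1 / sqrt 2) x) * ennreal (x\<^sup>2) \<partial>lborel) = ennreal (1 / 2)"
    by (subst ennreal_mult[symmetric], simp, simp, intro has_bochner_integral_nn_integral_eq) simp_all
  have "(\<integral>\<^sup>+z. ennreal ((cmod z)\<^sup>2) \<partial>std_complex_gaussian) =
      (\<integral>\<^sup>+z. ennreal ((Re z)\<^sup>2) * 1 + 1 * ennreal ((Im z)\<^sup>2) \<partial>std_complex_gaussian)"
    by (simp add: cmod_power2)
  also have "\<dots> = ennreal (1 / 2) * 1 + 1 * ennreal (1 / 2)"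
    by (subst nn_integral_add, measurable, subst (1 2) nn_integral_std_complex_gaussian_product, measurable)
      (simp add: *)
  also have "\<dots> = 1" unfolding mult_1_right mult_1_left by (subst ennreal_plus[symmetric]) simp_all
  finally show ?thesis .
qed

text \<open>A quarter turn exchanges the two independent normal coordinates up to a sign. This
  single phase is enough below: the moments that have to vanish are multiplied by
  \<open>\<i>\<close> or by \<open>- 1\<close>.\<close>

lemma distr_std_complex_gaussian_ii: "distr std_complex_gaussian borel ((*) \<i>) = std_complex_gaussian"
proof (rule measure_eqI)
  let ?n = "\<lambda>x. ennreal (normal_density 0 (1 / sqrt 2) x)"
  have iC: "\<i> * Complex x y = Complex (- y) x" for x y
    by (simp add: complex_eq_iff)
  have C [measurable]: "(\<lambda>(x, y). Complex x y) \<in> borel_measurable (borel \<Otimes>\<^sub>M borel)"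
    unfolding Complex_eq by measurable
  fix A assume "A \<in> sets (distr std_complex_gaussian borel ((*) \<i>))"
  then have A [measurable]: "A \<in> sets borel" by simp
  have m [measurable]: "(\<lambda>(x, y). ?n x * ?n y * indicator A (Complex x y)) \<in> borel_measurable (borel \<Otimes>\<^sub>M borel)"
    "(\<lambda>(x, y). ?n y * ?n x * indicator A (Complex x y)) \<in> borel_measurable (borel \<Otimes>\<^sub>M borel)"
  proof -
    have "(\<lambda>p. indicator A ((\<lambda>(x, y). Complex x y) p) :: ennreal) \<in> borel_measurable (borel \<Otimes>\<^sub>M borel)"
      by measurable
    then have [measurable]: "(\<lambda>p. indicator A (Complex (fst p) (snd p)) :: ennreal) \<in> borel_measurable (borel \<Otimes>\<^sub>M borel)"
      by (simp add: split_beta')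
    show "(\<lambda>(x, y). ?n x * ?n y * indicator A (Complex x y)) \<in> borel_measurable (borel \<Otimes>\<^sub>M borel)"
    "(\<lambda>(x, y). ?n y * ?n x * indicator A (Complex x y)) \<in> borel_measurable (borel \<Otimes>\<^sub>M borel)"
      unfolding split_beta' by measurable
  qed
  have "emeasure (distr std_complex_gaussian borel ((*) \<i>)) A = (\<integral>\<^sup>+z. indicator A (\<i> * z) \<partial>std_complex_gaussian)"
    by (subst nn_integral_indicator[symmetric], simp, rule nn_integral_distr) measurable
  also have "\<dots> = (\<integral>\<^sup>+x. \<integral>\<^sup>+y. ?n x * ?n y * indicator A (Complex (- y) x) \<partial>lborel \<partial>lborel)"
    by (subst nn_integral_std_complex_gaussian_normal) (auto intro!: nn_integral_cong simp: iC)
  also have "\<dots> = (\<integral>\<^sup>+x. \<integral>\<^sup>+y. ?n x * ?n y * indicator A (Complex y x) \<partial>lborel \<partial>lborel)"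
  proof (rule nn_integral_cong)
    fix x :: real
    have [measurable]: "(\<lambda>y. ?n x * ?n y * indicator A (Complex y x)) \<in> borel_measurable borel"
      using measurable_compose[OF measurable_Pair1'[of x borel borel, unfolded space_borel, OF UNIV_I], of "\<lambda>(x, y). ?n x * ?n y * indicator A (Complex y x)" borel]
        m(2) measurable_compose[OF measurable_pair_swap' m(2)] by (simp add: split_beta' o_def)
    show "(\<integral>\<^sup>+y. ?n x * ?n y * indicator A (Complex (- y) x) \<partial>lborel) = (\<integral>\<^sup>+y. ?n x * ?n y * indicator A (Complex y x) \<partial>lborel)"
      by (subst (2) nn_integral_real_affine[where c="-1" and t=0]) (simp_all add: normal_density_def)
  qed
  also have "\<dots> = (\<integral>\<^sup>+x. \<integral>\<^sup>+y. ?n y * ?n x * indicator A (Complex x y) \<partial>lborel \<partial>lborel)"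
    by (rule lborel_pair.Fubini') (use m(2) in measurable)
  also have "\<dots> = (\<integral>\<^sup>+z. indicator A z \<partial>std_complex_gaussian)"
    by (subst nn_integral_std_complex_gaussian_normal) (auto intro!: nn_integral_cong simp: mult.commute)
  finally show "emeasure (distr std_complex_gaussian borel ((*) \<i>)) A = emeasure std_complex_gaussian A"
    by simp
qed simp

lemma integrable_norm_le_sq:
  fixes f :: "'a \<Rightarrow> complex"
  assumes M: "finite_measure M" and [measurable]: "f \<in> borel_measurable M"
    and fin: "(\<integral>\<^sup>+x. ennreal ((cmod (f x))\<^sup>2) \<partial>M) < \<infinity>"
  shows "integrable M f"
proof -
  interpret finite_measure M by fact
  have "integrable M (\<lambda>x. (cmod (f x))\<^sup>2)"
    using fin by (intro integrableI_bounded) auto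
  then have "integrable M (\<lambda>x. 1 + (cmod (f x))\<^sup>2)" by simp
  then show ?thesis
  proof (rule Bochner_Integration.integrable_bound)
    have "cmod z \<le> 1 + (cmod z)\<^sup>2" for z
    proof -
      have "0 \<le> (cmod z - 1)\<^sup>2" by simp
      then have "2 * cmod z \<le> 1 + (cmod z)\<^sup>2" by (simp add: power2_diff)
      then show ?thesis using norm_ge_zero[of z] by linarith
    qed
    then show "AE x in M. cmod (f x) \<le> norm (1 + (cmod (f x))\<^sup>2)" by simp
  qed simp
qed

lemma std_complex_gaussian_integrals:
  "integrable std_complex_gaussian (\<lambda>z. z)" "(\<integral>z. z \<partial>std_complex_gaussian) = 0"
  "integrable std_complex_gaussian (\<lambda>z. z * cnj z)" "(\<integral>z. z * cnj z \<partial>std_complex_gaussian) = 1"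
proof -
  show *: "integrable std_complex_gaussian (\<lambda>z. z)"
    by (rule integrable_norm_le_sq) (auto simp: std_complex_gaussian_second_moment gauss.finite_measure_axioms)
  have "(\<integral>z. z \<partial>std_complex_gaussian) = (\<integral>z. z \<partial>distr std_complex_gaussian borel ((*) \<i>))"
    by (simp add: distr_std_complex_gaussian_ii)
  also have "\<dots> = \<i> * (\<integral>z. z \<partial>std_complex_gaussian)"
    by (subst integral_distr, simp, simp) (rule integral_mult_right_zero)
  finally have "(1 - \<i>) * (\<integral>z. z \<partial>std_complex_gaussian) = 0" by (simp add: algebra_simps)
  then show "(\<integral>z. z \<partial>std_complex_gaussian) = 0" by (simp add: complex_eq_iff)
  have sq: "z * cnj z = complex_of_real ((cmod z)\<^sup>2)" for z by (rule complex_norm_square[symmetric])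
  have "has_bochner_integral std_complex_gaussian (\<lambda>z. (cmod z)\<^sup>2) 1"
    by (rule has_bochner_integral_nn_integral) (auto simp: std_complex_gaussian_second_moment)
  then have "has_bochner_integral std_complex_gaussian (\<lambda>z. complex_of_real ((cmod z)\<^sup>2)) (of_real 1)"
    by (rule has_bochner_integral_of_real)
  then show "integrable std_complex_gaussian (\<lambda>z. z * cnj z)" "(\<integral>z. z * cnj z \<partial>std_complex_gaussian) = 1"
    unfolding sq by (auto simp: has_bochner_integral_iff)
qed

lemma gauss_PiM_component:
  assumes "j < m"
  shows "distr (gauss_PiM m) borel (\<lambda>v. v j) = std_complex_gaussian"
proof -
  have "distr (gauss_PiM m) std_complex_gaussian (\<lambda>v. v j) = std_complex_gaussian"
    by (rule distr_PiM_component) (use assms prob_space_std_complex_gaussian in auto)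
  moreover have "distr (gauss_PiM m) std_complex_gaussian (\<lambda>v. v j) = distr (gauss_PiM m) borel (\<lambda>v. v j)"
    by (rule distr_cong) auto
  ultimately show ?thesis by simp
qed

section \<open>Components, linear images, phases and independence of Gaussian vectors\<close>

lemma complex_gaussian_vectorD:
  assumes "complex_gaussian_vector M K Y"
  shows "finite K" "k \<in> K \<Longrightarrow> Y k \<in> borel_measurable M"
proof -
  show "finite K" using assms unfolding complex_gaussian_vector_def by (rule conjunct1)
  assume "k \<in> K"
  moreover have "\<forall>i\<in>K. Y i \<in> borel_measurable M"
    using assms unfolding complex_gaussian_vector_def by (elim conjE)
  ultimately show "Y k \<in> borel_measurable M" by simp
qed

lemma distr_component_PiM:
  assumes "\<And>k. k \<in> K \<Longrightarrow> Y k \<in> borel_measurable M" "k \<in> K"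
  shows "distr M borel (Y k) = distr (distr M (Pi\<^sub>M K (\<lambda>_. borel)) (\<lambda>\<omega>. \<lambda>k\<in>K. Y k \<omega>)) borel (\<lambda>v. v k)"
  using assms by (subst distr_distr) (auto simp: o_def intro!: measurable_restrict)

lemma gaussian_vector_component:
  assumes M: "prob_space M" and Y: "complex_gaussian_vector M K Y" and k: "k \<in> K"
  obtains b where "distr M borel (Y k) = distr std_complex_gaussian borel ((*) b)"
proof -
  obtain m B where m: "0 < m" and
    law: "distr M (Pi\<^sub>M K (\<lambda>_. borel)) (\<lambda>\<omega>. \<lambda>k\<in>K. Y k \<omega>) = distr (gauss_PiM m) (Pi\<^sub>M K (\<lambda>_. borel)) (lin_map K m B)"
    and B0: "\<And>j. 0 < j \<Longrightarrow> j < m \<Longrightarrow> B k j = 0"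
    by (rule gaussian_vector_canonical[OF M Y, of k]) blast
  have "lin_map K m B v k = B k 0 * v 0" for v
  proof -
    have "(\<Sum>j<m. B k j * v j) = (\<Sum>j\<in>{0}. B k j * v j)"
      using B0 m by (intro sum.mono_neutral_right) auto
    then show ?thesis using k by (simp add: lin_map_def)
  qed
  note lin = this
  have "distr M borel (Y k) = distr (distr M (Pi\<^sub>M K (\<lambda>_. borel)) (\<lambda>\<omega>. \<lambda>k\<in>K. Y k \<omega>)) borel (\<lambda>v. v k)"
    using complex_gaussian_vectorD[OF Y] k by (intro distr_component_PiM) auto
  also have "\<dots> = distr (gauss_PiM m) borel (\<lambda>v. B k 0 * v 0)"
    unfolding law by (subst distr_distr) (use k in \<open>auto simp: o_def lin\<close>)
  also have "\<dots> = distr (distr (gauss_PiM m) borel (\<lambda>v. v 0)) borel ((*) (B k 0))"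
    using m by (subst distr_distr) (auto simp: o_def)
  also have "\<dots> = distr std_complex_gaussian borel ((*) (B k 0))"
    using m by (simp add: gauss_PiM_component)
  finally show ?thesis by (rule that)
qed

text \<open>\<open>Y k\<close> has the law of \<open>b\<close> times a standard Gaussian and
  variance \<open>|b|^2\<close>, so every absolute moment scales with a power of the variance.
  Uniform bounds on variances thus give uniform bounds on all moments.\<close>

lemma gaussian_vector_moments:
  assumes M: "prob_space M" and Y: "complex_gaussian_vector M K Y" and k: "k \<in> K"
  shows "integrable M (\<lambda>\<omega>. (cmod (Y k \<omega>))\<^sup>2)"
    and "(\<integral>\<^sup>+\<omega>. ennreal (cmod (Y k \<omega>) ^ (2 * n)) \<partial>M) =
      (\<integral>\<^sup>+z. ennreal (cmod z ^ (2 * n)) \<partial>std_complex_gaussian) * ennreal ((\<integral>\<omega>. (cmod (Y k \<omega>))\<^sup>2 \<partial>M) ^ n)"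
    and "(\<integral>\<omega>. (cmod (Y k \<omega>))\<^sup>2 \<partial>M) \<noteq> 0 \<Longrightarrow> (\<integral>\<^sup>+\<omega>. ennreal (cmod (Y k \<omega>) powr - q) \<partial>M) =
      (\<integral>\<^sup>+z. ennreal (cmod z powr - q) \<partial>std_complex_gaussian) * ennreal ((\<integral>\<omega>. (cmod (Y k \<omega>))\<^sup>2 \<partial>M) powr - (q / 2))"
proof -
  obtain b where b: "distr M borel (Y k) = distr std_complex_gaussian borel ((*) b)"
    by (rule gaussian_vector_component[OF M Y k])
  have [measurable]: "Y k \<in> borel_measurable M" using complex_gaussian_vectorD[OF Y] k by auto
  have tr: "(\<integral>\<^sup>+\<omega>. g (Y k \<omega>) \<partial>M) = (\<integral>\<^sup>+z. g (b * z) \<partial>std_complex_gaussian)"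
    if [measurable]: "g \<in> borel_measurable borel" for g :: "complex \<Rightarrow> ennreal"
  proof -
    have "(\<integral>\<^sup>+\<omega>. g (Y k \<omega>) \<partial>M) = (\<integral>\<^sup>+z. g z \<partial>distr M borel (Y k))"
      by (subst nn_integral_distr) auto
    also have "\<dots> = (\<integral>\<^sup>+z. g (b * z) \<partial>std_complex_gaussian)"
      unfolding b by (subst nn_integral_distr) auto
    finally show ?thesis .
  qed
  have pw: "(\<integral>\<^sup>+\<omega>. ennreal (cmod (Y k \<omega>) ^ n) \<partial>M) = (\<integral>\<^sup>+z. ennreal (cmod z ^ n) \<partial>std_complex_gaussian) * ennreal (cmod b ^ n)" for n
    by (subst tr) (auto simp: norm_mult power_mult_distrib ennreal_mult nn_integral_cmult intro: mult.commute)
  have "(\<integral>\<^sup>+\<omega>. ennreal ((cmod (Y k \<omega>))\<^sup>2) \<partial>M) = ennreal ((cmod b)\<^sup>2)"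
    unfolding pw std_complex_gaussian_second_moment by simp
  then have "has_bochner_integral M (\<lambda>\<omega>. (cmod (Y k \<omega>))\<^sup>2) ((cmod b)\<^sup>2)"
    by (intro has_bochner_integral_nn_integral) auto
  then have int: "integrable M (\<lambda>\<omega>. (cmod (Y k \<omega>))\<^sup>2)" and v: "(\<integral>\<omega>. (cmod (Y k \<omega>))\<^sup>2 \<partial>M) = (cmod b)\<^sup>2"
    by (auto simp: has_bochner_integral_iff)
  show "integrable M (\<lambda>\<omega>. (cmod (Y k \<omega>))\<^sup>2)" by (rule int)
  show "(\<integral>\<^sup>+\<omega>. ennreal (cmod (Y k \<omega>) ^ (2 * n)) \<partial>M) =
      (\<integral>\<^sup>+z. ennreal (cmod z ^ (2 * n)) \<partial>std_complex_gaussian) * ennreal ((\<integral>\<omega>. (cmod (Y k \<omega>))\<^sup>2 \<partial>M) ^ n)"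
    unfolding pw v by (simp add: power_mult)
  assume "(\<integral>\<omega>. (cmod (Y k \<omega>))\<^sup>2 \<partial>M) \<noteq> 0"
  then have b0: "cmod b > 0" using v by auto
  then have "(cmod b)\<^sup>2 = cmod b powr 2" by simp
  then have "((cmod b)\<^sup>2) powr - (q / 2) = cmod b powr - q" by (simp only: powr_powr) simp
  then show "(\<integral>\<^sup>+\<omega>. ennreal (cmod (Y k \<omega>) powr - q) \<partial>M) =
      (\<integral>\<^sup>+z. ennreal (cmod z powr - q) \<partial>std_complex_gaussian) * ennreal ((\<integral>\<omega>. (cmod (Y k \<omega>))\<^sup>2 \<partial>M) powr - (q / 2))"
    unfolding v by (subst tr) (auto simp: norm_mult powr_mult ennreal_mult nn_integral_cmult intro: mult.commute)
qed

text \<open>The matrices multiply. This makes difference quotients, residuals and orthogonal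
  decompositions of the process jointly Gaussian.\<close>

lemma gaussian_vector_linear:
  assumes Y: "complex_gaussian_vector M K Y" and L: "finite L"
    and W: "\<And>l \<omega>. l \<in> L \<Longrightarrow> W l \<omega> = (\<Sum>k\<in>K. c l k * Y k \<omega>)"
  shows "complex_gaussian_vector M L W"
proof -
  note [measurable] = complex_gaussian_vectorD(2)[OF Y]
  have K: "finite K" by (rule complex_gaussian_vectorD(1)[OF Y])
  obtain m A where A: "distr M (Pi\<^sub>M K (\<lambda>_. borel)) (\<lambda>\<omega>. \<lambda>i\<in>K. Y i \<omega>) = distr (gauss_PiM m) (Pi\<^sub>M K (\<lambda>_. borel)) (\<lambda>v. \<lambda>i\<in>K. \<Sum>j<m. A i j * v j)"
    using Y unfolding complex_gaussian_vector_def by (elim conjE exE)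
  define \<Phi> where "\<Phi> y = (\<lambda>l\<in>L. \<Sum>k\<in>K. c l k * y k)" for y :: "'b \<Rightarrow> complex"
  have [measurable]: "\<Phi> \<in> measurable (Pi\<^sub>M K (\<lambda>_. borel)) (Pi\<^sub>M L (\<lambda>_. borel))"
    unfolding \<Phi>_def by measurable
  have eq: "(\<lambda>v. \<Phi> (\<lambda>i\<in>K. \<Sum>j<m. A i j * v j)) = (\<lambda>v. \<lambda>l\<in>L. \<Sum>j<m. (\<Sum>k\<in>K. c l k * A k j) * v j)"
  proof -
    have "(\<Sum>k\<in>K. c l k * (\<Sum>j<m. A k j * v j)) = (\<Sum>j<m. (\<Sum>k\<in>K. c l k * A k j) * v j)" for l v
      unfolding sum_distrib_left sum_distrib_right mult.assoc by (rule sum.swap)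
    then have "(\<Sum>k\<in>K. c l k * (\<lambda>i\<in>K. \<Sum>j<m. A i j * v j) k) = (\<Sum>j<m. (\<Sum>k\<in>K. c l k * A k j) * v j)" for l v
      by simp
    then show ?thesis by (simp add: \<Phi>_def)
  qed
  have "distr M (Pi\<^sub>M L (\<lambda>_. borel)) (\<lambda>\<omega>. \<lambda>l\<in>L. W l \<omega>) = distr (distr M (Pi\<^sub>M K (\<lambda>_. borel)) (\<lambda>\<omega>. \<lambda>i\<in>K. Y i \<omega>)) (Pi\<^sub>M L (\<lambda>_. borel)) \<Phi>"
  proof -
    have "(\<lambda>\<omega>. \<lambda>l\<in>L. W l \<omega>) = \<Phi> \<circ> (\<lambda>\<omega>. \<lambda>i\<in>K. Y i \<omega>)"
      by (auto simp: fun_eq_iff \<Phi>_def W restrict_def)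
    then show ?thesis by (subst distr_distr) auto
  qed
  also have "\<dots> = distr (gauss_PiM m) (Pi\<^sub>M L (\<lambda>_. borel)) (\<lambda>v. \<lambda>l\<in>L. \<Sum>j<m. (\<Sum>k\<in>K. c l k * A k j) * v j)"
    unfolding A by (subst distr_distr) (auto simp: o_def eq)
  finally have law: "distr M (Pi\<^sub>M L (\<lambda>_. borel)) (\<lambda>\<omega>. \<lambda>l\<in>L. W l \<omega>) = distr (gauss_PiM m) (Pi\<^sub>M L (\<lambda>_. borel)) (\<lambda>v. \<lambda>l\<in>L. \<Sum>j<m. (\<Sum>k\<in>K. c l k * A k j) * v j)" .
  have "W l \<in> borel_measurable M" if "l \<in> L" for l
  proof -
    have "W l = (\<lambda>\<omega>. \<Sum>k\<in>K. c l k * Y k \<omega>)" using W[OF that] by (rule ext)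
    moreover have "(\<lambda>\<omega>. \<Sum>k\<in>K. c l k * Y k \<omega>) \<in> borel_measurable M"
      by (intro borel_measurable_sum borel_measurable_times borel_measurable_const complex_gaussian_vectorD(2)[OF Y])
    ultimately show ?thesis by simp
  qed
  moreover have "\<exists>(m::nat) B. distr M (Pi\<^sub>M L (\<lambda>_. borel)) (\<lambda>\<omega>. \<lambda>l\<in>L. W l \<omega>) =
      distr (gauss_PiM m) (Pi\<^sub>M L (\<lambda>_. borel)) (\<lambda>v. \<lambda>l\<in>L. \<Sum>j<m. B l j * v j)"
    by (rule exI[of _ m], rule exI[of _ "\<lambda>l j. \<Sum>k\<in>K. c l k * A k j"], rule law)
  ultimately show ?thesis
    unfolding complex_gaussian_vector_def using L by (intro conjI ballI)
qed

text \<open>The scalar commutes with the matrix, \<open>\<i> (A v) = A (\<i> v)\<close>, and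
  \<open>\<i> v\<close> has the law of \<open>v\<close> because each coordinate does.\<close>

lemma gaussian_vector_phase:
  assumes Y: "complex_gaussian_vector M K Y"
  shows "distr M (Pi\<^sub>M K (\<lambda>_. borel)) (\<lambda>\<omega>. \<lambda>k\<in>K. \<i> * Y k \<omega>) = distr M (Pi\<^sub>M K (\<lambda>_. borel)) (\<lambda>\<omega>. \<lambda>k\<in>K. Y k \<omega>)"
proof -
  note [measurable] = complex_gaussian_vectorD(2)[OF Y]
  obtain m A where A: "distr M (Pi\<^sub>M K (\<lambda>_. borel)) (\<lambda>\<omega>. \<lambda>i\<in>K. Y i \<omega>) = distr (gauss_PiM m) (Pi\<^sub>M K (\<lambda>_. borel)) (lin_map K m A)"
    using Y unfolding complex_gaussian_vector_def lin_map_def[abs_def] by blast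
  define R where "R = compose {..<m} ((*) \<i> :: complex \<Rightarrow> complex)"
  have R: "distr (gauss_PiM m) (gauss_PiM m) R = gauss_PiM m"
  proof -
    have "distr (gauss_PiM m) (Pi\<^sub>M {..<m} (\<lambda>_. std_complex_gaussian)) R = Pi\<^sub>M {..<m} (\<lambda>_. distr std_complex_gaussian std_complex_gaussian ((*) \<i>))"
      unfolding R_def by (rule distr_PiM_finite_prob_space') (auto intro: prob_space_std_complex_gaussian)
    also have "distr std_complex_gaussian std_complex_gaussian ((*) \<i>) = std_complex_gaussian"
      using distr_std_complex_gaussian_ii by (simp cong: distr_cong)
    finally show ?thesis .
  qed
  have [measurable]: "R \<in> measurable (gauss_PiM m) (gauss_PiM m)"
    unfolding R_def compose_def by measurable
  have "distr M (Pi\<^sub>M K (\<lambda>_. borel)) (\<lambda>\<omega>. \<lambda>k\<in>K. \<i> * Y k \<omega>) = distr (distr M (Pi\<^sub>M K (\<lambda>_. borel)) (\<lambda>\<omega>. \<lambda>i\<in>K. Y i \<omega>)) (Pi\<^sub>M K (\<lambda>_. borel)) (\<lambda>y. \<lambda>k\<in>K. \<i> * y k)"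
  proof -
    have "(\<lambda>\<omega>. \<lambda>k\<in>K. \<i> * Y k \<omega>) = (\<lambda>y. \<lambda>k\<in>K. \<i> * y k) \<circ> (\<lambda>\<omega>. \<lambda>i\<in>K. Y i \<omega>)"
      by (auto simp: fun_eq_iff restrict_def)
    then show ?thesis by (subst distr_distr) auto
  qed
  also have "\<dots> = distr (gauss_PiM m) (Pi\<^sub>M K (\<lambda>_. borel)) (\<lambda>v. \<lambda>k\<in>K. \<i> * lin_map K m A v k)"
    unfolding A by (subst distr_distr) (auto simp: o_def)
  also have "\<dots> = distr (gauss_PiM m) (Pi\<^sub>M K (\<lambda>_. borel)) (\<lambda>v. lin_map K m A (R v))"
    by (intro distr_cong) (auto simp: lin_map_def R_def compose_def sum_distrib_left fun_eq_iff intro!: sum.cong)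
  also have "\<dots> = distr (distr (gauss_PiM m) (gauss_PiM m) R) (Pi\<^sub>M K (\<lambda>_. borel)) (lin_map K m A)"
    by (subst distr_distr) (auto simp: o_def)
  finally show ?thesis by (simp add: R A)
qed

lemma borel_measurable_cnj [measurable]: "cnj \<in> borel_measurable borel"
  by (intro borel_measurable_continuous_onI continuous_intros)

lemma gauss_PiM_covariance:
  assumes j: "j < m" and m: "0 < m"
  shows "integrable (gauss_PiM m) (\<lambda>v. v j * cnj (v 0))"
    and "(\<integral>v. v j * cnj (v 0) \<partial>gauss_PiM m) = (if j = 0 then 1 else 0)"
proof -
  have "integrable (gauss_PiM m) (\<lambda>v. v j * cnj (v 0)) \<and> (\<integral>v. v j * cnj (v 0) \<partial>gauss_PiM m) = (if j = 0 then 1 else 0)"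
  proof (cases "j = 0")
    case True
    have "integrable (distr (gauss_PiM m) borel (\<lambda>v. v 0)) (\<lambda>z. z * cnj z)"
      "(\<integral>z. z * cnj z \<partial>distr (gauss_PiM m) borel (\<lambda>v. v 0)) = 1"
      using std_complex_gaussian_integrals m by (simp_all add: gauss_PiM_component)
    moreover have "(\<lambda>v. v 0) \<in> measurable (gauss_PiM m) borel"
      using measurable_component_singleton[of 0 "{..<m}" "\<lambda>_. std_complex_gaussian"] m by simp
    ultimately show ?thesis
      using True integrable_distr[of "\<lambda>v. v 0" "gauss_PiM m" borel "\<lambda>z. z * cnj z"]
      by (simp add: integral_distr)
  next
    case False
    \<comment> \<open>A product over all coordinates that reduces to \<open>v j * cnj (v 0)\<close>,
      so that the integral factors; the factor at \<open>j\<close> has mean zero.\<close>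
    define f :: "nat \<Rightarrow> complex \<Rightarrow> complex" where "f i = (if i = 0 then cnj else if i = j then (\<lambda>z. z) else (\<lambda>_. 1))" for i
    define J where "J = {..<m} - {0, j}"
    have mJ: "{..<m} = insert 0 (insert j J)" "finite J" "0 \<notin> J" "j \<notin> J" using m j by (auto simp: J_def)
    have p: "(\<Prod>i<m. f i (v i)) = v j * cnj (v 0)" for v
    proof -
      have "(\<Prod>i\<in>J. f i (v i)) = 1" by (rule prod.neutral) (auto simp: f_def J_def)
      then show ?thesis using mJ False by (simp add: f_def mult.commute)
    qed
    have int: "integrable std_complex_gaussian (f i)" for i
      using std_complex_gaussian_integrals(1) by (simp add: f_def)
    have "integrable (gauss_PiM m) (\<lambda>v. \<Prod>i<m. f i (v i))"
      by (rule gauss_pi.product_integrable_prod) (auto intro: int)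
    moreover have "(\<integral>v. (\<Prod>i<m. f i (v i)) \<partial>gauss_PiM m) = (\<Prod>i<m. integral\<^sup>L std_complex_gaussian (f i))"
      by (rule gauss_pi.product_integral_prod) (auto intro: int)
    moreover have "(\<Prod>i<m. integral\<^sup>L std_complex_gaussian (f i)) = 0"
      using j False std_complex_gaussian_integrals(2) by (intro prod_zero bexI[of _ j]) (auto simp: f_def)
    ultimately show ?thesis using False by (simp add: p)
  qed
  then show "integrable (gauss_PiM m) (\<lambda>v. v j * cnj (v 0))"
    and "(\<integral>v. v j * cnj (v 0) \<partial>gauss_PiM m) = (if j = 0 then 1 else 0)" by auto
qed

lemma indep_vars_gauss_PiM:
  assumes "0 < m"
  shows "prob_space.indep_vars (gauss_PiM m) (\<lambda>_. borel) (\<lambda>j v. v j) {..<m}"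
proof -
  have "distr (gauss_PiM m) (Pi\<^sub>M {..<m} (\<lambda>_. borel)) (\<lambda>v. \<lambda>i\<in>{..<m}. v i) = distr (gauss_PiM m) (gauss_PiM m) (\<lambda>v. v)"
    by (rule distr_cong) (auto simp: space_PiM PiE_def extensional_restrict sets_PiM_gauss)
  also have "\<dots> = (\<Pi>\<^sub>M i\<in>{..<m}. distr (gauss_PiM m) borel (\<lambda>v. v i))"
    unfolding distr_id by (rule PiM_cong) (auto simp: gauss_PiM_component)
  finally show ?thesis
    using assms by (subst prob_space.indep_vars_iff_distr_eq_PiM'[OF prob_space_gauss_PiM]) auto
qed

text \<open>Uncorrelated implies independent. In normal form \<open>Y k0\<close> is a nonzero
  multiple of \<open>v 0\<close>, and its covariance with \<open>Y k\<close> is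
  \<open>B k 0 * cnj (B k0 0)\<close>. Orthogonality therefore clears column \<open>0\<close> in all
  rows of \<open>K'\<close>, and the two sides depend on disjoint blocks of i.i.d.
  coordinates.\<close>

lemma gaussian_vector_indep:
  assumes M: "prob_space M" and Y: "complex_gaussian_vector M K Y" and k0: "k0 \<in> K" and K': "K' \<subseteq> K"
    and v0: "(\<integral>\<omega>. (cmod (Y k0 \<omega>))\<^sup>2 \<partial>M) \<noteq> 0"
    and orth: "\<And>k. k \<in> K' \<Longrightarrow> (\<integral>\<omega>. Y k \<omega> * cnj (Y k0 \<omega>) \<partial>M) = 0"
    and f [measurable]: "f \<in> measurable borel N" and g [measurable]: "g \<in> measurable (Pi\<^sub>M K' (\<lambda>_. borel)) N"
  shows "prob_space.indep_var M N (\<lambda>\<omega>. f (Y k0 \<omega>)) N (\<lambda>\<omega>. g (\<lambda>k\<in>K'. Y k \<omega>))"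
proof -
  interpret M: prob_space M by fact
  note Ym [measurable] = complex_gaussian_vectorD(2)[OF Y]
  have Ym' [measurable]: "k \<in> K' \<Longrightarrow> Y k \<in> borel_measurable M" for k using K' Ym by auto
  obtain m B where m: "0 < m" and
    law: "distr M (Pi\<^sub>M K (\<lambda>_. borel)) (\<lambda>\<omega>. \<lambda>k\<in>K. Y k \<omega>) = distr (gauss_PiM m) (Pi\<^sub>M K (\<lambda>_. borel)) (lin_map K m B)"
    and B0: "\<And>j. 0 < j \<Longrightarrow> j < m \<Longrightarrow> B k0 j = 0"
    by (rule gaussian_vector_canonical[OF M Y, of k0]) blast
  have lin: "lin_map K m B v k0 = B k0 0 * v 0" for v
  proof -
    have "(\<Sum>j<m. B k0 j * v j) = (\<Sum>j\<in>{0}. B k0 j * v j)"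
      using B0 m by (intro sum.mono_neutral_right) auto
    then show ?thesis using k0 by (simp add: lin_map_def)
  qed
  have Yrm [measurable]: "(\<lambda>\<omega>. \<lambda>k\<in>K. Y k \<omega>) \<in> measurable M (Pi\<^sub>M K (\<lambda>_. borel))"
    by (rule measurable_restrict) (rule Ym)
  have tr: "(\<integral>\<omega>. g (\<lambda>k\<in>K. Y k \<omega>) \<partial>M) = (\<integral>v. g (lin_map K m B v) \<partial>gauss_PiM m)"
    if g [measurable]: "g \<in> borel_measurable (Pi\<^sub>M K (\<lambda>_. borel))" for g :: "_ \<Rightarrow> complex"
    using arg_cong[OF law, of "\<lambda>N. integral\<^sup>L N g"]
    by (subst (asm) (1 2) integral_distr) (use g Yrm measurable_lin_map in auto)
  have cov: "(\<integral>\<omega>. Y k \<omega> * cnj (Y k0 \<omega>) \<partial>M) = B k 0 * cnj (B k0 0)" if k: "k \<in> K" for k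
  proof -
    have "(\<integral>\<omega>. Y k \<omega> * cnj (Y k0 \<omega>) \<partial>M) = (\<integral>v. lin_map K m B v k * cnj (lin_map K m B v k0) \<partial>gauss_PiM m)"
    proof -
      have [measurable]: "(\<lambda>y. y k) \<in> borel_measurable (Pi\<^sub>M K (\<lambda>_. borel :: complex measure))" "(\<lambda>y. y k0) \<in> borel_measurable (Pi\<^sub>M K (\<lambda>_. borel :: complex measure))"
        using k k0 by (auto intro: measurable_component_singleton)
      have "(\<lambda>y. y k * cnj (y k0)) \<in> borel_measurable (Pi\<^sub>M K (\<lambda>_. borel :: complex measure))"
        by (intro borel_measurable_times measurable_compose[OF _ borel_measurable_cnj] measurable_component_singleton k k0)
      from tr[OF this] show ?thesis using k k0 by simp
    qed
    also have "\<dots> = (\<integral>v. (\<Sum>j<m. B k j * cnj (B k0 0) * (v j * cnj (v 0))) \<partial>gauss_PiM m)"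
      using k by (intro Bochner_Integration.integral_cong) (auto simp: lin, auto simp: lin_map_def sum_distrib_right sum_distrib_left mult_ac)
    also have "\<dots> = (\<Sum>j<m. B k j * cnj (B k0 0) * (\<integral>v. v j * cnj (v 0) \<partial>gauss_PiM m))"
      using gauss_PiM_covariance[OF _ m] by (subst Bochner_Integration.integral_sum) auto
    also have "\<dots> = (\<Sum>j<m. if j = 0 then B k j * cnj (B k0 0) else 0)"
      using gauss_PiM_covariance[OF _ m] by (intro sum.cong) auto
    also have "\<dots> = B k 0 * cnj (B k0 0)" using m by simp
    finally show ?thesis .
  qed
  have "(\<integral>\<omega>. Y k0 \<omega> * cnj (Y k0 \<omega>) \<partial>M) = of_real (\<integral>\<omega>. (cmod (Y k0 \<omega>))\<^sup>2 \<partial>M)"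
    unfolding complex_norm_square[symmetric] by (rule integral_complex_of_real)
  \<comment> \<open>The covariance formula at \<open>k0\<close> itself gives the variance
    \<open>|B k0 0|^2\<close>; a nonzero variance allows division by this entry.\<close>
  then have b0: "B k0 0 \<noteq> 0" using v0 cov[OF k0] by auto
  have Bk: "B k 0 = 0" if "k \<in> K'" for k
    using cov[of k] orth[OF that] K' that b0 by auto
  define \<Psi> :: "(nat \<Rightarrow> complex) \<Rightarrow> _" where "\<Psi> u = (\<lambda>k\<in>K'. \<Sum>j\<in>{1..<m}. B k j * u j)" for u
  have [measurable]: "\<Psi> \<in> measurable (Pi\<^sub>M {1..<m} (\<lambda>_. borel)) (Pi\<^sub>M K' (\<lambda>_. borel))"
    unfolding \<Psi>_def by measurable
  interpret G: prob_space "gauss_PiM m" by (rule prob_space_gauss_PiM)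
  have "prob_space.indep_var (gauss_PiM m) (Pi\<^sub>M {0} (\<lambda>_. borel)) (\<lambda>v. restrict (\<lambda>i. v i) {0}) (Pi\<^sub>M {1..<m} (\<lambda>_. borel)) (\<lambda>v. restrict (\<lambda>i. v i) {1..<m})"
    by (rule prob_space.indep_var_restrict[OF prob_space_gauss_PiM indep_vars_gauss_PiM[OF m]]) (use m in auto)
  then have "prob_space.indep_var (gauss_PiM m) N ((\<lambda>u. f (B k0 0 * u 0)) \<circ> (\<lambda>v. restrict (\<lambda>i. v i) {0})) N ((\<lambda>u. g (\<Psi> u)) \<circ> (\<lambda>v. restrict (\<lambda>i. v i) {1..<m}))"
    by (rule prob_space.indep_var_compose[OF prob_space_gauss_PiM]) measurable
  moreover have "(\<lambda>u. f (B k0 0 * u 0)) \<circ> (\<lambda>v. restrict (\<lambda>i. v i) {0}) = (\<lambda>v. f (lin_map K m B v k0))"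
    by (auto simp: lin)
  moreover have "(\<lambda>u. g (\<Psi> u)) \<circ> (\<lambda>v. restrict (\<lambda>i. v i) {1..<m}) = (\<lambda>v. g (restrict (lin_map K m B v) K'))"
  proof -
    have "(\<Sum>j\<in>{1..<m}. B k j * v j) = (\<Sum>j<m. B k j * v j)" if "k \<in> K'" for k v
      using Bk[OF that] by (intro sum.mono_neutral_left) (auto simp: not_le)
    then have "\<Psi> (restrict (\<lambda>i. v i) {1..<m}) = restrict (lin_map K m B v) K'" for v
      using K' by (auto simp: \<Psi>_def fun_eq_iff lin_map_def restrict_def)
    then show ?thesis by (simp add: o_def)
  qed
  ultimately have "prob_space.indep_var (gauss_PiM m) N (\<lambda>v. f (lin_map K m B v k0)) N (\<lambda>v. g (restrict (lin_map K m B v) K'))"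
    by simp
  then have ind: "distr (gauss_PiM m) N (\<lambda>v. f (lin_map K m B v k0)) \<Otimes>\<^sub>M distr (gauss_PiM m) N (\<lambda>v. g (restrict (lin_map K m B v) K'))
     = distr (gauss_PiM m) (N \<Otimes>\<^sub>M N) (\<lambda>v. (f (lin_map K m B v k0), g (restrict (lin_map K m B v) K')))"
    by (subst (asm) prob_space.indep_var_distribution_eq[OF prob_space_gauss_PiM]) blast
  have trd: "distr M N (\<lambda>\<omega>. g (\<lambda>k\<in>K. Y k \<omega>)) = distr (gauss_PiM m) N (\<lambda>v. g (lin_map K m B v))"
    if g [measurable]: "g \<in> measurable (Pi\<^sub>M K (\<lambda>_. borel)) N" for g :: "_ \<Rightarrow> 'd" and N
  proof -
    have "distr M N (\<lambda>\<omega>. g (\<lambda>k\<in>K. Y k \<omega>)) = distr (distr M (Pi\<^sub>M K (\<lambda>_. borel)) (\<lambda>\<omega>. \<lambda>k\<in>K. Y k \<omega>)) N g"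
      by (subst distr_distr) (auto simp: o_def)
    then show ?thesis unfolding law by (subst (asm) distr_distr) (auto simp: o_def)
  qed
  have rr: "restrict (\<lambda>k\<in>K. Y k \<omega>) K' = (\<lambda>k\<in>K'. Y k \<omega>)" for \<omega> using K' by (auto simp: restrict_def fun_eq_iff)
  have rm [measurable]: "(\<lambda>y. restrict y K') \<in> measurable (Pi\<^sub>M K (\<lambda>_. borel)) (Pi\<^sub>M K' (\<lambda>_. borel))"
    by (rule measurable_restrict_subset[OF K'])
  have km [measurable]: "(\<lambda>y. y k0) \<in> measurable (Pi\<^sub>M K (\<lambda>_. borel)) borel"
    using k0 by (rule measurable_component_singleton)
  have fm: "(\<lambda>y. f (y k0)) \<in> measurable (Pi\<^sub>M K (\<lambda>_. borel)) N" and gm: "(\<lambda>y. g (restrict y K')) \<in> measurable (Pi\<^sub>M K (\<lambda>_. borel)) N"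
    by measurable
  have 1: "distr M N (\<lambda>\<omega>. f (Y k0 \<omega>)) = distr (gauss_PiM m) N (\<lambda>v. f (lin_map K m B v k0))"
    using trd[OF fm] k0 by simp
  have 2: "distr M N (\<lambda>\<omega>. g (\<lambda>k\<in>K'. Y k \<omega>)) = distr (gauss_PiM m) N (\<lambda>v. g (restrict (lin_map K m B v) K'))"
    using trd[OF gm] by (simp only: rr)
  have 3: "distr M (N \<Otimes>\<^sub>M N) (\<lambda>\<omega>. (f (Y k0 \<omega>), g (\<lambda>k\<in>K'. Y k \<omega>))) = distr (gauss_PiM m) (N \<Otimes>\<^sub>M N) (\<lambda>v. (f (lin_map K m B v k0), g (restrict (lin_map K m B v) K')))"
    using trd[OF measurable_Pair[OF fm gm]] k0 by (simp only: rr) simp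
  have "(\<lambda>\<omega>. f (Y k0 \<omega>)) \<in> measurable M N"
    using Ym[OF k0] by measurable
  moreover have "(\<lambda>\<omega>. g (\<lambda>k\<in>K'. Y k \<omega>)) \<in> measurable M N"
    by (rule measurable_compose[OF _ g]) (rule measurable_restrict, rule Ym')
  ultimately show ?thesis
    unfolding M.indep_var_distribution_eq 1 2 3 ind by simp
qed

section \<open>Integrability of products and quotients of Gaussian variables\<close>

lemma power_le_one_plus: "0 \<le> x \<Longrightarrow> i \<le> n \<Longrightarrow> x ^ i \<le> 1 + x ^ n" for x :: real
  by (cases "x \<le> 1") (auto intro: order.trans[OF power_le_one] order.trans[OF power_increasing[of i n x]])

lemma gaussian_vector_integrable_power:
  assumes M: "prob_space M" and Y: "complex_gaussian_vector M K Y" and k: "k \<in> K"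
  shows "integrable M (\<lambda>\<omega>. cmod (Y k \<omega>) ^ n)"
proof -
  interpret prob_space M by fact
  have [measurable]: "Y k \<in> borel_measurable M" using complex_gaussian_vectorD(2)[OF Y k] .
  have "integrable M (\<lambda>\<omega>. cmod (Y k \<omega>) ^ (2 * n))"
  proof (rule integrableI_nonneg)
    show "(\<integral>\<^sup>+\<omega>. ennreal (cmod (Y k \<omega>) ^ (2 * n)) \<partial>M) < \<infinity>"
      unfolding gaussian_vector_moments(2)[OF M Y k] using std_complex_gaussian_moment[of n]
      by (auto simp: ennreal_mult_less_top)
  qed auto
  then have "integrable M (\<lambda>\<omega>. 1 + cmod (Y k \<omega>) ^ (2 * n))" by simp
  then show ?thesis
    by (rule Bochner_Integration.integrable_bound) (auto intro!: power_le_one_plus)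
qed

lemma gaussian_vector_integrable_inverse:
  assumes M: "prob_space M" and Y: "complex_gaussian_vector M K Y" and k: "k \<in> K"
    and v: "(\<integral>\<omega>. (cmod (Y k \<omega>))\<^sup>2 \<partial>M) \<noteq> 0"
  shows "integrable M (\<lambda>\<omega>. 1 / cmod (Y k \<omega>))"
proof -
  have [measurable]: "Y k \<in> borel_measurable M" using complex_gaussian_vectorD(2)[OF Y k] .
  have "(\<integral>\<^sup>+\<omega>. ennreal (cmod (Y k \<omega>) powr - 1) \<partial>M) < \<infinity>"
    unfolding gaussian_vector_moments(3)[OF M Y k v] using std_complex_gaussian_neg_moment[of 1]
    by (auto simp: ennreal_mult_less_top)
  then show ?thesis
    by (intro integrableI_nonneg) (auto simp: powr_minus_divide)
qed

lemma gaussian_vector_phase_integral: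
  assumes Y: "complex_gaussian_vector M K Y" and g: "g \<in> borel_measurable (Pi\<^sub>M K (\<lambda>_. borel))"
  shows "(\<integral>\<omega>. g (\<lambda>k\<in>K. \<i> * Y k \<omega>) \<partial>M) = (\<integral>\<omega>. (g (\<lambda>k\<in>K. Y k \<omega>) :: complex) \<partial>M)"
proof -
  note [measurable] = complex_gaussian_vectorD(2)[OF Y]
  show ?thesis
    using arg_cong[OF gaussian_vector_phase[OF Y], of "\<lambda>N. integral\<^sup>L N g"]
    by (subst (asm) (1 2) integral_distr) (use g in \<open>auto intro!: measurable_restrict\<close>)
qed


text \<open>Independence of the two orthogonal variables splits the integral. Nonnegative integrals
  are used so that the splitting precedes any question of finiteness.\<close>

lemma gaussian_vector_nn_integral_neg_powr_product:
  assumes M: "prob_space M" and Y: "complex_gaussian_vector M K Y" and k: "i \<in> K" "j \<in> K"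
    and vi: "(\<integral>\<omega>. (cmod (Y i \<omega>))\<^sup>2 \<partial>M) \<noteq> 0"
    and orth: "(\<integral>\<omega>. Y j \<omega> * cnj (Y i \<omega>) \<partial>M) = 0"
  shows "(\<integral>\<^sup>+\<omega>. ennreal (cmod (Y i \<omega>) powr - p) * ennreal (cmod (Y j \<omega>) powr - q) \<partial>M)
    = (\<integral>\<^sup>+\<omega>. ennreal (cmod (Y i \<omega>) powr - p) \<partial>M) * (\<integral>\<^sup>+\<omega>. ennreal (cmod (Y j \<omega>) powr - q) \<partial>M)"
proof -
  interpret M: prob_space M by fact
  have [measurable]: "Y i \<in> borel_measurable M" "Y j \<in> borel_measurable M"
    using complex_gaussian_vectorD(2)[OF Y] k by auto
  let ?f = "\<lambda>\<omega>. cmod (Y i \<omega>) powr - p" and ?g = "\<lambda>\<omega>. cmod (Y j \<omega>) powr - q"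
  have m: "(\<lambda>y. cmod (y j) powr - q) \<in> borel_measurable (Pi\<^sub>M {j} (\<lambda>_. borel))"
    by measurable
  have "M.indep_var borel ?f borel ?g"
    using gaussian_vector_indep[OF M Y k(1) _ vi, of "{j}" "\<lambda>z. cmod z powr - p" borel "\<lambda>y. cmod (y j) powr - q"] k orth m
    by simp
  then have ind: "distr M borel ?f \<Otimes>\<^sub>M distr M borel ?g = distr M (borel \<Otimes>\<^sub>M borel) (\<lambda>\<omega>. (?f \<omega>, ?g \<omega>))"
    unfolding M.indep_var_distribution_eq by blast
  interpret g: prob_space "distr M borel ?g" by (rule M.prob_space_distr) simp
  have "(\<integral>\<^sup>+\<omega>. ennreal (?f \<omega>) * ennreal (?g \<omega>) \<partial>M) = (\<integral>\<^sup>+z. ennreal (fst z) * ennreal (snd z) \<partial>distr M (borel \<Otimes>\<^sub>M borel) (\<lambda>\<omega>. (?f \<omega>, ?g \<omega>)))"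
    by (subst nn_integral_distr) auto
  also have "\<dots> = (\<integral>\<^sup>+x. \<integral>\<^sup>+y. ennreal x * ennreal y \<partial>distr M borel ?g \<partial>distr M borel ?f)"
    unfolding ind[symmetric] by (subst g.nn_integral_fst[symmetric]) auto
  also have "\<dots> = (\<integral>\<^sup>+x. ennreal x \<partial>distr M borel ?f) * (\<integral>\<^sup>+y. ennreal y \<partial>distr M borel ?g)"
    by (simp add: nn_integral_cmult nn_integral_multc)
  finally show ?thesis by (simp add: nn_integral_distr)
qed

lemma gaussian_four_integrable:
  assumes M: "prob_space M" and Y: "complex_gaussian_vector M K Y" and k: "a \<in> K" "b \<in> K" "c \<in> K"
    and g [measurable]: "g \<in> borel_measurable M"
    and bd: "\<And>\<omega>. cmod (g \<omega>) \<le> cmod (Y a \<omega>) ^ n + cmod (Y b \<omega>) ^ n + cmod (Y c \<omega>) ^ n + 1"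
  shows "integrable M (g :: _ \<Rightarrow> complex)"
proof -
  interpret M: prob_space M by fact
  have "integrable M (\<lambda>\<omega>. cmod (Y a \<omega>) ^ n + cmod (Y b \<omega>) ^ n + cmod (Y c \<omega>) ^ n + 1)"
    using k by (intro Bochner_Integration.integrable_add gaussian_vector_integrable_power[OF M Y]) auto
  then show ?thesis
    by (rule Bochner_Integration.integrable_bound) (use bd in \<open>auto intro!: AE_I2 intro: order.trans\<close>)
qed

lemma prod3_le_sum_cubes:
  fixes x y z :: real
  assumes "0 \<le> x" "0 \<le> y" "0 \<le> z"
  shows "x * y * z \<le> x ^ 3 + y ^ 3 + z ^ 3"
proof -
  define m where "m = max x (max y z)"
  have "x * y * z \<le> m * m * m"
    using assms by (intro mult_mono) (auto simp: m_def)
  also have "\<dots> = m ^ 3" by (simp add: power3_eq_cube)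
  also have "\<dots> \<le> x ^ 3 + y ^ 3 + z ^ 3"
    using assms unfolding m_def max_def by auto
  finally show ?thesis .
qed

lemma prod2_le_sum_squares:
  fixes x y :: real
  assumes "0 \<le> x" "0 \<le> y"
  shows "x * y \<le> x ^ 2 + y ^ 2"
  using sum_squares_bound[of x y] mult_nonneg_nonneg[OF assms] by linarith

lemma gaussian_vector_integrable_products:
  assumes M: "prob_space M" and Y: "complex_gaussian_vector M K Y" and k: "a \<in> K" "b \<in> K" "c \<in> K"
  shows "integrable M (Y a)" "integrable M (\<lambda>\<omega>. Y a \<omega> * Y b \<omega>)" "integrable M (\<lambda>\<omega>. Y a \<omega> * cnj (Y b \<omega>))"
    "integrable M (\<lambda>\<omega>. Y a \<omega> * Y b \<omega> * cnj (Y c \<omega>))"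
proof -
  note Ym = complex_gaussian_vectorD(2)[OF Y]
  have [measurable]: "Y a \<in> borel_measurable M" "Y b \<in> borel_measurable M" "Y c \<in> borel_measurable M" using Ym k by auto
  show "integrable M (Y a)"
    by (rule gaussian_four_integrable[OF M Y k, where n=1]) (auto intro: add_nonneg_nonneg)
  have 2: "cmod (Y a \<omega>) * cmod (Y b \<omega>) \<le> cmod (Y a \<omega>) ^ 2 + cmod (Y b \<omega>) ^ 2 + cmod (Y c \<omega>) ^ 2 + 1" for \<omega>
    using prod2_le_sum_squares[of "cmod (Y a \<omega>)" "cmod (Y b \<omega>)", OF norm_ge_zero norm_ge_zero] zero_le_power2[of "cmod (Y c \<omega>)"] by linarith
  show "integrable M (\<lambda>\<omega>. Y a \<omega> * Y b \<omega>)"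
    by (rule gaussian_four_integrable[OF M Y k, where n=2]) (use 2 in \<open>auto simp: norm_mult\<close>)
  show "integrable M (\<lambda>\<omega>. Y a \<omega> * cnj (Y b \<omega>))"
    by (rule gaussian_four_integrable[OF M Y k, where n=2]) (use 2 in \<open>auto simp: norm_mult\<close>)
  have 3: "cmod (Y a \<omega>) * cmod (Y b \<omega>) * cmod (Y c \<omega>) \<le> cmod (Y a \<omega>) ^ 3 + cmod (Y b \<omega>) ^ 3 + cmod (Y c \<omega>) ^ 3 + 1" for \<omega>
    using prod3_le_sum_cubes[of "cmod (Y a \<omega>)" "cmod (Y b \<omega>)" "cmod (Y c \<omega>)"] by simp
  show "integrable M (\<lambda>\<omega>. Y a \<omega> * Y b \<omega> * cnj (Y c \<omega>))"
    by (rule gaussian_four_integrable[OF M Y k, where n=3]) (use 3 in \<open>auto simp: norm_mult\<close>)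
qed

lemma gaussian_vector_AE_nonzero:
  assumes M: "prob_space M" and Y: "complex_gaussian_vector M K Y" and k: "k \<in> K"
    and v: "(\<integral>\<omega>. (cmod (Y k \<omega>))\<^sup>2 \<partial>M) \<noteq> 0"
  shows "AE \<omega> in M. Y k \<omega> \<noteq> 0"
proof -
  obtain b where b: "distr M borel (Y k) = distr std_complex_gaussian borel ((*) b)"
    by (rule gaussian_vector_component[OF M Y k])
  have [measurable]: "Y k \<in> borel_measurable M" using complex_gaussian_vectorD(2)[OF Y k] .
  have "b \<noteq> 0"
  proof
    assume "b = 0"
    then have "(\<integral>z. (cmod z)\<^sup>2 \<partial>distr M borel (Y k)) = 0"
      unfolding b by (subst integral_distr) auto
    then show False using v by (simp add: integral_distr)
  qed
  have "AE z in lborel. (z::complex) \<noteq> 0" by (rule AE_lborel_singleton)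
  then have "AE z in std_complex_gaussian. z \<noteq> 0"
    unfolding std_complex_gaussian_def by (subst AE_density) auto
  then have "AE z in std_complex_gaussian. b * z \<noteq> 0" by eventually_elim (use \<open>b \<noteq> 0\<close> in simp)
  then have "AE z in distr std_complex_gaussian borel ((*) b). z \<noteq> 0" by (subst AE_distr_iff) auto
  then show ?thesis unfolding b[symmetric] by (subst (asm) AE_distr_iff) auto
qed

text \<open>Write \<open>Y 2 = W 2 + u * Y 0\<close> and \<open>Y 3 = W 3 + v * Y 0\<close> with
  \<open>W 2\<close>, \<open>W 3\<close> orthogonal to \<open>Y 0\<close>; \<open>Y 1\<close>
  already is. Expanding gives four terms, each a function of \<open>Y 0\<close> times an independent
  product of the \<open>W\<close>. Three of these products are unbalanced in conjugates and have
  mean zero. In the survivor the only trace of \<open>\<phi>\<close> is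
  \<open>E (\<phi> (Y 0) * Y 0) = 1\<close>, and the result is Wick's formula for
  \<open>\<phi> = cnj\<close>. The bound on \<open>\<phi>\<close> admits both \<open>cnj\<close> and
  \<open>1 / x\<close>.\<close>

lemma gaussian_quotient_covariance:
  fixes \<phi> :: "complex \<Rightarrow> complex"
  assumes M: "prob_space M" and Y: "complex_gaussian_vector M {0, 1, 2, 3 :: nat} Y"
    and v0: "(\<integral>\<omega>. (cmod (Y 0 \<omega>))\<^sup>2 \<partial>M) = 1"
    and orth: "(\<integral>\<omega>. Y 1 \<omega> * cnj (Y 0 \<omega>) \<partial>M) = 0"
    and \<phi> [measurable]: "\<phi> \<in> borel_measurable borel" and bd: "\<And>x. cmod (\<phi> x) \<le> 1 / cmod x + cmod x"
    and \<phi>1: "(\<integral>\<omega>. \<phi> (Y 0 \<omega>) * Y 0 \<omega> \<partial>M) = 1"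
  shows "integrable M (\<lambda>\<omega>. Y 1 \<omega> * \<phi> (Y 0 \<omega>) * (Y 2 \<omega> * cnj (Y 3 \<omega>)))"
    and "(\<integral>\<omega>. Y 1 \<omega> * \<phi> (Y 0 \<omega>) * (Y 2 \<omega> * cnj (Y 3 \<omega>)) \<partial>M)
     = (\<integral>\<omega>. Y 1 \<omega> * cnj (Y 3 \<omega>) \<partial>M) * (\<integral>\<omega>. Y 2 \<omega> * cnj (Y 0 \<omega>) \<partial>M)"
proof -
  interpret M: prob_space M by fact
  let ?K = "{0, 1, 2, 3 :: nat}"
  note Yi = gaussian_vector_integrable_products[OF M Y]
  define u v where "u = (\<integral>\<omega>. Y 2 \<omega> * cnj (Y 0 \<omega>) \<partial>M)" and "v = (\<integral>\<omega>. Y 3 \<omega> * cnj (Y 0 \<omega>) \<partial>M)"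
  \<comment> \<open>The identity matrix, except that rows 2 and 3 also subtract the projections
    \<open>u * Y 0\<close> and \<open>v * Y 0\<close>.\<close>
  define c :: "nat \<Rightarrow> nat \<Rightarrow> complex" where
    "c l k = (if k = l then 1 else 0) - (if k = 0 then if l = 2 then u else if l = 3 then v else 0 else 0)" for l k
  define W where "W l \<omega> = (\<Sum>k\<in>?K. c l k * Y k \<omega>)" for l \<omega>
  have W: "complex_gaussian_vector M ?K W"
    by (rule gaussian_vector_linear[OF Y]) (auto simp only: W_def finite_insert finite.emptyI)
  have W0: "W 0 = Y 0" and W1: "W 1 = Y 1" and W2: "W 2 = (\<lambda>\<omega>. Y 2 \<omega> - u * Y 0 \<omega>)" and W3: "W 3 = (\<lambda>\<omega>. Y 3 \<omega> - v * Y 0 \<omega>)"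
    by (auto simp: W_def c_def fun_eq_iff)
  note Wi = gaussian_vector_integrable_products[OF M W]
  note Wm = complex_gaussian_vectorD(2)[OF W]
  have [measurable]: "W 0 \<in> borel_measurable M" "W 1 \<in> borel_measurable M" "W 2 \<in> borel_measurable M" "W 3 \<in> borel_measurable M"
    by (auto intro: Wm)
  have YY: "(\<integral>\<omega>. Y 0 \<omega> * cnj (Y 0 \<omega>) \<partial>M) = 1"
    unfolding complex_norm_square[symmetric] integral_complex_of_real v0 by simp
  have orthW: "(\<integral>\<omega>. W k \<omega> * cnj (W 0 \<omega>) \<partial>M) = 0" if "k \<in> {1, 2, 3}" for k
  proof -
    have sub: "(\<integral>\<omega>. (Y j \<omega> - w * Y 0 \<omega>) * cnj (Y 0 \<omega>) \<partial>M) = (\<integral>\<omega>. Y j \<omega> * cnj (Y 0 \<omega>) \<partial>M) - w"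
      if "j \<in> ?K" for j w
    proof -
      have "(\<integral>\<omega>. (Y j \<omega> - w * Y 0 \<omega>) * cnj (Y 0 \<omega>) \<partial>M) = (\<integral>\<omega>. Y j \<omega> * cnj (Y 0 \<omega>) - w * (Y 0 \<omega> * cnj (Y 0 \<omega>)) \<partial>M)"
        by (simp add: algebra_simps)
      also have "\<dots> = (\<integral>\<omega>. Y j \<omega> * cnj (Y 0 \<omega>) \<partial>M) - w * (\<integral>\<omega>. Y 0 \<omega> * cnj (Y 0 \<omega>) \<partial>M)"
        using that by (subst Bochner_Integration.integral_diff) (auto intro!: Yi(3) integrable_mult_right)
      finally show ?thesis using YY by simp
    qed
    from that have "k = 1 \<or> k = 2 \<or> k = 3" by auto
    then show ?thesis
      using sub[of 2 u] sub[of 3 v] orth by (elim disjE) (simp_all only: W0 W1 W2 W3, simp_all add: u_def v_def)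
  qed
  have v0': "(\<integral>\<omega>. (cmod (W 0 \<omega>))\<^sup>2 \<partial>M) \<noteq> 0" by (simp add: W0 v0)
  have fac: "integrable M (\<lambda>\<omega>. f (W 0 \<omega>) * g (\<lambda>k\<in>{1,2,3}. W k \<omega>)) \<and>
     (\<integral>\<omega>. f (W 0 \<omega>) * g (\<lambda>k\<in>{1,2,3}. W k \<omega>) \<partial>M) = (\<integral>\<omega>. f (W 0 \<omega>) \<partial>M) * (\<integral>\<omega>. g (\<lambda>k\<in>{1,2,3}. W k \<omega>) \<partial>M)"
    if f: "f \<in> borel_measurable borel" "integrable M (\<lambda>\<omega>. f (W 0 \<omega>))"
     and g: "g \<in> borel_measurable (Pi\<^sub>M {1,2,3} (\<lambda>_. borel))" "integrable M (\<lambda>\<omega>. g (\<lambda>k\<in>{1,2,3}. W k \<omega>))" for f g :: "_ \<Rightarrow> complex"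
  proof -
    have "M.indep_var borel (\<lambda>\<omega>. f (W 0 \<omega>)) borel (\<lambda>\<omega>. g (\<lambda>k\<in>{1,2,3}. W k \<omega>))"
      by (rule gaussian_vector_indep[OF M W _ _ v0' orthW f(1) g(1)]) auto
    from M.indep_var_lebesgue_integral[OF this f(2) g(2)] M.indep_var_integrable[OF this f(2) g(2)]
    show ?thesis by blast
  qed
  have phase: "(\<integral>\<omega>. g (\<lambda>k\<in>?K. \<i> * W k \<omega>) \<partial>M) = (\<integral>\<omega>. g (\<lambda>k\<in>?K. W k \<omega>) \<partial>M)"
    if "g \<in> borel_measurable (Pi\<^sub>M ?K (\<lambda>_. borel))" for g :: "_ \<Rightarrow> complex"
    by (rule gaussian_vector_phase_integral[OF W that])
  have z0: "x = 0" if "c * x = x" "c \<noteq> 1" for c x :: complex using that by auto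
  \<comment> \<open>The quarter turn multiplies these three moments by \<open>\<i>\<close>,
    \<open>- 1\<close> and \<open>\<i>\<close>, so invariance forces them to vanish.\<close>
  have E1: "(\<integral>\<omega>. W 1 \<omega> \<partial>M) = 0"
  proof (rule z0[of \<i>])
    have "(\<integral>\<omega>. \<i> * W 1 \<omega> \<partial>M) = (\<integral>\<omega>. W 1 \<omega> \<partial>M)"
      using phase[of "\<lambda>y. y 1"] by simp
    then show "\<i> * (\<integral>\<omega>. W 1 \<omega> \<partial>M) = (\<integral>\<omega>. W 1 \<omega> \<partial>M)"
      by (simp only: integral_mult_right_zero)
  qed (simp add: complex_eq_iff)
  have E2: "(\<integral>\<omega>. W 1 \<omega> * W 2 \<omega> \<partial>M) = 0"
  proof (rule z0[of "-1"])
    have eq: "(\<i> * W 1 \<omega>) * (\<i> * W 2 \<omega>) = (-1) * (W 1 \<omega> * W 2 \<omega>)" for \<omega>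
      by (simp add: algebra_simps)
    have "(\<integral>\<omega>. (\<i> * W 1 \<omega>) * (\<i> * W 2 \<omega>) \<partial>M) = (\<integral>\<omega>. W 1 \<omega> * W 2 \<omega> \<partial>M)"
      using phase[of "\<lambda>y. y 1 * y 2"] by simp
    then show "(-1) * (\<integral>\<omega>. W 1 \<omega> * W 2 \<omega> \<partial>M) = (\<integral>\<omega>. W 1 \<omega> * W 2 \<omega> \<partial>M)"
      unfolding eq by (simp only: integral_mult_right_zero)
  qed simp
  have E3: "(\<integral>\<omega>. W 1 \<omega> * W 2 \<omega> * cnj (W 3 \<omega>) \<partial>M) = 0"
  proof (rule z0[of \<i>])
    have eq: "(\<i> * W 1 \<omega>) * (\<i> * W 2 \<omega>) * cnj (\<i> * W 3 \<omega>) = \<i> * (W 1 \<omega> * W 2 \<omega> * cnj (W 3 \<omega>))" for \<omega>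
      by (simp add: algebra_simps)
    have "(\<integral>\<omega>. (\<i> * W 1 \<omega>) * (\<i> * W 2 \<omega>) * cnj (\<i> * W 3 \<omega>) \<partial>M) = (\<integral>\<omega>. W 1 \<omega> * W 2 \<omega> * cnj (W 3 \<omega>) \<partial>M)"
      using phase[of "\<lambda>y. y 1 * y 2 * cnj (y 3)"] by simp
    then show "\<i> * (\<integral>\<omega>. W 1 \<omega> * W 2 \<omega> * cnj (W 3 \<omega>) \<partial>M) = (\<integral>\<omega>. W 1 \<omega> * W 2 \<omega> * cnj (W 3 \<omega>) \<partial>M)"
      unfolding eq by (simp only: integral_mult_right_zero)
  qed (simp add: complex_eq_iff)
  define f1 f2 f3 where "f1 x = u * cnj v * (\<phi> x * (x * cnj x))" and "f2 x = u * (\<phi> x * x)" and "f3 x = cnj v * (\<phi> x * cnj x)" for x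
  have [measurable]: "f1 \<in> borel_measurable borel" "f2 \<in> borel_measurable borel" "f3 \<in> borel_measurable borel"
    unfolding f1_def f2_def f3_def by measurable
  have intb: "integrable M (\<lambda>\<omega>. 1 / cmod (W 0 \<omega>) + 2 + 2 * cmod (W 0 \<omega>) ^ 4)"
    using gaussian_vector_integrable_inverse[OF M W, of 0] gaussian_vector_integrable_power[OF M W, of 0 4] v0' by simp
  have ib: "integrable M (\<lambda>\<omega>. h (W 0 \<omega>))"
    if [measurable]: "h \<in> borel_measurable borel" and "\<And>x. cmod (h x) \<le> 1 / cmod x + 2 + 2 * cmod x ^ 4" for h :: "complex \<Rightarrow> complex"
    by (rule Bochner_Integration.integrable_bound[OF intb]) (use that(2) in \<open>auto intro!: AE_I2 intro: order.trans\<close>)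
  have p4: "cmod x ^ i \<le> 1 + cmod x ^ 4" if "i \<le> 4" for x :: complex and i
    using that by (intro power_le_one_plus) auto
  have b0: "cmod (\<phi> x) \<le> 1 / cmod x + 2 + 2 * cmod x ^ 4" for x
  proof -
    have "cmod x \<le> 1 + cmod x ^ 4" using p4[of 1 x] by simp
    moreover have "0 \<le> cmod x ^ 4" by simp
    ultimately show ?thesis using bd[of x] by linarith
  qed
  have b1: "cmod (\<phi> x) * cmod x \<le> 1 / cmod x + 2 + 2 * cmod x ^ 4" for x
  proof -
    have "cmod (\<phi> x) * cmod x \<le> (1 / cmod x + cmod x) * cmod x" by (intro mult_right_mono bd) auto
    also have "\<dots> \<le> 1 + cmod x ^ 2" by (simp add: distrib_right power2_eq_square)
    also have "\<dots> \<le> 2 + cmod x ^ 4" using p4[of 2 x] by simp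
    also have "\<dots> \<le> 1 / cmod x + 2 + 2 * cmod x ^ 4" by simp
    finally show ?thesis .
  qed
  have b2: "cmod (\<phi> x) * (cmod x * cmod x) \<le> 1 / cmod x + 2 + 2 * cmod x ^ 4" for x
  proof -
    have "cmod (\<phi> x) * (cmod x * cmod x) \<le> (1 / cmod x + cmod x) * (cmod x * cmod x)" by (intro mult_right_mono bd) auto
    also have "\<dots> \<le> cmod x ^ 1 + cmod x ^ 3" by (simp add: distrib_right power3_eq_cube)
    also have "\<dots> \<le> 2 + 2 * cmod x ^ 4" using p4[of 1 x] p4[of 3 x] by linarith
    also have "\<dots> \<le> 1 / cmod x + 2 + 2 * cmod x ^ 4" by simp
    finally show ?thesis .
  qed
  have i0: "integrable M (\<lambda>\<omega>. \<phi> (W 0 \<omega>))" by (rule ib) (use b0 in auto)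
  have i1: "integrable M (\<lambda>\<omega>. f1 (W 0 \<omega>))"
    unfolding f1_def by (intro integrable_mult_right ib) (use b2 in \<open>auto simp: norm_mult\<close>)
  have i2: "integrable M (\<lambda>\<omega>. f2 (W 0 \<omega>))"
    unfolding f2_def by (intro integrable_mult_right ib) (use b1 in \<open>auto simp: norm_mult\<close>)
  have i3: "integrable M (\<lambda>\<omega>. f3 (W 0 \<omega>))"
    unfolding f3_def by (intro integrable_mult_right ib) (use b1 in \<open>auto simp: norm_mult\<close>)
  have t1: "integrable M (\<lambda>\<omega>. f1 (W 0 \<omega>) * W 1 \<omega>)" "(\<integral>\<omega>. f1 (W 0 \<omega>) * W 1 \<omega> \<partial>M) = 0"
    using fac[of f1 "\<lambda>y. y 1"] i1 E1 Wi(1)[of 1 1 1] by simp_all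
  have t2: "integrable M (\<lambda>\<omega>. f2 (W 0 \<omega>) * (W 1 \<omega> * cnj (W 3 \<omega>)))" "(\<integral>\<omega>. f2 (W 0 \<omega>) * (W 1 \<omega> * cnj (W 3 \<omega>)) \<partial>M) = u * (\<integral>\<omega>. W 1 \<omega> * cnj (W 3 \<omega>) \<partial>M)"
    using fac[of f2 "\<lambda>y. y 1 * cnj (y 3)"] i2 Wi(3)[of 1 3 3] \<phi>1 by (simp_all add: f2_def W0)
  have t3: "integrable M (\<lambda>\<omega>. f3 (W 0 \<omega>) * (W 1 \<omega> * W 2 \<omega>))" "(\<integral>\<omega>. f3 (W 0 \<omega>) * (W 1 \<omega> * W 2 \<omega>) \<partial>M) = 0"
    using fac[of f3 "\<lambda>y. y 1 * y 2"] i3 E2 Wi(2)[of 1 2 2] by simp_all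
  have t4: "integrable M (\<lambda>\<omega>. \<phi> (W 0 \<omega>) * (W 1 \<omega> * W 2 \<omega> * cnj (W 3 \<omega>)))" "(\<integral>\<omega>. \<phi> (W 0 \<omega>) * (W 1 \<omega> * W 2 \<omega> * cnj (W 3 \<omega>)) \<partial>M) = 0"
    using fac[of \<phi> "\<lambda>y. y 1 * y 2 * cnj (y 3)"] i0 E3 Wi(4)[of 1 2 3] by simp_all
  have exp: "Y 1 \<omega> * \<phi> (Y 0 \<omega>) * (Y 2 \<omega> * cnj (Y 3 \<omega>)) =
     f1 (W 0 \<omega>) * W 1 \<omega> + f2 (W 0 \<omega>) * (W 1 \<omega> * cnj (W 3 \<omega>)) + f3 (W 0 \<omega>) * (W 1 \<omega> * W 2 \<omega>) + \<phi> (W 0 \<omega>) * (W 1 \<omega> * W 2 \<omega> * cnj (W 3 \<omega>))" for \<omega>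
  proof -
    have y: "Y 2 \<omega> = W 2 \<omega> + u * Y 0 \<omega>" "Y 3 \<omega> = W 3 \<omega> + v * Y 0 \<omega>" by (simp_all add: W2 W3)
    show ?thesis
      unfolding y f1_def f2_def f3_def W0 W1 by (simp add: algebra_simps)
  qed
  show "integrable M (\<lambda>\<omega>. Y 1 \<omega> * \<phi> (Y 0 \<omega>) * (Y 2 \<omega> * cnj (Y 3 \<omega>)))"
    unfolding exp by (intro Bochner_Integration.integrable_add t1(1) t2(1) t3(1) t4(1))
  have "(\<integral>\<omega>. Y 1 \<omega> * \<phi> (Y 0 \<omega>) * (Y 2 \<omega> * cnj (Y 3 \<omega>)) \<partial>M) = u * (\<integral>\<omega>. W 1 \<omega> * cnj (W 3 \<omega>) \<partial>M)"
    unfolding exp using t1 t2 t3 t4 by simp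
  also have "(\<integral>\<omega>. W 1 \<omega> * cnj (W 3 \<omega>) \<partial>M) = (\<integral>\<omega>. Y 1 \<omega> * cnj (Y 3 \<omega>) - cnj v * (Y 1 \<omega> * cnj (Y 0 \<omega>)) \<partial>M)"
    unfolding W1 W3 by (simp add: algebra_simps)
  also have "\<dots> = (\<integral>\<omega>. Y 1 \<omega> * cnj (Y 3 \<omega>) \<partial>M) - cnj v * (\<integral>\<omega>. Y 1 \<omega> * cnj (Y 0 \<omega>) \<partial>M)"
    by (subst Bochner_Integration.integral_diff) (auto intro!: Yi(3) integrable_mult_right)
  finally show "(\<integral>\<omega>. Y 1 \<omega> * \<phi> (Y 0 \<omega>) * (Y 2 \<omega> * cnj (Y 3 \<omega>)) \<partial>M)
     = (\<integral>\<omega>. Y 1 \<omega> * cnj (Y 3 \<omega>) \<partial>M) * (\<integral>\<omega>. Y 2 \<omega> * cnj (Y 0 \<omega>) \<partial>M)"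
    unfolding orth u_def mult_zero_right diff_zero by (simp only: mult.commute)
qed

subsection \<open>Differentiability from an oscillation integral\<close>

lemma has_vector_derivative_iff_quotient:
  fixes g :: "real \<Rightarrow> complex"
  shows "(g has_vector_derivative L) (at t) \<longleftrightarrow> ((\<lambda>h. (g (t + h) - g t) / of_real h) \<longlongrightarrow> L) (at 0)"
proof -
  have eq: "cmod (g (t + h) - g t - h *\<^sub>R L) / norm h = cmod ((g (t + h) - g t) / of_real h - L)" if "h \<noteq> 0" for h
  proof -
    have "(g (t + h) - g t) / of_real h - L = (g (t + h) - g t - h *\<^sub>R L) / of_real h"
      using that by (simp add: diff_divide_distrib scaleR_conv_of_real)
    then show ?thesis by (simp add: norm_divide)
  qed
  have "(g has_vector_derivative L) (at t) \<longleftrightarrow> ((\<lambda>h. cmod (g (t + h) - g t - h *\<^sub>R L) / norm h) \<longlongrightarrow> 0) (at 0)"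
    unfolding has_vector_derivative_def has_derivative_at by (simp add: bounded_linear_scaleR_left)
  also have "\<dots> \<longleftrightarrow> ((\<lambda>h. cmod ((g (t + h) - g t) / of_real h - L)) \<longlongrightarrow> 0) (at 0)"
    by (intro filterlim_cong refl eventually_at_topological[THEN iffD2] exI[of _ UNIV]) (auto simp: eq[unfolded real_norm_def])
  also have "\<dots> \<longleftrightarrow> ((\<lambda>h. (g (t + h) - g t) / of_real h) \<longlongrightarrow> L) (at 0)"
    by (simp add: tendsto_norm_zero_iff LIM_zero_iff)
  finally show ?thesis .
qed

text \<open>Differentiability as a Cauchy condition with countable quantifiers only: difference
  quotients are continuous in the increment away from 0, so rational increments suffice. The set of
  differentiability points is then visibly Borel.\<close>

lemma differentiable_at_iff_rational_Cauchy:
  fixes g :: "real \<Rightarrow> complex"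
  assumes g: "continuous_on UNIV g"
  defines "Q \<equiv> \<lambda>t h. (g (t + h) - g t) / of_real h"
  shows "g differentiable (at t) \<longleftrightarrow>
    (\<forall>k::nat. \<exists>n::nat. \<forall>p\<in>\<rat>. \<forall>q\<in>\<rat>. 0 < \<bar>p\<bar> \<and> \<bar>p\<bar> < 1 / real (Suc n) \<and> 0 < \<bar>q\<bar> \<and> \<bar>q\<bar> < 1 / real (Suc n) \<longrightarrow>
       cmod (Q t p - Q t q) \<le> 1 / real (Suc k))" (is "_ \<longleftrightarrow> ?C")
proof
  assume "g differentiable (at t)"
  then obtain L where "(g has_vector_derivative L) (at t)"
    using vector_derivative_works by blast
  then have lim: "(Q t \<longlongrightarrow> L) (at 0)"
    by (simp add: has_vector_derivative_iff_quotient Q_def)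
  show ?C
  proof
    fix k :: nat
    have "eventually (\<lambda>h. dist (Q t h) L < 1 / (2 * real (Suc k))) (at 0)"
      using lim by (rule tendstoD) simp
    then obtain d where d: "d > 0" "\<And>h. h \<noteq> 0 \<Longrightarrow> \<bar>h\<bar> < d \<Longrightarrow> dist (Q t h) L < 1 / (2 * real (Suc k))"
      by (auto simp: eventually_at)
    obtain n where n: "1 / real (Suc n) < d" using reals_Archimedean[OF d(1)] by (auto simp: inverse_eq_divide)
    show "\<exists>n::nat. \<forall>p\<in>\<rat>. \<forall>q\<in>\<rat>. 0 < \<bar>p\<bar> \<and> \<bar>p\<bar> < 1 / real (Suc n) \<and> 0 < \<bar>q\<bar> \<and> \<bar>q\<bar> < 1 / real (Suc n) \<longrightarrow>
       cmod (Q t p - Q t q) \<le> 1 / real (Suc k)"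
    proof (intro exI[of _ n] ballI impI)
      fix p q :: real assume pq: "0 < \<bar>p\<bar> \<and> \<bar>p\<bar> < 1 / real (Suc n) \<and> 0 < \<bar>q\<bar> \<and> \<bar>q\<bar> < 1 / real (Suc n)"
      have "dist (Q t p) (Q t q) < 1 / (2 * real (Suc k)) + 1 / (2 * real (Suc k))"
        using pq n dist_triangle2[of "Q t p" "Q t q" L] d(2)[of p] d(2)[of q] by auto
      also have "1 / (2 * real (Suc k)) + 1 / (2 * real (Suc k)) = 1 / real (Suc k)"
        by (simp only: add_divide_distrib[symmetric]) (simp add: field_simps)
      finally show "cmod (Q t p - Q t q) \<le> 1 / real (Suc k)" by (simp only: dist_norm less_imp_le)
    qed
  qed
next
  assume C: ?C
  have Qc: "isCont (Q t) h" if "h \<noteq> 0" for h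
  proof -
    have "isCont g x" for x using g by (simp add: continuous_on_eq_continuous_at)
    then have "isCont (\<lambda>h. g (t + h)) h"
      by (intro isCont_o2[of h "\<lambda>h. t + h" g]) (auto intro: continuous_intros)
    then show ?thesis using that unfolding Q_def
      by (intro isCont_divide isCont_diff isCont_of_real) auto
  qed
  have rat: "\<exists>f. (\<forall>n. f n \<in> \<rat>) \<and> f \<longlonglongrightarrow> h" for h :: real
  proof -
    have "h \<in> closure \<rat>" using Rats_closure_real by simp
    then show ?thesis unfolding closure_sequential by auto
  qed
  have C': "\<exists>n::nat. \<forall>p q. 0 < \<bar>p\<bar> \<and> \<bar>p\<bar> < 1 / real (Suc n) \<and> 0 < \<bar>q\<bar> \<and> \<bar>q\<bar> < 1 / real (Suc n) \<longrightarrow>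
       cmod (Q t p - Q t q) \<le> 1 / real (Suc k)" for k
  proof -
    from C obtain n where n: "\<And>p q. p \<in> \<rat> \<Longrightarrow> q \<in> \<rat> \<Longrightarrow> 0 < \<bar>p\<bar> \<and> \<bar>p\<bar> < 1 / real (Suc n) \<and> 0 < \<bar>q\<bar> \<and> \<bar>q\<bar> < 1 / real (Suc n) \<Longrightarrow>
       cmod (Q t p - Q t q) \<le> 1 / real (Suc k)" by meson
    show ?thesis
    proof (intro exI[of _ n] allI impI)
      fix p q :: real assume pq: "0 < \<bar>p\<bar> \<and> \<bar>p\<bar> < 1 / real (Suc n) \<and> 0 < \<bar>q\<bar> \<and> \<bar>q\<bar> < 1 / real (Suc n)"
      obtain a b where a: "\<And>i. a i \<in> \<rat>" "a \<longlonglongrightarrow> p" and b: "\<And>i. b i \<in> \<rat>" "b \<longlonglongrightarrow> q"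
        using rat[of p] rat[of q] by auto
      have ab: "(\<lambda>i. \<bar>a i\<bar>) \<longlonglongrightarrow> \<bar>p\<bar>" "(\<lambda>i. \<bar>b i\<bar>) \<longlonglongrightarrow> \<bar>q\<bar>"
        using a(2) b(2) by (auto intro: tendsto_rabs)
      have ev: "eventually (\<lambda>i. cmod (Q t (a i) - Q t (b i)) \<le> 1 / real (Suc k)) sequentially"
      proof -
        have "eventually (\<lambda>i. 0 < \<bar>a i\<bar>) sequentially" "eventually (\<lambda>i. \<bar>a i\<bar> < 1 / real (Suc n)) sequentially"
          "eventually (\<lambda>i. 0 < \<bar>b i\<bar>) sequentially" "eventually (\<lambda>i. \<bar>b i\<bar> < 1 / real (Suc n)) sequentially"
          using pq order_tendstoD[OF ab(1)] order_tendstoD[OF ab(2)] by blast+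
        then show ?thesis by eventually_elim (intro n a(1) b(1) conjI)
      qed
      have "(\<lambda>i. cmod (Q t (a i) - Q t (b i))) \<longlonglongrightarrow> cmod (Q t p - Q t q)"
        using pq by (intro tendsto_norm tendsto_diff isCont_tendsto_compose[OF Qc] a(2) b(2)) auto
      then show "cmod (Q t p - Q t q) \<le> 1 / real (Suc k)"
        using ev by (rule tendsto_upperbound) simp
    qed
  qed
  \<comment> \<open>With \<open>Suc (Suc m)\<close> the increment is strictly below
    \<open>1 / real (Suc n)\<close> for every \<open>m \<ge> n\<close>, as the Cauchy condition
    demands.\<close>
  define A where "A m = Q t (1 / real (Suc (Suc m)))" for m :: nat
  have "Cauchy A"
  proof (rule metric_CauchyI)
    fix e :: real assume "e > 0"
    then obtain k where k: "1 / real (Suc k) < e" using reals_Archimedean by (auto simp: inverse_eq_divide)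
    obtain n where n: "\<forall>p q. 0 < \<bar>p\<bar> \<and> \<bar>p\<bar> < 1 / real (Suc n) \<and> 0 < \<bar>q\<bar> \<and> \<bar>q\<bar> < 1 / real (Suc n) \<longrightarrow>
       cmod (Q t p - Q t q) \<le> 1 / real (Suc k)" using C'[of k] by blast
    have "dist (A i) (A j) < e" if "i \<ge> n" "j \<ge> n" for i j
    proof -
      have "cmod (A i - A j) \<le> 1 / real (Suc k)"
        unfolding A_def by (rule n[rule_format]) (use that in \<open>auto intro!: divide_strict_left_mono\<close>)
      then show ?thesis using k by (simp add: dist_norm)
    qed
    then show "\<exists>M. \<forall>m\<ge>M. \<forall>n\<ge>M. dist (A m) (A n) < e" by blast
  qed
  then obtain L where L: "A \<longlonglongrightarrow> L" using Cauchy_convergent convergent_def by blast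
  have "(Q t \<longlongrightarrow> L) (at 0)"
  proof (rule tendstoI)
    fix e :: real assume "e > 0"
    then obtain k where k: "1 / real (Suc k) < e" using reals_Archimedean by (auto simp: inverse_eq_divide)
    obtain n where n: "\<forall>p q. 0 < \<bar>p\<bar> \<and> \<bar>p\<bar> < 1 / real (Suc n) \<and> 0 < \<bar>q\<bar> \<and> \<bar>q\<bar> < 1 / real (Suc n) \<longrightarrow>
       cmod (Q t p - Q t q) \<le> 1 / real (Suc k)" using C'[of k] by blast
    have "dist (Q t h) L < e" if h: "h \<noteq> 0" "\<bar>h\<bar> < 1 / real (Suc n)" for h
    proof -
      have "eventually (\<lambda>i. cmod (Q t h - A i) \<le> 1 / real (Suc k)) sequentially"
        using eventually_ge_at_top[of n]
      proof eventually_elim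
        case (elim i)
        show ?case unfolding A_def by (rule n[rule_format]) (use h elim in \<open>auto intro!: divide_strict_left_mono\<close>)
      qed
      moreover have "(\<lambda>i. cmod (Q t h - A i)) \<longlonglongrightarrow> cmod (Q t h - L)"
        by (intro tendsto_intros L)
      ultimately have "cmod (Q t h - L) \<le> 1 / real (Suc k)"
        by (intro tendsto_upperbound) auto
      then show ?thesis using k by (simp add: dist_norm)
    qed
    then show "eventually (\<lambda>h. dist (Q t h) L < e) (at 0)"
      unfolding eventually_at by (intro exI[of _ "1 / real (Suc n)"]) auto
  qed
  then have "(g has_vector_derivative L) (at t)"
    by (simp add: has_vector_derivative_iff_quotient Q_def)
  then show "g differentiable (at t)"
    by (rule differentiableI_vector)
qed

text \<open>The integral in \<open>winding\<close> involves \<open>vector_derivative\<close> itself.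
  Its integrand has to be measurable before it can be exchanged for one that agrees with it almost
  everywhere.\<close>

lemma borel_measurable_vector_derivative:
  fixes g :: "real \<Rightarrow> complex"
  assumes g: "continuous_on UNIV g"
  shows "(\<lambda>t. vector_derivative g (at t)) \<in> borel_measurable borel"
proof -
  define Q where "Q t h = (g (t + h) - g t) / of_real h" for t h :: real
  define D where "D = {t. g differentiable (at t)}"
  have Qm [measurable]: "(\<lambda>t. Q t h) \<in> borel_measurable borel" for h
  proof -
    have "continuous_on UNIV (\<lambda>t. g (t + h))"
      by (rule continuous_on_compose2[OF g]) (auto intro: continuous_intros)
    then have "(\<lambda>t. g (t + h)) \<in> borel_measurable borel" by (rule borel_measurable_continuous_onI)
    moreover have "g \<in> borel_measurable borel" using g by (rule borel_measurable_continuous_onI)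
    ultimately show ?thesis unfolding Q_def by measurable
  qed
  have rat: "(\<forall>p\<in>\<rat>. P p) \<longleftrightarrow> (\<forall>p::rat. P (of_rat p))" for P :: "real \<Rightarrow> bool"
    by (auto simp: Rats_def)
  have "D = {t \<in> space borel. \<forall>k::nat. \<exists>n::nat. \<forall>p\<in>\<rat>. \<forall>q\<in>\<rat>. 0 < \<bar>p\<bar> \<and> \<bar>p\<bar> < 1 / real (Suc n) \<and> 0 < \<bar>q\<bar> \<and> \<bar>q\<bar> < 1 / real (Suc n) \<longrightarrow>
       cmod (Q t p - Q t q) \<le> 1 / real (Suc k)}"
    unfolding D_def Q_def using differentiable_at_iff_rational_Cauchy[OF g] by simp
  also have "\<dots> \<in> sets borel"
    unfolding rat by measurable
  finally have D [measurable]: "D \<in> sets borel" .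
  \<comment> \<open>Where no derivative exists, \<open>vector_derivative\<close> chooses from an
    empty predicate, so its value is one fixed constant.\<close>
  define c where "c = (SOME L::complex. False)"
  have "vector_derivative g (at t) = (if t \<in> D then lim (\<lambda>n. Q t (1 / real (Suc n))) else c)" for t
  proof (cases "t \<in> D")
    case True
    then have d: "(g has_vector_derivative vector_derivative g (at t)) (at t)"
      by (simp add: D_def vector_derivative_works)
    moreover have "Q t = (\<lambda>h. (g (t + h) - g t) / of_real h)" by (auto simp: Q_def)
    ultimately have "(Q t \<longlongrightarrow> vector_derivative g (at t)) (at 0)"
      by (simp add: has_vector_derivative_iff_quotient)
    moreover have "filterlim (\<lambda>n. 1 / real (Suc n)) (at 0) sequentially"
      using LIMSEQ_Suc[OF lim_1_over_n] by (simp add: filterlim_at)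
    ultimately have "(\<lambda>n. Q t (1 / real (Suc n))) \<longlonglongrightarrow> vector_derivative g (at t)"
      by (rule filterlim_compose)
    then show ?thesis using True by (simp add: limI)
  next
    case False
    then have "\<not> (g has_vector_derivative L) (at t)" for L
      by (auto simp: D_def intro: differentiableI_vector)
    then show ?thesis using False by (simp add: vector_derivative_def c_def)
  qed
  then have "(\<lambda>t. vector_derivative g (at t)) = (\<lambda>t. if t \<in> D then lim (\<lambda>n. Q t (1 / real (Suc n))) else c)"
    by auto
  also have "\<dots> \<in> borel_measurable borel"
    by (intro measurable_If borel_measurable_lim_metric Qm) auto
  finally show ?thesis .
qed

text \<open>The weight \<open>1 / \<bar>s\<bar>\<close> makes the mean square oscillation at scale \<open>h\<close> a tail of one convergent integral.\<close>

lemma has_vector_derivative_of_oscillation: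
  fixes g G :: "real \<Rightarrow> complex"
  assumes G [measurable]: "G \<in> borel_measurable borel"
    and ftc: "\<And>x y. a \<le> x \<Longrightarrow> x \<le> y \<Longrightarrow> y \<le> b \<Longrightarrow> set_integrable lborel {x..y} G \<and> (LINT u:{x..y}|lborel. G u) = g y - g x"
    and t: "a < t" "t < b"
    and fin: "(\<integral>\<^sup>+s. ennreal ((cmod (G (t + s) - G t))\<^sup>2 / \<bar>s\<bar>) * indicator {-1..1} s \<partial>lborel) < \<infinity>"
  shows "(g has_vector_derivative G t) (at t)"
proof -
  define k where "k s = ennreal ((cmod (G (t + s) - G t))\<^sup>2 / \<bar>s\<bar>) * indicator {-1..1} s" for s
  have [measurable]: "k \<in> borel_measurable borel" unfolding k_def by measurable
  define \<nu> where "\<nu> = density lborel k"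
  have [measurable_cong]: "sets \<nu> = sets borel" by (simp add: \<nu>_def)
  have em: "emeasure \<nu> A = (\<integral>\<^sup>+s. k s * indicator A s \<partial>lborel)" if "A \<in> sets borel" for A
    unfolding \<nu>_def using that by (subst emeasure_density) auto
  have fin\<nu>: "emeasure \<nu> UNIV < \<infinity>" using fin by (subst em) (auto simp: k_def)
  \<comment> \<open>\<open>\<nu>\<close> is a finite measure with density, so the point 0 has mass
    zero and the masses of intervals shrinking to it tend to zero.\<close>
  have lim: "(\<lambda>n. emeasure \<nu> {-1/real (Suc n)..1/real (Suc n)}) \<longlonglongrightarrow> 0"
  proof -
    have "(\<lambda>n. emeasure \<nu> {-1/real (Suc n)..1/real (Suc n)}) \<longlonglongrightarrow> emeasure \<nu> (\<Inter>n. {-1/real (Suc n)..1/real (Suc n)})"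
    proof (rule Lim_emeasure_decseq)
      show "decseq (\<lambda>n. {-1/real (Suc n)..1/real (Suc n)})"
        by (auto simp: decseq_def field_simps)
      show "emeasure \<nu> {- 1 / real (Suc n)..1 / real (Suc n)} \<noteq> \<infinity>" for n
        using fin\<nu> emeasure_mono[of "{- 1 / real (Suc n)..1 / real (Suc n)}" UNIV \<nu>] by (auto simp: top_unique)
    qed auto
    moreover have "(\<Inter>n. {-1/real (Suc n)..1/real (Suc n)}) = {0::real}"
    proof -
      have "x = 0" if "\<forall>n. -1/real (Suc n) \<le> x \<and> x \<le> 1/real (Suc n)" for x :: real
      proof (rule ccontr)
        assume "x \<noteq> 0"
        then obtain n where "1 / real (Suc n) < \<bar>x\<bar>" using reals_Archimedean[of "\<bar>x\<bar>"] by (auto simp: inverse_eq_divide)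
        with that[rule_format, of n] show False by auto
      qed
      then show ?thesis by force
    qed
    moreover have "emeasure \<nu> {0} = 0"
      by (subst em) (auto intro!: nn_integral_null_set simp: null_sets_def)
    ultimately show ?thesis by simp
  qed
  have key: "\<exists>d>0. \<forall>h. \<bar>h\<bar> < d \<longrightarrow> cmod (g (t + h) - g t - h *\<^sub>R G t) \<le> e * \<bar>h\<bar>" if e: "e > 0" for e
  proof -
    define e' where "e' = e / 3"
    have e': "e' > 0" using e by (simp add: e'_def)
    have "eventually (\<lambda>n. emeasure \<nu> {-1/real (Suc n)..1/real (Suc n)} < ennreal (e'\<^sup>2)) sequentially"
      using lim by (rule order_tendstoD) (use e' in simp)
    then obtain n where n: "emeasure \<nu> {-1/real (Suc n)..1/real (Suc n)} < ennreal (e'\<^sup>2)"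
      by (auto simp: eventually_sequentially)
    define d where "d = Min {1 / real (Suc n), t - a, b - t}"
    have d: "d > 0" "d \<le> 1 / real (Suc n)" "d \<le> t - a" "d \<le> b - t" using t by (auto simp: d_def)
    have "cmod (g (t + h) - g t - h *\<^sub>R G t) \<le> e * \<bar>h\<bar>" if h: "\<bar>h\<bar> < d" for h
    proof -
      define x y where "x = min t (t + h)" and "y = max t (t + h)"
      have xy: "a \<le> x" "x \<le> y" "y \<le> b" using h d by (auto simp: x_def y_def)
      have yx: "y - x = \<bar>h\<bar>" by (auto simp: x_def y_def)
      have int: "set_integrable lborel {x..y} G" and ftc': "(LINT u:{x..y}|lborel. G u) = g y - g x" using ftc[OF xy] by auto
      have intc: "set_integrable lborel {x..y} (\<lambda>u. G t)" unfolding set_integrable_def by (intro integrable_scaleR_left integrable_real_indicator) (auto simp: emeasure_lborel_Icc_eq)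
      have "(LINT u:{x..y}|lborel. G u - G t) = g y - g x - (y - x) *\<^sub>R G t"
        using set_integral_diff(2)[OF int intc] xy ftc' by (simp add: set_lebesgue_integral_def scaleR_conv_of_real)
      moreover have "cmod (g (t + h) - g t - h *\<^sub>R G t) = cmod (g y - g x - (y - x) *\<^sub>R G t)"
      proof (cases "h \<ge> 0")
        case True then show ?thesis by (simp add: x_def y_def)
      next
        case False
        then have "g y - g x - (y - x) *\<^sub>R G t = - (g (t + h) - g t - h *\<^sub>R G t)" by (simp add: x_def y_def)
        then show ?thesis by (simp only: norm_minus_cancel)
      qed
      ultimately have "ennreal (cmod (g (t + h) - g t - h *\<^sub>R G t)) = ennreal (cmod (LINT u|lborel. indicator {x..y} u *\<^sub>R (G u - G t)))"
        by (simp add: set_lebesgue_integral_def)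
      also have "\<dots> \<le> (\<integral>\<^sup>+u. ennreal (cmod (indicator {x..y} u *\<^sub>R (G u - G t))) \<partial>lborel)"
      proof (rule integral_norm_bound_ennreal)
        show "integrable lborel (\<lambda>u. indicator {x..y} u *\<^sub>R (G u - G t))"
          using set_integral_diff(1)[OF int intc] by (simp add: set_integrable_def)
      qed
      also have "\<dots> = (\<integral>\<^sup>+s. ennreal (cmod (indicator {x..y} (t + s) *\<^sub>R (G (t + s) - G t))) \<partial>lborel)"
        by (subst nn_integral_real_affine[where c=1 and t=t]) auto
      also have "\<dots> \<le> (\<integral>\<^sup>+s. ennreal e' * indicator {x - t..y - t} s + ennreal (\<bar>h\<bar> / e') * (k s * indicator {-1/real (Suc n)..1/real (Suc n)} s) \<partial>lborel)"
      proof (rule nn_integral_mono_AE)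
        have "AE s in lborel. s \<noteq> (0::real)" by (rule AE_lborel_singleton)
        then show "AE s in lborel. ennreal (cmod (indicator {x..y} (t + s) *\<^sub>R (G (t + s) - G t))) \<le>
            ennreal e' * indicator {x - t..y - t} s + ennreal (\<bar>h\<bar> / e') * (k s * indicator {-1/real (Suc n)..1/real (Suc n)} s)"
        proof eventually_elim
          case (elim s)
          show ?case
          proof (cases "x \<le> t + s \<and> t + s \<le> y")
            case True
            then have sh: "\<bar>s\<bar> \<le> \<bar>h\<bar>" by (auto simp: x_def y_def)
            then have s1: "\<bar>s\<bar> \<le> 1 / real (Suc n)" using h d by auto
            have "1 / real (Suc n) \<le> 1" by simp
            then have s2: "\<bar>s\<bar> \<le> 1" using s1 by linarith
            define z where "z = cmod (G (t + s) - G t)"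
            \<comment> \<open>The part \<open>e'\<close> integrates to \<open>e' * |h|\<close>. In
              the rest, \<open>|s| \<le> |h|\<close> turns \<open>z^2\<close> into at most
              \<open>|h|\<close> times the density \<open>k\<close>, and the small mass
              \<open>(e')^2\<close> of \<open>\<nu>\<close> near 0 again leaves
              \<open>e' * |h|\<close>.\<close>
            have "z \<le> e' + z\<^sup>2 / e'"
            proof -
              have "0 \<le> z * e'" using e' by (simp add: z_def)
              then have "z * e' \<le> e'\<^sup>2 + z\<^sup>2" using sum_squares_bound[of z e'] by linarith
              then show ?thesis using e' by (simp add: field_simps power2_eq_square)
            qed
            also have "z\<^sup>2 / e' \<le> \<bar>h\<bar> / e' * (z\<^sup>2 / \<bar>s\<bar>)"
              using elim e' sh by (simp add: field_simps mult_right_mono)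
            finally have "ennreal z \<le> ennreal (e' + \<bar>h\<bar> / e' * (z\<^sup>2 / \<bar>s\<bar>))" by (simp add: ennreal_leI)
            also have "\<dots> = ennreal e' + ennreal (\<bar>h\<bar> / e') * ennreal (z\<^sup>2 / \<bar>s\<bar>)"
              using e' by (subst ennreal_plus) (auto simp: ennreal_mult[symmetric])
            finally show ?thesis
              using True s1 s2 by (auto simp: k_def z_def indicator_def abs_le_iff)
          qed auto
        qed
      qed
      also have "\<dots> = ennreal e' * ennreal \<bar>h\<bar> + ennreal (\<bar>h\<bar> / e') * emeasure \<nu> {-1/real (Suc n)..1/real (Suc n)}"
        using yx xy by (subst nn_integral_add) (auto simp: nn_integral_cmult em)
      also have "\<dots> \<le> ennreal e' * ennreal \<bar>h\<bar> + ennreal (\<bar>h\<bar> / e') * ennreal (e'\<^sup>2)"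
        using n by (intro add_left_mono mult_left_mono) auto
      also have "\<dots> = ennreal (2 * e' * \<bar>h\<bar>)"
        using e' by (simp add: ennreal_mult[symmetric] ennreal_plus[symmetric] power2_eq_square del: ennreal_plus)
      finally have "cmod (g (t + h) - g t - h *\<^sub>R G t) \<le> 2 * e' * \<bar>h\<bar>"
        using e' by (subst (asm) ennreal_le_iff) auto
      also have "\<dots> \<le> e * \<bar>h\<bar>" using e by (intro mult_right_mono) (auto simp: e'_def)
      finally show ?thesis .
    qed
    then show ?thesis using d(1) by blast
  qed
  show ?thesis
    unfolding has_vector_derivative_def has_derivative_at_alt
  proof (intro conjI allI impI)
    show "bounded_linear (\<lambda>x. x *\<^sub>R G t)" by (rule bounded_linear_scaleR_left)
    fix e :: real assume "e > 0"
    from key[OF this] obtain d where d: "d > 0" "\<And>h. \<bar>h\<bar> < d \<Longrightarrow> cmod (g (t + h) - g t - h *\<^sub>R G t) \<le> e * \<bar>h\<bar>" by blast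
    show "\<exists>d>0. \<forall>y. norm (y - t) < d \<longrightarrow> norm (g y - g t - (y - t) *\<^sub>R G t) \<le> e * norm (y - t)"
      using d(1) d(2)[of "_ - t"] by (intro exI[of _ d]) auto
  qed
qed

subsection \<open>The path derivative of a stationary Gaussian process\<close>

text \<open>A list of coefficients and times encodes a finite combination of the process. The same
  list has a second reading \<open>symbol\<close>, its image under the spectral isometry that sends
  \<open>F t\<close> to the function \<open>exp (- i t l)\<close> in \<open>L^2(\<rho>)\<close>.
  Keeping the list explicit ties the two readings together.\<close>

definition lin_comb :: "(real \<Rightarrow> 'a \<Rightarrow> complex) \<Rightarrow> (complex \<times> real) list \<Rightarrow> 'a \<Rightarrow> complex" where
  "lin_comb F ps \<omega> = (\<Sum>(a, t)\<leftarrow>ps. a * F t \<omega>)"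

definition symbol :: "(complex \<times> real) list \<Rightarrow> real \<Rightarrow> complex" where
  "symbol ps l = (\<Sum>(a, t)\<leftarrow>ps. a * iexp (- (t * l)))"

lemma lin_comb_simps [simp]:
  "lin_comb F [] \<omega> = 0" "lin_comb F ((a, t) # ps) \<omega> = a * F t \<omega> + lin_comb F ps \<omega>"
  by (simp_all add: lin_comb_def)

lemma symbol_simps [simp]:
  "symbol [] l = 0" "symbol ((a, t) # ps) l = a * iexp (- (t * l)) + symbol ps l"
  by (simp_all add: symbol_def)

lemma lin_comb_append [simp]: "lin_comb F (ps @ qs) \<omega> = lin_comb F ps \<omega> + lin_comb F qs \<omega>"
  and symbol_append [simp]: "symbol (ps @ qs) l = symbol ps l + symbol qs l"
  by (simp_all add: lin_comb_def symbol_def)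

definition scale_comb :: "complex \<Rightarrow> (complex \<times> real) list \<Rightarrow> (complex \<times> real) list" where
  "scale_comb c ps = map (\<lambda>(a, t). (c * a, t)) ps"

lemma lin_comb_scale [simp]: "lin_comb F (scale_comb c ps) \<omega> = c * lin_comb F ps \<omega>"
  and symbol_scale [simp]: "symbol (scale_comb c ps) l = c * symbol ps l"
  by (induction ps) (auto simp: scale_comb_def algebra_simps)

lemma borel_measurable_symbol [measurable]: "symbol ps \<in> borel_measurable borel"
proof (induction ps)
  case Nil
  then show ?case by (simp add: symbol_def)
next
  case (Cons p ps)
  obtain a t where p: "p = (a, t)" by (cases p)
  have "symbol (p # ps) = (\<lambda>l. a * iexp (- (t * l)) + symbol ps l)" by (auto simp: p)
  then show ?case using Cons by simp
qed

lemma norm_symbol_le: "cmod (symbol ps l) \<le> (\<Sum>(a, t)\<leftarrow>ps. cmod a)"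
proof (induction ps)
  case (Cons p ps)
  obtain a t where p: "p = (a, t)" by (cases p)
  have "cmod (symbol (p # ps) l) \<le> cmod (a * iexp (- (t * l))) + cmod (symbol ps l)"
    unfolding p by (simp add: norm_triangle_ineq)
  then show ?case using Cons by (simp add: p norm_mult)
qed simp

lemma lin_comb_eq_sum:
  assumes "finite K" "snd ` set ps \<subseteq> K"
  shows "lin_comb F ps \<omega> = (\<Sum>k\<in>K. (\<Sum>(a, t)\<leftarrow>ps. if t = k then a else 0) * F k \<omega>)"
  using assms(2)
proof (induction ps)
  case (Cons p ps)
  obtain a t where p: "p = (a, t)" by (cases p)
  have "(\<Sum>k\<in>K. (\<Sum>(a, t)\<leftarrow>p # ps. if t = k then a else 0) * F k \<omega>) =
      (\<Sum>k\<in>K. if t = k then a * F k \<omega> else 0) + (\<Sum>k\<in>K. (\<Sum>(a, t)\<leftarrow>ps. if t = k then a else 0) * F k \<omega>)"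
    unfolding sum.distrib[symmetric] by (intro sum.cong) (auto simp: p algebra_simps)
  also have "(\<Sum>k\<in>K. if t = k then a * F k \<omega> else 0) = a * F t \<omega>"
    using assms(1) Cons.prems p by simp
  finally show ?case using Cons p by simp
qed simp

text \<open>The spectral multiplier of the difference quotient with step \<open>h\<close>. It tends
  to \<open>- i l\<close> as \<open>h\<close> tends to 0 and is dominated by
  \<open>|l|\<close>.\<close>

definition dsym :: "real \<Rightarrow> real \<Rightarrow> complex" where
  "dsym h l = (iexp (- (h * l)) - 1) / of_real h"

definition diffq :: "real \<Rightarrow> real \<Rightarrow> (complex \<times> real) list" where
  "diffq h t = [(1 / of_real h, t + h), (- 1 / of_real h, t)]"

lemma symbol_diffq: "symbol (diffq h t) l = iexp (- (t * l)) * dsym h l"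
  by (simp add: diffq_def dsym_def algebra_simps diff_divide_distrib add_divide_distrib exp_add exp_diff)
    (simp add: exp_minus field_simps)

lemma lin_comb_diffq: "lin_comb F (diffq h t) \<omega> = (F (t + h) \<omega> - F t \<omega>) / of_real h"
  by (simp add: diffq_def diff_divide_distrib)

lemma borel_measurable_dsym [measurable]: "dsym h \<in> borel_measurable borel"
  unfolding dsym_def by measurable

lemma norm_dsym_le: "cmod (dsym h l) \<le> \<bar>l\<bar>"
proof (cases "h = 0")
  case False
  have "cmod (iexp (- (h * l)) - 1) \<le> \<bar>h * l\<bar>"
    using iexp_approx1[of "- (h * l)" 0] by simp
  then show ?thesis using False by (simp add: dsym_def norm_divide abs_mult field_simps)
qed (simp add: dsym_def)

lemma norm_dsym_approx: "h \<noteq> 0 \<Longrightarrow> cmod (dsym h l + \<i> * of_real l) \<le> \<bar>h\<bar> * l\<^sup>2 / 2"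
proof -
  assume h: "h \<noteq> 0"
  have ap: "cmod (iexp (- (h * l)) - (1 + \<i> * of_real (- (h * l)))) \<le> \<bar>h * l\<bar>\<^sup>2 / 2"
    using iexp_approx1[of "- (h * l)" 1] by (simp add: numeral_2_eq_2 power2_eq_square abs_mult)
  have "dsym h l + \<i> * of_real l = (iexp (- (h * l)) - (1 + \<i> * of_real (- (h * l)))) / of_real h"
    using h by (simp add: dsym_def field_simps)
  then have "cmod (dsym h l + \<i> * of_real l) = cmod (iexp (- (h * l)) - (1 + \<i> * of_real (- (h * l)))) / \<bar>h\<bar>"
    by (simp only: norm_divide norm_of_real)
  also have "\<dots> \<le> (\<bar>h * l\<bar>\<^sup>2 / 2) / \<bar>h\<bar>"
    by (rule divide_right_mono[OF ap]) simp
  also have "\<dots> = \<bar>h\<bar> * l\<^sup>2 / 2"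
    using h by (simp add: power2_eq_square abs_mult)
  finally show ?thesis .
qed

lemma dsym_tendsto:
  assumes "h \<longlonglongrightarrow> 0" "\<And>k. h k \<noteq> 0"
  shows "(\<lambda>k. dsym (h k) l) \<longlonglongrightarrow> - \<i> * of_real l"
proof -
  have "(\<lambda>k. \<bar>h k\<bar> * l\<^sup>2 / 2) \<longlonglongrightarrow> \<bar>0\<bar> * l\<^sup>2 / 2" by (intro tendsto_intros assms) simp
  then have "(\<lambda>k. \<bar>h k\<bar> * l\<^sup>2 / 2) \<longlonglongrightarrow> 0" by simp
  then have "(\<lambda>k. dsym (h k) l + \<i> * of_real l) \<longlonglongrightarrow> 0"
    by (rule Lim_null_comparison[rotated]) (use norm_dsym_approx[OF assms(2)] in auto)
  from tendsto_diff[OF this tendsto_const[of "\<i> * of_real l"]] show ?thesis by simp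
qed

lemma sq_norm_add_le: "(cmod (a + b))\<^sup>2 \<le> 2 * (cmod a)\<^sup>2 + 2 * (cmod b)\<^sup>2"
proof -
  have "(cmod (a + b))\<^sup>2 \<le> (cmod a + cmod b)\<^sup>2" by (intro power_mono norm_triangle_ineq) auto
  also have "\<dots> \<le> 2 * (cmod a)\<^sup>2 + 2 * (cmod b)\<^sup>2"
    using sum_squares_bound[of "cmod a" "cmod b"] by (simp add: power2_sum)
  finally show ?thesis .
qed

text \<open>The setting after passing to a modification: continuity holds for every
  \<open>\<omega>\<close>, which gives joint measurability in time and chance. The logarithm enters
  to the first power, the order that arises when the weight \<open>1 / |s|\<close> is integrated
  against the spectral increment.\<close>

locale smooth_gaussian = prob_space M for M :: "'a measure" +
  fixes F :: "real \<Rightarrow> 'a \<Rightarrow> complex" and \<rho> :: "real measure"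
  assumes gauss: "finite I \<Longrightarrow> complex_gaussian_vector M I F"
    and paths: "continuous_on UNIV (\<lambda>t. F t \<omega>)"
    and cov: "(\<integral>\<omega>. F t \<omega> * cnj (F s \<omega>) \<partial>M) = (CLINT l|\<rho>. iexp (- ((t - s) * l)))"
    and rho: "real_distribution \<rho>"
    and moment2: "integrable \<rho> (\<lambda>l. l\<^sup>2)"
    and moment_log: "integrable \<rho> (\<lambda>l. l\<^sup>2 * ln (1 + \<bar>l\<bar>))"
begin

sublocale rho: real_distribution \<rho> by (rule rho)

lemma F_measurable [measurable]: "F t \<in> borel_measurable M"
  using complex_gaussian_vectorD(2)[OF gauss[of "{t}"], of t] by simp

lemma lin_comb_measurable [measurable]: "lin_comb F ps \<in> borel_measurable M"
proof (induction ps)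
  case Nil
  then show ?case by (simp add: lin_comb_def)
next
  case (Cons p ps)
  obtain a t where p: "p = (a, t)" by (cases p)
  have "lin_comb F (p # ps) = (\<lambda>l. a * F t l + lin_comb F ps l)" by (auto simp: p)
  then show ?case using Cons by simp
qed

lemma lin_comb_gaussian:
  assumes "finite L"
  shows "complex_gaussian_vector M L (\<lambda>l. lin_comb F (P l))"
proof -
  define K where "K = (\<Union>l\<in>L. snd ` set (P l))"
  have K: "finite K" unfolding K_def using assms by auto
  show ?thesis
  proof (rule gaussian_vector_linear[OF gauss[OF K] assms])
    fix l \<omega> assume "l \<in> L"
    then show "lin_comb F (P l) \<omega> = (\<Sum>k\<in>K. (\<Sum>(a, t)\<leftarrow>P l. if t = k then a else 0) * F k \<omega>)"
      by (intro lin_comb_eq_sum[OF K]) (auto simp: K_def)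
  qed
qed

lemma lin_comb_integrable:
  "integrable M (lin_comb F ps)" "integrable M (\<lambda>\<omega>. lin_comb F ps \<omega> * cnj (lin_comb F qs \<omega>))"
proof -
  have G: "complex_gaussian_vector M {0, 1 :: nat} (\<lambda>l. lin_comb F (if l = 0 then ps else qs))"
    by (rule lin_comb_gaussian) auto
  show "integrable M (lin_comb F ps)"
    using gaussian_vector_integrable_products(1)[OF prob_space_axioms G, of 0 0 0] by simp
  show "integrable M (\<lambda>\<omega>. lin_comb F ps \<omega> * cnj (lin_comb F qs \<omega>))"
    using gaussian_vector_integrable_products(3)[OF prob_space_axioms G, of 0 1 0] by simp
qed

lemma symbol_integrable: "integrable \<rho> (\<lambda>l. symbol ps l * cnj (symbol qs l))"
proof (rule rho.integrable_const_bound)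
  show "AE l in \<rho>. cmod (symbol ps l * cnj (symbol qs l)) \<le> (\<Sum>(a, t)\<leftarrow>ps. cmod a) * (\<Sum>(a, t)\<leftarrow>qs. cmod a)"
    unfolding norm_mult complex_mod_cnj
    by (intro AE_I2 mult_mono norm_symbol_le order_trans[OF norm_ge_zero norm_symbol_le]) auto
qed simp

text \<open>The spectral isometry: sesquilinear extension of the covariance formula, by induction on
  both lists. It turns second moments of combinations into integrals against
  \<open>\<rho>\<close>.\<close>

lemma lin_comb_covariance:
  "(\<integral>\<omega>. lin_comb F ps \<omega> * cnj (lin_comb F qs \<omega>) \<partial>M) = (CLINT l|\<rho>. symbol ps l * cnj (symbol qs l))"
proof -
  have 1: "(\<integral>\<omega>. F t \<omega> * cnj (lin_comb F qs \<omega>) \<partial>M) = (CLINT l|\<rho>. iexp (- (t * l)) * cnj (symbol qs l))" for t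
  proof (induction qs)
    case (Cons q qs)
    obtain b s where q: "q = (b, s)" by (cases q)
    have i: "integrable M (\<lambda>\<omega>. F t \<omega> * cnj (F s \<omega>))" for s
      using lin_comb_integrable(2)[of "[(1, t)]" "[(1, s)]"] by simp
    have i': "integrable M (\<lambda>\<omega>. F t \<omega> * cnj (lin_comb F qs \<omega>))"
      using lin_comb_integrable(2)[of "[(1, t)]" qs] by simp
    have j: "integrable \<rho> (\<lambda>l. iexp (- (t * l)) * cnj (symbol qs l))"
      using symbol_integrable[of "[(1, t)]" qs] by simp
    have j': "integrable \<rho> (\<lambda>l. iexp (- ((t - s) * l)))"
      using symbol_integrable[of "[(1, t - s)]" "[(1, 0)]"] by simp
    have e: "iexp (- (t * l)) * cnj (iexp (- (s * l))) = iexp (- ((t - s) * l))" for l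
      by (simp add: exp_cnj mult_exp_exp algebra_simps)
    have "(\<integral>\<omega>. F t \<omega> * cnj (lin_comb F (q # qs) \<omega>) \<partial>M) = (\<integral>\<omega>. cnj b * (F t \<omega> * cnj (F s \<omega>)) + F t \<omega> * cnj (lin_comb F qs \<omega>) \<partial>M)"
      unfolding q by (intro Bochner_Integration.integral_cong) (auto simp: algebra_simps)
    also have "\<dots> = cnj b * (\<integral>\<omega>. F t \<omega> * cnj (F s \<omega>) \<partial>M) + (\<integral>\<omega>. F t \<omega> * cnj (lin_comb F qs \<omega>) \<partial>M)"
      using i i' by (subst Bochner_Integration.integral_add) (auto intro: integrable_mult_right)
    also have "\<dots> = (CLINT l|\<rho>. cnj b * iexp (- ((t - s) * l)) + iexp (- (t * l)) * cnj (symbol qs l))"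
      unfolding Cons.IH cov using j j' by (subst Bochner_Integration.integral_add) (auto intro: integrable_mult_right)
    also have "\<dots> = (CLINT l|\<rho>. iexp (- (t * l)) * cnj (symbol (q # qs) l))"
      unfolding q e[symmetric] by (intro Bochner_Integration.integral_cong) (auto simp: algebra_simps)
    finally show ?case .
  qed simp
  show ?thesis
  proof (induction ps)
    case (Cons p ps)
    obtain a t where p: "p = (a, t)" by (cases p)
    have i: "integrable M (\<lambda>\<omega>. F t \<omega> * cnj (lin_comb F qs \<omega>))"
      using lin_comb_integrable(2)[of "[(1, t)]" qs] by simp
    have j: "integrable \<rho> (\<lambda>l. iexp (- (t * l)) * cnj (symbol qs l))"
      using symbol_integrable[of "[(1, t)]" qs] by simp
    have "(\<integral>\<omega>. lin_comb F (p # ps) \<omega> * cnj (lin_comb F qs \<omega>) \<partial>M) = (\<integral>\<omega>. a * (F t \<omega> * cnj (lin_comb F qs \<omega>)) + lin_comb F ps \<omega> * cnj (lin_comb F qs \<omega>) \<partial>M)"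
      unfolding p by (intro Bochner_Integration.integral_cong) (auto simp: algebra_simps)
    also have "\<dots> = a * (\<integral>\<omega>. F t \<omega> * cnj (lin_comb F qs \<omega>) \<partial>M) + (\<integral>\<omega>. lin_comb F ps \<omega> * cnj (lin_comb F qs \<omega>) \<partial>M)"
      using i lin_comb_integrable(2) by (subst Bochner_Integration.integral_add) (auto intro: integrable_mult_right)
    also have "\<dots> = (CLINT l|\<rho>. a * (iexp (- (t * l)) * cnj (symbol qs l)) + symbol ps l * cnj (symbol qs l))"
      unfolding Cons.IH 1 using j symbol_integrable by (subst Bochner_Integration.integral_add) (auto intro: integrable_mult_right)
    also have "\<dots> = (CLINT l|\<rho>. symbol (p # ps) l * cnj (symbol qs l))"
      unfolding p by (intro Bochner_Integration.integral_cong) (auto simp: algebra_simps)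
    finally show ?case .
  qed simp
qed

lemma lin_comb_second_moment:
  "(\<integral>\<omega>. (cmod (lin_comb F ps \<omega>))\<^sup>2 \<partial>M) = (\<integral>l. (cmod (symbol ps l))\<^sup>2 \<partial>\<rho>)"
  "integrable M (\<lambda>\<omega>. (cmod (lin_comb F ps \<omega>))\<^sup>2)" "integrable \<rho> (\<lambda>l. (cmod (symbol ps l))\<^sup>2)"
proof -
  have "complex_of_real (\<integral>\<omega>. (cmod (lin_comb F ps \<omega>))\<^sup>2 \<partial>M) = complex_of_real (\<integral>l. (cmod (symbol ps l))\<^sup>2 \<partial>\<rho>)"
    unfolding integral_complex_of_real[symmetric] complex_norm_square by (rule lin_comb_covariance)
  then show "(\<integral>\<omega>. (cmod (lin_comb F ps \<omega>))\<^sup>2 \<partial>M) = (\<integral>l. (cmod (symbol ps l))\<^sup>2 \<partial>\<rho>)"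
    by (simp only: of_real_eq_iff)
  show "integrable M (\<lambda>\<omega>. (cmod (lin_comb F ps \<omega>))\<^sup>2)"
    using lin_comb_integrable(2)[of ps ps] unfolding complex_norm_square[symmetric] complex_of_real_integrable_eq .
  show "integrable \<rho> (\<lambda>l. (cmod (symbol ps l))\<^sup>2)"
    using symbol_integrable[of ps ps] unfolding complex_norm_square[symmetric] complex_of_real_integrable_eq .
qed

lemma nn_lin_comb_second_moment:
  "(\<integral>\<^sup>+\<omega>. ennreal ((cmod (lin_comb F ps \<omega>))\<^sup>2) \<partial>M) = (\<integral>\<^sup>+l. ennreal ((cmod (symbol ps l))\<^sup>2) \<partial>\<rho>)"
  by (simp add: nn_integral_eq_integral lin_comb_second_moment)

lemma nn_lin_comb_moment:
  "(\<integral>\<^sup>+\<omega>. ennreal (cmod (lin_comb F ps \<omega>) ^ (2 * n)) \<partial>M) =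
    (\<integral>\<^sup>+z. ennreal (cmod z ^ (2 * n)) \<partial>std_complex_gaussian) * ennreal ((\<integral>l. (cmod (symbol ps l))\<^sup>2 \<partial>\<rho>) ^ n)"
  using gaussian_vector_moments(2)[OF prob_space_axioms lin_comb_gaussian[of "{0::nat}" "\<lambda>_. ps"], of 0 n]
  by (simp add: lin_comb_second_moment)

text \<open>Dominated convergence with majorant \<open>4 * l^2\<close> sends the error to zero, so a
  subsequence of \<open>1 / n\<close> reaches any prescribed rate. The rate \<open>4^-k\<close> for
  squares makes consecutive quotients differ by order \<open>2^-k\<close> in mean, which is
  summable.\<close>

lemma step_sequence_exists:
  "\<exists>h. (\<forall>k. 0 < h k \<and> h k \<le> 1) \<and> h \<longlonglongrightarrow> 0 \<and>
    (\<forall>k. (\<integral>\<^sup>+l. ennreal ((cmod (dsym (h k) l + \<i> * of_real l))\<^sup>2) \<partial>\<rho>) \<le> ennreal ((1 / 4) ^ k))"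
proof -
  define e where "e n = (\<integral>l. (cmod (dsym (1 / real (Suc n)) l + \<i> * of_real l))\<^sup>2 \<partial>\<rho>)" for n
  have b4: "(cmod (dsym h l + \<i> * of_real l))\<^sup>2 \<le> 4 * l\<^sup>2" for h l
  proof -
    have "(cmod (dsym h l + \<i> * of_real l))\<^sup>2 \<le> 2 * (cmod (dsym h l))\<^sup>2 + 2 * (cmod (\<i> * of_real l))\<^sup>2" by (rule sq_norm_add_le)
    also have "(cmod (dsym h l))\<^sup>2 \<le> \<bar>l\<bar>\<^sup>2" by (intro power_mono norm_dsym_le) auto
    finally show ?thesis by (simp add: norm_mult)
  qed
  have i4: "integrable \<rho> (\<lambda>l. 4 * l\<^sup>2)" using moment2 by simp
  have int: "integrable \<rho> (\<lambda>l. (cmod (dsym h l + \<i> * of_real l))\<^sup>2)" for h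
    by (rule Bochner_Integration.integrable_bound[OF i4]) (use b4 in auto)
  have "e \<longlonglongrightarrow> (\<integral>l. 0 \<partial>\<rho>)"
    unfolding e_def
  proof (rule integral_dominated_convergence[OF _ _ i4])
    have lim: "(\<lambda>n. 1 / real (Suc n)) \<longlonglongrightarrow> 0" by (rule LIMSEQ_Suc[OF lim_1_over_n])
    have "(\<lambda>n. (cmod (dsym (1 / real (Suc n)) l + \<i> * of_real l))\<^sup>2) \<longlonglongrightarrow> (cmod (- \<i> * of_real l + \<i> * of_real l))\<^sup>2" for l
      by (intro tendsto_intros dsym_tendsto lim) auto
    then show "AE l in \<rho>. (\<lambda>n. (cmod (dsym (1 / real (Suc n)) l + \<i> * of_real l))\<^sup>2) \<longlonglongrightarrow> 0" by simp
  qed (use b4 in auto)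
  then have e0: "e \<longlonglongrightarrow> 0" by simp
  have "\<exists>n\<ge>k. e n < (1 / 4) ^ k" for k
  proof -
    have "eventually (\<lambda>n. e n < (1 / 4) ^ k) sequentially" using e0 by (rule order_tendstoD) simp
    then obtain N where "\<forall>n\<ge>N. e n < (1 / 4) ^ k" by (auto simp: eventually_sequentially)
    then show ?thesis by (intro exI[of _ "max N k"]) auto
  qed
  then obtain N where N: "\<And>k. N k \<ge> k" "\<And>k. e (N k) < (1 / 4) ^ k" by metis
  define h where "h k = 1 / real (Suc (N k))" for k
  have "h \<longlonglongrightarrow> 0"
  proof (rule tendsto_sandwich[OF _ _ tendsto_const])
    show "(\<lambda>k. 1 / real (Suc k)) \<longlonglongrightarrow> 0" by (rule LIMSEQ_Suc[OF lim_1_over_n])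
    show "eventually (\<lambda>k. h k \<le> 1 / real (Suc k)) sequentially"
    proof (intro always_eventually allI)
      fix k show "h k \<le> 1 / real (Suc k)" using N(1)[of k] by (simp add: h_def frac_le)
    qed
  qed (auto simp: h_def)
  moreover have "(\<integral>\<^sup>+l. ennreal ((cmod (dsym (h k) l + \<i> * of_real l))\<^sup>2) \<partial>\<rho>) \<le> ennreal ((1 / 4) ^ k)" for k
    using N(2)[of k] int by (subst nn_integral_eq_integral) (auto simp: e_def h_def intro!: ennreal_leI less_imp_le)
  moreover have "0 < h k \<and> h k \<le> 1" for k by (simp add: h_def)
  ultimately show ?thesis by blast
qed

text \<open>A sequence of steps along which the difference quotients converge almost surely, not only in mean square.\<close>

definition hs :: "nat \<Rightarrow> real" where
  "hs = (SOME h. (\<forall>k. 0 < h k \<and> h k \<le> 1) \<and> h \<longlonglongrightarrow> 0 \<and>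
    (\<forall>k. (\<integral>\<^sup>+l. ennreal ((cmod (dsym (h k) l + \<i> * of_real l))\<^sup>2) \<partial>\<rho>) \<le> ennreal ((1 / 4) ^ k)))"

lemma hs: "0 < hs k" "hs k \<le> 1" "hs \<longlonglongrightarrow> 0"
    "(\<integral>\<^sup>+l. ennreal ((cmod (dsym (hs k) l + \<i> * of_real l))\<^sup>2) \<partial>\<rho>) \<le> ennreal ((1 / 4) ^ k)"
  using someI_ex[OF step_sequence_exists] unfolding hs_def[symmetric] by auto

section \<open>Almost sure limits of difference quotients and joint measurability\<close>

definition D :: "nat \<Rightarrow> real \<Rightarrow> 'a \<Rightarrow> complex" where
  "D k t \<omega> = (F (t + hs k) \<omega> - F t \<omega>) / of_real (hs k)"

lemma D_eq: "D k t \<omega> = lin_comb F (diffq (hs k) t) \<omega>"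
  by (simp add: D_def lin_comb_diffq)

text \<open>Where this total variation is finite, the quotients converge absolutely. It also serves
  as a majorant for all of them at once.\<close>

definition S :: "real \<Rightarrow> 'a \<Rightarrow> ennreal" where
  "S t \<omega> = (\<Sum>k. ennreal (cmod (D (Suc k) t \<omega> - D k t \<omega>)))"

text \<open>A version of the mean square derivative, chosen as a pointwise limit so that it is
  jointly measurable in time and chance; its value where the quotients diverge is
  immaterial.\<close>

definition G :: "real \<Rightarrow> 'a \<Rightarrow> complex" where
  "G t \<omega> = lim (\<lambda>k. D k t \<omega>)"

text \<open>By path continuity \<open>F\<close> is the pointwise limit of its values at the grid
  point just below \<open>t\<close>. Each approximation uses only countably many times and is
  therefore jointly measurable.\<close>

lemma F_joint [measurable]: "(\<lambda>p. F (fst p) (snd p)) \<in> borel_measurable (borel \<Otimes>\<^sub>M M)"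
proof (rule borel_measurable_LIMSEQ_metric)
  fix n :: nat
  show "(\<lambda>p. F (real_of_int \<lfloor>real (Suc n) * fst p\<rfloor> / real (Suc n)) (snd p)) \<in> borel_measurable (borel \<Otimes>\<^sub>M M)"
    by (rule measurable_compose_countable[where f="\<lambda>i p. F (real_of_int i / real (Suc n)) (snd p)"]) measurable
next
  fix p :: "real \<times> 'a"
  have "(\<lambda>n. real_of_int \<lfloor>real (Suc n) * fst p\<rfloor> / real (Suc n)) \<longlonglongrightarrow> fst p"
  proof (rule tendsto_sandwich[of "\<lambda>n. fst p - 1 / real (Suc n)" _ _ "\<lambda>_. fst p"])
    have "(\<lambda>n. fst p - 1 / real (Suc n)) \<longlonglongrightarrow> fst p - 0"
      by (intro tendsto_diff tendsto_const LIMSEQ_Suc[OF lim_1_over_n])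
    then show "(\<lambda>n. fst p - 1 / real (Suc n)) \<longlonglongrightarrow> fst p" by simp
    have "real (Suc n) * fst p - 1 \<le> real_of_int \<lfloor>real (Suc n) * fst p\<rfloor>" for n by linarith
    then have "(real (Suc n) * fst p - 1) / real (Suc n) \<le> real_of_int \<lfloor>real (Suc n) * fst p\<rfloor> / real (Suc n)" for n
      by (rule divide_right_mono) simp
    then show "\<forall>\<^sub>F n in sequentially. fst p - 1 / real (Suc n) \<le> real_of_int \<lfloor>real (Suc n) * fst p\<rfloor> / real (Suc n)"
      by (simp add: diff_divide_distrib)
    have "real_of_int \<lfloor>real (Suc n) * fst p\<rfloor> \<le> real (Suc n) * fst p" for n by linarith
    then have "real_of_int \<lfloor>real (Suc n) * fst p\<rfloor> / real (Suc n) \<le> (real (Suc n) * fst p) / real (Suc n)" for n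
      by (rule divide_right_mono) simp
    then show "\<forall>\<^sub>F n in sequentially. real_of_int \<lfloor>real (Suc n) * fst p\<rfloor> / real (Suc n) \<le> fst p"
      by simp
  qed simp
  moreover have "isCont (\<lambda>t. F t (snd p)) (fst p)" using paths by (simp add: continuous_on_eq_continuous_at)
  ultimately show "(\<lambda>n. F (real_of_int \<lfloor>real (Suc n) * fst p\<rfloor> / real (Suc n)) (snd p)) \<longlonglongrightarrow> F (fst p) (snd p)"
    by (rule isCont_tendsto_compose[rotated])
qed

lemma F_joint' [measurable (raw)]:
  assumes [measurable]: "f \<in> borel_measurable N" "g \<in> measurable N M"
  shows "(\<lambda>x. F (f x) (g x)) \<in> borel_measurable N"
  using measurable_compose[OF measurable_Pair[OF assms] F_joint] by simp

lemma D_joint [measurable (raw)]: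
  assumes [measurable]: "f \<in> borel_measurable N" "g \<in> measurable N M"
  shows "(\<lambda>x. D k (f x) (g x)) \<in> borel_measurable N"
  unfolding D_def by measurable

lemma S_joint [measurable (raw)]:
  assumes [measurable]: "f \<in> borel_measurable N" "g \<in> measurable N M"
  shows "(\<lambda>x. S (f x) (g x)) \<in> borel_measurable N"
  unfolding S_def by measurable

lemma G_joint [measurable (raw)]:
  assumes [measurable]: "f \<in> borel_measurable N" "g \<in> measurable N M"
  shows "(\<lambda>x. G (f x) (g x)) \<in> borel_measurable N"
  unfolding G_def by measurable

text \<open>Telescoping from \<open>D 0\<close>. The second claim is the majorant for dominated
  convergence in time.\<close>

lemma G_lim:
  assumes "S t \<omega> < \<infinity>"
  shows "(\<lambda>k. D k t \<omega>) \<longlonglongrightarrow> G t \<omega>" "cmod (D k t \<omega>) \<le> cmod (D 0 t \<omega>) + enn2real (S t \<omega>)"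
proof -
  have sm: "summable (\<lambda>k. cmod (D (Suc k) t \<omega> - D k t \<omega>))"
    using assms unfolding S_def by (intro summable_suminf_not_top) auto
  then have "summable (\<lambda>k. D (Suc k) t \<omega> - D k t \<omega>)" by (rule summable_norm_cancel)
  then have "convergent (\<lambda>n. \<Sum>k<n. D (Suc k) t \<omega> - D k t \<omega>)" by (simp add: summable_iff_convergent)
  then have "convergent (\<lambda>n. D n t \<omega> - D 0 t \<omega>)" by (simp add: sum_lessThan_telescope[of "\<lambda>k. D k t \<omega>"])
  then have "convergent (\<lambda>n. (D n t \<omega> - D 0 t \<omega>) + D 0 t \<omega>)" by (intro convergent_add convergent_const)
  then show "(\<lambda>k. D k t \<omega>) \<longlonglongrightarrow> G t \<omega>" unfolding G_def by (simp add: convergent_LIMSEQ_iff)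
  have "D k t \<omega> = D 0 t \<omega> + (\<Sum>i<k. D (Suc i) t \<omega> - D i t \<omega>)" by (simp add: sum_lessThan_telescope[of "\<lambda>k. D k t \<omega>"])
  then have "cmod (D k t \<omega>) \<le> cmod (D 0 t \<omega>) + cmod (\<Sum>i<k. D (Suc i) t \<omega> - D i t \<omega>)"
    by (metis norm_triangle_ineq)
  also have "cmod (\<Sum>i<k. D (Suc i) t \<omega> - D i t \<omega>) \<le> (\<Sum>i<k. cmod (D (Suc i) t \<omega> - D i t \<omega>))" by (rule norm_sum)
  also have "\<dots> \<le> (\<Sum>i. cmod (D (Suc i) t \<omega> - D i t \<omega>))" by (rule sum_le_suminf[OF sm]) auto
  also have "\<dots> = enn2real (S t \<omega>)" unfolding S_def by (simp add: suminf_ennreal2 sm suminf_nonneg)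
  finally show "cmod (D k t \<omega>) \<le> cmod (D 0 t \<omega>) + enn2real (S t \<omega>)" by simp
qed

text \<open>Both quotients are close in mean square to the same limit, so the square of their
  difference has mean at most \<open>4 * 4^-k\<close>. The inequality
  \<open>z \<le> 2^-k + 2^k * z^2\<close> converts this to a first moment:
  \<open>2^-k + 4 * 2^-k\<close> is the stated bound.\<close>

lemma nn_D_step: "(\<integral>\<^sup>+\<omega>. ennreal (cmod (D (Suc k) t \<omega> - D k t \<omega>)) \<partial>M) \<le> ennreal (5 * (1 / 2) ^ k)"
proof -
  define ps where "ps = diffq (hs (Suc k)) t @ scale_comb (- 1) (diffq (hs k) t)"
  have ps: "D (Suc k) t \<omega> - D k t \<omega> = lin_comb F ps \<omega>" for \<omega>
    by (simp add: ps_def D_eq)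
  have sy: "symbol ps l = iexp (- (t * l)) * ((dsym (hs (Suc k)) l + \<i> * of_real l) + - (dsym (hs k) l + \<i> * of_real l))" for l
    by (simp add: ps_def symbol_diffq algebra_simps)
  have sq: "(cmod (symbol ps l))\<^sup>2 \<le> 2 * (cmod (dsym (hs (Suc k)) l + \<i> * of_real l))\<^sup>2 + 2 * (cmod (dsym (hs k) l + \<i> * of_real l))\<^sup>2" for l
    using sq_norm_add_le[of "dsym (hs (Suc k)) l + \<i> * of_real l" "- (dsym (hs k) l + \<i> * of_real l)"]
    unfolding sy norm_mult norm_minus_cancel by simp
  have "(\<integral>\<^sup>+l. ennreal ((cmod (symbol ps l))\<^sup>2) \<partial>\<rho>)
      \<le> (\<integral>\<^sup>+l. 2 * ennreal ((cmod (dsym (hs (Suc k)) l + \<i> * of_real l))\<^sup>2) + 2 * ennreal ((cmod (dsym (hs k) l + \<i> * of_real l))\<^sup>2) \<partial>\<rho>)"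
  proof (rule nn_integral_mono)
    fix l
    have "ennreal ((cmod (symbol ps l))\<^sup>2) \<le> ennreal (2 * (cmod (dsym (hs (Suc k)) l + \<i> * of_real l))\<^sup>2 + 2 * (cmod (dsym (hs k) l + \<i> * of_real l))\<^sup>2)"
      by (rule ennreal_leI[OF sq])
    then show "ennreal ((cmod (symbol ps l))\<^sup>2) \<le> 2 * ennreal ((cmod (dsym (hs (Suc k)) l + \<i> * of_real l))\<^sup>2) + 2 * ennreal ((cmod (dsym (hs k) l + \<i> * of_real l))\<^sup>2)"
      by (simp add: ennreal_mult)
  qed
  also have "\<dots> = 2 * (\<integral>\<^sup>+l. ennreal ((cmod (dsym (hs (Suc k)) l + \<i> * of_real l))\<^sup>2) \<partial>\<rho>) + 2 * (\<integral>\<^sup>+l. ennreal ((cmod (dsym (hs k) l + \<i> * of_real l))\<^sup>2) \<partial>\<rho>)"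
    by (subst nn_integral_add) (auto simp: nn_integral_cmult)
  also have "\<dots> \<le> 2 * ennreal ((1 / 4) ^ Suc k) + 2 * ennreal ((1 / 4) ^ k)"
    by (intro add_mono mult_left_mono hs) auto
  also have "\<dots> = ennreal (2 * (1 / 4) ^ Suc k + 2 * (1 / 4) ^ k)"
  proof -
    have "2 * ennreal x + 2 * ennreal y = ennreal (2 * x + 2 * y)" if "0 \<le> x" "0 \<le> y" for x y
      using that by (simp add: ennreal_mult)
    then show ?thesis by this auto
  qed
  also have "\<dots> \<le> ennreal (4 * (1 / 4) ^ k)" by (rule ennreal_leI) simp
  finally have m: "(\<integral>\<^sup>+\<omega>. ennreal ((cmod (lin_comb F ps \<omega>))\<^sup>2) \<partial>M) \<le> ennreal (4 * (1 / 4) ^ k)"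
    unfolding nn_lin_comb_second_moment .
  have bd: "ennreal z \<le> ennreal ((1 / 2) ^ k) + ennreal (2 ^ k) * ennreal (z\<^sup>2)" if "0 \<le> z" for z
  proof -
    have "z \<le> (1 / 2) ^ k + 2 ^ k * z\<^sup>2"
    proof (cases "z \<le> (1 / 2) ^ k")
      case True then show ?thesis by (simp add: add_increasing2)
    next
      case False
      then have "(1 / 2) ^ k * z \<le> z * z" using that by (intro mult_right_mono) auto
      then have "2 ^ k * ((1 / 2) ^ k * z) \<le> 2 ^ k * (z * z)" by (intro mult_left_mono) auto
      then have "z \<le> 2 ^ k * z\<^sup>2" by (simp add: power2_eq_square power_one_over)
      then show ?thesis by (simp add: add_increasing)
    qed
    then have "ennreal z \<le> ennreal ((1 / 2) ^ k + 2 ^ k * z\<^sup>2)" by (rule ennreal_leI)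
    then show ?thesis by (simp add: ennreal_mult)
  qed
  have "(\<integral>\<^sup>+\<omega>. ennreal (cmod (D (Suc k) t \<omega> - D k t \<omega>)) \<partial>M)
     \<le> (\<integral>\<^sup>+\<omega>. ennreal ((1 / 2) ^ k) + ennreal (2 ^ k) * ennreal ((cmod (lin_comb F ps \<omega>))\<^sup>2) \<partial>M)"
    unfolding ps by (intro nn_integral_mono bd) auto
  also have "\<dots> = ennreal ((1 / 2) ^ k) + ennreal (2 ^ k) * (\<integral>\<^sup>+\<omega>. ennreal ((cmod (lin_comb F ps \<omega>))\<^sup>2) \<partial>M)"
    by (subst nn_integral_add) (auto simp: nn_integral_cmult emeasure_space_1)
  also have "\<dots> \<le> ennreal ((1 / 2) ^ k) + ennreal (2 ^ k) * ennreal (4 * (1 / 4) ^ k)"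
    by (intro add_left_mono mult_left_mono m) auto
  also have "\<dots> = ennreal ((1 / 2) ^ k + 2 ^ k * (4 * (1 / 4) ^ k))"
    by (subst ennreal_plus) (auto simp: ennreal_mult[symmetric])
  also have "(2::real) ^ k * (4 * (1 / 4) ^ k) = 4 * (1 / 2) ^ k"
  proof -
    have "(1 / 4 :: real) ^ k = (1 / 2) ^ k * (1 / 2) ^ k" by (simp add: power_mult_distrib[symmetric])
    moreover have "(2::real) ^ k * (1 / 2) ^ k = 1" by (simp add: power_mult_distrib[symmetric])
    ultimately show ?thesis by (simp add: mult.left_commute flip: mult.assoc)
  qed
  finally show ?thesis by simp
qed

lemma nn_S: "(\<integral>\<^sup>+\<omega>. S t \<omega> \<partial>M) \<le> 10"
proof -
  have "(\<integral>\<^sup>+\<omega>. S t \<omega> \<partial>M) = (\<Sum>k. \<integral>\<^sup>+\<omega>. ennreal (cmod (D (Suc k) t \<omega> - D k t \<omega>)) \<partial>M)"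
    unfolding S_def by (rule nn_integral_suminf) measurable
  also have "\<dots> \<le> (\<Sum>k. ennreal (5 * (1 / 2) ^ k))"
    by (intro suminf_le nn_D_step) auto
  also have "\<dots> = ennreal (\<Sum>k. 5 * (1 / 2) ^ k)"
    by (intro suminf_ennreal2 summable_mult summable_geometric) auto
  also have "(\<Sum>k. 5 * (1 / 2) ^ k) = (10::real)"
    by (subst suminf_mult) (auto simp: suminf_geometric summable_geometric)
  finally show ?thesis by simp
qed

lemma AE_S_finite: "AE \<omega> in M. S t \<omega> < \<infinity>"
proof -
  have "(\<integral>\<^sup>+\<omega>. S t \<omega> \<partial>M) \<noteq> \<infinity>" using nn_S[of t] by (auto simp: top_unique)
  then have "AE \<omega> in M. S t \<omega> \<noteq> \<infinity>" by (intro nn_integral_PInf_AE) auto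
  then show ?thesis by (simp add: less_top)
qed

lemma AE_G_lim: "AE \<omega> in M. (\<lambda>k. D k t \<omega>) \<longlonglongrightarrow> G t \<omega>"
  using AE_S_finite[of t] by eventually_elim (rule G_lim)

end

text \<open>The integral is split at \<open>|s| = 1 / (1 + |l|)\<close>. Inside, the integrand is at
  most \<open>|l|\<close> and contributes at most 2; outside, \<open>4 / |s|\<close> contributes
  \<open>4 * ln (1 + |l|)\<close> on each side. This is how the logarithmic moment enters.\<close>

lemma nn_integral_log_weight:
  "(\<integral>\<^sup>+s. ennreal (min 4 ((s * l)\<^sup>2) / \<bar>s\<bar>) * indicator {-1..1} s \<partial>lborel) \<le> ennreal (2 + 8 * ln (1 + \<bar>l\<bar>))"
proof -
  define c where "c = 1 / (1 + \<bar>l\<bar>)"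
  have c: "0 < c" "c \<le> 1" by (auto simp: c_def field_simps)
  have lc: "c * \<bar>l\<bar> \<le> 1" by (simp add: c_def field_simps)
  have ln: "(\<integral>\<^sup>+s. ennreal (4 / s) * indicator {c..1} s \<partial>lborel) = ennreal (4 * ln (1 + \<bar>l\<bar>))"
  proof -
    have "(\<integral>\<^sup>+s. ennreal (4 / s) * indicator {c..1} s \<partial>lborel) = ennreal (4 * ln 1 - 4 * ln c)"
      by (rule nn_integral_FTC_Icc) (use c in \<open>auto intro!: derivative_eq_intros simp: field_simps\<close>)
    also have "4 * ln 1 - 4 * ln c = 4 * ln (1 + \<bar>l\<bar>)" by (simp add: c_def ln_div)
    finally show ?thesis .
  qed
  have "(\<integral>\<^sup>+s. ennreal (min 4 ((s * l)\<^sup>2) / \<bar>s\<bar>) * indicator {-1..1} s \<partial>lborel)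
     \<le> (\<integral>\<^sup>+s. ennreal \<bar>l\<bar> * indicator {-c..c} s + (ennreal (4 / s) * indicator {c..1} s + ennreal (4 / (- s)) * indicator {c..1} (- s)) \<partial>lborel)"
  proof (rule nn_integral_mono)
    fix s :: real
    show "ennreal (min 4 ((s * l)\<^sup>2) / \<bar>s\<bar>) * indicator {-1..1} s \<le>
      ennreal \<bar>l\<bar> * indicator {-c..c} s + (ennreal (4 / s) * indicator {c..1} s + ennreal (4 / (- s)) * indicator {c..1} (- s))"
    proof (cases "\<bar>s\<bar> \<le> c")
      case True
      have "min 4 ((s * l)\<^sup>2) / \<bar>s\<bar> \<le> (s * l)\<^sup>2 / \<bar>s\<bar>" by (intro divide_right_mono) auto
      also have "\<dots> = (\<bar>s\<bar> * \<bar>l\<bar>) * \<bar>l\<bar>" by (cases "s = 0") (auto simp: power2_eq_square abs_mult field_simps abs_if)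
      also have "\<dots> \<le> (c * \<bar>l\<bar>) * \<bar>l\<bar>" using True by (intro mult_right_mono) auto
      also have "\<dots> \<le> 1 * \<bar>l\<bar>" using lc by (intro mult_right_mono) auto
      finally have "ennreal (min 4 ((s * l)\<^sup>2) / \<bar>s\<bar>) \<le> ennreal \<bar>l\<bar>" by (intro ennreal_leI) simp
      then have "ennreal (min 4 ((s * l)\<^sup>2) / \<bar>s\<bar>) * indicator {-1..1} s \<le> ennreal \<bar>l\<bar> * indicator {-c..c} s"
        using True by (auto simp: indicator_def abs_le_iff)
      then show ?thesis by (rule order_trans) (rule add_increasing2[OF zero_le order_refl])
    next
      case False
      show ?thesis
      proof (cases "\<bar>s\<bar> \<le> 1")
        case True
        have "ennreal (min 4 ((s * l)\<^sup>2) / \<bar>s\<bar>) \<le> ennreal (4 / \<bar>s\<bar>)" by (intro ennreal_leI divide_right_mono) auto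
        also have "\<dots> \<le> ennreal (4 / s) * indicator {c..1} s + ennreal (4 / (- s)) * indicator {c..1} (- s)"
          using True False c by (cases "s \<ge> 0") (auto simp: indicator_def abs_le_iff)
        finally show ?thesis using True by (auto simp: indicator_def abs_le_iff intro: add_increasing)
      next
        case False
        then show ?thesis by (auto simp: indicator_def)
      qed
    qed
  qed
  also have "\<dots> = ennreal \<bar>l\<bar> * ennreal (2 * c) + ((\<integral>\<^sup>+s. ennreal (4 / s) * indicator {c..1} s \<partial>lborel) + (\<integral>\<^sup>+s. ennreal (4 / (- s)) * indicator {c..1} (- s) \<partial>lborel))"
    using c by (simp add: nn_integral_add nn_integral_cmult)
  also have "(\<integral>\<^sup>+s. ennreal (4 / (- s)) * indicator {c..1} (- s) \<partial>lborel) = (\<integral>\<^sup>+s. ennreal (4 / s) * indicator {c..1} s \<partial>lborel)"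
    using nn_integral_real_affine[of "\<lambda>s. ennreal (4 / s) * indicator {c..1} s" "-1" 0] by simp
  also have "ennreal \<bar>l\<bar> * ennreal (2 * c) + ((\<integral>\<^sup>+s. ennreal (4 / s) * indicator {c..1} s \<partial>lborel) + (\<integral>\<^sup>+s. ennreal (4 / s) * indicator {c..1} s \<partial>lborel))
     = ennreal (\<bar>l\<bar> * (2 * c) + (4 * ln (1 + \<bar>l\<bar>) + 4 * ln (1 + \<bar>l\<bar>)))"
  proof -
    have "ennreal \<bar>l\<bar> * ennreal (2 * c) = ennreal (\<bar>l\<bar> * (2 * c))"
      using c by (intro ennreal_mult[symmetric]) auto
    moreover have "0 \<le> 4 * ln (1 + \<bar>l\<bar>)" "0 \<le> \<bar>l\<bar> * (2 * c)" using c by auto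
    ultimately show ?thesis unfolding ln by (simp only: ennreal_plus add_nonneg_nonneg)
  qed
  also have "\<dots> \<le> ennreal (2 + 8 * ln (1 + \<bar>l\<bar>))"
    using lc by (intro ennreal_leI) (simp add: mult.commute)
  finally show ?thesis .
qed

text \<open>The integral of the difference quotient equals the difference quotient of a primitive at
  \<open>y\<close> minus that at \<open>x\<close>. Both converge because \<open>f\<close> is
  continuous, even if \<open>f\<close> is nowhere differentiable.\<close>

lemma set_integral_difference_quotient:
  fixes f :: "real \<Rightarrow> complex"
  assumes f: "continuous_on UNIV f" and xy: "x \<le> y" and h: "\<And>k. 0 < h k" "\<And>k. h k \<le> (1::real)" "h \<longlonglongrightarrow> 0"
  shows "(\<lambda>k. LINT t:{x..y}|lborel. (f (t + h k) - f t) / of_real (h k)) \<longlonglongrightarrow> f y - f x"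
proof -
  define P where "P u = integral {x - 1..u} f" for u
  have P: "(P has_vector_derivative f u) (at u)" if "x - 1 < u" "u < y + 2" for u
  proof -
    have "(P has_vector_derivative f u) (at u within {x - 1..y + 2})"
      unfolding P_def using that by (intro integral_has_vector_derivative continuous_on_subset[OF f]) auto
    then show ?thesis using that by (simp add: at_within_Icc_at)
  qed
  have eq: "(LINT t:{x..y}|lborel. (f (t + h k) - f t) / of_real (h k)) = (P (y + h k) - P y) / of_real (h k) - (P (x + h k) - P x) / of_real (h k)" for k
  proof -
    have d: "((\<lambda>u. (P (u + h k) - P u) / of_real (h k)) has_vector_derivative (f (t + h k) - f t) / of_real (h k)) (at t within {x..y})"
      if "x \<le> t" "t \<le> y" for t
    proof -
      have "((P \<circ> (\<lambda>u. u + h k)) has_vector_derivative 1 *\<^sub>R f (t + h k)) (at t)"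
        by (rule vector_diff_chain_at) (use that h(1)[of k] h(2)[of k] in \<open>auto intro!: P derivative_eq_intros\<close>)
      then have "((\<lambda>u. P (u + h k)) has_vector_derivative f (t + h k)) (at t)" by (simp add: o_def)
      from has_vector_derivative_diff[OF this P[of t]] that
      have "((\<lambda>u. P (u + h k) - P u) has_vector_derivative f (t + h k) - f t) (at t)" by simp
      then have "((\<lambda>u. (P (u + h k) - P u) * (1 / of_real (h k))) has_vector_derivative (f (t + h k) - f t) * (1 / of_real (h k))) (at t)"
        by (rule has_vector_derivative_mult_left)
      then show ?thesis by (auto intro: has_vector_derivative_at_within simp: divide_inverse)
    qed
    have "continuous_on {x..y} (\<lambda>t. (f (t + h k) - f t) / of_real (h k))"
      using h(1)[of k] by (intro continuous_intros continuous_on_compose2[OF f] continuous_on_subset[OF f]) auto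
    from integral_FTC_Icc[OF xy d this]
    show ?thesis unfolding set_lebesgue_integral_def .
  qed
  have hat: "filterlim h (at 0) sequentially"
    using h by (auto simp: filterlim_at intro!: always_eventually) (metis less_irrefl)
  have lim: "(\<lambda>k. (P (u + h k) - P u) / of_real (h k)) \<longlonglongrightarrow> f u" if "x \<le> u" "u \<le> y" for u
  proof -
    have "((\<lambda>h. (P (u + h) - P u) / of_real h) \<longlongrightarrow> f u) (at 0)"
      using P[of u] that by (simp add: has_vector_derivative_iff_quotient)
    then show ?thesis using hat by (rule filterlim_compose)
  qed
  show ?thesis unfolding eq using xy by (intro tendsto_diff lim) auto
qed

context smooth_gaussian
begin

section \<open>From the limit to the pathwise derivative and the winding\<close>

sublocale lm: pair_sigma_finite lborel M ..

text \<open>The bound on \<open>E (S t)\<close> is uniform in \<open>t\<close>, so Tonelli's theorem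
  applies on each bounded interval; one null set then serves all of them.\<close>

lemma AE_integral_S: "AE \<omega> in M. \<forall>N::nat. (\<integral>\<^sup>+t. S t \<omega> * indicator {- real N..real N} t \<partial>lborel) < \<infinity>"
  unfolding AE_all_countable
proof
  fix N :: nat
  have "(\<integral>\<^sup>+\<omega>. \<integral>\<^sup>+t. S t \<omega> * indicator {- real N..real N} t \<partial>lborel \<partial>M) = (\<integral>\<^sup>+t. \<integral>\<^sup>+\<omega>. S t \<omega> * indicator {- real N..real N} t \<partial>M \<partial>lborel)"
    by (rule lm.Fubini') measurable
  also have "\<dots> = (\<integral>\<^sup>+t. (\<integral>\<^sup>+\<omega>. S t \<omega> \<partial>M) * indicator {- real N..real N} t \<partial>lborel)"
    by (simp add: nn_integral_multc)
  also have "\<dots> \<le> (\<integral>\<^sup>+t. 10 * indicator {- real N..real N} t \<partial>lborel)"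
    by (intro nn_integral_mono mult_right_mono nn_S) auto
  also have "\<dots> < \<infinity>" by (simp add: nn_integral_cmult ennreal_mult_less_top)
  finally have "AE \<omega> in M. (\<integral>\<^sup>+t. S t \<omega> * indicator {- real N..real N} t \<partial>lborel) \<noteq> \<infinity>"
    by (intro nn_integral_PInf_AE) auto
  then show "AE \<omega> in M. (\<integral>\<^sup>+t. S t \<omega> * indicator {- real N..real N} t \<partial>lborel) < \<infinity>"
    by (simp add: less_top)
qed

text \<open>Dominated convergence in time with majorant \<open>|D 0| + S\<close>. It shows that
  almost every path is absolutely continuous with density \<open>G\<close>; that \<open>G\<close> is
  the derivative at given points is left to the oscillation criterion.\<close>

lemma path_FTC:
  assumes \<omega>: "\<omega> \<in> space M" and fin: "\<And>N::nat. (\<integral>\<^sup>+t. S t \<omega> * indicator {- real N..real N} t \<partial>lborel) < \<infinity>"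
    and xy: "x \<le> y"
  shows "set_integrable lborel {x..y} (\<lambda>t. G t \<omega>)" "(LINT t:{x..y}|lborel. G t \<omega>) = F y \<omega> - F x \<omega>"
proof -
  have [measurable]: "(\<lambda>t. S t \<omega>) \<in> borel_measurable borel" "(\<lambda>t. G t \<omega>) \<in> borel_measurable borel" "(\<lambda>t. D k t \<omega>) \<in> borel_measurable borel" for k
    using \<omega> by measurable
  obtain N where N: "\<bar>x\<bar> \<le> real N" "\<bar>y\<bar> \<le> real N"
    using real_arch_simple[of "max \<bar>x\<bar> \<bar>y\<bar>"] by auto
  have "(\<integral>\<^sup>+t. S t \<omega> * indicator {x..y} t \<partial>lborel) \<le> (\<integral>\<^sup>+t. S t \<omega> * indicator {- real N..real N} t \<partial>lborel)"
    using N by (intro nn_integral_mono mult_left_mono) (auto simp: indicator_def)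
  also have "\<dots> < \<infinity>" by (rule fin)
  finally have finxy: "(\<integral>\<^sup>+t. S t \<omega> * indicator {x..y} t \<partial>lborel) < \<infinity>" .
  then have "AE t in lborel. S t \<omega> * indicator {x..y} t \<noteq> \<infinity>"
    by (intro nn_integral_PInf_AE) auto
  then have AES: "AE t in lborel. t \<in> {x..y} \<longrightarrow> S t \<omega> < \<infinity>"
    by eventually_elim (auto simp: indicator_def less_top)
  have iS: "integrable lborel (\<lambda>t. indicator {x..y} t *\<^sub>R enn2real (S t \<omega>))"
  proof (rule integrableI_nonneg)
    have "(\<integral>\<^sup>+t. ennreal (indicator {x..y} t *\<^sub>R enn2real (S t \<omega>)) \<partial>lborel) \<le> (\<integral>\<^sup>+t. S t \<omega> * indicator {x..y} t \<partial>lborel)"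
      by (intro nn_integral_mono) (auto simp: indicator_def ennreal_enn2real_if)
    then show "(\<integral>\<^sup>+t. ennreal (indicator {x..y} t *\<^sub>R enn2real (S t \<omega>)) \<partial>lborel) < \<infinity>" using finxy by (rule le_less_trans)
  qed auto
  have Dc: "continuous_on UNIV (\<lambda>t. D 0 t \<omega>)"
    unfolding D_def using hs(1)[of 0] by (intro continuous_intros paths continuous_on_compose2[OF paths]) auto
  have iD: "integrable lborel (\<lambda>t. indicator {x..y} t *\<^sub>R cmod (D 0 t \<omega>))"
    using borel_integrable_atLeastAtMost'[of x y "\<lambda>t. cmod (D 0 t \<omega>)"] continuous_on_norm[OF continuous_on_subset[OF Dc]]
    by (simp add: set_integrable_def)
  have w: "integrable lborel (\<lambda>t. indicator {x..y} t *\<^sub>R cmod (D 0 t \<omega>) + indicator {x..y} t *\<^sub>R enn2real (S t \<omega>))"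
    using iD iS by (rule Bochner_Integration.integrable_add)
  have lim: "AE t in lborel. (\<lambda>k. indicator {x..y} t *\<^sub>R D k t \<omega>) \<longlonglongrightarrow> indicator {x..y} t *\<^sub>R G t \<omega>"
    using AES by eventually_elim (auto simp: indicator_def intro: G_lim)
  have bd: "AE t in lborel. norm (indicator {x..y} t *\<^sub>R D k t \<omega>) \<le> indicator {x..y} t *\<^sub>R cmod (D 0 t \<omega>) + indicator {x..y} t *\<^sub>R enn2real (S t \<omega>)" for k
    using AES by eventually_elim (auto simp: indicator_def intro: G_lim)
  have mG: "(\<lambda>t. indicator {x..y} t *\<^sub>R G t \<omega>) \<in> borel_measurable lborel"
    and mD: "\<And>k. (\<lambda>t. indicator {x..y} t *\<^sub>R D k t \<omega>) \<in> borel_measurable lborel" by measurable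
  show "set_integrable lborel {x..y} (\<lambda>t. G t \<omega>)"
    unfolding set_integrable_def by (rule integrable_dominated_convergence[OF mG mD w lim bd])
  have "(\<lambda>k. LINT t:{x..y}|lborel. D k t \<omega>) \<longlonglongrightarrow> (LINT t:{x..y}|lborel. G t \<omega>)"
    unfolding set_lebesgue_integral_def by (rule integral_dominated_convergence[OF mG mD w lim bd])
  moreover have "(\<lambda>k. LINT t:{x..y}|lborel. D k t \<omega>) \<longlonglongrightarrow> F y \<omega> - F x \<omega>"
    unfolding D_def by (rule set_integral_difference_quotient[OF paths xy hs(1,2,3)])
  ultimately show "(LINT t:{x..y}|lborel. G t \<omega>) = F y \<omega> - F x \<omega>" by (rule LIMSEQ_unique)
qed

text \<open>For each quotient the symbol of the increment is \<open>dsym\<close> times a phase times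
  \<open>exp (- i s l) - 1\<close>, bounded by \<open>|l|\<close> and by both \<open>2\<close> and
  \<open>|s l|\<close> respectively. Fatou's lemma passes the bound to \<open>G\<close>.\<close>

lemma nn_G_increment:
  "(\<integral>\<^sup>+\<omega>. ennreal ((cmod (G (t + s) \<omega> - G t \<omega>))\<^sup>2) \<partial>M) \<le> (\<integral>\<^sup>+l. ennreal (l\<^sup>2 * min 4 ((s * l)\<^sup>2)) \<partial>\<rho>)"
proof -
  define a where "a k \<omega> = ennreal ((cmod (D k (t + s) \<omega> - D k t \<omega>))\<^sup>2)" for k \<omega>
  have [measurable]: "a k \<in> borel_measurable M" for k unfolding a_def by measurable
  have "AE \<omega> in M. ennreal ((cmod (G (t + s) \<omega> - G t \<omega>))\<^sup>2) = liminf (\<lambda>k. a k \<omega>)"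
    using AE_G_lim[of t] AE_G_lim[of "t + s"]
  proof eventually_elim
    case (elim \<omega>)
    have "(\<lambda>k. a k \<omega>) \<longlonglongrightarrow> ennreal ((cmod (G (t + s) \<omega> - G t \<omega>))\<^sup>2)"
      unfolding a_def by (intro tendsto_ennrealI tendsto_intros elim)
    then show ?case by (simp add: lim_imp_Liminf)
  qed
  then have "(\<integral>\<^sup>+\<omega>. ennreal ((cmod (G (t + s) \<omega> - G t \<omega>))\<^sup>2) \<partial>M) = (\<integral>\<^sup>+\<omega>. liminf (\<lambda>k. a k \<omega>) \<partial>M)"
    by (rule nn_integral_cong_AE)
  also have "\<dots> \<le> liminf (\<lambda>k. \<integral>\<^sup>+\<omega>. a k \<omega> \<partial>M)" by (rule nn_integral_liminf) measurable
  also have "\<dots> \<le> limsup (\<lambda>k. \<integral>\<^sup>+\<omega>. a k \<omega> \<partial>M)" by (rule Liminf_le_Limsup) simp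
  also have "\<dots> \<le> (\<integral>\<^sup>+l. ennreal (l\<^sup>2 * min 4 ((s * l)\<^sup>2)) \<partial>\<rho>)"
  proof (rule Limsup_bounded, rule always_eventually, rule allI)
    fix k
    define ps where "ps = diffq (hs k) (t + s) @ scale_comb (- 1) (diffq (hs k) t)"
    have sy: "symbol ps l = dsym (hs k) l * (iexp (- (t * l)) * (iexp (- (s * l)) - 1))" for l
    proof -
      have "iexp (- ((t + s) * l)) = iexp (- (t * l)) * iexp (- (s * l))" by (simp add: mult_exp_exp algebra_simps)
      then show ?thesis by (simp add: ps_def symbol_diffq algebra_simps)
    qed
    have "(cmod (symbol ps l))\<^sup>2 \<le> l\<^sup>2 * min 4 ((s * l)\<^sup>2)" for l
    proof -
      have "cmod (iexp (- (s * l)) - 1) \<le> \<bar>s * l\<bar>" using iexp_approx1[of "- (s * l)" 0] by simp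
      then have 1: "(cmod (iexp (- (s * l)) - 1))\<^sup>2 \<le> (s * l)\<^sup>2" by (metis norm_ge_zero power2_abs power_mono)
      have "cmod (iexp (- (s * l)) - 1) \<le> cmod (iexp (- (s * l))) + cmod 1" by (rule norm_triangle_ineq4)
      then have "cmod (iexp (- (s * l)) - 1) \<le> 2" by simp
      then have "(cmod (iexp (- (s * l)) - 1))\<^sup>2 \<le> 2\<^sup>2" by (intro power_mono) auto
      with 1 have "(cmod (iexp (- (s * l)) - 1))\<^sup>2 \<le> min 4 ((s * l)\<^sup>2)" by simp
      moreover have "(cmod (dsym (hs k) l))\<^sup>2 \<le> l\<^sup>2" using norm_dsym_le[of "hs k" l] by (metis norm_ge_zero power2_abs power_mono)
      ultimately show ?thesis
        unfolding sy norm_mult power_mult_distrib by (simp add: mult_mono)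
    qed
    then have "(\<integral>\<^sup>+l. ennreal ((cmod (symbol ps l))\<^sup>2) \<partial>\<rho>) \<le> (\<integral>\<^sup>+l. ennreal (l\<^sup>2 * min 4 ((s * l)\<^sup>2)) \<partial>\<rho>)"
      by (intro nn_integral_mono ennreal_leI)
    moreover have "(\<integral>\<^sup>+\<omega>. a k \<omega> \<partial>M) = (\<integral>\<^sup>+l. ennreal ((cmod (symbol ps l))\<^sup>2) \<partial>\<rho>)"
      unfolding nn_lin_comb_second_moment[symmetric] a_def by (simp add: ps_def D_eq)
    ultimately show "(\<integral>\<^sup>+\<omega>. a k \<omega> \<partial>M) \<le> (\<integral>\<^sup>+l. ennreal (l\<^sup>2 * min 4 ((s * l)\<^sup>2)) \<partial>\<rho>)" by simp
  qed
  finally show ?thesis .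
qed

definition osc :: "real \<Rightarrow> 'a \<Rightarrow> ennreal" where
  "osc t \<omega> = (\<integral>\<^sup>+s. ennreal ((cmod (G (t + s) \<omega> - G t \<omega>))\<^sup>2 / \<bar>s\<bar>) * indicator {-1..1} s \<partial>lborel)"

lemma osc_joint [measurable (raw)]:
  assumes [measurable]: "f \<in> borel_measurable N" "g \<in> measurable N M"
  shows "(\<lambda>x. osc (f x) (g x)) \<in> borel_measurable N"
  unfolding osc_def by measurable

text \<open>Tonelli's theorem moves the expectation inside, then the spectral integral outside,
  where the weight \<open>1 / |s|\<close> is integrated for each frequency separately.\<close>

lemma nn_osc: "(\<integral>\<^sup>+\<omega>. osc t \<omega> \<partial>M) < \<infinity>"
proof -
  interpret lr: pair_sigma_finite lborel \<rho> ..
  have "(\<integral>\<^sup>+\<omega>. osc t \<omega> \<partial>M) = (\<integral>\<^sup>+s. \<integral>\<^sup>+\<omega>. ennreal ((cmod (G (t + s) \<omega> - G t \<omega>))\<^sup>2 / \<bar>s\<bar>) * indicator {-1..1} s \<partial>M \<partial>lborel)"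
    unfolding osc_def by (rule lm.Fubini') measurable
  also have "\<dots> = (\<integral>\<^sup>+s. (\<integral>\<^sup>+\<omega>. ennreal ((cmod (G (t + s) \<omega> - G t \<omega>))\<^sup>2) \<partial>M) * (ennreal (1 / \<bar>s\<bar>) * indicator {-1..1} s) \<partial>lborel)"
  proof (intro nn_integral_cong)
    fix s :: real
    have "ennreal ((cmod (G (t + s) \<omega> - G t \<omega>))\<^sup>2 / \<bar>s\<bar>) * indicator {-1..1} s = ennreal ((cmod (G (t + s) \<omega> - G t \<omega>))\<^sup>2) * (ennreal (1 / \<bar>s\<bar>) * indicator {-1..1} s)" for \<omega>
      by (simp add: mult.assoc[symmetric] ennreal_mult[symmetric])
    then show "(\<integral>\<^sup>+\<omega>. ennreal ((cmod (G (t + s) \<omega> - G t \<omega>))\<^sup>2 / \<bar>s\<bar>) * indicator {-1..1} s \<partial>M) = (\<integral>\<^sup>+\<omega>. ennreal ((cmod (G (t + s) \<omega> - G t \<omega>))\<^sup>2) \<partial>M) * (ennreal (1 / \<bar>s\<bar>) * indicator {-1..1} s)"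
      by (simp add: nn_integral_multc)
  qed
  also have "\<dots> \<le> (\<integral>\<^sup>+s. (\<integral>\<^sup>+l. ennreal (l\<^sup>2 * min 4 ((s * l)\<^sup>2)) \<partial>\<rho>) * (ennreal (1 / \<bar>s\<bar>) * indicator {-1..1} s) \<partial>lborel)"
    by (intro nn_integral_mono mult_right_mono nn_G_increment) auto
  also have "\<dots> = (\<integral>\<^sup>+s. \<integral>\<^sup>+l. ennreal (l\<^sup>2) * (ennreal (min 4 ((s * l)\<^sup>2) / \<bar>s\<bar>) * indicator {-1..1} s) \<partial>\<rho> \<partial>lborel)"
  proof (intro nn_integral_cong)
    fix s :: real
    have "ennreal (l\<^sup>2) * (ennreal (min 4 ((s * l)\<^sup>2) / \<bar>s\<bar>) * indicator {-1..1} s) = ennreal (l\<^sup>2 * min 4 ((s * l)\<^sup>2)) * (ennreal (1 / \<bar>s\<bar>) * indicator {-1..1} s)" for l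
      by (simp add: mult.assoc[symmetric] ennreal_mult[symmetric])
    then show "(\<integral>\<^sup>+l. ennreal (l\<^sup>2 * min 4 ((s * l)\<^sup>2)) \<partial>\<rho>) * (ennreal (1 / \<bar>s\<bar>) * indicator {-1..1} s) = (\<integral>\<^sup>+l. ennreal (l\<^sup>2) * (ennreal (min 4 ((s * l)\<^sup>2) / \<bar>s\<bar>) * indicator {-1..1} s) \<partial>\<rho>)"
      by (simp add: nn_integral_multc)
  qed
  also have "\<dots> = (\<integral>\<^sup>+l. \<integral>\<^sup>+s. ennreal (l\<^sup>2) * (ennreal (min 4 ((s * l)\<^sup>2) / \<bar>s\<bar>) * indicator {-1..1} s) \<partial>lborel \<partial>\<rho>)"
    by (rule lr.Fubini'[symmetric]) measurable
  also have "\<dots> = (\<integral>\<^sup>+l. ennreal (l\<^sup>2) * (\<integral>\<^sup>+s. (ennreal (min 4 ((s * l)\<^sup>2) / \<bar>s\<bar>) * indicator {-1..1} s) \<partial>lborel) \<partial>\<rho>)"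
    by (intro nn_integral_cong nn_integral_cmult) measurable
  also have "\<dots> \<le> (\<integral>\<^sup>+l. ennreal (l\<^sup>2) * ennreal (2 + 8 * ln (1 + \<bar>l\<bar>)) \<partial>\<rho>)"
    by (intro nn_integral_mono mult_left_mono nn_integral_log_weight) auto
  also have "\<dots> = (\<integral>\<^sup>+l. ennreal (2 * l\<^sup>2 + 8 * (l\<^sup>2 * ln (1 + \<bar>l\<bar>))) \<partial>\<rho>)"
    by (intro nn_integral_cong, subst ennreal_mult[symmetric]) (auto simp: distrib_left mult.commute mult.left_commute)
  also have "\<dots> < \<infinity>"
    using moment2 moment_log by (subst nn_integral_eq_integral) auto
  finally show ?thesis .
qed

lemma AE_osc: "AE \<omega> in M. AE t in lborel. osc t \<omega> < \<infinity>"
proof -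
  have "AE \<omega> in M. osc t \<omega> < \<infinity>" for t
  proof -
    have "AE \<omega> in M. osc t \<omega> \<noteq> \<infinity>" using nn_osc[of t] by (intro nn_integral_PInf_AE) auto
    then show ?thesis by (simp add: less_top)
  qed
  then have "AE t in lborel. AE \<omega> in M. osc t \<omega> < \<infinity>" by simp
  then show ?thesis by (subst (asm) lm.AE_commute) measurable
qed

text \<open>Differentiability at almost every time is enough, because \<open>winding\<close> meets
  the derivative only under a time integral. It also lets the exceptional sets for fixed
  \<open>t\<close> be exchanged by Fubini's theorem.\<close>

lemma AE_vector_derivative: "AE \<omega> in M. AE t in lborel. vector_derivative (\<lambda>t. F t \<omega>) (at t) = G t \<omega>"
  using AE_integral_S AE_osc AE_space
proof eventually_elim
  case (elim \<omega>)
  have [measurable]: "(\<lambda>t. G t \<omega>) \<in> borel_measurable borel" using elim(3) by measurable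
  from elim(2) show ?case
  proof eventually_elim
    case (elim t)
    have "((\<lambda>t. F t \<omega>) has_vector_derivative G t \<omega>) (at t)"
      by (rule has_vector_derivative_of_oscillation[where a="t - 1" and b="t + 1"])
        (use path_FTC[of \<omega>] \<open>\<omega> \<in> space M\<close> \<open>\<forall>N::nat. _\<close> elim in \<open>auto simp: osc_def\<close>)
    then show ?case by (rule vector_derivative_at)
  qed
qed

lemma AE_winding: "AE \<omega> in M. winding (\<lambda>t. F t \<omega>) T = (LINT t:{0..T}|lborel. Im (G t \<omega> / F t \<omega>))"
  using AE_vector_derivative AE_space
proof eventually_elim
  case (elim \<omega>)
  have [measurable]: "(\<lambda>t. G t \<omega>) \<in> borel_measurable borel" "(\<lambda>t. F t \<omega>) \<in> borel_measurable borel" using elim(2) by measurable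
  have [measurable]: "(\<lambda>t. vector_derivative (\<lambda>t. F t \<omega>) (at t)) \<in> borel_measurable borel"
    by (rule borel_measurable_vector_derivative[OF paths])
  have "(CLBINT t:{0..T}. vector_derivative (\<lambda>t. F t \<omega>) (at t) / F t \<omega> - cnj (vector_derivative (\<lambda>t. F t \<omega>) (at t) / F t \<omega>))
     = (CLBINT t. (2 * \<i>) * of_real (indicator {0..T} t * Im (G t \<omega> / F t \<omega>)))"
    unfolding set_lebesgue_integral_def
  proof (rule integral_cong_AE)
    show "AE t in lborel. indicat_real {0..T} t *\<^sub>R (vector_derivative (\<lambda>t. F t \<omega>) (at t) / F t \<omega> - cnj (vector_derivative (\<lambda>t. F t \<omega>) (at t) / F t \<omega>)) =
         2 * \<i> * complex_of_real (indicator {0..T} t * Im (G t \<omega> / F t \<omega>))"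
      using elim(1)
    proof eventually_elim
      case (elim t)
      show ?case unfolding elim complex_diff_cnj by (simp add: indicator_def)
    qed
  qed measurable
  also have "\<dots> = (2 * \<i>) * of_real (LINT t:{0..T}|lborel. Im (G t \<omega> / F t \<omega>))"
    unfolding set_lebesgue_integral_def integral_mult_right_zero integral_complex_of_real by simp
  finally show ?case unfolding winding_def by simp
qed

end

subsection \<open>Integrability tools\<close>

text \<open>Convergence of means by uniform integrability with respect to the finite measure of
  density \<open>y\<close>. The singular factor of a quotient goes into \<open>y\<close>, which only
  has to be integrable, while the remaining factor is controlled through its square.\<close>

lemma weighted_Vitali:
  fixes y :: "'a \<Rightarrow> real" and w :: "nat \<Rightarrow> 'a \<Rightarrow> real"
  assumes y: "integrable M y" "\<And>x. 0 \<le> y x"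
    and wm [measurable]: "\<And>k. w k \<in> borel_measurable M" "v \<in> borel_measurable M"
    and lim: "AE x in M. (\<lambda>k. w k x) \<longlonglongrightarrow> v x"
    and bd: "\<And>k. (\<integral>\<^sup>+x. ennreal (y x * (w k x)\<^sup>2) \<partial>M) \<le> ennreal C" and C: "0 \<le> C"
  shows "(\<integral>\<^sup>+x. ennreal (y x * (v x)\<^sup>2) \<partial>M) \<le> ennreal C"
    and "(\<integral>\<^sup>+x. ennreal (y x * \<bar>v x\<bar>) \<partial>M) \<le> ennreal ((\<integral>x. y x \<partial>M) + C)"
    and "(\<lambda>k. \<integral>x. y x * w k x \<partial>M) \<longlonglongrightarrow> (\<integral>x. y x * v x \<partial>M)"
proof -
  have [measurable]: "y \<in> borel_measurable M" using y by auto
  have "AE x in M. ennreal (y x * (v x)\<^sup>2) = liminf (\<lambda>k. ennreal (y x * (w k x)\<^sup>2))"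
    using lim
  proof eventually_elim
    case (elim x)
    have "(\<lambda>k. ennreal (y x * (w k x)\<^sup>2)) \<longlonglongrightarrow> ennreal (y x * (v x)\<^sup>2)"
      by (intro tendsto_ennrealI tendsto_intros elim)
    then show ?case by (simp add: lim_imp_Liminf)
  qed
  then have "(\<integral>\<^sup>+x. ennreal (y x * (v x)\<^sup>2) \<partial>M) = (\<integral>\<^sup>+x. liminf (\<lambda>k. ennreal (y x * (w k x)\<^sup>2)) \<partial>M)"
    by (rule nn_integral_cong_AE)
  also have "\<dots> \<le> liminf (\<lambda>k. \<integral>\<^sup>+x. ennreal (y x * (w k x)\<^sup>2) \<partial>M)" by (rule nn_integral_liminf) measurable
  also have "\<dots> \<le> limsup (\<lambda>k. \<integral>\<^sup>+x. ennreal (y x * (w k x)\<^sup>2) \<partial>M)" by (rule Liminf_le_Limsup) simp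
  also have "\<dots> \<le> ennreal C" by (rule Limsup_bounded) (intro always_eventually allI bd)
  finally show v2: "(\<integral>\<^sup>+x. ennreal (y x * (v x)\<^sup>2) \<partial>M) \<le> ennreal C" .
  have le1: "\<bar>z\<bar> \<le> 1 + z\<^sup>2" for z :: real
    using sum_squares_bound[of "\<bar>z\<bar>" 1] abs_ge_zero[of z] unfolding power2_abs one_power2 by linarith
  have nn1: "(\<integral>\<^sup>+x. ennreal (y x * \<bar>u x\<bar>) \<partial>M) \<le> ennreal ((\<integral>x. y x \<partial>M) + C)"
    if [measurable]: "u \<in> borel_measurable M" and u: "(\<integral>\<^sup>+x. ennreal (y x * (u x)\<^sup>2) \<partial>M) \<le> ennreal C" for u
  proof -
    have "(\<integral>\<^sup>+x. ennreal (y x * \<bar>u x\<bar>) \<partial>M) \<le> (\<integral>\<^sup>+x. ennreal (y x) + ennreal (y x * (u x)\<^sup>2) \<partial>M)"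
    proof (rule nn_integral_mono)
      fix x
      have "y x * \<bar>u x\<bar> \<le> y x * (1 + (u x)\<^sup>2)" by (intro mult_left_mono le1 y)
      then have "ennreal (y x * \<bar>u x\<bar>) \<le> ennreal (y x + y x * (u x)\<^sup>2)" by (intro ennreal_leI) (simp add: algebra_simps)
      then show "ennreal (y x * \<bar>u x\<bar>) \<le> ennreal (y x) + ennreal (y x * (u x)\<^sup>2)" using y by simp
    qed
    also have "\<dots> = (\<integral>\<^sup>+x. ennreal (y x) \<partial>M) + (\<integral>\<^sup>+x. ennreal (y x * (u x)\<^sup>2) \<partial>M)"
      by (rule nn_integral_add) measurable
    also have "\<dots> \<le> ennreal (\<integral>x. y x \<partial>M) + ennreal C"
      using u y by (intro add_mono) (auto simp: nn_integral_eq_integral)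
    also have "\<dots> = ennreal ((\<integral>x. y x \<partial>M) + C)" using y C by (simp add: integral_nonneg_AE)
    finally show ?thesis .
  qed
  show "(\<integral>\<^sup>+x. ennreal (y x * \<bar>v x\<bar>) \<partial>M) \<le> ennreal ((\<integral>x. y x \<partial>M) + C)" by (rule nn1[OF _ v2]) simp
  \<comment> \<open>Truncation at height \<open>R\<close>: the truncated means converge by dominated
    convergence, and the error is at most \<open>C / R\<close> uniformly in \<open>k\<close>, since
    \<open>|z - clip R z| \<le> z^2 / R\<close>.\<close>
  define clip where "clip R z = max (- R) (min R z)" for R z :: real
  have clip_bd: "\<bar>clip R z\<bar> \<le> R" if "0 < R" for R z using that by (auto simp: clip_def)
  have clip_y: "\<bar>y x * clip R z\<bar> \<le> R * y x" if "0 < R" for R z x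
  proof -
    have "y x * \<bar>clip R z\<bar> \<le> y x * R" by (intro mult_left_mono clip_bd y that)
    then show ?thesis by (simp add: abs_mult y mult.commute)
  qed
  have clip_diff: "\<bar>z - clip R z\<bar> \<le> z\<^sup>2 / R" if "0 < R" for R z
  proof (cases "\<bar>z\<bar> \<le> R")
    case True then show ?thesis using that by (auto simp: clip_def)
  next
    case False
    then have "\<bar>z - clip R z\<bar> \<le> \<bar>z\<bar>" using that by (auto simp: clip_def)
    also have "\<dots> \<le> z\<^sup>2 / R"
    proof -
      have "\<bar>z\<bar> * R \<le> \<bar>z\<bar> * \<bar>z\<bar>" using False by (intro mult_left_mono) auto
      then show ?thesis using that by (simp add: field_simps power2_eq_square)
    qed
    finally show ?thesis .
  qed
  have int: "integrable M (\<lambda>x. y x * u x)"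
    if [measurable]: "u \<in> borel_measurable M" and u: "(\<integral>\<^sup>+x. ennreal (y x * (u x)\<^sup>2) \<partial>M) \<le> ennreal C" for u
    using nn1[OF that] by (intro integrableI_bounded) (auto simp: abs_mult y intro: le_less_trans)
  have ic: "integrable M (\<lambda>x. y x * clip R (u x))" if "0 < R" and [measurable]: "u \<in> borel_measurable M" for R u
  proof (rule Bochner_Integration.integrable_bound)
    show "integrable M (\<lambda>x. R * y x)" using y by simp
    show "(\<lambda>x. y x * clip R (u x)) \<in> borel_measurable M" unfolding clip_def by measurable
    show "AE x in M. norm (y x * clip R (u x)) \<le> norm (R * y x)"
      using order_trans[OF clip_y[OF that(1)] abs_ge_self] by (intro AE_I2) (simp only: real_norm_def)
  qed
  have tail: "\<bar>(\<integral>x. y x * u x \<partial>M) - (\<integral>x. y x * clip R (u x) \<partial>M)\<bar> \<le> C / R"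
    if R: "0 < R" and um [measurable]: "u \<in> borel_measurable M" and u: "(\<integral>\<^sup>+x. ennreal (y x * (u x)\<^sup>2) \<partial>M) \<le> ennreal C" for u R
  proof -
    have "integrable M (\<lambda>x. y x * (u x)\<^sup>2)"
      using u by (intro integrableI_nonneg) (auto simp: y intro: le_less_trans)
    then have i2: "integrable M (\<lambda>x. y x * (u x)\<^sup>2)" and le: "(\<integral>x. y x * (u x)\<^sup>2 \<partial>M) \<le> C"
      using u C by (auto simp: nn_integral_eq_integral y)
    have "(\<integral>x. y x * u x \<partial>M) - (\<integral>x. y x * clip R (u x) \<partial>M) = (\<integral>x. y x * (u x - clip R (u x)) \<partial>M)"
      using int[OF um u] ic[OF R um] by (simp add: right_diff_distrib)
    also have "\<bar>\<dots>\<bar> \<le> (\<integral>x. \<bar>y x * (u x - clip R (u x))\<bar> \<partial>M)" by (rule integral_abs_bound)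
    also have "\<dots> \<le> (\<integral>x. y x * (u x)\<^sup>2 / R \<partial>M)"
    proof (rule integral_mono_AE)
      show "integrable M (\<lambda>x. \<bar>y x * (u x - clip R (u x))\<bar>)"
        using int[OF um u] ic[OF R um] by (simp add: right_diff_distrib)
      show "integrable M (\<lambda>x. y x * (u x)\<^sup>2 / R)" using i2 by simp
      show "AE x in M. \<bar>y x * (u x - clip R (u x))\<bar> \<le> y x * (u x)\<^sup>2 / R"
        using mult_left_mono[OF clip_diff[OF R] y(2)] by (intro AE_I2) (simp add: abs_mult y)
    qed
    also have "\<dots> = (\<integral>x. y x * (u x)\<^sup>2 \<partial>M) / R" by simp
    also have "\<dots> \<le> C / R" using le R by (intro divide_right_mono) auto
    finally show ?thesis .
  qed
  show "(\<lambda>k. \<integral>x. y x * w k x \<partial>M) \<longlonglongrightarrow> (\<integral>x. y x * v x \<partial>M)"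
  proof (rule LIMSEQ_I)
    fix e :: real assume e: "0 < e"
    \<comment> \<open>Each of the two truncation errors is at most \<open>e / 4\<close>, leaving
      room for the error \<open>e / 4\<close> of the truncated means; \<open>C + 1\<close> keeps
      \<open>R\<close> positive when \<open>C = 0\<close>.\<close>
    define R where "R = 4 * (C + 1) / e"
    have R: "0 < R" using e C by (simp add: R_def)
    have CR: "C / R \<le> e / 4"
    proof -
      have "C / R = (C / (C + 1)) * (e / 4)" using C e by (simp add: R_def)
      also have "\<dots> \<le> 1 * (e / 4)" using C e by (intro mult_right_mono) (auto simp: divide_le_eq)
      finally show ?thesis by simp
    qed
    have "(\<lambda>k. \<integral>x. y x * clip R (w k x) \<partial>M) \<longlonglongrightarrow> (\<integral>x. y x * clip R (v x) \<partial>M)"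
    proof (rule integral_dominated_convergence[where w="\<lambda>x. R * y x"])
      show "(\<lambda>x. y x * clip R (v x)) \<in> borel_measurable M" unfolding clip_def by measurable
      show "(\<lambda>x. y x * clip R (w k x)) \<in> borel_measurable M" for k unfolding clip_def by measurable
      show "integrable M (\<lambda>x. R * y x)" using y by simp
      show "AE x in M. (\<lambda>k. y x * clip R (w k x)) \<longlonglongrightarrow> y x * clip R (v x)"
        using lim by eventually_elim (auto simp: clip_def intro!: tendsto_intros)
      show "AE x in M. norm (y x * clip R (w k x)) \<le> R * y x" for k
        using clip_y[OF R] by (intro AE_I2) (simp only: real_norm_def)
    qed
    from LIMSEQ_D[OF this, of "e / 4"] e
    obtain N where N: "\<forall>k\<ge>N. \<bar>(\<integral>x. y x * clip R (w k x) \<partial>M) - (\<integral>x. y x * clip R (v x) \<partial>M)\<bar> < e / 4"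
      unfolding real_norm_def by (meson zero_less_divide_iff zero_less_numeral)
    show "\<exists>no. \<forall>k\<ge>no. norm ((\<integral>x. y x * w k x \<partial>M) - (\<integral>x. y x * v x \<partial>M)) < e"
    proof (intro exI[of _ N] allI impI)
      fix k assume "N \<le> k"
      from N[rule_format, OF this] tail[OF R wm(1) bd, of k] tail[OF R wm(2) v2] CR e
      show "norm ((\<integral>x. y x * w k x \<partial>M) - (\<integral>x. y x * v x \<partial>M)) < e" unfolding real_norm_def by linarith
    qed
  qed
qed

text \<open>The smaller of \<open>\<bar>x\<bar>\<close> and \<open>\<bar>y\<bar>\<close> carries the exponent \<open>16/9 < 2\<close>, the larger one is replaced by \<open>\<bar>w\<bar>\<close> with
  exponent \<open>8/9 < 1\<close>, which is integrable in time across the diagonal.\<close>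

lemma inverse_product_bound:
  fixes x y w w' :: complex
  assumes w: "cmod w \<le> cmod x + cmod y" "w \<noteq> 0" and w': "cmod w' \<le> cmod x + cmod y" "w' \<noteq> 0"
    and xy: "x \<noteq> 0" "y \<noteq> 0"
  shows "(1 / (cmod x * cmod y)) powr (4/3) \<le>
    2 * (cmod x powr - (16/9) * cmod w powr - (8/9) + cmod y powr - (16/9) * cmod w' powr - (8/9))"
proof -
  have main: "(1 / (a * b)) powr (4/3) \<le> 2 * (a powr - (16/9) * c powr - (8/9))"
    if ab: "0 < a" "a \<le> b" "0 < c" "c \<le> a + b" for a b c :: real
  proof -
    have "(1 / (a * b)) powr (4/3) = a powr - (4/3) * b powr - (4/3)"
      using ab by (simp add: powr_divide powr_mult powr_minus_divide)
    \<comment> \<open>The power \<open>4/9\<close> is moved from the smaller modulus to the larger: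
      \<open>-4/3 = -16/9 + 4/9\<close> and \<open>4/9 - 4/3 = -8/9\<close>. Afterwards
      \<open>c \<le> a + b \<le> 2 * b\<close> replaces \<open>b\<close> by
      \<open>c / 2\<close>.\<close>
    also have "a powr - (4/3) = a powr - (16/9) * a powr (4/9)"
      by (simp add: powr_add[symmetric])
    also have "a powr - (16/9) * a powr (4/9) * b powr - (4/3) \<le> a powr - (16/9) * b powr (4/9) * b powr - (4/3)"
      using ab by (intro mult_right_mono mult_left_mono powr_mono2) auto
    also have "\<dots> = a powr - (16/9) * b powr - (8/9)"
      by (simp add: mult.assoc powr_add[symmetric])
    also have "\<dots> \<le> a powr - (16/9) * (c / 2) powr - (8/9)"
      using ab by (intro mult_left_mono powr_mono2') auto
    also have "(c / 2) powr - (8/9) = 2 powr (8/9) * c powr - (8/9)"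
      using ab by (simp add: powr_divide powr_minus_divide)
    also have "a powr - (16/9) * (2 powr (8/9) * c powr - (8/9)) = 2 powr (8/9) * (a powr - (16/9) * c powr - (8/9))"
      by simp
    also have "\<dots> \<le> 2 powr 1 * (a powr - (16/9) * c powr - (8/9))"
      by (intro mult_right_mono powr_mono) auto
    finally show ?thesis by simp
  qed
  show ?thesis
  proof (cases "cmod x \<le> cmod y")
    case True
    from main[of "cmod x" "cmod y" "cmod w"] True w xy show ?thesis
      by (simp add: distrib_left add_increasing2)
  next
    case False
    from main[of "cmod y" "cmod x" "cmod w'"] False w' xy show ?thesis
      by (simp add: distrib_left add_increasing mult.commute[of "cmod x"] add.commute)
  qed
qed

text \<open>Young's inequality with exponents 4 and 4/3, constants dropped, by comparing
  \<open>b\<close> with \<open>a^6\<close>. It separates positive moments of \<open>U\<close> from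
  the product of inverse moduli, whose power \<open>4/3\<close> is the one treated above.\<close>

lemma mult_le_powr_sum:
  fixes a b :: real
  assumes "0 \<le> a" "0 \<le> b"
  shows "a\<^sup>2 * b \<le> a ^ 8 + b powr (4/3)"
proof (cases "b \<le> a ^ 6")
  case True
  have "a\<^sup>2 * b \<le> a\<^sup>2 * a ^ 6" using True by (intro mult_left_mono) auto
  also have "\<dots> = a ^ 8" by (simp add: power_add[symmetric])
  finally show ?thesis by (simp add: add_increasing2)
next
  case False
  then have b: "0 < b" using assms by (meson le_less_trans not_le zero_le_power)
  have "a\<^sup>2 \<le> b powr (1/3)"
  proof -
    have "(a\<^sup>2) ^ 3 \<le> (b powr (1/3)) ^ 3"
      using False b by (simp add: power_mult[symmetric] powr_realpow[symmetric] powr_powr)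
    then show ?thesis by (rule power_le_imp_le_base[where n=2, unfolded numeral_2_eq_2[symmetric], simplified]) simp
  qed
  then have "a\<^sup>2 * b \<le> b powr (1/3) * b" using b by (intro mult_right_mono) auto
  also have "\<dots> = b powr (1/3) * b powr 1" using b by simp
  also have "\<dots> = b powr (4/3)" by (simp only: powr_add[symmetric]) simp
  finally show ?thesis by (simp add: add_increasing)
qed

text \<open>Young's inequality with exponents 3/2 and 3. The power \<open>3/2\<close> stays below 2,
  so the inverse moment of a Gaussian remains finite.\<close>

lemma mult_le_powr_sum2:
  fixes x v :: real
  assumes "0 \<le> x" "0 \<le> v"
  shows "(1 / x + x) * v \<le> x powr - (3/2) + v ^ 3 + x\<^sup>2 + v\<^sup>2"
proof -
  have "1 / x * v \<le> x powr - (3/2) + v ^ 3"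
  proof (cases "x = 0")
    case True then show ?thesis using assms by simp
  next
    case False
    then have x: "0 < x" using assms by simp
    define y where "y = 1 / x"
    have y: "0 < y" using x by (simp add: y_def)
    have yp: "x powr - (3/2) = y powr (3/2)" using x by (simp add: y_def powr_divide powr_minus_divide)
    have "y * v \<le> y powr (3/2) + v ^ 3"
    proof (cases "v \<le> y powr (1/2)")
      case True
      have "y * v \<le> y powr 1 * y powr (1/2)" using y True by (simp add: mult_left_mono)
      also have "\<dots> = y powr (3/2)" by (simp only: powr_add[symmetric]) simp
      finally show ?thesis using assms by (simp add: add_increasing2)
    next
      case False
      then have "(y powr (1/2))\<^sup>2 \<le> v\<^sup>2" by (intro power_mono) auto
      then have "y \<le> v\<^sup>2" using y by (simp add: power2_eq_square powr_add[symmetric])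
      then have "y * v \<le> v\<^sup>2 * v" using assms by (intro mult_right_mono) auto
      also have "\<dots> = v ^ 3" by (simp add: power2_eq_square power3_eq_cube)
      finally show ?thesis by (simp add: add_increasing)
    qed
    then show ?thesis unfolding yp by (simp add: y_def)
  qed
  moreover have "x * v \<le> x\<^sup>2 + v\<^sup>2" using assms by (rule prod2_le_sum_squares)
  ultimately show ?thesis by (simp add: distrib_right)
qed

subsection \<open>The derivative with its drift removed\<close>

lemma ennreal_add_square_le: "(x + y)\<^sup>2 \<le> 4 * (x\<^sup>2 + y\<^sup>2)" for x y :: ennreal
proof -
  have "x + y \<le> 2 * max x y" unfolding mult_2 by (intro add_mono) auto
  then have "(x + y)\<^sup>2 \<le> (2 * max x y)\<^sup>2" by (intro power_mono) auto
  also have "\<dots> = 4 * (max x y)\<^sup>2" by (simp add: power_mult_distrib)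
  also have "\<dots> \<le> 4 * (x\<^sup>2 + y\<^sup>2)"
    by (intro mult_left_mono) (auto simp: max_def add_increasing add_increasing2)
  finally show ?thesis .
qed

definition spectral_mean :: "real measure \<Rightarrow> real" where "spectral_mean \<rho> = (\<integral>l. l \<partial>\<rho>)"

definition spectral_variance :: "real measure \<Rightarrow> real" where
  "spectral_variance \<rho> = (\<integral>l. (l - spectral_mean \<rho>)\<^sup>2 \<partial>\<rho>)"

context smooth_gaussian
begin

abbreviation mean :: real where "mean \<equiv> spectral_mean \<rho>"

abbreviation spread :: real where "spread \<equiv> spectral_variance \<rho>"

text \<open>The covariance of the difference quotient with \<open>F\<close> at the same time, hence
  its projection coefficient, since \<open>F\<close> has variance one. It tends to
  \<open>- i * mean\<close>.\<close>

definition csym :: "real \<Rightarrow> complex" where "csym h = (CLINT l|\<rho>. dsym h l)"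

text \<open>Subtracting \<open>csym\<close> from the difference quotient makes it orthogonal to \<open>F t\<close> already before the limit.\<close>

definition usym :: "real \<Rightarrow> real \<Rightarrow> complex" where "usym h l = dsym h l - csym h"

text \<open>A square integrable majorant of \<open>usym h\<close>, the same for all
  \<open>h\<close>.\<close>

definition bsym :: "real \<Rightarrow> real" where "bsym l = \<bar>l\<bar> + (\<integral>l. \<bar>l\<bar> \<partial>\<rho>)"

definition uq :: "real \<Rightarrow> real \<Rightarrow> (complex \<times> real) list" where
  "uq h t = diffq h t @ scale_comb (- csym h) [(1, t)]"

definition U :: "real \<Rightarrow> 'a \<Rightarrow> complex" where "U t \<omega> = G t \<omega> + \<i> * of_real mean * F t \<omega>"

abbreviation Uk :: "nat \<Rightarrow> real \<Rightarrow> 'a \<Rightarrow> complex" where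
  "Uk k t \<equiv> lin_comb F (uq (hs k) t)"

lemma borel_measurable_usym [measurable]: "usym h \<in> borel_measurable borel"
  unfolding usym_def by measurable

lemma symbol_uq: "symbol (uq h t) l = iexp (- (t * l)) * usym h l"
  by (simp add: uq_def symbol_diffq usym_def algebra_simps)

lemma Uk_eq: "Uk k t \<omega> = D k t \<omega> - csym (hs k) * F t \<omega>"
  by (simp add: uq_def D_eq)

lemma U_joint [measurable (raw)]:
  assumes [measurable]: "f \<in> borel_measurable N" "g \<in> measurable N M"
  shows "(\<lambda>x. U (f x) (g x)) \<in> borel_measurable N"
  unfolding U_def by measurable

lemma integrable_abs: "integrable \<rho> (\<lambda>l. \<bar>l\<bar>)" "integrable \<rho> (\<lambda>l. l)"
proof -
  have "integrable \<rho> (\<lambda>l. 1 + l\<^sup>2)" using moment2 by simp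
  then show "integrable \<rho> (\<lambda>l. \<bar>l\<bar>)"
  proof (rule Bochner_Integration.integrable_bound)
    have "\<bar>l\<bar> \<le> 1 + l\<^sup>2" for l :: real
      using power_le_one_plus[of "\<bar>l\<bar>" 1 2] by simp
    then show "AE l in \<rho>. norm \<bar>l\<bar> \<le> norm (1 + l\<^sup>2)" by (intro AE_I2) simp
  qed simp
  then show "integrable \<rho> (\<lambda>l. l)" by (simp add: integrable_abs_iff)
qed

lemma integrable_dsym: "integrable \<rho> (dsym h)"
  by (rule Bochner_Integration.integrable_bound[OF integrable_abs(1)]) (auto intro!: AE_I2 norm_dsym_le)

lemma norm_csym_le: "cmod (csym h) \<le> (\<integral>l. \<bar>l\<bar> \<partial>\<rho>)"
proof -
  have "cmod (csym h) \<le> (\<integral>l. cmod (dsym h l) \<partial>\<rho>)" unfolding csym_def by (rule integral_norm_bound)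
  also have "\<dots> \<le> (\<integral>l. \<bar>l\<bar> \<partial>\<rho>)"
    by (intro integral_mono integrable_norm integrable_dsym integrable_abs norm_dsym_le)
  finally show ?thesis .
qed

lemma norm_usym_le: "cmod (usym h l) \<le> bsym l"
  unfolding usym_def bsym_def
  by (rule order_trans[OF norm_triangle_ineq4]) (intro add_mono norm_dsym_le norm_csym_le)

lemma integrable_bsym: "integrable \<rho> bsym" "integrable \<rho> (\<lambda>l. (bsym l)\<^sup>2)"
proof -
  show "integrable \<rho> bsym" unfolding bsym_def using integrable_abs by simp
  have "(bsym l)\<^sup>2 = l\<^sup>2 + 2 * (\<integral>l. \<bar>l\<bar> \<partial>\<rho>) * \<bar>l\<bar> + (\<integral>l. \<bar>l\<bar> \<partial>\<rho>)\<^sup>2" for l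
    by (simp add: bsym_def power2_sum)
  then show "integrable \<rho> (\<lambda>l. (bsym l)\<^sup>2)" using moment2 integrable_abs by simp
qed

lemma integral_usym: "integrable \<rho> (usym h)" "(CLINT l|\<rho>. usym h l) = 0"
  using integrable_dsym[of h] rho.prob_space by (simp_all add: usym_def[abs_def] csym_def)

lemma usym_tendsto:
  assumes "h \<longlonglongrightarrow> 0" "\<And>k. h k \<noteq> 0"
  shows "(\<lambda>k. csym (h k)) \<longlonglongrightarrow> - \<i> * of_real mean" "(\<lambda>k. usym (h k) l) \<longlonglongrightarrow> - \<i> * of_real (l - mean)"
proof -
  have "(\<lambda>k. csym (h k)) \<longlonglongrightarrow> (CLINT l|\<rho>. - \<i> * of_real l)"
    unfolding csym_def
  proof (rule integral_dominated_convergence[OF _ _ integrable_abs(1)])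
    show "AE l in \<rho>. (\<lambda>k. dsym (h k) l) \<longlonglongrightarrow> - \<i> * of_real l" by (intro AE_I2 dsym_tendsto assms)
    show "AE l in \<rho>. norm (dsym (h k) l) \<le> \<bar>l\<bar>" for k by (intro AE_I2 norm_dsym_le)
  qed auto
  also have "(CLINT l|\<rho>. - \<i> * of_real l) = - \<i> * of_real mean"
    unfolding integral_mult_right_zero integral_complex_of_real spectral_mean_def ..
  finally show c: "(\<lambda>k. csym (h k)) \<longlonglongrightarrow> - \<i> * of_real mean" .
  have "(\<lambda>k. usym (h k) l) \<longlonglongrightarrow> - \<i> * of_real l - (- \<i> * of_real mean)"
    unfolding usym_def by (intro tendsto_diff dsym_tendsto assms c)
  then show "(\<lambda>k. usym (h k) l) \<longlonglongrightarrow> - \<i> * of_real (l - mean)" by (simp add: algebra_simps)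
qed

lemma spread_limit:
  assumes "h \<longlonglongrightarrow> 0" "\<And>k. h k \<noteq> 0"
  shows "(\<lambda>k. \<integral>l. (cmod (usym (h k) l))\<^sup>2 \<partial>\<rho>) \<longlonglongrightarrow> spread"
  unfolding spectral_variance_def
proof (rule integral_dominated_convergence[OF _ _ integrable_bsym(2)])
  have "(\<lambda>k. (cmod (usym (h k) l))\<^sup>2) \<longlonglongrightarrow> (cmod (- \<i> * of_real (l - mean)))\<^sup>2" for l
    by (intro tendsto_intros usym_tendsto assms)
  then show "AE l in \<rho>. (\<lambda>k. (cmod (usym (h k) l))\<^sup>2) \<longlonglongrightarrow> (l - mean)\<^sup>2"
    unfolding norm_mult norm_of_real by simp
  show "AE l in \<rho>. norm ((cmod (usym (h k) l))\<^sup>2) \<le> (bsym l)\<^sup>2" for k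
    using norm_usym_le by (intro AE_I2) (simp add: power_mono)
qed auto

text \<open>The second moment of \<open>usym h\<close> tends to \<open>spread\<close> along every
  null sequence of steps, so it cannot stay below half of it. This is the uniform nondegeneracy of
  the process near the diagonal of time.\<close>

lemma spread_lower:
  assumes "0 < spread"
  shows "\<exists>\<delta>>0. \<delta> \<le> 1 \<and> (\<forall>h. 0 < \<bar>h\<bar> \<and> \<bar>h\<bar> \<le> \<delta> \<longrightarrow> spread / 2 \<le> (\<integral>l. (cmod (usym h l))\<^sup>2 \<partial>\<rho>))"
proof (rule ccontr)
  assume "\<not> ?thesis"
  then have "\<exists>h. 0 < \<bar>h\<bar> \<and> \<bar>h\<bar> \<le> \<delta> \<and> (\<integral>l. (cmod (usym h l))\<^sup>2 \<partial>\<rho>) < spread / 2" if "\<delta> > 0" "\<delta> \<le> 1" for \<delta>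
    using that by (auto simp: not_le)
  from this[of "1 / real (Suc n)" for n]
  have "\<forall>n. \<exists>h. 0 < \<bar>h\<bar> \<and> \<bar>h\<bar> \<le> 1 / real (Suc n) \<and> (\<integral>l. (cmod (usym h l))\<^sup>2 \<partial>\<rho>) < spread / 2" by simp
  then obtain h where h: "\<And>n. 0 < \<bar>h n\<bar>" "\<And>n. \<bar>h n\<bar> \<le> 1 / real (Suc n)" "\<And>n. (\<integral>l. (cmod (usym (h n) l))\<^sup>2 \<partial>\<rho>) < spread / 2"
    by metis
  have "h \<longlonglongrightarrow> 0"
    by (rule Lim_null_comparison[OF _ LIMSEQ_Suc[OF lim_1_over_n]]) (use h(2) in auto)
  then have "(\<lambda>k. \<integral>l. (cmod (usym (h k) l))\<^sup>2 \<partial>\<rho>) \<longlonglongrightarrow> spread"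
    by (rule spread_limit) (use h(1) in fastforce)
  then have "spread \<le> spread / 2"
    by (rule tendsto_upperbound) (use h(3) in \<open>auto intro!: always_eventually less_imp_le\<close>)
  then show False using assms by simp
qed

lemma AE_Uk_lim: "AE \<omega> in M. (\<lambda>k. Uk k t \<omega>) \<longlonglongrightarrow> U t \<omega>"
  using AE_G_lim[of t]
proof eventually_elim
  case (elim \<omega>)
  have "hs k \<noteq> 0" for k using hs(1)[of k] by simp
  then have "(\<lambda>k. D k t \<omega> - csym (hs k) * F t \<omega>) \<longlonglongrightarrow> G t \<omega> - (- \<i> * of_real mean) * F t \<omega>"
    by (intro tendsto_intros elim usym_tendsto(1)[OF hs(3)])
  then show ?case by (simp add: Uk_eq U_def)
qed

text \<open>One constant for the moment of order \<open>2 * n\<close> of \<open>F t\<close>, of the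
  corrected quotients and of \<open>U t\<close>: their variances are all at most
  \<open>1 + \<integral> bsym^2\<close>.\<close>

definition mom :: "nat \<Rightarrow> real" where
  "mom n = enn2real (\<integral>\<^sup>+z. ennreal (cmod z ^ (2 * n)) \<partial>std_complex_gaussian) * (1 + (\<integral>l. (bsym l)\<^sup>2 \<partial>\<rho>)) ^ n"

lemma mom_nonneg: "0 \<le> mom n"
  unfolding mom_def by (intro mult_nonneg_nonneg zero_le_power) (auto intro: add_nonneg_nonneg integral_nonneg_AE)

lemma nn_moment_le:
  assumes "(\<integral>l. (cmod (symbol ps l))\<^sup>2 \<partial>\<rho>) \<le> 1 + (\<integral>l. (bsym l)\<^sup>2 \<partial>\<rho>)"
  shows "(\<integral>\<^sup>+\<omega>. ennreal (cmod (lin_comb F ps \<omega>) ^ (2 * n)) \<partial>M) \<le> ennreal (mom n)"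
proof -
  define K where "K = enn2real (\<integral>\<^sup>+z. ennreal (cmod z ^ (2 * n)) \<partial>std_complex_gaussian)"
  have K: "(\<integral>\<^sup>+z. ennreal (cmod z ^ (2 * n)) \<partial>std_complex_gaussian) = ennreal K"
    using std_complex_gaussian_moment[of n] by (simp add: K_def)
  have K0: "0 \<le> K" by (simp add: K_def)
  have "(\<integral>l. (cmod (symbol ps l))\<^sup>2 \<partial>\<rho>) ^ n \<le> (1 + (\<integral>l. (bsym l)\<^sup>2 \<partial>\<rho>)) ^ n"
    using assms by (intro power_mono) auto
  then have "K * (\<integral>l. (cmod (symbol ps l))\<^sup>2 \<partial>\<rho>) ^ n \<le> mom n"
    unfolding mom_def K_def[symmetric] using K0 by (rule mult_left_mono)
  then have "ennreal (K * (\<integral>l. (cmod (symbol ps l))\<^sup>2 \<partial>\<rho>) ^ n) \<le> ennreal (mom n)" by (rule ennreal_leI)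
  then show ?thesis unfolding nn_lin_comb_moment K ennreal_mult'[OF K0] .
qed

lemma F_lin_comb: "lin_comb F [(1, t)] = F t"
  by auto

lemma F_second_moment: "(\<integral>\<omega>. (cmod (F t \<omega>))\<^sup>2 \<partial>M) = 1"
  using lin_comb_second_moment(1)[of "[(1, t)]"] rho.prob_space by simp

lemma nn_F_moment: "(\<integral>\<^sup>+\<omega>. ennreal (cmod (F t \<omega>) ^ (2 * n)) \<partial>M) \<le> ennreal (mom n)"
  using nn_moment_le[of "[(1, t)]" n] rho.prob_space by (simp add: integral_nonneg_AE)

lemma nn_Uk_moment: "(\<integral>\<^sup>+\<omega>. ennreal (cmod (Uk k t \<omega>) ^ (2 * n)) \<partial>M) \<le> ennreal (mom n)"
proof (rule nn_moment_le)
  have "(\<integral>l. (cmod (symbol (uq (hs k) t) l))\<^sup>2 \<partial>\<rho>) \<le> (\<integral>l. (bsym l)\<^sup>2 \<partial>\<rho>)"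
  proof (rule integral_mono)
    show "(cmod (symbol (uq (hs k) t) l))\<^sup>2 \<le> (bsym l)\<^sup>2" for l
      unfolding symbol_uq norm_mult using norm_usym_le[of "hs k" l] by (intro power_mono) auto
  qed (rule lin_comb_second_moment(3) integrable_bsym(2))+
  then show "(\<integral>l. (cmod (symbol (uq (hs k) t) l))\<^sup>2 \<partial>\<rho>) \<le> 1 + (\<integral>l. (bsym l)\<^sup>2 \<partial>\<rho>)" by simp
qed

text \<open>The limit \<open>U\<close> is not represented by a finite combination; its moments are
  inherited from the Gaussian quotients by Fatou's lemma.\<close>

lemma nn_U_moment: "(\<integral>\<^sup>+\<omega>. ennreal (cmod (U t \<omega>) ^ (2 * n)) \<partial>M) \<le> ennreal (mom n)"
proof -
  have "AE \<omega> in M. ennreal (cmod (U t \<omega>) ^ (2 * n)) = liminf (\<lambda>k. ennreal (cmod (Uk k t \<omega>) ^ (2 * n)))"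
    using AE_Uk_lim[of t]
  proof eventually_elim
    case (elim \<omega>)
    have "(\<lambda>k. ennreal (cmod (Uk k t \<omega>) ^ (2 * n))) \<longlonglongrightarrow> ennreal (cmod (U t \<omega>) ^ (2 * n))"
      by (intro tendsto_ennrealI tendsto_intros elim)
    from lim_imp_Liminf[OF trivial_limit_sequentially this, symmetric] show ?case .
  qed
  then have "(\<integral>\<^sup>+\<omega>. ennreal (cmod (U t \<omega>) ^ (2 * n)) \<partial>M) = (\<integral>\<^sup>+\<omega>. liminf (\<lambda>k. ennreal (cmod (Uk k t \<omega>) ^ (2 * n))) \<partial>M)"
    by (rule nn_integral_cong_AE)
  also have "\<dots> \<le> liminf (\<lambda>k. \<integral>\<^sup>+\<omega>. ennreal (cmod (Uk k t \<omega>) ^ (2 * n)) \<partial>M)" by (rule nn_integral_liminf) measurable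
  also have "\<dots> \<le> limsup (\<lambda>k. \<integral>\<^sup>+\<omega>. ennreal (cmod (Uk k t \<omega>) ^ (2 * n)) \<partial>M)" by (rule Liminf_le_Limsup) simp
  also have "\<dots> \<le> ennreal (mom n)" by (rule Limsup_bounded) (intro always_eventually allI nn_Uk_moment)
  finally show ?thesis .
qed

definition negmom :: "real \<Rightarrow> real" where
  "negmom q = enn2real (\<integral>\<^sup>+z. ennreal (cmod z powr - q) \<partial>std_complex_gaussian)"

lemma negmom_nonneg [simp]: "0 \<le> negmom q" by (simp add: negmom_def)

lemma negmom: "0 \<le> q \<Longrightarrow> q < 2 \<Longrightarrow> (\<integral>\<^sup>+z. ennreal (cmod z powr - q) \<partial>std_complex_gaussian) = ennreal (negmom q)"
  using std_complex_gaussian_neg_moment[of q] by (simp add: negmom_def)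

lemma nn_neg_moment:
  assumes "(\<integral>l. (cmod (symbol ps l))\<^sup>2 \<partial>\<rho>) \<noteq> 0" "0 \<le> q" "q < 2"
  shows "(\<integral>\<^sup>+\<omega>. ennreal (cmod (lin_comb F ps \<omega>) powr - q) \<partial>M) = ennreal (negmom q * (\<integral>l. (cmod (symbol ps l))\<^sup>2 \<partial>\<rho>) powr - (q / 2))"
  using gaussian_vector_moments(3)[OF prob_space_axioms lin_comb_gaussian[of "{0::nat}" "\<lambda>_. ps"], of 0 q] assms
  by (simp add: lin_comb_second_moment negmom ennreal_mult')

lemma nn_F_neg_moment: "0 \<le> q \<Longrightarrow> q < 2 \<Longrightarrow> (\<integral>\<^sup>+\<omega>. ennreal (cmod (F t \<omega>) powr - q) \<partial>M) = ennreal (negmom q)"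
  using nn_neg_moment[of "[(1, t)]" q] rho.prob_space by simp

lemma AE_lin_comb_nonzero:
  assumes "(\<integral>l. (cmod (symbol ps l))\<^sup>2 \<partial>\<rho>) \<noteq> 0"
  shows "AE \<omega> in M. lin_comb F ps \<omega> \<noteq> 0"
  using gaussian_vector_AE_nonzero[OF prob_space_axioms lin_comb_gaussian[of "{0::nat}" "\<lambda>_. ps"], of 0] assms
  by (simp add: lin_comb_second_moment)

lemma AE_F_nonzero: "AE \<omega> in M. F t \<omega> \<noteq> 0"
  using AE_lin_comb_nonzero[of "[(1, t)]"] rho.prob_space by simp

definition corr :: "real \<Rightarrow> complex" where "corr h = (CLINT l|\<rho>. iexp (- (h * l)))"

lemma norm_corr_le: "cmod (corr h) \<le> 1"
proof -
  have "cmod (corr h) \<le> (\<integral>l. cmod (iexp (- (h * l))) \<partial>\<rho>)" unfolding corr_def by (rule integral_norm_bound)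
  then show ?thesis using rho.prob_space by simp
qed

text \<open>The part of \<open>F s\<close> orthogonal to, hence independent of, \<open>F t\<close>.\<close>

definition resid :: "real \<Rightarrow> real \<Rightarrow> (complex \<times> real) list" where
  "resid t s = [(1, s), (- corr (s - t), t)]"

text \<open>For lag \<open>h = s - t\<close> the identity
  \<open>h * usym h l = exp (- i h l) - corr h\<close> shows that the residual is, up to a phase in
  its symbol, \<open>h\<close> times the corrected difference quotient. Its variance is therefore of
  order \<open>h^2\<close> for small \<open>h\<close>.\<close>

lemma resid_second_moment:
  assumes "s \<noteq> t"
  shows "(\<integral>l. (cmod (symbol (resid t s) l))\<^sup>2 \<partial>\<rho>) = (s - t)\<^sup>2 * (\<integral>l. (cmod (usym (s - t) l))\<^sup>2 \<partial>\<rho>)"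
proof -
  define h where "h = s - t"
  have h: "h \<noteq> 0" using assms by (simp add: h_def)
  have i: "integrable \<rho> (\<lambda>l. iexp (- (h * l)))" using symbol_integrable[of "[(1, h)]" "[(1, 0)]"] by simp
  have "csym h = (corr h - 1) / of_real h"
    using i rho.prob_space by (simp add: csym_def dsym_def corr_def)
  then have u: "of_real h * usym h l = iexp (- (h * l)) - corr h" for l
    using h by (simp add: usym_def dsym_def field_simps)
  have "symbol (resid t s) l = iexp (- (t * l)) * (of_real h * usym h l)" for l
  proof -
    have "iexp (- (s * l)) = iexp (- (t * l)) * iexp (- (h * l))" by (simp add: h_def mult_exp_exp algebra_simps)
    then show ?thesis unfolding u by (simp add: resid_def h_def algebra_simps)
  qed
  then have "(cmod (symbol (resid t s) l))\<^sup>2 = h\<^sup>2 * (cmod (usym h l))\<^sup>2" for l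
    by (simp add: norm_mult power_mult_distrib)
  then show ?thesis by (simp add: h_def)
qed

lemma resid_orthogonal: "(\<integral>\<omega>. lin_comb F (resid t s) \<omega> * cnj (F t \<omega>) \<partial>M) = 0"
proof -
  have i: "integrable \<rho> (\<lambda>l. iexp (- ((s - t) * l)))" using symbol_integrable[of "[(1, s - t)]" "[(1, 0)]"] by simp
  have e: "symbol (resid t s) l * cnj (symbol [(1, t)] l) = iexp (- ((s - t) * l)) - corr (s - t)" for l
    by (simp add: resid_def exp_cnj algebra_simps mult_exp_exp)
  have "(\<integral>\<omega>. lin_comb F (resid t s) \<omega> * cnj (F t \<omega>) \<partial>M) = (CLINT l|\<rho>. iexp (- ((s - t) * l)) - corr (s - t))"
    using lin_comb_covariance[of "resid t s" "[(1, t)]"] unfolding F_lin_comb e .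
  also have "\<dots> = 0" using i rho.prob_space by (simp add: corr_def)
  finally show ?thesis .
qed

text \<open>The residual is independent of \<open>F t\<close>, so the inverse moments multiply. The
  exponent \<open>8/9\<close> becomes \<open>4/9\<close> on the variance, and the variance is at
  least \<open>(s - t)^2 * spread / 2\<close>, which gives the singularity
  \<open>|s - t|^(-8/9)\<close>.\<close>

lemma nn_F_resid:
  assumes st: "s \<noteq> t" and \<delta>: "spread / 2 \<le> (\<integral>l. (cmod (usym (s - t) l))\<^sup>2 \<partial>\<rho>)" and sp: "0 < spread"
  shows "(\<integral>\<^sup>+\<omega>. ennreal (cmod (F t \<omega>) powr - (16/9)) * ennreal (cmod (lin_comb F (resid t s) \<omega>) powr - (8/9)) \<partial>M)
    \<le> ennreal (negmom (16/9) * negmom (8/9) * (spread / 2) powr - (4/9) * \<bar>s - t\<bar> powr - (8/9))"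
    and "AE \<omega> in M. lin_comb F (resid t s) \<omega> \<noteq> 0"
proof -
  define v where "v = (\<integral>l. (cmod (symbol (resid t s) l))\<^sup>2 \<partial>\<rho>)"
  have v: "(s - t)\<^sup>2 * (spread / 2) \<le> v"
    unfolding v_def resid_second_moment[OF st] by (intro mult_left_mono \<delta>) auto
  have pos: "0 < (s - t)\<^sup>2 * (spread / 2)" using st sp by simp
  then have v0: "v \<noteq> 0" using v by linarith
  show "AE \<omega> in M. lin_comb F (resid t s) \<omega> \<noteq> 0" using v0 unfolding v_def by (rule AE_lin_comb_nonzero)
  let ?Y = "\<lambda>i::nat. lin_comb F (if i = 0 then [(1, t)] else resid t s)"
  have G: "complex_gaussian_vector M {0, 1::nat} ?Y" by (rule lin_comb_gaussian) auto
  have "(\<integral>\<^sup>+\<omega>. ennreal (cmod (F t \<omega>) powr - (16/9)) * ennreal (cmod (lin_comb F (resid t s) \<omega>) powr - (8/9)) \<partial>M)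
     = (\<integral>\<^sup>+\<omega>. ennreal (cmod (F t \<omega>) powr - (16/9)) \<partial>M) * (\<integral>\<^sup>+\<omega>. ennreal (cmod (lin_comb F (resid t s) \<omega>) powr - (8/9)) \<partial>M)"
    using gaussian_vector_nn_integral_neg_powr_product[OF prob_space_axioms G, of 0 1 "16/9" "8/9"] F_second_moment resid_orthogonal
    by (simp add: F_lin_comb)
  also have "\<dots> = ennreal (negmom (16/9) * (negmom (8/9) * v powr - (4/9)))"
    using v0 by (subst nn_F_neg_moment, simp, simp, subst nn_neg_moment) (auto simp: v_def ennreal_mult)
  also have "\<dots> \<le> ennreal (negmom (16/9) * (negmom (8/9) * ((s - t)\<^sup>2 * (spread / 2)) powr - (4/9)))"
    using v pos by (intro ennreal_leI mult_left_mono powr_mono2') auto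
  also have "((s - t)\<^sup>2 * (spread / 2)) powr - (4/9) = ((s - t)\<^sup>2) powr - (4/9) * (spread / 2) powr - (4/9)"
    using sp by (intro powr_mult)
  also have "((s - t)\<^sup>2) powr - (4/9) = \<bar>s - t\<bar> powr - (8/9)"
  proof -
    have "(s - t)\<^sup>2 = \<bar>s - t\<bar> powr 2" using st by simp
    then show ?thesis by (simp only: powr_powr) simp
  qed
  finally show "(\<integral>\<^sup>+\<omega>. ennreal (cmod (F t \<omega>) powr - (16/9)) * ennreal (cmod (lin_comb F (resid t s) \<omega>) powr - (8/9)) \<partial>M)
    \<le> ennreal (negmom (16/9) * negmom (8/9) * (spread / 2) powr - (4/9) * \<bar>s - t\<bar> powr - (8/9))"
    by (simp add: mult_ac)
qed

definition q :: "real \<Rightarrow> 'a \<Rightarrow> real" where "q t \<omega> = cmod (U t \<omega>) / cmod (F t \<omega>)"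

lemma q_joint [measurable (raw)]:
  assumes [measurable]: "f \<in> borel_measurable N" "g \<in> measurable N M"
  shows "(\<lambda>x. q (f x) (g x)) \<in> borel_measurable N"
  unfolding q_def by measurable

text \<open>At equal times this expectation is infinite. Off the diagonal, Young's inequality pays
  for the factors \<open>U\<close> with eighth moments (\<open>mom 4\<close>), and the remaining
  power \<open>4/3\<close> of \<open>1 / |F t F s|\<close> is bounded through the residuals.\<close>

lemma nn_q_product:
  assumes sp: "0 < spread" and st: "s \<noteq> t"
    and \<delta>: "spread / 2 \<le> (\<integral>l. (cmod (usym (s - t) l))\<^sup>2 \<partial>\<rho>)" "spread / 2 \<le> (\<integral>l. (cmod (usym (t - s) l))\<^sup>2 \<partial>\<rho>)"
  shows "(\<integral>\<^sup>+\<omega>. ennreal (q t \<omega> * q s \<omega>) \<partial>M) \<le>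
    ennreal (2 * mom 4 + 8 * (negmom (16/9) * negmom (8/9) * (spread / 2) powr - (4/9) * \<bar>s - t\<bar> powr - (8/9)))"
proof -
  define N where "N = negmom (16/9) * negmom (8/9) * (spread / 2) powr - (4/9) * \<bar>s - t\<bar> powr - (8/9)"
  have N: "0 \<le> N" by (simp add: N_def)
  let ?X = "\<lambda>\<omega>. cmod (F t \<omega>) powr - (16/9)" and ?W = "\<lambda>\<omega>. cmod (lin_comb F (resid t s) \<omega>) powr - (8/9)"
  let ?X' = "\<lambda>\<omega>. cmod (F s \<omega>) powr - (16/9)" and ?W' = "\<lambda>\<omega>. cmod (lin_comb F (resid s t) \<omega>) powr - (8/9)"
  have b1: "(\<integral>\<^sup>+\<omega>. ennreal (?X \<omega>) * ennreal (?W \<omega>) \<partial>M) \<le> ennreal N"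
    unfolding N_def by (rule nn_F_resid(1)[OF st \<delta>(1) sp])
  have b2: "(\<integral>\<^sup>+\<omega>. ennreal (?X' \<omega>) * ennreal (?W' \<omega>) \<partial>M) \<le> ennreal N"
    unfolding N_def using nn_F_resid(1)[OF st[symmetric] \<delta>(2) sp] by (simp add: abs_minus_commute)
  have tri: "cmod (lin_comb F (resid a b) \<omega>) \<le> cmod (F a \<omega>) + cmod (F b \<omega>)" for a b \<omega>
  proof -
    have "cmod (F b \<omega> + (- corr (b - a)) * F a \<omega>) \<le> cmod (F b \<omega>) + cmod ((- corr (b - a)) * F a \<omega>)" by (rule norm_triangle_ineq)
    also have "cmod ((- corr (b - a)) * F a \<omega>) \<le> 1 * cmod (F a \<omega>)"
      unfolding norm_mult norm_minus_cancel by (intro mult_right_mono norm_corr_le) auto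
    finally show ?thesis by (simp add: resid_def)
  qed
  have "AE \<omega> in M. ennreal (q t \<omega> * q s \<omega>) \<le> (ennreal (cmod (U t \<omega>) ^ (2 * 4)) + ennreal (cmod (U s \<omega>) ^ (2 * 4))) +
      4 * (ennreal (?X \<omega>) * ennreal (?W \<omega>) + ennreal (?X' \<omega>) * ennreal (?W' \<omega>))"
    using nn_F_resid(2)[OF st \<delta>(1) sp] nn_F_resid(2)[OF st[symmetric] \<delta>(2) sp] AE_F_nonzero[of t] AE_F_nonzero[of s]
  proof eventually_elim
    case (elim \<omega>)
    define a b w where "a = cmod (U t \<omega>)" and "b = cmod (U s \<omega>)" and "w = 1 / (cmod (F t \<omega>) * cmod (F s \<omega>))"
    have nn: "0 \<le> a" "0 \<le> b" "0 \<le> w" by (auto simp: a_def b_def w_def)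
    have "q t \<omega> * q s \<omega> = (a * b) * w" by (simp add: q_def a_def b_def w_def)
    also have "\<dots> \<le> (a\<^sup>2 + b\<^sup>2) * w" using nn by (intro mult_right_mono prod2_le_sum_squares)
    also have "\<dots> = a\<^sup>2 * w + b\<^sup>2 * w" by (simp add: distrib_right)
    also have "\<dots> \<le> (a ^ 8 + w powr (4/3)) + (b ^ 8 + w powr (4/3))" using nn by (intro add_mono mult_le_powr_sum)
    also have "\<dots> = (a ^ 8 + b ^ 8) + 2 * w powr (4/3)" by simp
    also have "w powr (4/3) \<le> 2 * (?X \<omega> * ?W \<omega> + ?X' \<omega> * ?W' \<omega>)"
      unfolding w_def using elim tri[of t s \<omega>] tri[of s t \<omega>] by (intro inverse_product_bound) (auto simp: add.commute)
    finally have "q t \<omega> * q s \<omega> \<le> (a ^ 8 + b ^ 8) + 4 * (?X \<omega> * ?W \<omega> + ?X' \<omega> * ?W' \<omega>)" by simp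
    then have "ennreal (q t \<omega> * q s \<omega>) \<le> ennreal ((a ^ 8 + b ^ 8) + 4 * (?X \<omega> * ?W \<omega> + ?X' \<omega> * ?W' \<omega>))" by (rule ennreal_leI)
    also have "\<dots> = (ennreal (a ^ 8) + ennreal (b ^ 8)) + 4 * (ennreal (?X \<omega>) * ennreal (?W \<omega>) + ennreal (?X' \<omega>) * ennreal (?W' \<omega>))"
      using nn by (simp add: ennreal_mult distrib_left del: ennreal_power)
    finally show ?case by (simp add: a_def b_def)
  qed
  then have "(\<integral>\<^sup>+\<omega>. ennreal (q t \<omega> * q s \<omega>) \<partial>M) \<le> (\<integral>\<^sup>+\<omega>. (ennreal (cmod (U t \<omega>) ^ (2 * 4)) + ennreal (cmod (U s \<omega>) ^ (2 * 4))) +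
      4 * (ennreal (?X \<omega>) * ennreal (?W \<omega>) + ennreal (?X' \<omega>) * ennreal (?W' \<omega>)) \<partial>M)"
    by (rule nn_integral_mono_AE)
  also have "\<dots> = ((\<integral>\<^sup>+\<omega>. ennreal (cmod (U t \<omega>) ^ (2 * 4)) \<partial>M) + (\<integral>\<^sup>+\<omega>. ennreal (cmod (U s \<omega>) ^ (2 * 4)) \<partial>M)) +
      4 * ((\<integral>\<^sup>+\<omega>. ennreal (?X \<omega>) * ennreal (?W \<omega>) \<partial>M) + (\<integral>\<^sup>+\<omega>. ennreal (?X' \<omega>) * ennreal (?W' \<omega>) \<partial>M))"
    by (simp add: nn_integral_add nn_integral_cmult)
  also have "\<dots> \<le> (ennreal (mom 4) + ennreal (mom 4)) + 4 * (ennreal N + ennreal N)"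
    by (intro add_mono mult_left_mono nn_U_moment b1 b2) auto
  also have "\<dots> = ennreal (2 * mom 4 + 8 * N)"
  proof -
    have "(ennreal x + ennreal x) + 4 * (ennreal y + ennreal y) = ennreal (2 * x + 8 * y)" if "0 \<le> x" "0 \<le> y" for x y
    proof -
      have "4 * ennreal (y + y) = ennreal (4 * (y + y))" using that by (simp add: ennreal_mult del: ennreal_plus)
      then show ?thesis using that by (simp flip: ennreal_plus)
    qed
    then show ?thesis using N mom_nonneg by simp
  qed
  finally show ?thesis by (simp only: N_def)
qed

end

subsection \<open>Covariance of the angular velocity\<close>

lemma nn_integral_add8:
  assumes [measurable]: "f1 \<in> borel_measurable M" "f2 \<in> borel_measurable M" "f3 \<in> borel_measurable M" "f4 \<in> borel_measurable M"
    "f5 \<in> borel_measurable M" "f6 \<in> borel_measurable M" "f7 \<in> borel_measurable M" "f8 \<in> borel_measurable M"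
  shows "(\<integral>\<^sup>+x. f1 x + f2 x + (f3 x + f4 x + f5 x) + (f6 x + f7 x + f8 x) \<partial>M) =
    integral\<^sup>N M f1 + integral\<^sup>N M f2 + (integral\<^sup>N M f3 + integral\<^sup>N M f4 + integral\<^sup>N M f5) +
    (integral\<^sup>N M f6 + integral\<^sup>N M f7 + integral\<^sup>N M f8)"
  by (simp add: nn_integral_add)

text \<open>The covariance of \<open>Im (U cnj F)\<close> at two times with lag
  \<open>\<tau>\<close>, by Wick's formula and the isometry. The two mixed covariances of
  \<open>U\<close> and \<open>F\<close> each carry a factor \<open>- \<i>\<close>, which turns the
  minus sign of \<open>Im a * Im b\<close> into a plus.\<close>

definition spectral_kernel :: "real measure \<Rightarrow> real \<Rightarrow> real" where
  "spectral_kernel \<rho> \<tau> = Re (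
     (CLINT l|\<rho>. of_real ((l - spectral_mean \<rho>)\<^sup>2) * iexp (- (\<tau> * l))) * (CLINT l|\<rho>. iexp (\<tau> * l)) +
     (CLINT l|\<rho>. of_real (l - spectral_mean \<rho>) * iexp (- (\<tau> * l))) *
     (CLINT l|\<rho>. of_real (l - spectral_mean \<rho>) * iexp (\<tau> * l))) / 2"

context smooth_gaussian
begin

text \<open>The square of the time integral is a double integral. On an interval of length
  \<open>\<delta>\<close> all lags lie where \<open>spread_lower\<close> applies, and the
  singularity \<open>|s - t|^(-8/9)\<close> is integrable.\<close>

lemma nn_q_square_short:
  assumes sp: "0 < spread" and \<delta>: "0 < \<delta>" "\<delta> \<le> 1"
    and low: "\<And>h. 0 < \<bar>h\<bar> \<Longrightarrow> \<bar>h\<bar> \<le> \<delta> \<Longrightarrow> spread / 2 \<le> (\<integral>l. (cmod (usym h l))\<^sup>2 \<partial>\<rho>)"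
  shows "(\<integral>\<^sup>+\<omega>. (\<integral>\<^sup>+t. ennreal (q t \<omega>) * indicator {a..a + \<delta>} t \<partial>lborel)\<^sup>2 \<partial>M) < \<infinity>"
proof -
  define f where "f t \<omega> = ennreal (q t \<omega>) * indicator {a..a + \<delta>} t" for t \<omega>
  define A where "A = 2 * mom 4"
  define B where "B = 8 * (negmom (16/9) * negmom (8/9) * (spread / 2) powr - (4/9))"
  have AB: "0 \<le> A" "0 \<le> B" by (auto simp: A_def B_def mom_nonneg)
  define J where "J = (\<integral>\<^sup>+u. ennreal (\<bar>u\<bar> powr - (8/9)) * indicator {-1..1} u \<partial>lborel)"
  have J: "J < \<infinity>" unfolding J_def by (rule nn_integral_neg_powr_finite) auto
  have fm [measurable]: "(\<lambda>x. f (u x) (v x)) \<in> borel_measurable N" if [measurable]: "u \<in> borel_measurable N" "v \<in> measurable N M" for u v N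
    unfolding f_def by measurable
  have sq: "(\<integral>\<^sup>+t. f t \<omega> \<partial>lborel)\<^sup>2 = (\<integral>\<^sup>+t. \<integral>\<^sup>+s. f t \<omega> * f s \<omega> \<partial>lborel \<partial>lborel)" if [measurable]: "\<omega> \<in> space M" for \<omega>
    by (simp add: power2_eq_square nn_integral_cmult nn_integral_multc)
  have "(\<integral>\<^sup>+\<omega>. (\<integral>\<^sup>+t. f t \<omega> \<partial>lborel)\<^sup>2 \<partial>M) = (\<integral>\<^sup>+\<omega>. \<integral>\<^sup>+t. \<integral>\<^sup>+s. f t \<omega> * f s \<omega> \<partial>lborel \<partial>lborel \<partial>M)"
    by (intro nn_integral_cong sq)
  also have "\<dots> = (\<integral>\<^sup>+t. \<integral>\<^sup>+\<omega>. \<integral>\<^sup>+s. f t \<omega> * f s \<omega> \<partial>lborel \<partial>M \<partial>lborel)"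
    by (rule lm.Fubini') measurable
  also have "\<dots> = (\<integral>\<^sup>+t. \<integral>\<^sup>+s. \<integral>\<^sup>+\<omega>. f t \<omega> * f s \<omega> \<partial>M \<partial>lborel \<partial>lborel)"
    by (intro nn_integral_cong lm.Fubini') measurable
  also have "\<dots> \<le> (\<integral>\<^sup>+t. (ennreal A * ennreal \<delta> + ennreal B * J) * indicator {a..a + \<delta>} t \<partial>lborel)"
  proof (rule nn_integral_mono)
    fix t :: real
    show "(\<integral>\<^sup>+s. \<integral>\<^sup>+\<omega>. f t \<omega> * f s \<omega> \<partial>M \<partial>lborel) \<le> (ennreal A * ennreal \<delta> + ennreal B * J) * indicator {a..a + \<delta>} t"
    proof (cases "t \<in> {a..a + \<delta>}")
      case True
      have "(\<integral>\<^sup>+s. \<integral>\<^sup>+\<omega>. f t \<omega> * f s \<omega> \<partial>M \<partial>lborel)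
         \<le> (\<integral>\<^sup>+s. ennreal A * indicator {a..a + \<delta>} s + ennreal B * (ennreal (\<bar>s - t\<bar> powr - (8/9)) * indicator {-1..1} (s - t)) \<partial>lborel)"
      proof (rule nn_integral_mono_AE)
        have "AE s in lborel. s \<noteq> t" by (rule AE_lborel_singleton)
        then show "AE s in lborel. (\<integral>\<^sup>+\<omega>. f t \<omega> * f s \<omega> \<partial>M)
           \<le> ennreal A * indicator {a..a + \<delta>} s + ennreal B * (ennreal (\<bar>s - t\<bar> powr - (8/9)) * indicator {-1..1} (s - t))"
        proof eventually_elim
          case (elim s)
          show ?case
          proof (cases "s \<in> {a..a + \<delta>}")
            case s: True
            have d: "\<bar>s - t\<bar> \<le> \<delta>" "\<bar>t - s\<bar> \<le> \<delta>" "0 < \<bar>s - t\<bar>" "0 < \<bar>t - s\<bar>" using s True elim by (auto simp: abs_le_iff)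
            have "(\<integral>\<^sup>+\<omega>. f t \<omega> * f s \<omega> \<partial>M) = (\<integral>\<^sup>+\<omega>. ennreal (q t \<omega> * q s \<omega>) \<partial>M)"
            proof -
              have "0 \<le> q u \<omega>" for u \<omega> by (simp add: q_def)
              then show ?thesis using s True by (simp add: f_def ennreal_mult)
            qed
            also have "\<dots> \<le> ennreal (A + B * \<bar>s - t\<bar> powr - (8/9))"
              using nn_q_product[OF sp elim low[OF d(3,1)] low[OF d(4,2)]] by (simp add: A_def B_def mult_ac)
            also have "\<dots> = ennreal A + ennreal B * ennreal (\<bar>s - t\<bar> powr - (8/9))"
              using AB by (simp add: ennreal_mult)
            finally show ?thesis using s d \<delta> by (simp add: indicator_def abs_le_iff)
          next
            case False
            then show ?thesis by (simp add: f_def)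
          qed
        qed
      qed
      also have "\<dots> = ennreal A * ennreal \<delta> + ennreal B * (\<integral>\<^sup>+s. ennreal (\<bar>s - t\<bar> powr - (8/9)) * indicator {-1..1} (s - t) \<partial>lborel)"
        using \<delta> by (simp add: nn_integral_add nn_integral_cmult)
      also have "(\<integral>\<^sup>+s. ennreal (\<bar>s - t\<bar> powr - (8/9)) * indicator {-1..1} (s - t) \<partial>lborel) = J"
        unfolding J_def using nn_integral_real_affine[of "\<lambda>s. ennreal (\<bar>s - t\<bar> powr - (8/9)) * indicator {-1..1} (s - t)" 1 t] by simp
      finally show ?thesis using True by simp
    next
      case False
      then show ?thesis by (simp add: f_def)
    qed
  qed
  also have "\<dots> < \<infinity>"
    using J by (subst nn_integral_cmult) (auto simp: ennreal_mult_less_top emeasure_lborel_Icc_eq)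
  finally show ?thesis by (simp only: f_def)
qed

text \<open>For larger lags the residual may degenerate: if \<open>\<rho>\<close> is carried by a
  lattice, \<open>|corr|\<close> returns to 1. Pairs of distant times are therefore never estimated.
  The interval is cut into pieces of length \<open>\<delta>\<close>, and the squares of the pieces
  bound the square of the sum.\<close>

lemma nn_q_square:
  assumes sp: "0 < spread"
  shows "(\<integral>\<^sup>+\<omega>. (\<integral>\<^sup>+t. ennreal (q t \<omega>) * indicator {0..T} t \<partial>lborel)\<^sup>2 \<partial>M) < \<infinity>"
proof -
  obtain \<delta> where \<delta>: "0 < \<delta>" "\<delta> \<le> 1" and low: "\<And>h. 0 < \<bar>h\<bar> \<Longrightarrow> \<bar>h\<bar> \<le> \<delta> \<Longrightarrow> spread / 2 \<le> (\<integral>l. (cmod (usym h l))\<^sup>2 \<partial>\<rho>)"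
    using spread_lower[OF sp] by blast
  define Q where "Q b \<omega> = (\<integral>\<^sup>+t. ennreal (q t \<omega>) * indicator {0..b} t \<partial>lborel)" for b \<omega>
  have [measurable]: "Q b \<in> borel_measurable M" for b unfolding Q_def by measurable
  have main: "(\<integral>\<^sup>+\<omega>. (Q (real n * \<delta>) \<omega>)\<^sup>2 \<partial>M) < \<infinity>" for n
  proof (induction n)
    case 0
    have "(\<integral>\<^sup>+t. ennreal (q t \<omega>) * indicator {0::real..0} t \<partial>lborel) = 0" for \<omega>
      by (rule nn_integral_null_set) (auto simp: null_sets_def)
    then show ?case by (simp add: Q_def)
  next
    case (Suc n)
    define R where "R \<omega> = (\<integral>\<^sup>+t. ennreal (q t \<omega>) * indicator {real n * \<delta>..real n * \<delta> + \<delta>} t \<partial>lborel)" for \<omega>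
    have [measurable]: "R \<in> borel_measurable M" unfolding R_def by measurable
    have "Q (real (Suc n) * \<delta>) \<omega> \<le> Q (real n * \<delta>) \<omega> + R \<omega>" if [measurable]: "\<omega> \<in> space M" for \<omega>
    proof -
      have "Q (real (Suc n) * \<delta>) \<omega> \<le> (\<integral>\<^sup>+t. ennreal (q t \<omega>) * indicator {0..real n * \<delta>} t + ennreal (q t \<omega>) * indicator {real n * \<delta>..real n * \<delta> + \<delta>} t \<partial>lborel)"
        unfolding Q_def distrib_left[symmetric] by (intro nn_integral_mono mult_left_mono) (auto simp: indicator_def algebra_simps)
      also have "\<dots> = Q (real n * \<delta>) \<omega> + R \<omega>" unfolding Q_def R_def by (rule nn_integral_add) measurable
      finally show ?thesis .
    qed
    then have "(\<integral>\<^sup>+\<omega>. (Q (real (Suc n) * \<delta>) \<omega>)\<^sup>2 \<partial>M) \<le> (\<integral>\<^sup>+\<omega>. 4 * ((Q (real n * \<delta>) \<omega>)\<^sup>2 + (R \<omega>)\<^sup>2) \<partial>M)"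
      by (intro nn_integral_mono) (rule order_trans[OF power_mono ennreal_add_square_le], auto)
    also have "\<dots> = 4 * ((\<integral>\<^sup>+\<omega>. (Q (real n * \<delta>) \<omega>)\<^sup>2 \<partial>M) + (\<integral>\<^sup>+\<omega>. (R \<omega>)\<^sup>2 \<partial>M))"
      by (simp add: nn_integral_cmult nn_integral_add)
    also have "\<dots> < \<infinity>"
      using Suc.IH nn_q_square_short[OF sp \<delta> low, of "real n * \<delta>"] by (simp add: R_def ennreal_mult_less_top)
    finally show ?case .
  qed
  obtain n where "T / \<delta> \<le> real n" using real_arch_simple by blast
  then have n: "T \<le> real n * \<delta>" using \<delta> by (simp add: field_simps)
  have "(\<integral>\<^sup>+\<omega>. (Q T \<omega>)\<^sup>2 \<partial>M) \<le> (\<integral>\<^sup>+\<omega>. (Q (real n * \<delta>) \<omega>)\<^sup>2 \<partial>M)"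
    using n unfolding Q_def by (intro nn_integral_mono power_mono mult_left_mono) (auto simp: indicator_def)
  also note main[of n]
  finally show ?thesis by (simp only: Q_def)
qed

text \<open>Fubini's theorem is applied twice: to the first time variable with the second integral
  kept as a random variable \<open>Y\<close>, and then inside for each fixed first time. One bound
  on absolute values justifies both.\<close>

lemma time_integral_product:
  fixes f g :: "real \<Rightarrow> 'a \<Rightarrow> real"
  assumes f [measurable]: "(\<lambda>p. f (fst p) (snd p)) \<in> borel_measurable (lborel \<Otimes>\<^sub>M M)"
    and g [measurable]: "(\<lambda>p. g (fst p) (snd p)) \<in> borel_measurable (lborel \<Otimes>\<^sub>M M)"
    and bd: "\<And>t s. (\<integral>\<^sup>+\<omega>. ennreal \<bar>f t \<omega> * g s \<omega>\<bar> \<partial>M) \<le> ennreal C * indicator {a..b} t * indicator {c..d} s"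
  shows "integrable M (\<lambda>\<omega>. (\<integral>t. f t \<omega> \<partial>lborel) * (\<integral>s. g s \<omega> \<partial>lborel))"
    and "(\<integral>\<omega>. (\<integral>t. f t \<omega> \<partial>lborel) * (\<integral>s. g s \<omega> \<partial>lborel) \<partial>M) = (\<integral>t. \<integral>s. (\<integral>\<omega>. f t \<omega> * g s \<omega> \<partial>M) \<partial>lborel \<partial>lborel)"
proof -
  have fm [measurable]: "(\<lambda>x. f (u x) (v x)) \<in> borel_measurable N" if [measurable]: "u \<in> borel_measurable N" "v \<in> measurable N M" for u v N
    using measurable_compose[OF measurable_Pair[of u N lborel v M] f] that by simp
  have gm [measurable]: "(\<lambda>x. g (u x) (v x)) \<in> borel_measurable N" if [measurable]: "u \<in> borel_measurable N" "v \<in> measurable N M" for u v N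
    using measurable_compose[OF measurable_Pair[of u N lborel v M] g] that by simp
  define Y where "Y \<omega> = (\<integral>s. g s \<omega> \<partial>lborel)" for \<omega>
  have [measurable]: "Y \<in> borel_measurable M" unfolding Y_def by measurable
  have inner: "(\<integral>\<^sup>+s. \<integral>\<^sup>+\<omega>. ennreal \<bar>f t \<omega> * g s \<omega>\<bar> \<partial>M \<partial>lborel) \<le> ennreal C * ennreal (max 0 (d - c)) * indicator {a..b} t" for t
  proof -
    have "(\<integral>\<^sup>+s. \<integral>\<^sup>+\<omega>. ennreal \<bar>f t \<omega> * g s \<omega>\<bar> \<partial>M \<partial>lborel) \<le> (\<integral>\<^sup>+s. ennreal C * indicator {a..b} t * indicator {c..d} s \<partial>lborel)"
      by (intro nn_integral_mono bd)
    also have "\<dots> = ennreal C * indicator {a..b} t * emeasure lborel {c..d}"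
      by (rule nn_integral_cmult_indicator) simp
    also have "emeasure lborel {c..d} = ennreal (max 0 (d - c))" by (cases "c \<le> d") auto
    finally show ?thesis by (simp only: mult_ac)
  qed
  have i2: "integrable (lborel \<Otimes>\<^sub>M M) (\<lambda>(s, \<omega>). f t \<omega> * g s \<omega>)" for t
  proof (rule integrableI_bounded)
    show "(\<lambda>(s, \<omega>). f t \<omega> * g s \<omega>) \<in> borel_measurable (lborel \<Otimes>\<^sub>M M)" by measurable
    have "(\<integral>\<^sup>+x. ennreal (norm (case x of (s, \<omega>) \<Rightarrow> f t \<omega> * g s \<omega>)) \<partial>(lborel \<Otimes>\<^sub>M M)) = (\<integral>\<^sup>+s. \<integral>\<^sup>+\<omega>. ennreal \<bar>f t \<omega> * g s \<omega>\<bar> \<partial>M \<partial>lborel)"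
      by (subst nn_integral_fst[symmetric]) (auto simp: split_beta')
    also have "\<dots> < \<infinity>" by (rule le_less_trans[OF inner]) (auto simp: ennreal_mult_less_top indicator_def)
    finally show "(\<integral>\<^sup>+x. ennreal (norm (case x of (s, \<omega>) \<Rightarrow> f t \<omega> * g s \<omega>)) \<partial>(lborel \<Otimes>\<^sub>M M)) < \<infinity>" .
  qed
  have i1: "integrable (lborel \<Otimes>\<^sub>M M) (\<lambda>(t, \<omega>). f t \<omega> * Y \<omega>)"
  proof (rule integrableI_bounded)
    show "(\<lambda>(t, \<omega>). f t \<omega> * Y \<omega>) \<in> borel_measurable (lborel \<Otimes>\<^sub>M M)" by measurable
    \<comment> \<open>If the section is not integrable, the Bochner integral is 0, so the bound
      holds for every \<open>\<omega>\<close> without an exceptional set.\<close>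
    have Yle: "ennreal \<bar>Y \<omega>\<bar> \<le> (\<integral>\<^sup>+s. ennreal \<bar>g s \<omega>\<bar> \<partial>lborel)" for \<omega>
    proof (cases "integrable lborel (\<lambda>s. g s \<omega>)")
      case True then show ?thesis unfolding Y_def using integral_norm_bound_ennreal[OF True] by simp
    next
      case False then show ?thesis by (simp add: Y_def not_integrable_integral_eq)
    qed
    have "(\<integral>\<^sup>+x. ennreal (norm (case x of (t, \<omega>) \<Rightarrow> f t \<omega> * Y \<omega>)) \<partial>(lborel \<Otimes>\<^sub>M M)) = (\<integral>\<^sup>+t. \<integral>\<^sup>+\<omega>. ennreal \<bar>f t \<omega>\<bar> * ennreal \<bar>Y \<omega>\<bar> \<partial>M \<partial>lborel)"
      by (subst nn_integral_fst[symmetric]) (auto simp: split_beta' abs_mult ennreal_mult)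
    also have "\<dots> \<le> (\<integral>\<^sup>+t. \<integral>\<^sup>+\<omega>. ennreal \<bar>f t \<omega>\<bar> * (\<integral>\<^sup>+s. ennreal \<bar>g s \<omega>\<bar> \<partial>lborel) \<partial>M \<partial>lborel)"
      by (intro nn_integral_mono mult_left_mono Yle) auto
    also have "\<dots> = (\<integral>\<^sup>+t. \<integral>\<^sup>+\<omega>. \<integral>\<^sup>+s. ennreal \<bar>f t \<omega> * g s \<omega>\<bar> \<partial>lborel \<partial>M \<partial>lborel)"
    proof (intro nn_integral_cong)
      fix t \<omega> assume [measurable]: "\<omega> \<in> space M"
      show "ennreal \<bar>f t \<omega>\<bar> * (\<integral>\<^sup>+s. ennreal \<bar>g s \<omega>\<bar> \<partial>lborel) = (\<integral>\<^sup>+s. ennreal \<bar>f t \<omega> * g s \<omega>\<bar> \<partial>lborel)"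
        by (subst nn_integral_cmult[symmetric]) (auto simp: abs_mult ennreal_mult)
    qed
    also have "\<dots> = (\<integral>\<^sup>+t. \<integral>\<^sup>+s. \<integral>\<^sup>+\<omega>. ennreal \<bar>f t \<omega> * g s \<omega>\<bar> \<partial>M \<partial>lborel \<partial>lborel)"
      by (intro nn_integral_cong lm.Fubini') measurable
    also have "\<dots> \<le> (\<integral>\<^sup>+t. ennreal C * ennreal (max 0 (d - c)) * indicator {a..b} t \<partial>lborel)"
      by (intro nn_integral_mono inner)
    also have "\<dots> < \<infinity>"
      by (subst nn_integral_cmult_indicator) (auto simp: ennreal_mult_less_top emeasure_lborel_Icc_eq)
    finally show "(\<integral>\<^sup>+x. ennreal (norm (case x of (t, \<omega>) \<Rightarrow> f t \<omega> * Y \<omega>)) \<partial>(lborel \<Otimes>\<^sub>M M)) < \<infinity>" .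
  qed
  have "integrable M (\<lambda>\<omega>. \<integral>t. f t \<omega> * Y \<omega> \<partial>lborel)"
    using lm.integrable_snd[OF i1] .
  then show "integrable M (\<lambda>\<omega>. (\<integral>t. f t \<omega> \<partial>lborel) * (\<integral>s. g s \<omega> \<partial>lborel))"
    by (simp add: Y_def)
  have "(\<integral>\<omega>. (\<integral>t. f t \<omega> \<partial>lborel) * (\<integral>s. g s \<omega> \<partial>lborel) \<partial>M) = (\<integral>\<omega>. (\<integral>t. f t \<omega> * Y \<omega> \<partial>lborel) \<partial>M)"
    by (simp add: Y_def)
  also have "\<dots> = (\<integral>t. (\<integral>\<omega>. f t \<omega> * Y \<omega> \<partial>M) \<partial>lborel)"
    by (rule lm.Fubini_integral[OF i1])
  also have "\<dots> = (\<integral>t. \<integral>\<omega>. (\<integral>s. f t \<omega> * g s \<omega> \<partial>lborel) \<partial>M \<partial>lborel)"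
    by (simp add: Y_def)
  also have "\<dots> = (\<integral>t. \<integral>s. (\<integral>\<omega>. f t \<omega> * g s \<omega> \<partial>M) \<partial>lborel \<partial>lborel)"
    using lm.Fubini_integral[OF i2] by simp
  finally show "(\<integral>\<omega>. (\<integral>t. f t \<omega> \<partial>lborel) * (\<integral>s. g s \<omega> \<partial>lborel) \<partial>M) = (\<integral>t. \<integral>s. (\<integral>\<omega>. f t \<omega> * g s \<omega> \<partial>M) \<partial>lborel \<partial>lborel)" .
qed

section \<open>The angular covariance for the corrected quotients and in the limit\<close>

abbreviation kernel :: "real \<Rightarrow> real" where "kernel \<equiv> spectral_kernel \<rho>"

lemma Uk_covariances:
  "(\<integral>\<omega>. Uk k t \<omega> * cnj (Uk k s \<omega>) \<partial>M) = (CLINT l|\<rho>. of_real ((cmod (usym (hs k) l))\<^sup>2) * iexp (- ((t - s) * l)))"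
  "(\<integral>\<omega>. F s \<omega> * cnj (F t \<omega>) \<partial>M) = (CLINT l|\<rho>. iexp ((t - s) * l))"
  "(\<integral>\<omega>. Uk k t \<omega> * cnj (F s \<omega>) \<partial>M) = (CLINT l|\<rho>. usym (hs k) l * iexp (- ((t - s) * l)))"
proof -
  have e: "iexp (- (t * l)) * cnj (iexp (- (s * l))) = iexp (- ((t - s) * l))" for l
    by (simp add: exp_cnj mult_exp_exp algebra_simps)
  have "symbol (uq (hs k) t) l * cnj (symbol (uq (hs k) s) l) = of_real ((cmod (usym (hs k) l))\<^sup>2) * iexp (- ((t - s) * l))" for l
    unfolding symbol_uq complex_norm_square e[symmetric] by (simp add: mult_ac)
  then show "(\<integral>\<omega>. Uk k t \<omega> * cnj (Uk k s \<omega>) \<partial>M) = (CLINT l|\<rho>. of_real ((cmod (usym (hs k) l))\<^sup>2) * iexp (- ((t - s) * l)))"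
    using lin_comb_covariance[of "uq (hs k) t" "uq (hs k) s"] by simp
  show "(\<integral>\<omega>. F s \<omega> * cnj (F t \<omega>) \<partial>M) = (CLINT l|\<rho>. iexp ((t - s) * l))"
    using cov[of s t] by (simp add: algebra_simps)
  have "symbol (uq (hs k) t) l * cnj (symbol [(1, s)] l) = usym (hs k) l * iexp (- ((t - s) * l))" for l
    unfolding symbol_uq e[symmetric] by (simp add: mult_ac)
  then show "(\<integral>\<omega>. Uk k t \<omega> * cnj (F s \<omega>) \<partial>M) = (CLINT l|\<rho>. usym (hs k) l * iexp (- ((t - s) * l)))"
    using lin_comb_covariance[of "uq (hs k) t" "[(1, s)]"] unfolding F_lin_comb by simp
qed

lemma kernel_limit:
  "(\<lambda>k. Re ((\<integral>\<omega>. Uk k t \<omega> * cnj (Uk k s \<omega>) \<partial>M) * (\<integral>\<omega>. F s \<omega> * cnj (F t \<omega>) \<partial>M) -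
      (\<integral>\<omega>. Uk k t \<omega> * cnj (F s \<omega>) \<partial>M) * (\<integral>\<omega>. Uk k s \<omega> * cnj (F t \<omega>) \<partial>M)) / 2) \<longlonglongrightarrow> kernel (t - s)"
proof -
  have h0: "hs k \<noteq> 0" for k using hs(1)[of k] by simp
  note ul = usym_tendsto(2)[OF hs(3) h0]
  have a: "(\<lambda>k. CLINT l|\<rho>. of_real ((cmod (usym (hs k) l))\<^sup>2) * iexp (- (\<tau> * l))) \<longlonglongrightarrow> (CLINT l|\<rho>. of_real ((l - mean)\<^sup>2) * iexp (- (\<tau> * l)))" for \<tau>
  proof (rule integral_dominated_convergence[OF _ _ integrable_bsym(2)])
    have "(\<lambda>k. complex_of_real ((cmod (usym (hs k) l))\<^sup>2) * iexp (- (\<tau> * l))) \<longlonglongrightarrow> of_real ((cmod (- \<i> * of_real (l - mean)))\<^sup>2) * iexp (- (\<tau> * l))" for l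
      by (intro tendsto_intros ul)
    then show "AE l in \<rho>. (\<lambda>k. complex_of_real ((cmod (usym (hs k) l))\<^sup>2) * iexp (- (\<tau> * l))) \<longlonglongrightarrow> of_real ((l - mean)\<^sup>2) * iexp (- (\<tau> * l))"
      unfolding norm_mult norm_of_real by simp
    show "AE l in \<rho>. norm (complex_of_real ((cmod (usym (hs k) l))\<^sup>2) * iexp (- (\<tau> * l))) \<le> (bsym l)\<^sup>2" for k
      using norm_usym_le by (intro AE_I2) (simp add: norm_mult norm_power power_mono)
  qed auto
  have b: "(\<lambda>k. CLINT l|\<rho>. usym (hs k) l * iexp (- (\<tau> * l))) \<longlonglongrightarrow> - \<i> * (CLINT l|\<rho>. of_real (l - mean) * iexp (- (\<tau> * l)))" for \<tau>
  proof -
    have "(\<lambda>k. CLINT l|\<rho>. usym (hs k) l * iexp (- (\<tau> * l))) \<longlonglongrightarrow> (CLINT l|\<rho>. - \<i> * (of_real (l - mean) * iexp (- (\<tau> * l))))"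
    proof (rule integral_dominated_convergence[OF _ _ integrable_bsym(1)])
      have "(\<lambda>k. usym (hs k) l * iexp (- (\<tau> * l))) \<longlonglongrightarrow> - \<i> * of_real (l - mean) * iexp (- (\<tau> * l))" for l
        by (intro tendsto_intros ul)
      then show "AE l in \<rho>. (\<lambda>k. usym (hs k) l * iexp (- (\<tau> * l))) \<longlonglongrightarrow> - \<i> * (of_real (l - mean) * iexp (- (\<tau> * l)))"
        unfolding mult.assoc by (intro AE_I2)
      show "AE l in \<rho>. norm (usym (hs k) l * iexp (- (\<tau> * l))) \<le> bsym l" for k
        using norm_usym_le by (intro AE_I2) (simp add: norm_mult)
    qed auto
    then show ?thesis by (simp only: integral_mult_right_zero)
  qed
  have e: "- ((s - t) * l) = (t - s) * l" for l by (simp add: algebra_simps)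
  have "(\<lambda>k. Re ((CLINT l|\<rho>. of_real ((cmod (usym (hs k) l))\<^sup>2) * iexp (- ((t - s) * l))) * (CLINT l|\<rho>. iexp ((t - s) * l)) -
      (CLINT l|\<rho>. usym (hs k) l * iexp (- ((t - s) * l))) * (CLINT l|\<rho>. usym (hs k) l * iexp (- ((s - t) * l)))) / 2)
    \<longlonglongrightarrow> Re ((CLINT l|\<rho>. of_real ((l - mean)\<^sup>2) * iexp (- ((t - s) * l))) * (CLINT l|\<rho>. iexp ((t - s) * l)) -
      (- \<i> * (CLINT l|\<rho>. of_real (l - mean) * iexp (- ((t - s) * l)))) * (- \<i> * (CLINT l|\<rho>. of_real (l - mean) * iexp (- ((s - t) * l))))) / 2"
    by (intro tendsto_intros a b) simp
  then show ?thesis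
    unfolding Uk_covariances spectral_kernel_def e by (simp add: algebra_simps)
qed

text \<open>The sum of the two constants fed into \<open>weighted_Vitali\<close> below: a bound for
  the mean of \<open>|\<phi> (F t)|\<close> and the uniform bound on the weighted squares.\<close>

definition covbound :: real where
  "covbound = negmom 1 + 1 + mom 1 + (negmom (3/2) + mom 1 + 3 * mom 9 + 3 * mom 6)"

lemma Im_mult_Im: "Im a * Im b = Re (a * cnj b - a * b) / 2"
  by (simp add: field_simps)

text \<open>For the corrected quotients the value follows from
  \<open>gaussian_quotient_covariance\<close> and does not depend on \<open>\<phi>\<close>. In the
  limit the modulus of \<open>\<phi> (F t)\<close> serves as weight, because
  \<open>1 / |F t|\<close> is integrable but not square integrable. The case \<open>1 / x\<close>
  then relates winding and projection, and \<open>cnj\<close> gives the second moment of the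
  projection.\<close>

lemma weighted_kernel:
  fixes \<phi> :: "complex \<Rightarrow> complex"
  assumes \<phi> [measurable]: "\<phi> \<in> borel_measurable borel" and bd: "\<And>x. cmod (\<phi> x) \<le> 1 / cmod x + cmod x"
    and \<phi>1: "(\<integral>\<omega>. \<phi> (F t \<omega>) * F t \<omega> \<partial>M) = 1"
  shows "(\<integral>\<^sup>+\<omega>. ennreal \<bar>Im (U t \<omega> * \<phi> (F t \<omega>)) * Im (U s \<omega> * cnj (F s \<omega>))\<bar> \<partial>M) \<le> ennreal covbound"
    and "(\<integral>\<omega>. Im (U t \<omega> * \<phi> (F t \<omega>)) * Im (U s \<omega> * cnj (F s \<omega>)) \<partial>M) = kernel (t - s)"
proof -
  define y where "y \<omega> = cmod (\<phi> (F t \<omega>))" for \<omega>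
  \<comment> \<open>Only the phase of \<open>\<phi> (F t)\<close> stays in \<open>w\<close>;
    together with the weight \<open>y\<close> it restores \<open>\<phi>\<close>, which is the
    identity \<open>pull\<close>.\<close>
  define w where "w k \<omega> = Im (Uk k t \<omega> * sgn (\<phi> (F t \<omega>))) * Im (Uk k s \<omega> * cnj (F s \<omega>))" for k \<omega>
  define v where "v \<omega> = Im (U t \<omega> * sgn (\<phi> (F t \<omega>))) * Im (U s \<omega> * cnj (F s \<omega>))" for \<omega>
  have [measurable]: "(sgn :: complex \<Rightarrow> complex) \<in> borel_measurable borel"
    unfolding sgn_div_norm[abs_def] by measurable
  have [measurable]: "y \<in> borel_measurable M" unfolding y_def by measurable
  have wm [measurable]: "w k \<in> borel_measurable M" for k unfolding w_def by measurable
  have vm [measurable]: "v \<in> borel_measurable M" unfolding v_def by measurable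
  have pull: "cmod c * Im (z * sgn c) = Im (z * c)" for z c :: complex
  proof -
    have "cmod c *\<^sub>R sgn c = c" by (cases "c = 0") (simp_all add: sgn_div_norm)
    then have "cmod c *\<^sub>R (z * sgn c) = z * c" by (simp only: mult_scaleR_right[symmetric])
    then show ?thesis by (metis scaleR_complex.simps(2))
  qed
  have ile: "\<bar>Im (z * sgn c)\<bar> \<le> cmod z" for z c :: complex
  proof -
    have "\<bar>Im (z * sgn c)\<bar> \<le> cmod z * cmod (sgn c)" using abs_Im_le_cmod[of "z * sgn c"] by (simp add: norm_mult)
    also have "\<dots> \<le> cmod z * 1" by (intro mult_left_mono) (auto simp: norm_sgn)
    finally show ?thesis by simp
  qed
  have nnE: "(\<integral>\<^sup>+\<omega>. ennreal (cmod (F t \<omega>) powr - (3/2)) \<partial>M) = ennreal (negmom (3/2))"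
     "(\<integral>\<^sup>+\<omega>. ennreal (cmod (F t \<omega>) powr - 1) \<partial>M) = ennreal (negmom 1)"
    by (rule nn_F_neg_moment; simp)+
  have nny: "(\<integral>\<^sup>+\<omega>. ennreal (y \<omega>) \<partial>M) \<le> ennreal (negmom 1 + 1 + mom 1)"
  proof -
    have "ennreal (y \<omega>) \<le> ennreal (cmod (F t \<omega>) powr - 1) + (1 + ennreal (cmod (F t \<omega>) ^ (2 * 1)))" for \<omega>
    proof -
      have "y \<omega> \<le> 1 / cmod (F t \<omega>) + cmod (F t \<omega>)" unfolding y_def by (rule bd)
      moreover have "cmod (F t \<omega>) \<le> 1 + cmod (F t \<omega>) ^ (2 * 1)" using power_le_one_plus[of "cmod (F t \<omega>)" 1 2] by simp
      moreover have "1 / cmod (F t \<omega>) = cmod (F t \<omega>) powr - 1" by (simp add: powr_minus_divide)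
      ultimately have "y \<omega> \<le> cmod (F t \<omega>) powr - 1 + (1 + cmod (F t \<omega>) ^ (2 * 1))" by linarith
      then have "ennreal (y \<omega>) \<le> ennreal (cmod (F t \<omega>) powr - 1 + (1 + cmod (F t \<omega>) ^ (2 * 1)))" by (rule ennreal_leI)
      also have "\<dots> = ennreal (cmod (F t \<omega>) powr - 1) + ennreal (1 + cmod (F t \<omega>) ^ (2 * 1))"
        by (rule ennreal_plus) (auto intro: add_nonneg_nonneg)
      also have "ennreal (1 + cmod (F t \<omega>) ^ (2 * 1)) = 1 + ennreal (cmod (F t \<omega>) ^ (2 * 1))"
        by (subst ennreal_plus) auto
      finally show ?thesis .
    qed
    then have "(\<integral>\<^sup>+\<omega>. ennreal (y \<omega>) \<partial>M) \<le> (\<integral>\<^sup>+\<omega>. ennreal (cmod (F t \<omega>) powr - 1) + (1 + ennreal (cmod (F t \<omega>) ^ (2 * 1))) \<partial>M)"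
      by (rule nn_integral_mono)
    also have "\<dots> = (\<integral>\<^sup>+\<omega>. ennreal (cmod (F t \<omega>) powr - 1) \<partial>M) + (1 + (\<integral>\<^sup>+\<omega>. ennreal (cmod (F t \<omega>) ^ (2 * 1)) \<partial>M))"
      by (subst nn_integral_add, measurable, subst nn_integral_add) (auto simp: emeasure_space_1)
    also have "\<dots> \<le> ennreal (negmom 1) + (1 + ennreal (mom 1))"
      unfolding nnE by (intro add_left_mono nn_F_moment)
    also have "\<dots> = ennreal (negmom 1 + 1 + mom 1)" using mom_nonneg[of 1] by (simp add: add.assoc)
    finally show ?thesis .
  qed
  have yint: "integrable M y"
    using nny by (intro integrableI_nonneg) (auto simp: y_def intro: le_less_trans)
  have yle: "(\<integral>\<omega>. y \<omega> \<partial>M) \<le> negmom 1 + 1 + mom 1"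
  proof -
    have "(\<integral>\<^sup>+\<omega>. ennreal (y \<omega>) \<partial>M) = ennreal (\<integral>\<omega>. y \<omega> \<partial>M)"
      by (rule nn_integral_eq_integral[OF yint]) (simp add: y_def)
    with nny have "ennreal (\<integral>\<omega>. y \<omega> \<partial>M) \<le> ennreal (negmom 1 + 1 + mom 1)" by (simp only:)
    moreover have "0 \<le> negmom 1 + 1 + mom 1" using mom_nonneg[of 1] negmom_nonneg[of 1] by linarith
    ultimately show ?thesis by (simp only: ennreal_le_iff)
  qed
  define C where "C = negmom (3/2) + mom 1 + 3 * mom 9 + 3 * mom 6"
  have C: "0 \<le> C" using mom_nonneg by (simp add: C_def)
  have wbd: "(\<integral>\<^sup>+\<omega>. ennreal (y \<omega> * (w k \<omega>)\<^sup>2) \<partial>M) \<le> ennreal C" for k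
  proof -
    let ?x = "\<lambda>\<omega>. cmod (F t \<omega>)" and ?a = "\<lambda>\<omega>. cmod (Uk k t \<omega>)" and ?b = "\<lambda>\<omega>. cmod (Uk k s \<omega>)" and ?c = "\<lambda>\<omega>. cmod (F s \<omega>)"
    \<comment> \<open>In \<open>V ^ 3\<close> each of the three moduli has power 6, and in
      \<open>V\<^sup>2\<close> power 4. Separating a product of three factors into cubes triples
      these powers, which gives 18 and 12, that is \<open>2 * 9\<close> and
      \<open>2 * 6\<close>.\<close>
    have "y \<omega> * (w k \<omega>)\<^sup>2 \<le> ?x \<omega> powr - (3/2) + ?x \<omega> ^ (2 * 1) + (?a \<omega> ^ (2 * 9) + ?b \<omega> ^ (2 * 9) + ?c \<omega> ^ (2 * 9)) + (?a \<omega> ^ (2 * 6) + ?b \<omega> ^ (2 * 6) + ?c \<omega> ^ (2 * 6))" for \<omega>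
    proof -
      define V where "V = (?a \<omega> * ?b \<omega> * ?c \<omega>)\<^sup>2"
      have "\<bar>w k \<omega>\<bar> \<le> ?a \<omega> * (?b \<omega> * ?c \<omega>)"
        unfolding w_def abs_mult using abs_Im_le_cmod[of "Uk k s \<omega> * cnj (F s \<omega>)"] by (intro mult_mono ile) (auto simp: norm_mult)
      then have "(w k \<omega>)\<^sup>2 \<le> V" unfolding V_def mult.assoc by (metis abs_ge_zero power2_abs power_mono)
      then have "y \<omega> * (w k \<omega>)\<^sup>2 \<le> (1 / ?x \<omega> + ?x \<omega>) * V"
        using bd[of "F t \<omega>"] by (intro mult_mono) (auto simp: y_def)
      also have "\<dots> \<le> ?x \<omega> powr - (3/2) + V ^ 3 + (?x \<omega>)\<^sup>2 + V\<^sup>2"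
        by (rule mult_le_powr_sum2) (auto simp: V_def)
      also have "V ^ 3 = (?a \<omega>) ^ 6 * (?b \<omega>) ^ 6 * (?c \<omega>) ^ 6" by (simp add: V_def power_mult_distrib flip: power_mult)
      also have "\<dots> \<le> (?a \<omega> ^ 6) ^ 3 + (?b \<omega> ^ 6) ^ 3 + (?c \<omega> ^ 6) ^ 3" by (rule prod3_le_sum_cubes) auto
      also have "V\<^sup>2 = (?a \<omega>) ^ 4 * (?b \<omega>) ^ 4 * (?c \<omega>) ^ 4" by (simp add: V_def power_mult_distrib flip: power_mult)
      also have "\<dots> \<le> (?a \<omega> ^ 4) ^ 3 + (?b \<omega> ^ 4) ^ 3 + (?c \<omega> ^ 4) ^ 3" by (rule prod3_le_sum_cubes) auto
      finally show ?thesis by (simp add: power_mult[symmetric])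
    qed
    then have "ennreal (y \<omega> * (w k \<omega>)\<^sup>2) \<le> ennreal (?x \<omega> powr - (3/2) + ?x \<omega> ^ (2 * 1) + (?a \<omega> ^ (2 * 9) + ?b \<omega> ^ (2 * 9) + ?c \<omega> ^ (2 * 9)) + (?a \<omega> ^ (2 * 6) + ?b \<omega> ^ (2 * 6) + ?c \<omega> ^ (2 * 6)))" for \<omega>
      by (rule ennreal_leI)
    then have "(\<integral>\<^sup>+\<omega>. ennreal (y \<omega> * (w k \<omega>)\<^sup>2) \<partial>M) \<le> (\<integral>\<^sup>+\<omega>. ennreal (?x \<omega> powr - (3/2)) + ennreal (?x \<omega> ^ (2 * 1)) + (ennreal (?a \<omega> ^ (2 * 9)) + ennreal (?b \<omega> ^ (2 * 9)) + ennreal (?c \<omega> ^ (2 * 9))) + (ennreal (?a \<omega> ^ (2 * 6)) + ennreal (?b \<omega> ^ (2 * 6)) + ennreal (?c \<omega> ^ (2 * 6))) \<partial>M)"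
      by (intro nn_integral_mono) (simp del: ennreal_power)
    also have "\<dots> = (\<integral>\<^sup>+\<omega>. ennreal (?x \<omega> powr - (3/2)) \<partial>M) + (\<integral>\<^sup>+\<omega>. ennreal (?x \<omega> ^ (2 * 1)) \<partial>M) + ((\<integral>\<^sup>+\<omega>. ennreal (?a \<omega> ^ (2 * 9)) \<partial>M) + (\<integral>\<^sup>+\<omega>. ennreal (?b \<omega> ^ (2 * 9)) \<partial>M) + (\<integral>\<^sup>+\<omega>. ennreal (?c \<omega> ^ (2 * 9)) \<partial>M)) + ((\<integral>\<^sup>+\<omega>. ennreal (?a \<omega> ^ (2 * 6)) \<partial>M) + (\<integral>\<^sup>+\<omega>. ennreal (?b \<omega> ^ (2 * 6)) \<partial>M) + (\<integral>\<^sup>+\<omega>. ennreal (?c \<omega> ^ (2 * 6)) \<partial>M))"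
      by (rule nn_integral_add8) measurable
    also have "\<dots> \<le> ennreal (negmom (3/2)) + ennreal (mom 1) + (ennreal (mom 9) + ennreal (mom 9) + ennreal (mom 9)) + (ennreal (mom 6) + ennreal (mom 6) + ennreal (mom 6))"
      unfolding nnE by (intro add_mono nn_F_moment nn_Uk_moment order_refl)
    also have "\<dots> = ennreal (negmom (3/2) + mom 1 + (mom 9 + mom 9 + mom 9) + (mom 6 + mom 6 + mom 6))"
      using mom_nonneg by (simp flip: ennreal_plus)
    also have "negmom (3/2) + mom 1 + (mom 9 + mom 9 + mom 9) + (mom 6 + mom 6 + mom 6) = C" by (simp add: C_def)
    finally show ?thesis .
  qed
  have lim: "AE \<omega> in M. (\<lambda>k. w k \<omega>) \<longlonglongrightarrow> v \<omega>"
    using AE_Uk_lim[of t] AE_Uk_lim[of s]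
  proof eventually_elim
    case (elim \<omega>)
    show ?case unfolding w_def v_def by (intro tendsto_intros elim)
  qed
  have y0: "0 \<le> y \<omega>" for \<omega> by (simp add: y_def)
  note vit = weighted_Vitali[OF yint y0 wm vm lim wbd C]
  have yw: "y \<omega> * w k \<omega> = Im (Uk k t \<omega> * \<phi> (F t \<omega>)) * Im (Uk k s \<omega> * cnj (F s \<omega>))" for k \<omega>
    unfolding w_def y_def mult.assoc[symmetric] pull ..
  have yv: "y \<omega> * v \<omega> = Im (U t \<omega> * \<phi> (F t \<omega>)) * Im (U s \<omega> * cnj (F s \<omega>))" for \<omega>
    unfolding v_def y_def mult.assoc[symmetric] pull ..
  have yvabs: "y \<omega> * \<bar>v \<omega>\<bar> = \<bar>Im (U t \<omega> * \<phi> (F t \<omega>)) * Im (U s \<omega> * cnj (F s \<omega>))\<bar>" for \<omega>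
    unfolding yv[symmetric] by (simp add: abs_mult y0)
  show "(\<integral>\<^sup>+\<omega>. ennreal \<bar>Im (U t \<omega> * \<phi> (F t \<omega>)) * Im (U s \<omega> * cnj (F s \<omega>))\<bar> \<partial>M) \<le> ennreal covbound"
    unfolding yvabs[symmetric] using yle by (intro order_trans[OF vit(2)] ennreal_leI) (simp add: covbound_def C_def)
  have Ek: "(\<integral>\<omega>. y \<omega> * w k \<omega> \<partial>M) = Re ((\<integral>\<omega>. Uk k t \<omega> * cnj (Uk k s \<omega>) \<partial>M) * (\<integral>\<omega>. F s \<omega> * cnj (F t \<omega>) \<partial>M) -
      (\<integral>\<omega>. Uk k t \<omega> * cnj (F s \<omega>) \<partial>M) * (\<integral>\<omega>. Uk k s \<omega> * cnj (F t \<omega>) \<partial>M)) / 2" for k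
  proof -
    \<comment> \<open>The product of two imaginary parts contains the second factor once conjugated
      and once not; \<open>P\<close> and \<open>P'\<close> list \<open>F s\<close> and the quotient
      at \<open>s\<close> in the two corresponding orders.\<close>
    define P where "P i = (if i = 0 then [(1, t)] else if i = 1 then uq (hs k) t else if i = 2 then uq (hs k) s else [(1, s)])" for i :: nat
    define P' where "P' i = (if i = 0 then [(1, t)] else if i = 1 then uq (hs k) t else if i = 2 then [(1, s)] else uq (hs k) s)" for i :: nat
    have G: "complex_gaussian_vector M {0, 1, 2, 3} (\<lambda>i. lin_comb F (P i))" by (rule lin_comb_gaussian) auto
    have G': "complex_gaussian_vector M {0, 1, 2, 3} (\<lambda>i. lin_comb F (P' i))" by (rule lin_comb_gaussian) auto
    have orth: "(\<integral>\<omega>. Uk k t \<omega> * cnj (F t \<omega>) \<partial>M) = 0"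
      unfolding Uk_covariances using integral_usym by simp
    have Pi: "P 0 = [(1, t)]" "P 1 = uq (hs k) t" "P 2 = uq (hs k) s" "P 3 = [(1, s)]" by (auto simp: P_def)
    have Pi': "P' 0 = [(1, t)]" "P' 1 = uq (hs k) t" "P' 2 = [(1, s)]" "P' 3 = uq (hs k) s" by (auto simp: P'_def)
    note q1 = gaussian_quotient_covariance[OF prob_space_axioms G, unfolded Pi F_lin_comb, OF F_second_moment orth \<phi> bd \<phi>1]
    note q2 = gaussian_quotient_covariance[OF prob_space_axioms G', unfolded Pi' F_lin_comb, OF F_second_moment orth \<phi> bd \<phi>1]
    let ?A = "\<lambda>\<omega>. Uk k t \<omega> * \<phi> (F t \<omega>) * (F s \<omega> * cnj (Uk k s \<omega>))" and ?B = "\<lambda>\<omega>. Uk k t \<omega> * \<phi> (F t \<omega>) * (Uk k s \<omega> * cnj (F s \<omega>))"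
    have "y \<omega> * w k \<omega> = Re (?A \<omega> - ?B \<omega>) / 2" for \<omega>
    proof -
      have "cnj (Uk k s \<omega> * cnj (F s \<omega>)) = F s \<omega> * cnj (Uk k s \<omega>)" by (simp only: complex_cnj_mult complex_cnj_cnj mult.commute)
      then show ?thesis unfolding yw Im_mult_Im by (simp only:)
    qed
    then have "(\<integral>\<omega>. y \<omega> * w k \<omega> \<partial>M) = (\<integral>\<omega>. Re (?A \<omega> - ?B \<omega>) / 2 \<partial>M)" by (simp only:)
    also have "\<dots> = (\<integral>\<omega>. Re (?A \<omega> - ?B \<omega>) \<partial>M) / 2" by (rule integral_divide_zero)
    also have "(\<integral>\<omega>. Re (?A \<omega> - ?B \<omega>) \<partial>M) = Re (\<integral>\<omega>. ?A \<omega> - ?B \<omega> \<partial>M)"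
      by (intro integral_Re Bochner_Integration.integrable_diff q1(1) q2(1))
    also have "(\<integral>\<omega>. ?A \<omega> - ?B \<omega> \<partial>M) = (\<integral>\<omega>. ?A \<omega> \<partial>M) - (\<integral>\<omega>. ?B \<omega> \<partial>M)"
      by (intro Bochner_Integration.integral_diff q1(1) q2(1))
    finally show ?thesis unfolding q1(2) q2(2) .
  qed
  have "(\<lambda>k. \<integral>\<omega>. y \<omega> * w k \<omega> \<partial>M) \<longlonglongrightarrow> kernel (t - s)"
    unfolding Ek by (rule kernel_limit)
  then have "(\<integral>\<omega>. y \<omega> * v \<omega> \<partial>M) = kernel (t - s)"
    using vit(3) by (rule LIMSEQ_unique[rotated])
  then show "(\<integral>\<omega>. Im (U t \<omega> * \<phi> (F t \<omega>)) * Im (U s \<omega> * cnj (F s \<omega>)) \<partial>M) = kernel (t - s)"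
    unfolding yv .
qed

text \<open>The corrected quotient is orthogonal to \<open>F\<close> at the same time, so the mean
  is zero before the limit; the limit is taken with constant weight 1.\<close>

lemma integral_Im_U:
  "(\<integral>\<omega>. Im (U s \<omega> * cnj (F s \<omega>)) \<partial>M) = 0" "(\<integral>\<^sup>+\<omega>. ennreal \<bar>Im (U s \<omega> * cnj (F s \<omega>))\<bar> \<partial>M) \<le> ennreal (1 + 2 * mom 2)"
proof -
  define w where "w k \<omega> = Im (Uk k s \<omega> * cnj (F s \<omega>))" for k \<omega>
  define v where "v \<omega> = Im (U s \<omega> * cnj (F s \<omega>))" for \<omega>
  have wm [measurable]: "w k \<in> borel_measurable M" for k unfolding w_def by measurable
  have vm [measurable]: "v \<in> borel_measurable M" unfolding v_def by measurable
  have lim: "AE \<omega> in M. (\<lambda>k. w k \<omega>) \<longlonglongrightarrow> v \<omega>"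
    using AE_Uk_lim[of s]
  proof eventually_elim
    case (elim \<omega>)
    show ?case unfolding w_def v_def by (intro tendsto_intros elim)
  qed
  have bd: "(\<integral>\<^sup>+\<omega>. ennreal (1 * (w k \<omega>)\<^sup>2) \<partial>M) \<le> ennreal (2 * mom 2)" for k
  proof -
    have "(w k \<omega>)\<^sup>2 \<le> cmod (Uk k s \<omega>) ^ (2 * 2) + cmod (F s \<omega>) ^ (2 * 2)" for \<omega>
    proof -
      have "\<bar>w k \<omega>\<bar> \<le> cmod (Uk k s \<omega>) * cmod (F s \<omega>)" unfolding w_def using abs_Im_le_cmod[of "Uk k s \<omega> * cnj (F s \<omega>)"] by (simp add: norm_mult)
      then have "(w k \<omega>)\<^sup>2 \<le> (cmod (Uk k s \<omega>) * cmod (F s \<omega>))\<^sup>2" by (metis abs_ge_zero power2_abs power_mono)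
      also have "\<dots> = (cmod (Uk k s \<omega>))\<^sup>2 * (cmod (F s \<omega>))\<^sup>2" by (rule power_mult_distrib)
      also have "\<dots> \<le> ((cmod (Uk k s \<omega>))\<^sup>2)\<^sup>2 + ((cmod (F s \<omega>))\<^sup>2)\<^sup>2" by (rule prod2_le_sum_squares) auto
      finally show ?thesis by (simp add: power_mult[symmetric])
    qed
    then have "ennreal ((w k \<omega>)\<^sup>2) \<le> ennreal (cmod (Uk k s \<omega>) ^ (2 * 2) + cmod (F s \<omega>) ^ (2 * 2))" for \<omega> by (rule ennreal_leI)
    then have "(\<integral>\<^sup>+\<omega>. ennreal (1 * (w k \<omega>)\<^sup>2) \<partial>M) \<le> (\<integral>\<^sup>+\<omega>. ennreal (cmod (Uk k s \<omega>) ^ (2 * 2)) + ennreal (cmod (F s \<omega>) ^ (2 * 2)) \<partial>M)"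
      by (intro nn_integral_mono) (simp del: ennreal_power)
    also have "\<dots> = (\<integral>\<^sup>+\<omega>. ennreal (cmod (Uk k s \<omega>) ^ (2 * 2)) \<partial>M) + (\<integral>\<^sup>+\<omega>. ennreal (cmod (F s \<omega>) ^ (2 * 2)) \<partial>M)"
      by (rule nn_integral_add) measurable
    also have "\<dots> \<le> ennreal (mom 2) + ennreal (mom 2)" by (intro add_mono nn_F_moment nn_Uk_moment)
    also have "\<dots> = ennreal (2 * mom 2)" using mom_nonneg[of 2] by (simp flip: ennreal_plus)
    finally show ?thesis .
  qed
  have c: "0 \<le> 2 * mom 2" using mom_nonneg[of 2] by simp
  have one: "integrable M (\<lambda>\<omega>. 1 :: real)" "\<And>\<omega>::'a. (0::real) \<le> 1" by auto
  note vit = weighted_Vitali[OF one wm vm lim bd c]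
  show "(\<integral>\<^sup>+\<omega>. ennreal \<bar>Im (U s \<omega> * cnj (F s \<omega>))\<bar> \<partial>M) \<le> ennreal (1 + 2 * mom 2)"
    using vit(2) prob_space by (simp add: v_def)
  have "(\<integral>\<omega>. w k \<omega> \<partial>M) = 0" for k
  proof -
    have "(\<integral>\<omega>. w k \<omega> \<partial>M) = Im (\<integral>\<omega>. Uk k s \<omega> * cnj (F s \<omega>) \<partial>M)"
      unfolding w_def using lin_comb_integrable(2)[of "uq (hs k) s" "[(1, s)]"] by (intro integral_Im) (simp only: F_lin_comb)
    also have "(\<integral>\<omega>. Uk k s \<omega> * cnj (F s \<omega>) \<partial>M) = 0"
      unfolding Uk_covariances using integral_usym by simp
    finally show ?thesis by simp
  qed
  then have "(\<lambda>k. \<integral>\<omega>. 1 * w k \<omega> \<partial>M) \<longlonglongrightarrow> 0" by simp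
  then have "(\<integral>\<omega>. 1 * v \<omega> \<partial>M) = 0" using vit(3) by (rule LIMSEQ_unique[rotated])
  then show "(\<integral>\<omega>. Im (U s \<omega> * cnj (F s \<omega>)) \<partial>M) = 0" by (simp add: v_def)
qed

end

subsection \<open>Lower bound for the integrated spectral kernel\<close>

lemma cos_ge_half: "\<bar>x\<bar> \<le> 1 \<Longrightarrow> 1 / 2 \<le> cos (x::real)"
proof -
  assume x: "\<bar>x\<bar> \<le> 1"
  have "\<bar>sin (x / 2)\<bar> \<le> \<bar>x / 2\<bar>" by (rule abs_sin_x_le_abs_x)
  also have "\<dots> \<le> 1 / 2" using x by simp
  finally have "\<bar>sin (x / 2)\<bar>\<^sup>2 \<le> (1 / 2)\<^sup>2" by (intro power_mono) auto
  then have "(sin (x / 2))\<^sup>2 \<le> 1 / 4" by (simp add: power2_eq_square)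
  moreover have "cos x = 1 - 2 * (sin (x / 2))\<^sup>2" using cos_double_sin[of "x / 2"] by simp
  ultimately show ?thesis by simp
qed

text \<open>The double integral is the squared modulus of \<open>\<integral>\<^sub>0\<^sup>T exp (i t x) dt\<close>.\<close>

lemma Fejer_integral:
  fixes x T :: real
  assumes T: "0 \<le> T"
  defines "J \<equiv> (\<integral>t. indicator {0..T} t * (\<integral>s. indicator {0..T} s * cos ((t - s) * x) \<partial>lborel) \<partial>lborel)"
  shows "0 \<le> J" "\<bar>x\<bar> * T \<le> 1 \<Longrightarrow> T\<^sup>2 / 4 \<le> J"
proof -
  define A where "A = (\<integral>s. indicator {0..T} s * cos (s * x) \<partial>lborel)"
  define B where "B = (\<integral>s. indicator {0..T} s * sin (s * x) \<partial>lborel)"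
  have i1: "integrable lborel (\<lambda>s. indicator {0..T} s * cos (s * x))"
    using borel_integrable_atLeastAtMost'[of 0 T "\<lambda>s. cos (s * x)"] by (simp add: set_integrable_def continuous_intros)
  have i2: "integrable lborel (\<lambda>s. indicator {0..T} s * sin (s * x))"
    using borel_integrable_atLeastAtMost'[of 0 T "\<lambda>s. sin (s * x)"] by (simp add: set_integrable_def continuous_intros)
  have inner: "(\<integral>s. indicator {0..T} s * cos ((t - s) * x) \<partial>lborel) = cos (t * x) * A + sin (t * x) * B" for t
  proof -
    have "indicator {0..T} s * cos ((t - s) * x) = cos (t * x) * (indicator {0..T} s * cos (s * x)) + sin (t * x) * (indicator {0..T} s * sin (s * x))" for s
      by (simp add: left_diff_distrib cos_diff algebra_simps)
    then show ?thesis using i1 i2 by (simp add: A_def B_def)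
  qed
  have "J = (\<integral>t. A * (indicator {0..T} t * cos (t * x)) + B * (indicator {0..T} t * sin (t * x)) \<partial>lborel)"
    unfolding J_def inner by (simp add: algebra_simps)
  also have "\<dots> = A * A + B * B"
    using i1 i2 by (simp add: A_def[symmetric] B_def[symmetric])
  finally have J: "J = A * A + B * B" .
  show "0 \<le> J" unfolding J by simp
  assume x: "\<bar>x\<bar> * T \<le> 1"
  have "(\<integral>s. indicator {0..T} s * (1 / 2) \<partial>lborel) \<le> A"
    unfolding A_def
  proof (rule integral_mono[OF _ i1])
    show "integrable lborel (\<lambda>s. indicator {0..T} s * (1 / 2 :: real))"
      by (intro integrable_mult_left integrable_real_indicator) (auto simp: emeasure_lborel_Icc_eq)
    fix s
    show "indicator {0..T} s * (1 / 2) \<le> indicator {0..T} s * cos (s * x)"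
    proof (cases "s \<in> {0..T}")
      case True
      then have "\<bar>s * x\<bar> \<le> \<bar>x\<bar> * T" by (simp add: abs_mult mult.commute[of _ T] mult_right_mono)
      then have "1 / 2 \<le> cos (s * x)" using x by (intro cos_ge_half) linarith
      then show ?thesis using True by simp
    qed simp
  qed
  then have "T / 2 \<le> A" using T by simp
  then have "(T / 2) * (T / 2) \<le> A * A" using T by (intro mult_mono) auto
  then show "T\<^sup>2 / 4 \<le> J" unfolding J by (simp add: power2_eq_square add_increasing2)
qed

context real_distribution
begin

section \<open>The kernel as a double spectral integral and its lower bound\<close>

sublocale MM: pair_sigma_finite M M ..
sublocale PP: pair_prob_space M M ..

lemma product_integrable_pair:
  fixes a b :: "real \<Rightarrow> real"
  assumes a: "integrable M a" and b: "integrable M b"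
  shows "integrable (M \<Otimes>\<^sub>M M) (\<lambda>z. a (fst z) * b (snd z))"
proof (rule integrableI_bounded)
  have [measurable]: "a \<in> borel_measurable M" "b \<in> borel_measurable M" using a b by auto
  show "(\<lambda>z. a (fst z) * b (snd z)) \<in> borel_measurable (M \<Otimes>\<^sub>M M)" by measurable
  have "(\<integral>\<^sup>+z. ennreal (norm (a (fst z) * b (snd z))) \<partial>(M \<Otimes>\<^sub>M M)) = (\<integral>\<^sup>+x. \<integral>\<^sup>+y. ennreal (norm (a x)) * ennreal (norm (b y)) \<partial>M \<partial>M)"
    by (subst nn_integral_fst[symmetric]) (auto simp: abs_mult ennreal_mult)
  also have "\<dots> = (\<integral>\<^sup>+x. ennreal (norm (a x)) \<partial>M) * (\<integral>\<^sup>+y. ennreal (norm (b y)) \<partial>M)"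
    by (simp add: nn_integral_cmult nn_integral_multc)
  also have "\<dots> < \<infinity>" using a b by (auto simp: integrable_iff_bounded ennreal_mult_less_top)
  finally show "(\<integral>\<^sup>+z. ennreal (norm (a (fst z) * b (snd z))) \<partial>(M \<Otimes>\<^sub>M M)) < \<infinity>" .
qed

text \<open>The two transforms have opposite signs in the exponent, so the product depends on the
  frequencies through their difference and its real part is a cosine.\<close>

lemma Re_Fourier_product:
  fixes a b :: "real \<Rightarrow> real"
  assumes a: "integrable M a" and b: "integrable M b"
  shows "Re ((CLINT l|M. of_real (a l) * iexp (- (\<tau> * l))) * (CLINT l|M. of_real (b l) * iexp (\<tau> * l)))
    = (\<integral>z. a (fst z) * b (snd z) * cos (\<tau> * (fst z - snd z)) \<partial>(M \<Otimes>\<^sub>M M))"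
proof -
  have [measurable]: "a \<in> borel_measurable M" "b \<in> borel_measurable M" using a b by auto
  let ?f = "\<lambda>z. complex_of_real (a (fst z) * b (snd z)) * iexp (- (\<tau> * (fst z - snd z)))"
  have int: "integrable (M \<Otimes>\<^sub>M M) ?f"
  proof (rule Bochner_Integration.integrable_bound[OF product_integrable_pair[OF a b]])
    show "?f \<in> borel_measurable (M \<Otimes>\<^sub>M M)" by measurable
    show "AE z in M \<Otimes>\<^sub>M M. norm (?f z) \<le> norm (a (fst z) * b (snd z))" by (simp add: norm_mult)
  qed
  have "(CLINT l|M. of_real (a l) * iexp (- (\<tau> * l))) * (CLINT l|M. of_real (b l) * iexp (\<tau> * l))
     = (CLINT l|M. (CLINT l'|M. of_real (a l) * iexp (- (\<tau> * l)) * (of_real (b l') * iexp (\<tau> * l'))))"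
    by (simp only: integral_mult_right_zero integral_mult_left_zero)
  also have "\<dots> = (CLINT l|M. (CLINT l'|M. ?f (l, l')))"
  proof (intro Bochner_Integration.integral_cong refl)
    fix l l'
    have "iexp (- (\<tau> * (l - l'))) = iexp (- (\<tau> * l)) * iexp (\<tau> * l')"
      by (simp add: mult_exp_exp algebra_simps)
    then show "of_real (a l) * iexp (- (\<tau> * l)) * (of_real (b l') * iexp (\<tau> * l')) = ?f (l, l')" by simp
  qed
  also have "\<dots> = (CLINT z|(M \<Otimes>\<^sub>M M). ?f z)"
    using MM.integral_fst'[OF int] by simp
  finally have "Re ((CLINT l|M. of_real (a l) * iexp (- (\<tau> * l))) * (CLINT l|M. of_real (b l) * iexp (\<tau> * l))) = Re (CLINT z|(M \<Otimes>\<^sub>M M). ?f z)"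
    by simp
  also have "\<dots> = (\<integral>z. Re (?f z) \<partial>(M \<Otimes>\<^sub>M M))" by (rule integral_Re[OF int, symmetric])
  also have "(\<lambda>z. Re (?f z)) = (\<lambda>z. a (fst z) * b (snd z) * cos (\<tau> * (fst z - snd z)))"
  proof
    fix z
    have "Re (iexp (- (\<tau> * (fst z - snd z)))) = cos (\<tau> * (fst z - snd z))" by (simp add: Re_exp)
    then show "Re (?f z) = a (fst z) * b (snd z) * cos (\<tau> * (fst z - snd z))" by (simp only: Re_complex_of_real Im_complex_of_real times_complex.simps mult_zero_left diff_zero)
  qed
  finally show ?thesis .
qed

text \<open>The cosine is symmetric in the two frequencies, so \<open>(p l)^2\<close> may be
  replaced by the average of \<open>(p l)^2\<close> and \<open>(p l')^2\<close>. Together with the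
  mixed term \<open>p l * p l'\<close> this completes a square, which makes the weight
  nonnegative.\<close>

lemma spectral_kernel_eq:
  assumes m2: "integrable M (\<lambda>l. l\<^sup>2)"
  defines "p \<equiv> \<lambda>l. l - spectral_mean M"
  shows "integrable (M \<Otimes>\<^sub>M M) (\<lambda>z. (p (fst z) + p (snd z))\<^sup>2)"
    and "spectral_kernel M \<tau> = (\<integral>z. (p (fst z) + p (snd z))\<^sup>2 * cos (\<tau> * (fst z - snd z)) \<partial>(M \<Otimes>\<^sub>M M)) / 4"
proof -
  have "integrable M (\<lambda>l. 1 + l\<^sup>2)" using m2 by simp
  then have i0: "integrable M (\<lambda>l. l)"
  proof (rule Bochner_Integration.integrable_bound)
    have "\<bar>l\<bar> \<le> 1 + l\<^sup>2" for l :: real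
      using power_le_one_plus[of "\<bar>l\<bar>" 1 2] by simp
    then show "AE l in M. norm l \<le> norm (1 + l\<^sup>2)" by (intro AE_I2) simp
  qed simp
  have i1: "integrable M p" unfolding p_def using i0 by simp
  have i2: "integrable M (\<lambda>l. (p l)\<^sup>2)" unfolding p_def power2_diff using i0 m2 by simp
  have one: "integrable M (\<lambda>l. 1 :: real)" by simp
  have [measurable]: "p \<in> borel_measurable borel" unfolding p_def by measurable
  have e: "(p x + p y)\<^sup>2 = (p x)\<^sup>2 * 1 + 1 * (p y)\<^sup>2 + 2 * (p x * p y)" for x y by (simp add: power2_sum)
  have P1: "integrable (M \<Otimes>\<^sub>M M) (\<lambda>z. (p (fst z))\<^sup>2 * 1)" by (rule product_integrable_pair[OF i2 one])
  have P2: "integrable (M \<Otimes>\<^sub>M M) (\<lambda>z. 1 * (p (snd z))\<^sup>2)" by (rule product_integrable_pair[OF one i2])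
  have P3: "integrable (M \<Otimes>\<^sub>M M) (\<lambda>z. p (fst z) * p (snd z))" by (rule product_integrable_pair[OF i1 i1])
  show "integrable (M \<Otimes>\<^sub>M M) (\<lambda>z. (p (fst z) + p (snd z))\<^sup>2)"
    unfolding e by (intro Bochner_Integration.integrable_add integrable_mult_right P1 P2 P3)
  let ?c = "\<lambda>z::real\<times>real. cos (\<tau> * (fst z - snd z))"
  have Q: "integrable (M \<Otimes>\<^sub>M M) (\<lambda>z. g z * ?c z)" if g: "integrable (M \<Otimes>\<^sub>M M) g" for g
  proof (rule Bochner_Integration.integrable_bound[OF g])
    show "(\<lambda>z. g z * ?c z) \<in> borel_measurable (M \<Otimes>\<^sub>M M)" using g by measurable
    show "AE z in M \<Otimes>\<^sub>M M. norm (g z * ?c z) \<le> norm (g z)"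
      by (intro AE_I2) (simp add: abs_mult mult_left_le)
  qed
  have k1: "Re ((CLINT l|M. of_real ((p l)\<^sup>2) * iexp (- (\<tau> * l))) * (CLINT l|M. iexp (\<tau> * l))) = (\<integral>z. (p (fst z))\<^sup>2 * 1 * ?c z \<partial>(M \<Otimes>\<^sub>M M))"
    using Re_Fourier_product[OF i2 one, of \<tau>] by simp
  have k2: "Re ((CLINT l|M. of_real (p l) * iexp (- (\<tau> * l))) * (CLINT l|M. of_real (p l) * iexp (\<tau> * l))) = (\<integral>z. p (fst z) * p (snd z) * ?c z \<partial>(M \<Otimes>\<^sub>M M))"
    by (rule Re_Fourier_product[OF i1 i1])
  have sw: "(\<integral>z. 1 * (p (snd z))\<^sup>2 * ?c z \<partial>(M \<Otimes>\<^sub>M M)) = (\<integral>z. (p (fst z))\<^sup>2 * 1 * ?c z \<partial>(M \<Otimes>\<^sub>M M))"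
  proof -
    have cs: "cos (\<tau> * (x - y)) = cos (\<tau> * (y - x))" for x y
      using cos_minus[of "\<tau> * (x - y)"] by (simp add: algebra_simps)
    have "(\<integral>(x, y). (p x)\<^sup>2 * cos (\<tau> * (x - y)) \<partial>(M \<Otimes>\<^sub>M M)) = (\<integral>(x, y). (p y)\<^sup>2 * cos (\<tau> * (y - x)) \<partial>(M \<Otimes>\<^sub>M M))"
      using MM.integral_product_swap[of "\<lambda>(x, y). (p x)\<^sup>2 * cos (\<tau> * (x - y))"] by simp
    then show ?thesis by (simp add: split_beta' cs[of "snd _"])
  qed
  have "(\<integral>z. (p (fst z) + p (snd z))\<^sup>2 * ?c z \<partial>(M \<Otimes>\<^sub>M M)) =
     (\<integral>z. (p (fst z))\<^sup>2 * 1 * ?c z + 1 * (p (snd z))\<^sup>2 * ?c z + 2 * (p (fst z) * p (snd z) * ?c z) \<partial>(M \<Otimes>\<^sub>M M))"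
    unfolding e by (simp add: algebra_simps)
  also have "\<dots> = (\<integral>z. (p (fst z))\<^sup>2 * 1 * ?c z \<partial>(M \<Otimes>\<^sub>M M)) + (\<integral>z. 1 * (p (snd z))\<^sup>2 * ?c z \<partial>(M \<Otimes>\<^sub>M M)) + 2 * (\<integral>z. p (fst z) * p (snd z) * ?c z \<partial>(M \<Otimes>\<^sub>M M))"
    using Q[OF P1] Q[OF P2] Q[OF P3] by simp
  finally show "spectral_kernel M \<tau> = (\<integral>z. (p (fst z) + p (snd z))\<^sup>2 * ?c z \<partial>(M \<Otimes>\<^sub>M M)) / 4"
    unfolding sw spectral_kernel_def plus_complex.sel k1[unfolded p_def] k2[unfolded p_def] by (simp add: p_def)
qed

text \<open>Exchanging times and frequencies replaces the oscillating cosine by the nonnegative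
  \<open>J\<close>; contributions from part of the frequency plane can then be discarded in a lower
  bound.\<close>

lemma integral_spectral_kernel:
  assumes m2: "integrable M (\<lambda>l. l\<^sup>2)" and T: "0 \<le> T"
  defines "p \<equiv> \<lambda>l. l - spectral_mean M"
  defines "J \<equiv> \<lambda>x. (\<integral>t. indicator {0..T} t * (\<integral>s. indicator {0..T} s * cos ((t - s) * x) \<partial>lborel) \<partial>lborel)"
  shows "(\<integral>t. indicator {0..T} t * (\<integral>s. indicator {0..T} s * spectral_kernel M (t - s) \<partial>lborel) \<partial>lborel)
     = (\<integral>z. (p (fst z) + p (snd z))\<^sup>2 * J (fst z - snd z) \<partial>(M \<Otimes>\<^sub>M M)) / 4"
    and "integrable (M \<Otimes>\<^sub>M M) (\<lambda>z. (p (fst z) + p (snd z))\<^sup>2 * J (fst z - snd z))"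
proof -
  let ?P = "M \<Otimes>\<^sub>M M"
  interpret LP: pair_sigma_finite lborel ?P ..
  have sf: "sigma_finite_measure ?P" ..
  define w where "w z = (p (fst z) + p (snd z))\<^sup>2" for z
  define c where "c t z = (\<integral>s. indicator {0..T} s * cos ((t - s) * (fst z - snd z)) \<partial>lborel)" for t and z :: "real \<times> real"
  have [measurable]: "p \<in> borel_measurable borel" unfolding p_def by measurable
  have w: "integrable ?P w" unfolding w_def p_def by (rule spectral_kernel_eq(1)[OF m2])
  have [measurable]: "w \<in> borel_measurable ?P" using w by auto
  have [measurable]: "(\<lambda>x. c (u x) (v x)) \<in> borel_measurable N" if [measurable]: "u \<in> borel_measurable N" "v \<in> measurable N (borel \<Otimes>\<^sub>M borel)" for u v N
    unfolding c_def by measurable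
  have base: "integrable (lborel \<Otimes>\<^sub>M ?P) (\<lambda>(s, z). indicator {0..T} s * w z)"
  proof (rule integrableI_bounded)
    have "(\<integral>\<^sup>+x. ennreal (norm (case x of (s, z) \<Rightarrow> indicator {0..T} s * w z)) \<partial>(lborel \<Otimes>\<^sub>M ?P)) = (\<integral>\<^sup>+s. \<integral>\<^sup>+z. indicator {0..T} s * ennreal (norm (w z)) \<partial>?P \<partial>lborel)"
      by (subst sigma_finite_measure.nn_integral_fst[OF sf, symmetric]) (auto simp: abs_mult ennreal_mult split_beta' ennreal_indicator)
    also have "\<dots> = (\<integral>\<^sup>+s. indicator {0..T} s \<partial>lborel) * (\<integral>\<^sup>+z. ennreal (norm (w z)) \<partial>?P)"
      by (simp add: nn_integral_cmult nn_integral_multc)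
    also have "\<dots> < \<infinity>" using w by (auto simp: integrable_iff_bounded ennreal_mult_less_top emeasure_lborel_Icc_eq)
    finally show "(\<integral>\<^sup>+x. ennreal (norm (case x of (s, z) \<Rightarrow> indicator {0..T} s * w z)) \<partial>(lborel \<Otimes>\<^sub>M ?P)) < \<infinity>" .
  qed measurable
  have i1: "integrable (lborel \<Otimes>\<^sub>M ?P) (\<lambda>(s, z). indicator {0..T} s * (w z * cos ((t - s) * (fst z - snd z))))" for t
    by (rule Bochner_Integration.integrable_bound[OF base])
      (auto intro!: AE_I2 simp: abs_mult mult_left_le indicator_def)
  have cT: "\<bar>c t z\<bar> \<le> T" for t z
  proof -
    have "\<bar>c t z\<bar> \<le> (\<integral>s. \<bar>indicator {0..T} s * cos ((t - s) * (fst z - snd z))\<bar> \<partial>lborel)"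
      unfolding c_def by (rule integral_abs_bound)
    also have "\<dots> \<le> (\<integral>s. indicator {0..T} s \<partial>lborel)"
    proof (rule integral_mono)
      show "integrable lborel (\<lambda>s. \<bar>indicator {0..T} s * cos ((t - s) * (fst z - snd z))\<bar>)"
        using borel_integrable_atLeastAtMost'[of 0 T "\<lambda>s. cos ((t - s) * (fst z - snd z))"]
        by (intro integrable_abs) (simp add: set_integrable_def continuous_intros)
      show "integrable lborel (indicator {0..T} :: real \<Rightarrow> real)" by (rule integrable_real_indicator) (auto simp: emeasure_lborel_Icc_eq)
    qed (auto simp: indicator_def)
    also have "\<dots> = T" using T by simp
    finally show ?thesis .
  qed
  have i2: "integrable (lborel \<Otimes>\<^sub>M ?P) (\<lambda>(t, z). indicator {0..T} t * (w z * c t z))"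
  proof (rule Bochner_Integration.integrable_bound[of _ "\<lambda>x. T * (case x of (s, z) \<Rightarrow> indicator {0..T} s * w z)"])
    show "integrable (lborel \<Otimes>\<^sub>M ?P) (\<lambda>x. T * (case x of (s, z) \<Rightarrow> indicator {0..T} s * w z))" using base by (rule integrable_mult_right)
    show "AE x in lborel \<Otimes>\<^sub>M ?P. norm (case x of (t, z) \<Rightarrow> indicator {0..T} t * (w z * c t z)) \<le> norm (T * (case x of (s, z) \<Rightarrow> indicator {0..T} s * w z))"
    proof (intro AE_I2)
      fix x :: "real \<times> real \<times> real"
      obtain t z where x: "x = (t, z)" by (cases x)
      have "\<bar>w z\<bar> * \<bar>c t z\<bar> \<le> \<bar>w z\<bar> * T" by (intro mult_left_mono cT) auto
      then show "norm (case x of (t, z) \<Rightarrow> indicator {0..T} t * (w z * c t z)) \<le> norm (T * (case x of (s, z) \<Rightarrow> indicator {0..T} s * w z))"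
        using T by (simp add: x abs_mult indicator_def mult.commute)
    qed
  qed measurable
  have kern: "spectral_kernel M (t - s) = (\<integral>z. w z * cos ((t - s) * (fst z - snd z)) \<partial>?P) / 4" for t s
    unfolding w_def p_def by (rule spectral_kernel_eq(2)[OF m2])
  have inner: "(\<integral>s. indicator {0..T} s * spectral_kernel M (t - s) \<partial>lborel) = (\<integral>z. w z * c t z \<partial>?P) / 4" for t
  proof -
    have "(\<integral>s. indicator {0..T} s * spectral_kernel M (t - s) \<partial>lborel) = (\<integral>s. (\<integral>z. indicator {0..T} s * (w z * cos ((t - s) * (fst z - snd z))) \<partial>?P) / 4 \<partial>lborel)"
      unfolding kern by simp
    also have "\<dots> = (\<integral>s. (\<integral>z. indicator {0..T} s * (w z * cos ((t - s) * (fst z - snd z))) \<partial>?P) \<partial>lborel) / 4"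
      by (rule integral_divide_zero)
    also have "(\<integral>s. (\<integral>z. indicator {0..T} s * (w z * cos ((t - s) * (fst z - snd z))) \<partial>?P) \<partial>lborel) = (\<integral>z. (\<integral>s. indicator {0..T} s * (w z * cos ((t - s) * (fst z - snd z))) \<partial>lborel) \<partial>?P)"
      by (rule LP.Fubini_integral[OF i1, symmetric])
    also have "\<dots> = (\<integral>z. w z * c t z \<partial>?P)"
      unfolding c_def by (simp add: mult.left_commute)
    finally show ?thesis .
  qed
  have "(\<integral>t. indicator {0..T} t * (\<integral>s. indicator {0..T} s * spectral_kernel M (t - s) \<partial>lborel) \<partial>lborel)
     = (\<integral>t. (\<integral>z. indicator {0..T} t * (w z * c t z) \<partial>?P) / 4 \<partial>lborel)"
    unfolding inner by simp
  also have "\<dots> = (\<integral>t. (\<integral>z. indicator {0..T} t * (w z * c t z) \<partial>?P) \<partial>lborel) / 4" by (rule integral_divide_zero)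
  also have "(\<integral>t. (\<integral>z. indicator {0..T} t * (w z * c t z) \<partial>?P) \<partial>lborel) = (\<integral>z. (\<integral>t. indicator {0..T} t * (w z * c t z) \<partial>lborel) \<partial>?P)"
    by (rule LP.Fubini_integral[OF i2, symmetric])
  also have wJ: "(\<lambda>z. \<integral>t. indicator {0..T} t * (w z * c t z) \<partial>lborel) = (\<lambda>z. w z * J (fst z - snd z))"
    unfolding J_def c_def by (simp add: mult.left_commute)
  finally show "(\<integral>t. indicator {0..T} t * (\<integral>s. indicator {0..T} s * spectral_kernel M (t - s) \<partial>lborel) \<partial>lborel)
     = (\<integral>z. (p (fst z) + p (snd z))\<^sup>2 * J (fst z - snd z) \<partial>?P) / 4" by (simp only: w_def)
  show "integrable ?P (\<lambda>z. (p (fst z) + p (snd z))\<^sup>2 * J (fst z - snd z))"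
  proof -
    have "integrable ?P (\<lambda>z. w z * J (fst z - snd z))"
      using LP.integrable_snd[OF i2] unfolding wJ .
    then show ?thesis unfolding w_def .
  qed
qed

text \<open>An interval on one side of the mean is sought, so that the deviations of two of its
  points have the same sign and add up instead of cancelling. If all such intervals were null,
  countably many of them would exhaust the complement of the mean and the variance would
  vanish.\<close>

lemma spectral_mass_away_from_mean:
  assumes m2: "integrable M (\<lambda>l. l\<^sup>2)" and v: "0 < spectral_variance M"
  shows "\<exists>\<alpha> \<beta> \<epsilon>. \<alpha> \<le> \<beta> \<and> 0 < \<epsilon> \<and> 0 < measure M {\<alpha>..\<beta>} \<and>
    (\<forall>x\<in>{\<alpha>..\<beta>}. \<forall>y\<in>{\<alpha>..\<beta>}. 4 * \<epsilon>\<^sup>2 \<le> ((x - spectral_mean M) + (y - spectral_mean M))\<^sup>2)"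
proof (rule ccontr)
  assume no: "\<not> ?thesis"
  define m where "m = spectral_mean M"
  have sq: "4 * \<epsilon>\<^sup>2 \<le> z\<^sup>2" if "0 < \<epsilon>" "2 * \<epsilon> \<le> \<bar>z\<bar>" for \<epsilon> z :: real
  proof -
    have "(2 * \<epsilon>)\<^sup>2 \<le> \<bar>z\<bar>\<^sup>2" using that by (intro power_mono) auto
    then show ?thesis by (simp add: power_mult_distrib)
  qed
  have z: "measure M {m + 1 / real (Suc n)..m + real (Suc n)} = 0 \<and> measure M {m - real (Suc n)..m - 1 / real (Suc n)} = 0" for n
  proof -
    have n1: "1 / real (Suc n) \<le> real (Suc n)"
    proof -
      have "1 / real (Suc n) \<le> 1" "1 \<le> real (Suc n)" by simp_all
      then show ?thesis by linarith
    qed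
    have "\<not> 0 < measure M {m + 1 / real (Suc n)..m + real (Suc n)}"
    proof
      assume p: "0 < measure M {m + 1 / real (Suc n)..m + real (Suc n)}"
      have "\<forall>x\<in>{m + 1 / real (Suc n)..m + real (Suc n)}. \<forall>y\<in>{m + 1 / real (Suc n)..m + real (Suc n)}. 4 * (1 / real (Suc n))\<^sup>2 \<le> ((x - m) + (y - m))\<^sup>2"
        by (intro ballI sq) auto
      with no p n1 show False unfolding m_def by (metis add_left_mono of_nat_0_less_iff zero_less_Suc zero_less_divide_1_iff)
    qed
    moreover have "\<not> 0 < measure M {m - real (Suc n)..m - 1 / real (Suc n)}"
    proof
      assume p: "0 < measure M {m - real (Suc n)..m - 1 / real (Suc n)}"
      have "\<forall>x\<in>{m - real (Suc n)..m - 1 / real (Suc n)}. \<forall>y\<in>{m - real (Suc n)..m - 1 / real (Suc n)}. 4 * (1 / real (Suc n))\<^sup>2 \<le> ((x - m) + (y - m))\<^sup>2"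
        by (intro ballI sq) auto
      with no p n1 show False unfolding m_def by (metis diff_left_mono of_nat_0_less_iff zero_less_Suc zero_less_divide_1_iff)
    qed
    ultimately show ?thesis using measure_nonneg by (simp add: not_less order.antisym)
  qed
  have "AE x in M. \<forall>n. x \<notin> {m + 1 / real (Suc n)..m + real (Suc n)} \<and> x \<notin> {m - real (Suc n)..m - 1 / real (Suc n)}"
    unfolding AE_all_countable
  proof (intro allI AE_conjI)
    fix n
    show "AE x in M. x \<notin> {m + 1 / real (Suc n)..m + real (Suc n)}" "AE x in M. x \<notin> {m - real (Suc n)..m - 1 / real (Suc n)}"
      using z[of n] by (intro AE_not_in, simp add: null_sets_def emeasure_eq_measure)+
  qed
  then have "AE x in M. x = m"
  proof eventually_elim
    case (elim x)
    show ?case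
    proof (rule ccontr)
      assume "x \<noteq> m"
      then have d: "0 < \<bar>x - m\<bar>" by simp
      obtain n1 where n1: "inverse (real (Suc n1)) < \<bar>x - m\<bar>" using reals_Archimedean[OF d] by blast
      obtain n2 where n2: "\<bar>x - m\<bar> \<le> real n2" using real_arch_simple by blast
      define n where "n = max n1 n2"
      have "1 / real (Suc n) \<le> 1 / real (Suc n1)" by (intro divide_left_mono) (auto simp: n_def)
      then have "1 / real (Suc n) \<le> \<bar>x - m\<bar>" using n1 by (simp add: inverse_eq_divide)
      moreover have "\<bar>x - m\<bar> \<le> real (Suc n)" using n2 by (simp add: n_def)
      ultimately show False using elim[rule_format, of n] by (auto simp: abs_if split: if_splits)
    qed
  qed
  then have "spectral_variance M = (\<integral>l. 0 \<partial>M)"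
    unfolding spectral_variance_def m_def[symmetric] by (intro integral_cong_AE) auto
  then show False using v by simp
qed

lemma spectral_kernel_lower_bound:
  assumes m2: "integrable M (\<lambda>l. l\<^sup>2)" and v: "0 < spectral_variance M" and T0: "0 < T0"
  shows "\<exists>C>0. \<forall>T\<ge>T0. C * T \<le> (\<integral>t. indicator {0..T} t * (\<integral>s. indicator {0..T} s * spectral_kernel M (t - s) \<partial>lborel) \<partial>lborel)"
proof -
  obtain \<alpha> \<beta> \<epsilon> where ab: "\<alpha> \<le> \<beta>" and \<epsilon>: "0 < \<epsilon>" and mass: "0 < measure M {\<alpha>..\<beta>}"
    and low: "\<And>x y. x \<in> {\<alpha>..\<beta>} \<Longrightarrow> y \<in> {\<alpha>..\<beta>} \<Longrightarrow> 4 * \<epsilon>\<^sup>2 \<le> ((x - spectral_mean M) + (y - spectral_mean M))\<^sup>2"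
    using spectral_mass_away_from_mean[OF m2 v] by blast
  \<comment> \<open>Between \<open>\<alpha>\<close> and \<open>\<beta>\<close> there are at most
    \<open>T * (\<beta> - \<alpha>) + 2\<close> cells. The summand 2 is absorbed as
    \<open>T * (2 / T0)\<close>, which is where \<open>T0\<close> enters the constant.\<close>
  define L where "L = \<beta> - \<alpha> + 2 / T0"
  have L: "0 < L" using ab T0 by (simp add: L_def add_nonneg_pos)
  define C where "C = \<epsilon>\<^sup>2 * (measure M {\<alpha>..\<beta>})\<^sup>2 / (4 * L)"
  have "0 < C" using \<epsilon> mass L by (simp add: C_def)
  moreover have "C * T \<le> (\<integral>t. indicator {0..T} t * (\<integral>s. indicator {0..T} s * spectral_kernel M (t - s) \<partial>lborel) \<partial>lborel)"
    if TT: "T0 \<le> T" for T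
  proof -
    have T: "0 < T" using TT T0 by linarith
    define S where "S = {\<lfloor>T * \<alpha>\<rfloor>..\<lfloor>T * \<beta>\<rfloor>}"
    \<comment> \<open>Points of one cell satisfy \<open>|x - y| * T \<le> 1\<close>, exactly the
      range where the second part of \<open>Fejer_integral\<close> gives \<open>T^2 / 4\<close>.
      Only masses of cells are used, so atoms and singular parts of \<open>\<rho>\<close> are
      covered.\<close>
    define I where "I j = {x \<in> {\<alpha>..\<beta>}. \<lfloor>T * x\<rfloor> = j}" for j
    have fin: "finite S" by (simp add: S_def)
    have Im [measurable]: "I j \<in> sets borel" for j
    proof -
      have "Measurable.pred borel (\<lambda>x. x \<in> {\<alpha>..\<beta>} \<and> \<lfloor>T * x\<rfloor> = j)" by measurable
      then show ?thesis unfolding I_def pred_def by simp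
    qed
    have Un: "{\<alpha>..\<beta>} = (\<Union>j\<in>S. I j)"
      using T by (auto simp: I_def S_def intro!: floor_mono)
    have disj: "disjoint_family_on I S" by (auto simp: disjoint_family_on_def I_def)
    have sum1: "measure M {\<alpha>..\<beta>} = (\<Sum>j\<in>S. measure M (I j))"
      unfolding Un by (rule finite_measure_finite_Union[OF fin _ disj]) auto
    have "T * \<alpha> \<le> T * \<beta>" using ab T by simp
    then have "real (card S) \<le> T * (\<beta> - \<alpha>) + 2"
      unfolding S_def card_atLeastAtMost_int by (simp add: algebra_simps) linarith
    also have "\<dots> \<le> T * L"
    proof -
      have "T0 * (2 / T0) \<le> T * (2 / T0)" using TT T0 by (intro mult_right_mono) auto
      then show ?thesis using T0 by (simp add: L_def distrib_left)
    qed
    finally have card: "real (card S) \<le> T * L" .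
    have CS: "(measure M {\<alpha>..\<beta>})\<^sup>2 \<le> (\<Sum>j\<in>S. (measure M (I j))\<^sup>2) * real (card S)"
      unfolding sum1 by (rule sum_squared_le_sum_of_squares)
    define J where "J x = (\<integral>t. indicator {0..T} t * (\<integral>s. indicator {0..T} s * cos ((t - s) * x) \<partial>lborel) \<partial>lborel)" for x
    note J = Fejer_integral[of T, folded J_def]
    define w where "w z = ((fst z - spectral_mean M) + (snd z - spectral_mean M))\<^sup>2" for z
    have main: "\<epsilon>\<^sup>2 * T\<^sup>2 * (\<Sum>j\<in>S. (measure M (I j))\<^sup>2) \<le> (\<integral>z. w z * J (fst z - snd z) \<partial>(M \<Otimes>\<^sub>M M))"
    proof -
      have em: "measure (M \<Otimes>\<^sub>M M) (I j \<times> I j) = (measure M (I j))\<^sup>2" for j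
        by (simp add: measure_def emeasure_pair_measure_Times enn2real_mult power2_eq_square)
      have iI: "integrable (M \<Otimes>\<^sub>M M) (\<lambda>z. \<epsilon>\<^sup>2 * T\<^sup>2 * indicator (I j \<times> I j) z :: real)" for j
        by (intro integrable_mult_right integrable_real_indicator) (auto simp: PP.emeasure_eq_measure)
      have "\<epsilon>\<^sup>2 * T\<^sup>2 * (\<Sum>j\<in>S. (measure M (I j))\<^sup>2) = (\<integral>z. (\<Sum>j\<in>S. \<epsilon>\<^sup>2 * T\<^sup>2 * indicator (I j \<times> I j) z) \<partial>(M \<Otimes>\<^sub>M M))"
        using iI by (subst Bochner_Integration.integral_sum) (auto simp: em[symmetric] sum_distrib_left space_pair_measure)
      also have "\<dots> \<le> (\<integral>z. w z * J (fst z - snd z) \<partial>(M \<Otimes>\<^sub>M M))"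
      proof (rule integral_mono)
        show "integrable (M \<Otimes>\<^sub>M M) (\<lambda>z. \<Sum>j\<in>S. \<epsilon>\<^sup>2 * T\<^sup>2 * indicator (I j \<times> I j) z)"
          by (intro Bochner_Integration.integrable_sum iI)
        show "integrable (M \<Otimes>\<^sub>M M) (\<lambda>z. w z * J (fst z - snd z))"
          unfolding w_def J_def using T by (intro integral_spectral_kernel(2)[OF m2]) simp
        fix z :: "real \<times> real"
        obtain x y where xy: "z = (x, y)" by (cases z)
        show "(\<Sum>j\<in>S. \<epsilon>\<^sup>2 * T\<^sup>2 * indicator (I j \<times> I j) z) \<le> w z * J (fst z - snd z)"
        proof (cases "\<exists>i\<in>S. x \<in> I i \<and> y \<in> I i")
          case True
          then obtain i where i: "i \<in> S" "x \<in> I i" "y \<in> I i" by blast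
          have "(\<Sum>j\<in>S. \<epsilon>\<^sup>2 * T\<^sup>2 * indicator (I j \<times> I j) z) = (\<Sum>j\<in>S. if j = i then \<epsilon>\<^sup>2 * T\<^sup>2 else 0)"
            using i by (intro sum.cong) (auto simp: xy indicator_def I_def)
          also have "\<dots> = (4 * \<epsilon>\<^sup>2) * (T\<^sup>2 / 4)" using fin i by simp
          also have "\<dots> \<le> w z * J (fst z - snd z)"
          proof (rule mult_mono)
            show "4 * \<epsilon>\<^sup>2 \<le> w z" using low[of x y] i by (simp add: w_def xy I_def)
            have "\<bar>T * x - T * y\<bar> \<le> 1" using i by (simp add: I_def) linarith
            then have "\<bar>x - y\<bar> * T \<le> 1" using T by (simp add: right_diff_distrib[symmetric] abs_mult mult.commute)
            then show "T\<^sup>2 / 4 \<le> J (fst z - snd z)" using J(2)[of "x - y"] T by (simp add: xy)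
          qed (auto simp: w_def)
          finally show ?thesis .
        next
          case False
          then have "(\<Sum>j\<in>S. \<epsilon>\<^sup>2 * T\<^sup>2 * indicator (I j \<times> I j) z) = 0"
            by (intro sum.neutral) (auto simp: xy indicator_def)
          then show ?thesis using J(1)[of "fst z - snd z"] T by (simp add: w_def)
        qed
      qed
      finally show ?thesis .
    qed
    \<comment> \<open>On a diagonal block \<open>4 * \<epsilon>^2\<close> and \<open>T^2 / 4\<close>
      multiply to \<open>\<epsilon>^2 * T^2\<close>; the factor 4 in \<open>C\<close> is the one
      from the spectral form of the kernel.\<close>
    have "C * T = \<epsilon>\<^sup>2 * T\<^sup>2 * ((measure M {\<alpha>..\<beta>})\<^sup>2 / (T * L)) / 4"
      using T L by (simp add: C_def power2_eq_square field_simps)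
    also have "\<dots> \<le> \<epsilon>\<^sup>2 * T\<^sup>2 * (\<Sum>j\<in>S. (measure M (I j))\<^sup>2) / 4"
    proof -
      have "(measure M {\<alpha>..\<beta>})\<^sup>2 \<le> (\<Sum>j\<in>S. (measure M (I j))\<^sup>2) * (T * L)"
        using CS card by (meson mult_left_mono order_trans sum_nonneg zero_le_power2)
      then have "(measure M {\<alpha>..\<beta>})\<^sup>2 / (T * L) \<le> (\<Sum>j\<in>S. (measure M (I j))\<^sup>2)"
        using T L by (simp add: divide_le_eq)
      then show ?thesis by (intro divide_right_mono mult_left_mono) auto
    qed
    also have "\<dots> \<le> (\<integral>z. w z * J (fst z - snd z) \<partial>(M \<Otimes>\<^sub>M M)) / 4" using main by simp
    also have "\<dots> = (\<integral>t. indicator {0..T} t * (\<integral>s. indicator {0..T} s * spectral_kernel M (t - s) \<partial>lborel) \<partial>lborel)"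
      unfolding w_def J_def using T by (intro integral_spectral_kernel(1)[OF m2, symmetric]) simp
    finally show ?thesis .
  qed
  ultimately show ?thesis by blast
qed

lemma spectral_variance_pos:
  assumes m2: "integrable M (\<lambda>l. l\<^sup>2)" and nd: "\<not> degenerate M"
  shows "0 < spectral_variance M"
proof (rule ccontr)
  assume "\<not> ?thesis"
  moreover have "0 \<le> spectral_variance M" unfolding spectral_variance_def by (rule integral_nonneg_AE) simp
  ultimately have z: "spectral_variance M = 0" by simp
  have "integrable M (\<lambda>l. 1 + l\<^sup>2)" using m2 by simp
  then have i0: "integrable M (\<lambda>l. l)"
  proof (rule Bochner_Integration.integrable_bound)
    have "\<bar>l\<bar> \<le> 1 + l\<^sup>2" for l :: real
      using power_le_one_plus[of "\<bar>l\<bar>" 1 2] by simp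
    then show "AE l in M. norm l \<le> norm (1 + l\<^sup>2)" by (intro AE_I2) simp
  qed simp
  have "integrable M (\<lambda>l. (l - spectral_mean M)\<^sup>2)" unfolding power2_diff using i0 m2 by simp
  then have "AE l in M. (l - spectral_mean M)\<^sup>2 = 0"
    using z unfolding spectral_variance_def by (subst (asm) integral_nonneg_eq_0_iff_AE) auto
  then have "AE l in M. l = spectral_mean M" by simp
  then have "M = return M (spectral_mean M)" by (rule AE_eq_constD)
  also have "\<dots> = return borel (spectral_mean M)" by (rule return_cong) simp
  finally show False using nd unfolding degenerate_def by blast
qed

end

subsection \<open>Projection of the winding\<close>

context smooth_gaussian
begin

definition drift_free_winding :: "real \<Rightarrow> 'a \<Rightarrow> real" where
  "drift_free_winding T \<omega> = (\<integral>t. indicator {0..T} t * Im (U t \<omega> * (1 / F t \<omega>)) \<partial>lborel)"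

definition projection :: "real \<Rightarrow> 'a \<Rightarrow> real" where
  "projection T \<omega> = (\<integral>t. indicator {0..T} t * Im (U t \<omega> * cnj (F t \<omega>)) \<partial>lborel)"

lemma drift_free_winding_measurable [measurable]: "drift_free_winding T \<in> borel_measurable M"
  unfolding drift_free_winding_def by measurable

lemma projection_measurable [measurable]: "projection T \<in> borel_measurable M"
  unfolding projection_def by measurable

lemma double_indicator_bound:
  assumes "(\<integral>\<^sup>+\<omega>. ennreal \<bar>a \<omega> * b \<omega>\<bar> \<partial>M) \<le> ennreal C"
  shows "(\<integral>\<^sup>+\<omega>. ennreal \<bar>(indicator A t * a \<omega>) * (indicator B s * b \<omega>)\<bar> \<partial>M) \<le> ennreal C * indicator A t * indicator B s"
  using assms by (cases "t \<in> A"; cases "s \<in> B") (auto simp: indicator_def)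

text \<open>A general \<open>\<phi>\<close> lets one computation yield both the covariance of the
  winding with its projection and the second moment of the projection.\<close>

lemma projection_products:
  assumes \<phi> [measurable]: "\<phi> \<in> borel_measurable borel" and bd: "\<And>x. cmod (\<phi> x) \<le> 1 / cmod x + cmod x"
    and \<phi>1: "\<And>t. (\<integral>\<omega>. \<phi> (F t \<omega>) * F t \<omega> \<partial>M) = 1"
  shows "integrable M (\<lambda>\<omega>. (\<integral>t. indicator {0..T} t * Im (U t \<omega> * \<phi> (F t \<omega>)) \<partial>lborel) * projection T \<omega>)"
    and "(\<integral>\<omega>. (\<integral>t. indicator {0..T} t * Im (U t \<omega> * \<phi> (F t \<omega>)) \<partial>lborel) * projection T \<omega> \<partial>M) =
      (\<integral>t. indicator {0..T} t * (\<integral>s. indicator {0..T} s * kernel (t - s) \<partial>lborel) \<partial>lborel)"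
proof -
  define f where "f t \<omega> = indicator {0..T} t * Im (U t \<omega> * \<phi> (F t \<omega>))" for t \<omega>
  define g where "g t \<omega> = indicator {0..T} t * Im (U t \<omega> * cnj (F t \<omega>))" for t \<omega>
  have m: "(\<lambda>p. f (fst p) (snd p)) \<in> borel_measurable (lborel \<Otimes>\<^sub>M M)" "(\<lambda>p. g (fst p) (snd p)) \<in> borel_measurable (lborel \<Otimes>\<^sub>M M)"
    unfolding f_def g_def by measurable
  have b: "(\<integral>\<^sup>+\<omega>. ennreal \<bar>f t \<omega> * g s \<omega>\<bar> \<partial>M) \<le> ennreal covbound * indicator {0..T} t * indicator {0..T} s" for t s
    unfolding f_def g_def by (rule double_indicator_bound) (rule weighted_kernel(1)[OF \<phi> bd \<phi>1])
  have e: "(\<integral>\<omega>. f t \<omega> * g s \<omega> \<partial>M) = indicator {0..T} t * (indicator {0..T} s * kernel (t - s))" for t s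
  proof -
    have "(\<integral>\<omega>. f t \<omega> * g s \<omega> \<partial>M) = (\<integral>\<omega>. (indicator {0..T} t * indicator {0..T} s) * (Im (U t \<omega> * \<phi> (F t \<omega>)) * Im (U s \<omega> * cnj (F s \<omega>))) \<partial>M)"
      by (intro Bochner_Integration.integral_cong refl) (simp only: f_def g_def mult_ac)
    also have "\<dots> = indicator {0..T} t * indicator {0..T} s * kernel (t - s)"
      unfolding integral_mult_right_zero weighted_kernel(2)[OF \<phi> bd \<phi>1] ..
    finally show ?thesis by (simp only: mult_ac)
  qed
  show "integrable M (\<lambda>\<omega>. (\<integral>t. indicator {0..T} t * Im (U t \<omega> * \<phi> (F t \<omega>)) \<partial>lborel) * projection T \<omega>)"
    using time_integral_product(1)[OF m b] unfolding f_def g_def projection_def .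
  show "(\<integral>\<omega>. (\<integral>t. indicator {0..T} t * Im (U t \<omega> * \<phi> (F t \<omega>)) \<partial>lborel) * projection T \<omega> \<partial>M) =
      (\<integral>t. indicator {0..T} t * (\<integral>s. indicator {0..T} s * kernel (t - s) \<partial>lborel) \<partial>lborel)"
    using time_integral_product(2)[OF m b] unfolding e integral_mult_right_zero unfolding f_def g_def projection_def .
qed

lemma expectation_projection: "integrable M (projection T)" "(\<integral>\<omega>. projection T \<omega> \<partial>M) = 0"
proof -
  \<comment> \<open>An auxiliary time integral equal to 1, so that the Fubini statement for products
    also yields the mean of a single time integral.\<close>
  define f where "f t \<omega> = indicator {0..1} t * (1::real)" for t :: real and \<omega> :: 'a
  define g where "g t \<omega> = indicator {0..T} t * Im (U t \<omega> * cnj (F t \<omega>))" for t \<omega>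
  have m: "(\<lambda>p. f (fst p) (snd p)) \<in> borel_measurable (lborel \<Otimes>\<^sub>M M)" "(\<lambda>p. g (fst p) (snd p)) \<in> borel_measurable (lborel \<Otimes>\<^sub>M M)"
    unfolding f_def g_def by measurable
  have b: "(\<integral>\<^sup>+\<omega>. ennreal \<bar>f t \<omega> * g s \<omega>\<bar> \<partial>M) \<le> ennreal (1 + 2 * mom 2) * indicator {0..1} t * indicator {0..T} s" for t s
    unfolding f_def g_def
  proof (rule double_indicator_bound)
    show "(\<integral>\<^sup>+\<omega>. ennreal \<bar>1 * Im (U s \<omega> * cnj (F s \<omega>))\<bar> \<partial>M) \<le> ennreal (1 + 2 * mom 2)"
      using integral_Im_U(2) unfolding mult_1 .
  qed
  have e: "(\<integral>\<omega>. f t \<omega> * g s \<omega> \<partial>M) = 0" for t s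
  proof -
    have "(\<integral>\<omega>. f t \<omega> * g s \<omega> \<partial>M) = (\<integral>\<omega>. (indicator {0..1} t * indicator {0..T} s) * Im (U s \<omega> * cnj (F s \<omega>)) \<partial>M)"
      by (intro Bochner_Integration.integral_cong refl) (simp only: f_def g_def mult_ac mult_1_right)
    then show ?thesis unfolding integral_mult_right_zero integral_Im_U(1) by simp
  qed
  have one: "(\<integral>t. f t \<omega> \<partial>lborel) = 1" for \<omega> by (simp add: f_def)
  show "integrable M (projection T)"
    using time_integral_product(1)[OF m b] unfolding one g_def projection_def[symmetric] mult_1 .
  show "(\<integral>\<omega>. projection T \<omega> \<partial>M) = 0"
    using time_integral_product(2)[OF m b] unfolding e one unfolding g_def projection_def[symmetric] mult_1 by simp
qed

lemma drift_free_integrand_le: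
  "ennreal (norm (indicator {0..T} t * Im (U t \<omega> * (1 / F t \<omega>)))) \<le> ennreal (q t \<omega>) * indicator {0..T} t"
proof (cases "t \<in> {0..T}")
  case True
  have "\<bar>Im (U t \<omega> * (1 / F t \<omega>))\<bar> \<le> cmod (U t \<omega> * (1 / F t \<omega>))" by (rule abs_Im_le_cmod)
  also have "\<dots> = q t \<omega>" by (simp add: q_def norm_mult norm_divide)
  finally show ?thesis using True by (auto intro!: ennreal_leI)
qed simp

lemma norm_drift_free_winding:
  "ennreal \<bar>drift_free_winding T \<omega>\<bar> \<le> (\<integral>\<^sup>+t. ennreal (q t \<omega>) * indicator {0..T} t \<partial>lborel)"
proof (cases "integrable lborel (\<lambda>t. indicator {0..T} t * Im (U t \<omega> * (1 / F t \<omega>)))")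
  case True
  have "ennreal \<bar>drift_free_winding T \<omega>\<bar> \<le> (\<integral>\<^sup>+t. ennreal (norm (indicator {0..T} t * Im (U t \<omega> * (1 / F t \<omega>)))) \<partial>lborel)"
    using integral_norm_bound_ennreal[OF True] by (simp add: drift_free_winding_def)
  also have "\<dots> \<le> (\<integral>\<^sup>+t. ennreal (q t \<omega>) * indicator {0..T} t \<partial>lborel)"
    by (intro nn_integral_mono drift_free_integrand_le)
  finally show ?thesis .
qed (simp add: drift_free_winding_def not_integrable_integral_eq)

lemma drift_free_winding_square_integrable:
  assumes "0 < spread"
  shows "integrable M (\<lambda>\<omega>. (drift_free_winding T \<omega>)\<^sup>2)"
proof (rule integrableI_bounded)
  have "(\<integral>\<^sup>+\<omega>. ennreal (norm ((drift_free_winding T \<omega>)\<^sup>2)) \<partial>M) \<le> (\<integral>\<^sup>+\<omega>. (\<integral>\<^sup>+t. ennreal (q t \<omega>) * indicator {0..T} t \<partial>lborel)\<^sup>2 \<partial>M)"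
  proof (rule nn_integral_mono)
    fix \<omega>
    have "ennreal (norm ((drift_free_winding T \<omega>)\<^sup>2)) = (ennreal \<bar>drift_free_winding T \<omega>\<bar>)\<^sup>2"
      by (simp add: ennreal_power)
    also have "\<dots> \<le> (\<integral>\<^sup>+t. ennreal (q t \<omega>) * indicator {0..T} t \<partial>lborel)\<^sup>2"
      by (intro power_mono norm_drift_free_winding) simp
    finally show "ennreal (norm ((drift_free_winding T \<omega>)\<^sup>2)) \<le> (\<integral>\<^sup>+t. ennreal (q t \<omega>) * indicator {0..T} t \<partial>lborel)\<^sup>2" .
  qed
  also have "\<dots> < \<infinity>" by (rule nn_q_square[OF assms])
  finally show "(\<integral>\<^sup>+\<omega>. ennreal (norm ((drift_free_winding T \<omega>)\<^sup>2)) \<partial>M) < \<infinity>" .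
qed simp

lemma drift_free_winding_integrable: "0 < spread \<Longrightarrow> integrable M (drift_free_winding T)"
  by (rule square_integrable_imp_integrable[OF _ drift_free_winding_square_integrable]) simp_all

lemma variance_drift_free_winding:
  assumes sp: "0 < spread"
  shows "(\<integral>t. indicator {0..T} t * (\<integral>s. indicator {0..T} s * kernel (t - s) \<partial>lborel) \<partial>lborel)
    \<le> variance (drift_free_winding T)"
proof -
  define V where "V = (\<integral>t. indicator {0..T} t * (\<integral>s. indicator {0..T} s * kernel (t - s) \<partial>lborel) \<partial>lborel)"
  define m where "m = expectation (drift_free_winding T)"
  have inv: "(\<integral>\<omega>. 1 / F t \<omega> * F t \<omega> \<partial>M) = 1" for t
  proof -
    have "(\<integral>\<omega>. 1 / F t \<omega> * F t \<omega> \<partial>M) = (\<integral>\<omega>. 1 \<partial>M)"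
    proof (rule integral_cong_AE)
      show "AE \<omega> in M. 1 / F t \<omega> * F t \<omega> = 1" using AE_F_nonzero[of t] by eventually_elim simp
    qed measurable
    then show ?thesis by (simp add: prob_space)
  qed
  have cnj1: "(\<integral>\<omega>. cnj (F t \<omega>) * F t \<omega> \<partial>M) = 1" for t
  proof -
    have "(\<integral>\<omega>. cnj (F t \<omega>) * F t \<omega> \<partial>M) = (\<integral>\<omega>. complex_of_real ((cmod (F t \<omega>))\<^sup>2) \<partial>M)"
      by (intro Bochner_Integration.integral_cong refl) (simp only: complex_norm_square mult.commute)
    then show ?thesis unfolding integral_complex_of_real F_second_moment by simp
  qed
  have DY: "integrable M (\<lambda>\<omega>. drift_free_winding T \<omega> * projection T \<omega>)" "(\<integral>\<omega>. drift_free_winding T \<omega> * projection T \<omega> \<partial>M) = V"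
    using projection_products[of "\<lambda>x. 1 / x" T, OF _ _ inv]
    unfolding drift_free_winding_def[symmetric] V_def[symmetric] by (simp_all add: norm_divide)
  have YY: "integrable M (\<lambda>\<omega>. projection T \<omega> * projection T \<omega>)" "(\<integral>\<omega>. projection T \<omega> * projection T \<omega> \<partial>M) = V"
    using projection_products[of cnj T, OF _ _ cnj1]
    unfolding projection_def[symmetric] V_def[symmetric] by simp_all
  note D2 = drift_free_winding_square_integrable[OF sp, of T]
  note D1 = drift_free_winding_integrable[OF sp, of T]
  have i1: "integrable M (\<lambda>\<omega>. (drift_free_winding T \<omega> - m)\<^sup>2)"
    unfolding power2_diff using D1 D2 by simp
  have i2: "integrable M (\<lambda>\<omega>. 2 * (drift_free_winding T \<omega> * projection T \<omega> - m * projection T \<omega>))"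
    using DY(1) expectation_projection(1) by (intro integrable_mult_right integrable_diff) auto
  \<comment> \<open>Expanding gives \<open>variance - 2 * V + V\<close>; the terms with
    \<open>m\<close> disappear because the projection has mean zero.\<close>
  have "0 \<le> (\<integral>\<omega>. (drift_free_winding T \<omega> - m - projection T \<omega>)\<^sup>2 \<partial>M)" by simp
  also have "\<dots> = (\<integral>\<omega>. (drift_free_winding T \<omega> - m)\<^sup>2 - 2 * (drift_free_winding T \<omega> * projection T \<omega> - m * projection T \<omega>) + projection T \<omega> * projection T \<omega> \<partial>M)"
    by (intro Bochner_Integration.integral_cong refl) (simp add: power2_eq_square algebra_simps)
  also have "\<dots> = (\<integral>\<omega>. (drift_free_winding T \<omega> - m)\<^sup>2 \<partial>M) - (\<integral>\<omega>. 2 * (drift_free_winding T \<omega> * projection T \<omega> - m * projection T \<omega>) \<partial>M) + V"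
    using i1 i2 YY by simp
  also have "(\<integral>\<omega>. 2 * (drift_free_winding T \<omega> * projection T \<omega> - m * projection T \<omega>) \<partial>M) = 2 * (V - m * 0)"
    unfolding integral_mult_right_zero using DY expectation_projection by simp
  finally show ?thesis by (simp add: V_def m_def)
qed

text \<open>Where \<open>F\<close> does not vanish, \<open>U / F\<close> differs from
  \<open>G / F\<close> by the constant \<open>\<i> * mean\<close>. Finiteness of the integral of
  \<open>q\<close> supplies the integrability needed to split off the drift.\<close>

lemma AE_winding_eq_drift_free:
  assumes sp: "0 < spread" and T: "0 \<le> T"
  shows "AE \<omega> in M. winding (\<lambda>t. F t \<omega>) T = drift_free_winding T \<omega> - mean * T"
proof -
  have fin: "AE \<omega> in M. (\<integral>\<^sup>+t. ennreal (q t \<omega>) * indicator {0..T} t \<partial>lborel) \<noteq> \<infinity>"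
  proof -
    have "AE \<omega> in M. (\<integral>\<^sup>+t. ennreal (q t \<omega>) * indicator {0..T} t \<partial>lborel)\<^sup>2 \<noteq> \<infinity>"
      using nn_q_square[OF sp, of T] by (intro nn_integral_PInf_AE) auto
    then show ?thesis by eventually_elim auto
  qed
  have nz: "AE \<omega> in M. AE t in lborel. F t \<omega> \<noteq> 0"
    by (rule iffD1[OF lm.AE_commute]) (measurable, simp add: AE_F_nonzero)
  show ?thesis
    using AE_winding[of T] fin nz AE_space
  proof eventually_elim
    case (elim \<omega>)
    have [measurable]: "\<omega> \<in> space M" by (rule elim(4))
    define f where "f t = indicator {0..T} t * Im (U t \<omega> * (1 / F t \<omega>))" for t
    have fi: "integrable lborel f"
    proof (rule integrableI_bounded)
      show "f \<in> borel_measurable lborel" unfolding f_def by measurable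
      have "(\<integral>\<^sup>+t. ennreal (norm (f t)) \<partial>lborel) \<le> (\<integral>\<^sup>+t. ennreal (q t \<omega>) * indicator {0..T} t \<partial>lborel)"
        unfolding f_def by (intro nn_integral_mono drift_free_integrand_le)
      then show "(\<integral>\<^sup>+t. ennreal (norm (f t)) \<partial>lborel) < \<infinity>" using elim(2) by (simp add: less_top top_unique)
    qed
    have "(LINT t:{0..T}|lborel. Im (G t \<omega> / F t \<omega>)) = (\<integral>t. f t - mean * indicator {0..T} t \<partial>lborel)"
      unfolding set_lebesgue_integral_def
    proof (rule integral_cong_AE)
      show "AE t in lborel. indicator {0..T} t *\<^sub>R Im (G t \<omega> / F t \<omega>) = f t - mean * indicator {0..T} t"
        using elim(3)
      proof eventually_elim
        case (elim t)
        have "U t \<omega> * (1 / F t \<omega>) = G t \<omega> / F t \<omega> + \<i> * of_real mean"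
          using elim by (simp add: U_def field_simps)
        then have "Im (U t \<omega> * (1 / F t \<omega>)) = Im (G t \<omega> / F t \<omega>) + mean" by simp
        then show ?case unfolding f_def by (simp only: indicator_def) (simp add: algebra_simps)
      qed
    qed (unfold f_def, measurable)
    also have "\<dots> = (\<integral>t. f t \<partial>lborel) - (\<integral>t. mean * indicator {0..T} t \<partial>lborel)"
      by (rule Bochner_Integration.integral_diff[OF fi]) (simp add: emeasure_lborel_Icc_eq)
    also have "(\<integral>t. mean * indicator {0..T} t \<partial>lborel) = mean * T" using T by simp
    finally show ?case using elim(1) by (simp only: f_def drift_free_winding_def)
  qed
qed

end

subsection \<open>Proof of the theorem\<close>

text \<open>The winding of the actual paths equals a measurable variable only almost surely, so its
  own measurability is available only in the completion.\<close>

lemma borel_measurable_completion_AE_eq: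
  assumes V: "V \<in> borel_measurable M" and ae: "AE \<omega> in M. W \<omega> = V \<omega>"
  shows "W \<in> borel_measurable (completion M)"
proof (rule measurableI)
  fix A :: "'b set" assume A: "A \<in> sets borel"
  show "W -` A \<inter> space (completion M) \<in> sets (completion M)"
  proof (rule completion.in_sets_AE)
    show "V -` A \<inter> space M \<in> sets (completion M)"
      using measurable_sets[OF V A] by simp
    show "AE x in completion M. (x \<in> V -` A \<inter> space M) = (x \<in> W -` A \<inter> space (completion M))"
      using AE_completion[OF ae] by eventually_elim simp
  qed simp
qed simp

lemma variance_completion_AE_eq:
  fixes V W :: "'a \<Rightarrow> real"
  assumes "prob_space M" and V [measurable]: "V \<in> borel_measurable M" and ae: "AE \<omega> in M. W \<omega> = V \<omega>"
  shows "prob_space.variance (completion M) W = prob_space.variance M V"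
proof -
  have W [measurable]: "W \<in> borel_measurable (completion M)" by (rule borel_measurable_completion_AE_eq[OF V ae])
  have V' [measurable]: "V \<in> borel_measurable (completion M)" by (rule measurable_completion[OF V])
  note ae' = AE_completion[OF ae]
  have e: "integral\<^sup>L (completion M) W = integral\<^sup>L M V"
    using integral_cong_AE[OF W V' ae'] integral_completion[OF V] by simp
  have "(\<integral>\<omega>. (W \<omega> - integral\<^sup>L (completion M) W)\<^sup>2 \<partial>completion M) = (\<integral>\<omega>. (V \<omega> - integral\<^sup>L M V)\<^sup>2 \<partial>completion M)"
    unfolding e
  proof (rule integral_cong_AE)
    show "AE \<omega> in completion M. (W \<omega> - integral\<^sup>L M V)\<^sup>2 = (V \<omega> - integral\<^sup>L M V)\<^sup>2"
      using ae' by eventually_elim simp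
  qed measurable
  also have "\<dots> = (\<integral>\<omega>. (V \<omega> - integral\<^sup>L M V)\<^sup>2 \<partial>M)"
    by (rule integral_completion) measurable
  finally show ?thesis .
qed

lemma log_moment_condition_moments:
  assumes \<rho>: "real_distribution \<rho>" and \<alpha>: "0 < \<alpha>" and lm: "log_moment_condition \<rho> \<alpha>"
  shows "integrable \<rho> (\<lambda>l. l\<^sup>2)" "integrable \<rho> (\<lambda>l. l\<^sup>2 * ln (1 + \<bar>l\<bar>))"
proof -
  interpret real_distribution \<rho> by (rule \<rho>)
  \<comment> \<open>If \<open>ln (1 + |l|) < 1\<close>, then \<open>|l| \<le> 2\<close> and the
    summand 4 dominates; otherwise enlarging the exponent of the logarithm enlarges the
    power.\<close>
  define w where "w l = 4 + l\<^sup>2 * ln (1 + \<bar>l\<bar>) powr (1 + \<alpha>)" for l :: real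
  have "integrable \<rho> (\<lambda>l. l\<^sup>2 * ln (1 + \<bar>l\<bar>) powr (1 + \<alpha>))"
    using lm unfolding log_moment_condition_def by (intro integrableI_nonneg) auto
  then have wi: "integrable \<rho> w" unfolding w_def[abs_def] by simp
  have w: "l\<^sup>2 \<le> w l \<and> l\<^sup>2 * ln (1 + \<bar>l\<bar>) \<le> w l" for l
  proof (cases "1 \<le> ln (1 + \<bar>l\<bar>)")
    case True
    have "1 \<le> ln (1 + \<bar>l\<bar>) powr (1 + \<alpha>)" using True \<alpha> by (intro ge_one_powr_ge_zero) auto
    moreover have "ln (1 + \<bar>l\<bar>) powr 1 \<le> ln (1 + \<bar>l\<bar>) powr (1 + \<alpha>)" using True \<alpha> by (intro powr_mono) auto
    ultimately have "l\<^sup>2 * 1 \<le> l\<^sup>2 * ln (1 + \<bar>l\<bar>) powr (1 + \<alpha>)" "l\<^sup>2 * ln (1 + \<bar>l\<bar>) powr 1 \<le> l\<^sup>2 * ln (1 + \<bar>l\<bar>) powr (1 + \<alpha>)"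
      by - (rule mult_left_mono[OF _ zero_le_power2], assumption)+
    moreover have "ln (1 + \<bar>l\<bar>) powr 1 = ln (1 + \<bar>l\<bar>)" using True by simp
    ultimately show ?thesis unfolding w_def by simp
  next
    case False
    have "exp (ln (1 + \<bar>l\<bar>)) < exp 1" using False by (simp only: not_le exp_less_cancel_iff)
    moreover have "exp (ln (1 + \<bar>l\<bar>)) = 1 + \<bar>l\<bar>" by (rule exp_ln) simp
    ultimately have "\<bar>l\<bar> \<le> 2" using exp_le by linarith
    then have l: "l\<^sup>2 \<le> 4" using power_mono[of "\<bar>l\<bar>" 2 2] by simp
    have "l\<^sup>2 * ln (1 + \<bar>l\<bar>) \<le> l\<^sup>2 * 1" using False by (intro mult_left_mono) auto
    moreover have "0 \<le> l\<^sup>2 * ln (1 + \<bar>l\<bar>) powr (1 + \<alpha>)" by simp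
    ultimately show ?thesis using l unfolding w_def by linarith
  qed
  show "integrable \<rho> (\<lambda>l. l\<^sup>2)"
    by (rule Bochner_Integration.integrable_bound[OF wi]) (use w in \<open>auto intro!: AE_I2 order_trans[OF _ abs_ge_self]\<close>)
  show "integrable \<rho> (\<lambda>l. l\<^sup>2 * ln (1 + \<bar>l\<bar>))"
    by (rule Bochner_Integration.integrable_bound[OF wi])
      (use w in \<open>auto intro!: AE_I2 order_trans[OF _ abs_ge_self] simp: abs_mult\<close>)
qed

lemma stationary_covariance:
  assumes st: "stationary M f" and f [measurable]: "\<And>t. f t \<in> borel_measurable M"
  shows "(\<integral>\<omega>. f t \<omega> * cnj (f s \<omega>) \<partial>M) = covariance_kernel M f (t - s)"
proof -
  define h :: "(real \<Rightarrow> complex) \<Rightarrow> complex" where "h x = x (t - s) * cnj (x 0)" for x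
  have [measurable]: "(\<lambda>\<omega> t. f (t + u) \<omega>) \<in> measurable M (Pi\<^sub>M UNIV (\<lambda>_. borel))" for u
    by (rule measurable_PiM_single') auto
  have [measurable]: "(\<lambda>\<omega> t. f t \<omega>) \<in> measurable M (Pi\<^sub>M UNIV (\<lambda>_. borel))"
    by (rule measurable_PiM_single') auto
  have [measurable]: "h \<in> borel_measurable (Pi\<^sub>M UNIV (\<lambda>_. borel))" unfolding h_def by measurable
  have "(\<integral>\<omega>. f t \<omega> * cnj (f s \<omega>) \<partial>M) = (\<integral>x. h x \<partial>distr M (Pi\<^sub>M UNIV (\<lambda>_. borel)) (\<lambda>\<omega> t. f (t + s) \<omega>))"
    by (subst integral_distr) (auto simp: h_def)
  also have "\<dots> = (\<integral>x. h x \<partial>distr M (Pi\<^sub>M UNIV (\<lambda>_. borel)) (\<lambda>\<omega> t. f t \<omega>))"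
    using st unfolding stationary_def by simp
  also have "\<dots> = (\<integral>\<omega>. f (t - s) \<omega> * cnj (f 0 \<omega>) \<partial>M)"
    by (subst integral_distr) (auto simp: h_def)
  finally show ?thesis unfolding covariance_kernel_def .
qed

lemma complex_gaussian_vector_AE_eq:
  assumes Y: "complex_gaussian_vector M I Y" and X [measurable]: "\<And>i. i \<in> I \<Longrightarrow> X i \<in> borel_measurable M"
    and ae: "AE \<omega> in M. \<forall>i\<in>I. X i \<omega> = Y i \<omega>"
  shows "complex_gaussian_vector M I X"
proof -
  have "distr M (Pi\<^sub>M I (\<lambda>_. borel)) (\<lambda>\<omega>. \<lambda>i\<in>I. X i \<omega>) = distr M (Pi\<^sub>M I (\<lambda>_. borel)) (\<lambda>\<omega>. \<lambda>i\<in>I. Y i \<omega>)"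
  proof (rule distr_cong_AE[OF refl refl])
    show "AE \<omega> in M. (\<lambda>i\<in>I. X i \<omega>) = (\<lambda>i\<in>I. Y i \<omega>)"
      using ae by eventually_elim (simp add: restrict_def fun_eq_iff)
    show "(\<lambda>\<omega>. \<lambda>i\<in>I. X i \<omega>) \<in> measurable M (Pi\<^sub>M I (\<lambda>_. borel))"
      by (intro measurable_restrict X)
    show "(\<lambda>\<omega>. \<lambda>i\<in>I. Y i \<omega>) \<in> measurable M (Pi\<^sub>M I (\<lambda>_. borel))"
      by (intro measurable_restrict complex_gaussian_vectorD(2)[OF Y])
  qed
  moreover have "\<forall>i\<in>I. X i \<in> borel_measurable M" using X by blast
  ultimately show ?thesis
    using Y unfolding complex_gaussian_vector_def by (elim conjE) (intro conjI; simp only:)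
qed

text \<open>The paths are set to zero on a measurable null set containing all discontinuous ones.
  Finite marginals and covariances are unchanged, and the null set is the same for all times, so
  whole paths agree almost surely.\<close>

lemma smooth_gaussian_modification:
  assumes gp: "complex_gaussian_process M f" and st: "stationary M f" and cp: "continuous_paths M f"
    and sm: "is_spectral_measure (covariance_kernel M f) \<rho>"
    and m2: "integrable \<rho> (\<lambda>l. l\<^sup>2)" and ml: "integrable \<rho> (\<lambda>l. l\<^sup>2 * ln (1 + \<bar>l\<bar>))"
  shows "\<exists>F. smooth_gaussian M F \<rho> \<and> (AE \<omega> in M. \<forall>t. F t \<omega> = f t \<omega>)"
proof -
  have pM: "prob_space M" and gv: "\<And>I. finite I \<Longrightarrow> complex_gaussian_vector M I f"
    using gp unfolding complex_gaussian_process_def by blast+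
  have f [measurable]: "f t \<in> borel_measurable M" for t
    by (rule complex_gaussian_vectorD(2)[OF gv[of "{t}"]]) auto
  have "AE \<omega> in M. continuous_on UNIV (\<lambda>t. f t \<omega>)" using cp unfolding continuous_paths_def .
  then obtain N where N: "{\<omega> \<in> space M. \<not> continuous_on UNIV (\<lambda>t. f t \<omega>)} \<subseteq> N" "emeasure M N = 0" "N \<in> sets M"
    by (rule AE_E)
  define F where "F t \<omega> = (if \<omega> \<in> space M - N then f t \<omega> else 0)" for t \<omega>
  have F [measurable]: "F t \<in> borel_measurable M" for t
    unfolding F_def using N(3) by measurable
  have "AE \<omega> in M. \<omega> \<notin> N" using N by (intro AE_not_in) (simp add: null_sets_def)
  then have ae: "AE \<omega> in M. \<forall>t. F t \<omega> = f t \<omega>"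
    using AE_space by eventually_elim (simp add: F_def)
  have "smooth_gaussian M F \<rho>"
  proof (intro smooth_gaussian.intro[OF pM] smooth_gaussian_axioms.intro)
    fix I :: "real set" assume I: "finite I"
    show "complex_gaussian_vector M I F"
    proof (rule complex_gaussian_vector_AE_eq[OF gv[OF I] F])
      show "AE \<omega> in M. \<forall>i\<in>I. F i \<omega> = f i \<omega>" using ae by eventually_elim simp
    qed
  next
    fix \<omega>
    show "continuous_on UNIV (\<lambda>t. F t \<omega>)"
      using N(1) by (cases "\<omega> \<in> space M - N") (auto simp: F_def)
  next
    fix t s
    have "(\<integral>\<omega>. F t \<omega> * cnj (F s \<omega>) \<partial>M) = (\<integral>\<omega>. f t \<omega> * cnj (f s \<omega>) \<partial>M)"
    proof (rule integral_cong_AE)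
      show "AE \<omega> in M. F t \<omega> * cnj (F s \<omega>) = f t \<omega> * cnj (f s \<omega>)" using ae by eventually_elim simp
    qed measurable
    also have "\<dots> = covariance_kernel M f (t - s)" by (rule stationary_covariance[OF st f])
    finally show "(\<integral>\<omega>. F t \<omega> * cnj (F s \<omega>) \<partial>M) = (CLINT l|\<rho>. iexp (- ((t - s) * l)))"
      using sm unfolding is_spectral_measure_def by simp
  next
    show "real_distribution \<rho>" using sm unfolding is_spectral_measure_def by blast
  qed (rule m2 ml)+
  with ae show ?thesis by blast
qed

theorem theorem2:
  fixes r :: "real \<Rightarrow> complex" and \<rho> :: "real measure" and \<alpha> T\<^sub>0 :: real
  assumes "continuous_on UNIV r" and "r 0 = 1"
    and "is_spectral_measure r \<rho>"
    and "\<not> degenerate \<rho>"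
    and "\<alpha> > 0" and "log_moment_condition \<rho> \<alpha>"
    and "T\<^sub>0 > 0"
  shows "\<exists>C>0. \<forall>(M :: 'a measure) (f :: real \<Rightarrow> 'a \<Rightarrow> complex).
           complex_gaussian_process M f \<and> stationary M f \<and> continuous_paths M f \<and>
           covariance_kernel M f = r \<longrightarrow>
           (\<forall>T\<ge>T\<^sub>0. winding_variance M f T \<ge> C * T)"
proof -
  have rd: "real_distribution \<rho>" using assms(3) unfolding is_spectral_measure_def by blast
  note mom = log_moment_condition_moments[OF rd assms(5,6)]
  have sp: "0 < spectral_variance \<rho>"
    by (rule real_distribution.spectral_variance_pos[OF rd mom(1) assms(4)])
  \<comment> \<open>The constant is fixed from \<open>\<rho>\<close> and \<open>T\<^sub>0\<close>
    before any probability space or process is introduced.\<close>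
  obtain C where C: "0 < C" and low: "\<And>T. T\<^sub>0 \<le> T \<Longrightarrow>
      C * T \<le> (\<integral>t. indicator {0..T} t * (\<integral>s. indicator {0..T} s * spectral_kernel \<rho> (t - s) \<partial>lborel) \<partial>lborel)"
    using real_distribution.spectral_kernel_lower_bound[OF rd mom(1) sp assms(7)] by blast
  have "C * T \<le> winding_variance M f T"
    if gp: "complex_gaussian_process M f" and st: "stationary M f" and cp: "continuous_paths M f"
      and cov: "covariance_kernel M f = r" and T: "T\<^sub>0 \<le> T"
    for M :: "'a measure" and f :: "real \<Rightarrow> 'a \<Rightarrow> complex" and T
  proof -
    obtain F where SG: "smooth_gaussian M F \<rho>" and ae: "AE \<omega> in M. \<forall>t. F t \<omega> = f t \<omega>"
      using smooth_gaussian_modification[OF gp st cp assms(3)[folded cov] mom] by blast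
    interpret smooth_gaussian M F \<rho> by (rule SG)
    have T': "0 \<le> T" using T assms(7) by simp
    have eq: "AE \<omega> in M. winding (\<lambda>t. f t \<omega>) T = drift_free_winding T \<omega> - mean * T"
      using AE_winding_eq_drift_free[OF sp T'] ae by eventually_elim simp
    have "expectation (\<lambda>\<omega>. drift_free_winding T \<omega> - mean * T) = expectation (drift_free_winding T) - mean * T"
      using drift_free_winding_integrable[OF sp] by (simp add: prob_space)
    then have "winding_variance M f T = variance (drift_free_winding T)"
      unfolding winding_variance_def
      by (subst variance_completion_AE_eq[OF prob_space_axioms _ eq]) simp_all
    then show ?thesis using low[OF T] variance_drift_free_winding[OF sp, of T] by simp
  qed
  with C show ?thesis by blast
qed

end
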